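(* Let $a,b\geq 0$ with $(a,b)\neq(0,0)$, let $\Psi_{a,b}$ be the periodic kernel described in the context, and for a real-valued initial datum $u_0$ on $\mathbb{T}^d$ let $$u^*(x)=\sup_{t>0}\int_{\mathbb{T}^d}\Psi_{a,b}(x-y,t)\,|u_0(y)|\,dy .$$ Then: (i) If $1<p\leq\infty$ and $u_0\in W^{1,p}(\mathbb{T})$, then $u^*\in W^{1,p}(\mathbb{T})$ and $\|(u^* )'\|_{L^p(\mathbb{T})}\leq\|u_0'\|_{L^p(\mathbb{T})}$. (ii) If $u_0\in W^{1,1}(\mathbb{T})$, then $u^*\in L^\infty(\mathbb{T})$ and $u^*$ has a weak derivative $(u^* )'$ satisfying $\|(u^* )'\|_{L^1(\mathbb{T})}\leq\|u_0'\|_{L^1(\mathbb{T})}$. (iii) If $u_0$ is of bounded variation on $\mathbb{T}$, then $u^*$ is of bounded variation on $\mathbb{T}$ and $V(u^* )\leq V(u_0)$. (iv) If $d>1$ and $u_0\in W^{1,p}(\mathbb{T}^d)$ with $p=2$ or $p=\infty$, then $u^*\in W^{1,p}(\mathbb{T}^d)$ and $\|\nabla u^*\|_{L^p(\mathbb{T}^d)}\leq\|\nabla u_0\|_{L^p(\mathbb{T}^d)}$.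
   Context: $\mathbb{T}^d=\mathbb{R}^d/\mathbb{Z}^d$; functions on $\mathbb{T}^d$ are identified with their $\mathbb{Z}^d$-periodic extensions. For $a>0$, $b\geq0$, $t>0$, $n\in\mathbb{Z}^d$ set $\widehat{\Psi}_{a,b}(n,t)=\exp\!\Big(-t\,\frac{-b+\sqrt{b^2+16a\pi^2|n|^2}}{2a}\Big)$; for $a=0$, $b>0$ set $\widehat{\Psi}_{0,b}(n,t)=\exp\!\big(-\tfrac{t}{b}(2\pi|n|)^2\big)$. Then $\Psi_{a,b}(x,t)=\sum_{n\in\mathbb{Z}^d}\widehat{\Psi}_{a,b}(n,t)e^{2\pi i x\cdot n}$. $V(f)$ denotes the total variation of $f$ on the circle $\mathbb{T}$ (supremum over finite partitions of the circle of sums of absolute increments). *)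

theory Defs
  imports "HOL-Probability.Probability"
begin

text \<open>The torus is modelled by Z^d-periodic functions on a Euclidean space 'a
  (d = DIM('a)); integration over the torus is integration over the unit cube.\<close>

definition lattice :: "'a::euclidean_space set" where
  "lattice = {k. \<forall>i\<in>Basis. k \<bullet> i \<in> \<int>}"

definition periodic_fn :: "('a::euclidean_space \<Rightarrow> 'b) \<Rightarrow> bool" where
  "periodic_fn f \<longleftrightarrow> (\<forall>x. \<forall>k\<in>lattice. f (x + k) = f x)"

abbreviation torus_measure :: "'a::euclidean_space measure" where
  "torus_measure \<equiv> lebesgue_on (cbox 0 One)"

definition Psi_hat :: "real \<Rightarrow> real \<Rightarrow> 'a::euclidean_space \<Rightarrow> real \<Rightarrow> real" where
  "Psi_hat a b n t =
     (if a = 0 then exp (- (t / b) * (2 * pi * norm n)\<^sup>2)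
      else exp (- t * ((- b + sqrt (b\<^sup>2 + 16 * a * pi\<^sup>2 * (norm n)\<^sup>2)) / (2 * a))))"

definition Psi :: "real \<Rightarrow> real \<Rightarrow> 'a::euclidean_space \<Rightarrow> real \<Rightarrow> complex" where
  "Psi a b x t = infsum (\<lambda>n. complex_of_real (Psi_hat a b n t) * cis (2 * pi * (x \<bullet> n))) lattice"

definition ustar :: "real \<Rightarrow> real \<Rightarrow> ('a::euclidean_space \<Rightarrow> real) \<Rightarrow> 'a \<Rightarrow> ereal" where
  "ustar a b u x = (SUP t\<in>{0<..}. ereal (\<integral>y. Re (Psi a b (x - y) t) * \<bar>u y\<bar> \<partial>torus_measure))"

definition Lp_mem :: "ennreal \<Rightarrow> ('a::euclidean_space \<Rightarrow> real) \<Rightarrow> bool" where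
  "Lp_mem p f \<longleftrightarrow> f \<in> borel_measurable torus_measure \<and>
     (if p = \<infinity> then esssup torus_measure (\<lambda>x. ereal \<bar>f x\<bar>) < \<infinity>
      else integrable torus_measure (\<lambda>x. \<bar>f x\<bar> powr enn2real p))"

definition Lp_norm :: "ennreal \<Rightarrow> ('a::euclidean_space \<Rightarrow> real) \<Rightarrow> real" where
  "Lp_norm p f =
     (if p = \<infinity> then real_of_ereal (esssup torus_measure (\<lambda>x. ereal \<bar>f x\<bar>))
      else (\<integral>x. \<bar>f x\<bar> powr enn2real p \<partial>torus_measure) powr (1 / enn2real p))"

definition pd :: "'a::euclidean_space \<Rightarrow> ('a \<Rightarrow> real) \<Rightarrow> 'a \<Rightarrow> real" where
  "pd i f = (\<lambda>x. frechet_derivative f (at x) i)"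

definition smooth_fn :: "('a::euclidean_space \<Rightarrow> real) \<Rightarrow> bool" where
  "smooth_fn f \<longleftrightarrow> (\<forall>is. set is \<subseteq> Basis \<longrightarrow> (\<forall>x. foldr pd is f differentiable (at x)))"

definition weak_grad :: "('a::euclidean_space \<Rightarrow> real) \<Rightarrow> ('a \<Rightarrow> 'a) \<Rightarrow> bool" where
  "weak_grad u g \<longleftrightarrow> integrable torus_measure u \<and>
     (\<forall>i\<in>Basis. integrable torus_measure (\<lambda>x. g x \<bullet> i)) \<and>
     (\<forall>\<phi>. smooth_fn \<phi> \<and> periodic_fn \<phi> \<longrightarrow>
        (\<forall>i\<in>Basis. (\<integral>x. u x * pd i \<phi> x \<partial>torus_measure)
                    = - (\<integral>x. (g x \<bullet> i) * \<phi> x \<partial>torus_measure)))"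

definition sobolev :: "ennreal \<Rightarrow> ('a::euclidean_space \<Rightarrow> real) \<Rightarrow> bool" where
  "sobolev p u \<longleftrightarrow> Lp_mem p u \<and> (\<exists>g. weak_grad u g \<and> Lp_mem p (\<lambda>x. norm (g x)))"

definition circ_var :: "(real \<Rightarrow> real) \<Rightarrow> ereal" where
  "circ_var f = (SUP nx \<in> {(n, x). 0 < n \<and> (\<forall>i<n. x i < x (Suc i)) \<and> x n = x 0 + 1}.
                   ereal (\<Sum>i<fst nx. \<bar>f (snd nx (Suc i)) - f (snd nx i)\<bar>))"

end

theory Submission
  imports Defs "HOL-Real_Asymp.Real_Asymp"
begin

text \<open>The coefficients \<open>exp (- t \<lambda>\<^sub>n)\<close> of the kernel satisfy \<open>a \<lambda>\<^sub>n\<^sup>2 + b \<lambda>\<^sub>n = 4 \<pi>\<^sup>2 \<bar>n\<bar>\<^sup>2\<close>, so \<open>U(x, t) = (\<Psi>(\<cdot>, t) * f)(x)\<close>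
  solves \<open>a U\<^sub>t\<^sub>t - b U\<^sub>t + \<Delta>U = 0\<close>; the maximum principle makes the kernel positive. For \<open>f = \<bar>u\<^sub>0\<bar>\<close> let
  \<open>w\<close> be the supremum of \<open>U(\<cdot>, t)\<close> over \<open>t \<ge> \<epsilon>\<close>. Where \<open>w\<close> exceeds \<open>v = U(\<cdot>, \<epsilon>)\<close>, the supremum is the
  limit at infinity (the mean, hence the minimum of \<open>w\<close>) or is attained at an interior time, where
  \<open>U\<^sub>t = 0\<close> and \<open>U\<^sub>t\<^sub>t \<le> 0\<close> give \<open>\<Delta>U \<ge> 0\<close>; so \<open>w\<close> is subharmonic there. Testing against \<open>w - v \<ge> 0\<close>
  yields \<open>\<integral>\<Theta>(\<nabla>w) \<le> \<integral>\<Theta>(\<nabla>v)\<close> for \<open>\<Theta>(\<xi>) = \<bar>\<xi>\<bar>\<^sup>2\<close> in every dimension, and for all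
  \<open>\<Theta>(\<xi>) = max 0 (\<bar>\<xi>\<bar> - M)\<close> in dimension one. To avoid differentiating \<open>w\<close>, gradients and Laplacians are
  replaced by finite differences with error \<open>O(h\<^sup>4)\<close>. By convexity \<open>\<integral>\<Theta>(\<nabla>v) \<le> \<integral>\<Theta>(\<nabla>u\<^sub>0)\<close>, and
  \<open>\<epsilon> \<rightarrow> 0\<close> transfers the bound to \<open>u\<^sup>*\<close>. In dimension one the truncations determine all \<open>L\<^sup>p\<close> norms and give
  the uniform integrability that produces a weak derivative in \<open>L\<^sup>1\<close>. For \<open>d > 1\<close> an \<open>L\<^sup>2\<close> maximal
  estimate by Parseval makes \<open>u\<^sup>*\<close> finite, and \<open>p = \<infinity>\<close> follows since suprema preserve Lipschitz bounds.\<close>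

section \<open>Integration over the torus\<close>

text \<open>The maximal function has no usable Laplacian, and nothing is known about the shape of
  the set where it is detached. Working with increments avoids both; their defect of order h^4 still
  vanishes after division by h^2. The quantity carried through the proof is the integral of \<Theta>
  applied to the gradient of the smoothed function \<open>Pt t w\<close>, bounded uniformly in t >
  0. For fixed t it is continuous in \<open>w\<close> under L1 convergence, so it passes through
  every limit. It is converted into a weak gradient only at the end; for p = 1 this requires uniform
  integrability, since a mere L1 bound could leave a measure in the limit. Integrands other than the
  square are confined to dimension one, because the comparison controls only the sum of the second
  differences over all coordinates. A nonlinear flux would need each summand separately, whereas the
  flux of the square is linear. In dimension one the variation also bounds the maximal function
  pointwise; for d > 1 a square-integrable gradient gives no such bound.\<close>

lemma cube_sets [simp, measurable]: "cbox 0 (One::'a::euclidean_space) \<in> sets lebesgue"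
  by simp

lemma prob_space_torus: "prob_space (torus_measure :: 'a::euclidean_space measure)"
proof
  have "emeasure lebesgue (cbox 0 One :: 'a set) = 1"
    by (simp add: emeasure_lborel_cbox_eq inner_diff)
  then show "emeasure (torus_measure :: 'a measure) (space torus_measure) = 1"
    by (simp add: emeasure_restrict_space)
qed

interpretation torus: prob_space "torus_measure :: 'a::euclidean_space measure"
  by (rule prob_space_torus)

lemma torus_measure_UNIV [simp]: "measure (torus_measure :: 'a::euclidean_space measure) (cbox 0 One) = 1"
  using torus.prob_space by simp

lemma integrable_torus_iff:
  fixes f :: "'a::euclidean_space \<Rightarrow> 'b::euclidean_space"
  shows "integrable torus_measure f \<longleftrightarrow> f absolutely_integrable_on cbox 0 One"
  by (simp add: set_integrable_def integrable_restrict_space)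

lemma continuous_integrable_torus:
  fixes f :: "'a::euclidean_space \<Rightarrow> 'b::euclidean_space"
  assumes "continuous_on UNIV f"
  shows "integrable torus_measure f"
  by (meson assms continuous_imp_integrable continuous_on_subset subset_UNIV)

lemma continuous_measurable_torus:
  fixes f :: "'a::euclidean_space \<Rightarrow> 'b::euclidean_space"
  assumes "continuous_on UNIV f"
  shows "f \<in> borel_measurable torus_measure"
  using continuous_integrable_torus[OF assms] by simp

lemma bounded_integrable_torus:
  fixes f :: "'a::euclidean_space \<Rightarrow> 'b::{banach, second_countable_topology}"
  assumes "f \<in> borel_measurable torus_measure" and "\<And>x. norm (f x) \<le> B"
  shows "integrable torus_measure f"
  by (rule torus.integrable_const_bound[of _ B]) (use assms in auto)

lemma lattice_add [intro]: "k \<in> lattice \<Longrightarrow> l \<in> lattice \<Longrightarrow> k + l \<in> lattice"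
  by (auto simp: lattice_def inner_add_left)

lemma lattice_minus [intro]: "k \<in> lattice \<Longrightarrow> - k \<in> lattice"
  by (auto simp: lattice_def)

lemma lattice_diff [intro]: "k \<in> lattice \<Longrightarrow> l \<in> lattice \<Longrightarrow> k - l \<in> lattice"
  by (auto simp: lattice_def inner_diff_left)

lemma lattice_0 [simp]: "0 \<in> lattice"
  by (auto simp: lattice_def)

lemma lattice_of_int_Basis [intro]: "i \<in> Basis \<Longrightarrow> of_int k *\<^sub>R i \<in> lattice"
  by (auto simp: lattice_def inner_Basis)

lemma lattice_inner: "k \<in> lattice \<Longrightarrow> n \<in> lattice \<Longrightarrow> k \<bullet> n \<in> \<int>"
  unfolding euclidean_inner[of k n] by (auto simp: lattice_def)

lemma lattice_norm_ge_1:
  assumes "n \<in> lattice" "n \<noteq> 0" shows "1 \<le> norm n"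
proof -
  obtain i where i: "i \<in> Basis" "n \<bullet> i \<noteq> 0"
    using assms(2) by (metis euclidean_all_zero_iff)
  then have "1 \<le> \<bar>n \<bullet> i\<bar>"
    using assms(1) by (auto simp: lattice_def intro!: Ints_nonzero_abs_ge1)
  also have "\<dots> \<le> norm n" using i by (simp add: Basis_le_norm)
  finally show ?thesis .
qed

lemma periodic_fn_compose: "periodic_fn f \<Longrightarrow> periodic_fn (\<lambda>x. F (f x))"
  by (simp add: periodic_fn_def)

text \<open>Cutting both cubes by hyperplanes orthogonal to \<open>i\<close> leaves two slabs each.
  One slab is common to both cubes; the other slab of the shifted cube is the remaining slab of the
  original one, translated by the lattice vector \<open>i\<close>, and there \<open>f\<close> takes
  the same values.\<close>

lemma has_integral_cube_shift_frac:
  fixes f :: "'a::euclidean_space \<Rightarrow> 'b::euclidean_space"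
  assumes per: "periodic_fn f" and I: "(f has_integral I) (cbox h (h + One))"
    and i: "i \<in> Basis" and c: "0 \<le> c" "c \<le> 1"
  shows "(f has_integral I) (cbox (h + c *\<^sub>R i) (h + c *\<^sub>R i + One))"
proof -
  \<comment> \<open>The min and max are kept because \<open>interval_split\<close> produces the
    corners of the slabs in exactly this form; the range of \<open>c\<close> simplifies them in the
    facts \<open>u\<close> and \<open>v\<close>.\<close>
  define u where "u = (\<Sum>j\<in>Basis. (if j = i then min ((h + One) \<bullet> i) (h \<bullet> i + c) else (h + One) \<bullet> j) *\<^sub>R j)"
  define v where "v = (\<Sum>j\<in>Basis. (if j = i then max (h \<bullet> i) (h \<bullet> i + c) else h \<bullet> j) *\<^sub>R j)"
  have A: "cbox h (h + One) \<inter> {x. x \<bullet> i \<le> h \<bullet> i + c} = cbox h u"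
    and B: "cbox h (h + One) \<inter> {x. x \<bullet> i \<ge> h \<bullet> i + c} = cbox v (h + One)"
    unfolding u_def v_def by (rule interval_split[OF i])+
  have "f integrable_on cbox h (h + One)" using I by blast
  then have "f integrable_on cbox h u" "f integrable_on cbox v (h + One)"
    using A B by (metis Int_lower1 integrable_on_subcbox)+
  then obtain IA IB where IA: "(f has_integral IA) (cbox h u)" and IB: "(f has_integral IB) (cbox v (h + One))"
    by blast
  have "(f has_integral (IA + IB)) (cbox h (h + One))"
    by (rule has_integral_split[where k=i and c="h \<bullet> i + c"]) (use A B IA IB i in auto)
  then have eq: "IA + IB = I" using I has_integral_unique by blast
  have "i \<in> lattice" using lattice_of_int_Basis[OF i, of 1] by simp
  then have "f (x - i) = f x" for x
    using per[unfolded periodic_fn_def, rule_format, of "i" "x - i"] by simp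
  then have IA': "(f has_integral IA) (cbox (h + i) (u + i))"
    using has_integral_shift_cbox[OF IA, of "-i"] by simp
  have u: "u \<bullet> j = (if j = i then h \<bullet> i + c else h \<bullet> j + 1)" if "j \<in> Basis" for j
    using that i c by (simp add: u_def inner_add_left)
  have v: "v \<bullet> j = (if j = i then h \<bullet> i + c else h \<bullet> j)" if "j \<in> Basis" for j
    using that i c by (simp add: v_def)
  let ?C = "cbox (h + c *\<^sub>R i) (h + c *\<^sub>R i + One)"
  have mem: "x \<in> cbox (h + c *\<^sub>R i) (h + c *\<^sub>R i + One) \<longleftrightarrow>
      (\<forall>j\<in>Basis. h \<bullet> j + (if j = i then c else 0) \<le> x \<bullet> j \<and> x \<bullet> j \<le> h \<bullet> j + (if j = i then c else 0) + 1)" for x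
    using i by (auto simp: mem_box inner_add_left inner_Basis)
  have "?C \<inter> {x. x \<bullet> i \<le> h \<bullet> i + 1} = cbox v (h + One)"
    using i c unfolding set_eq_iff Int_iff mem mem_Collect_eq
    by (auto simp: mem_box v inner_add_left split: if_splits; smt (verit))
  moreover have "?C \<inter> {x. x \<bullet> i \<ge> h \<bullet> i + 1} = cbox (h + i) (u + i)"
    using i c unfolding set_eq_iff Int_iff mem mem_Collect_eq
    by (auto simp: mem_box u inner_add_left inner_Basis split: if_splits; smt (verit))
  ultimately have "(f has_integral (IB + IA)) ?C"
    by (intro has_integral_split[where k=i and c="h \<bullet> i + 1"]) (use IA' IB i in auto)
  then show ?thesis using eq by (simp add: add.commute)
qed

text \<open>The translation is performed one coordinate at a time. The integer part of a coordinate
  is a lattice vector and moves the cube without changing the integral; only the fractional part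
  needs \<open>has_integral_cube_shift_frac\<close>.\<close>

lemma has_integral_cube_shift:
  fixes f :: "'a::euclidean_space \<Rightarrow> 'b::euclidean_space"
  assumes per: "periodic_fn f" and I: "(f has_integral I) (cbox 0 One)"
  shows "((\<lambda>x. f (x + h)) has_integral I) (cbox 0 One)"
proof -
  have step: "(f has_integral I) (cbox (h + c *\<^sub>R i) (h + c *\<^sub>R i + One))"
    if I: "(f has_integral I) (cbox h (h + One))" and i: "i \<in> Basis" for h i c
  proof -
    define k where "k = of_int \<lfloor>c\<rfloor> *\<^sub>R i"
    have k: "k \<in> lattice" unfolding k_def using i by blast
    have "f (x - k) = f x" for x
      using per[unfolded periodic_fn_def, rule_format, OF k, of "x - k"] by simp
    then have 1: "(f has_integral I) (cbox (h + k) (h + k + One))"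
      using has_integral_shift_cbox[OF I, of "-k"] by (simp add: algebra_simps)
    have "h + c *\<^sub>R i = (h + k) + frac c *\<^sub>R i"
      by (simp add: k_def frac_def algebra_simps)
    then show ?thesis
      using has_integral_cube_shift_frac[OF per 1 i, of "frac c"] frac_lt_1[of c] unfolding \<open>h + c *\<^sub>R i = (h + k) + frac c *\<^sub>R i\<close> by simp
  qed
  have "(f has_integral I) (cbox (\<Sum>i\<in>S. (h \<bullet> i) *\<^sub>R i) ((\<Sum>i\<in>S. (h \<bullet> i) *\<^sub>R i) + One))"
    if "S \<subseteq> Basis" for S
    using finite_subset[OF that finite_Basis] that
  proof (induction S rule: finite_induct)
    case empty then show ?case using I by simp
  next
    case (insert i S)
    then show ?case using step[of "\<Sum>i\<in>S. (h \<bullet> i) *\<^sub>R i" i "h \<bullet> i"]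
      by (simp add: add.commute)
  qed
  from this[of Basis] have "(f has_integral I) (cbox h (h + One))"
    by (simp add: euclidean_representation)
  from has_integral_shift_cbox[OF this, of h] show ?thesis by simp
qed

lemma
  fixes f :: "'a::euclidean_space \<Rightarrow> 'b::euclidean_space"
  assumes per: "periodic_fn f" and f: "integrable torus_measure f"
  shows integrable_torus_shift: "integrable torus_measure (\<lambda>x. f (x + h))"
    and integral_torus_shift: "(\<integral>x. f (x + h) \<partial>torus_measure) = (\<integral>x. f x \<partial>torus_measure)"
proof -
  have I1: "(f has_integral (\<integral>x. f x \<partial>torus_measure)) (cbox 0 One)"
    by (rule has_integral_integral_lebesgue_on[OF f]) simp
  \<comment> \<open>The gauge integral of \<open>f\<close> alone would not show absolute
    integrability of the translate, so the norm is shifted as well.\<close>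
  have I2: "((\<lambda>x. norm (f x)) has_integral (\<integral>x. norm (f x) \<partial>torus_measure)) (cbox 0 One)"
    by (rule has_integral_integral_lebesgue_on) (use f in auto)
  note J1 = has_integral_cube_shift[OF per I1, of h]
  note J2 = has_integral_cube_shift[OF periodic_fn_compose[OF per] I2, of h]
  show int: "integrable torus_measure (\<lambda>x. f (x + h))"
    unfolding integrable_torus_iff by (rule absolutely_integrable_onI) (use J1 J2 in blast)+
  show "(\<integral>x. f (x + h) \<partial>torus_measure) = (\<integral>x. f x \<partial>torus_measure)"
    using has_integral_integral_lebesgue_on[OF int cube_sets] J1 has_integral_unique by blast
qed

section \<open>Characters and lattice sums\<close>

definition ec :: "'a::euclidean_space \<Rightarrow> 'a \<Rightarrow> complex" where
  "ec n x = cis (2 * pi * (x \<bullet> n))"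

lemma ec_add: "ec n (x + y) = ec n x * ec n y"
  by (simp add: ec_def cis_mult inner_add_left distrib_left)

lemma ec_diff: "ec n (x - y) = ec n x * cnj (ec n y)"
  by (simp add: ec_def cis_cnj cis_mult inner_diff_left right_diff_distrib)

lemma ec_minus: "ec (- n) x = cnj (ec n x)"
  by (simp add: ec_def cis_cnj)

lemma ec_minus_diff: "ec (n - m) x = ec n x * cnj (ec m x)"
  by (simp add: ec_def cis_cnj cis_mult inner_diff_right right_diff_distrib)

lemma ec_0 [simp]: "ec 0 x = 1" "ec n 0 = 1"
  by (simp_all add: ec_def)

lemma norm_ec [simp]: "norm (ec n x) = 1"
  by (simp add: ec_def)

lemma ec_mult_cnj [simp]: "ec n x * cnj (ec n x) = 1" "cnj (ec n x) * ec n x = 1"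
  by (simp_all add: ec_def cis_cnj cis_mult)

lemma continuous_ec [continuous_intros]: "continuous_on S (ec n)"
  unfolding ec_def cis_conv_exp by (intro continuous_intros)

lemma integrable_ec [simp]: "integrable torus_measure (ec n)"
  by (intro continuous_integrable_torus continuous_intros)

lemma ec_lattice: "n \<in> lattice \<Longrightarrow> k \<in> lattice \<Longrightarrow> ec n k = 1"
  unfolding ec_def by (intro cis_multiple_2pi lattice_inner)

lemma periodic_ec: "n \<in> lattice \<Longrightarrow> periodic_fn (ec n)"
  by (simp add: periodic_fn_def ec_add ec_lattice)

lemma integral_ec:
  assumes n: "n \<in> lattice"
  shows "(\<integral>x. ec n x \<partial>torus_measure) = (if n = 0 then 1 else 0)"
proof (cases "n = 0")
  case True then show ?thesis using torus.prob_space by simp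
next
  case False
  then obtain i where i: "i \<in> Basis" "n \<bullet> i \<noteq> 0" by (metis euclidean_all_zero_iff)
  \<comment> \<open>Half a period in a direction in which \<open>n\<close> does not vanish: the
    character changes sign, so its integral equals its own negative.\<close>
  define h where "h = (1 / (2 * (n \<bullet> i))) *\<^sub>R i"
  have h: "ec n h = - 1" using i by (simp add: ec_def h_def inner_commute)
  have "(\<integral>x. ec n x \<partial>torus_measure) = (\<integral>x. ec n (x + h) \<partial>torus_measure)"
    by (rule integral_torus_shift[symmetric]) (use periodic_ec[OF n] in auto)
  also have "\<dots> = - (\<integral>x. ec n x \<partial>torus_measure)" by (simp add: ec_add h)
  finally show ?thesis using False by simp
qed

lemma sum_exp_int_le:
  fixes c :: real assumes c: "0 < c"
  shows "(\<Sum>j\<in>{- int N..int N}. exp (- c * \<bar>real_of_int j\<bar>)) \<le> 2 / (1 - exp (- c))"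
proof -
  define q where "q = exp (- c)"
  have q: "0 < q" "q < 1" using c by (auto simp: q_def)
  \<comment> \<open>The induction carries the exact remainder: the two new terms, together
    \<open>2 * q ^ Suc N\<close>, multiplied by \<open>1 - q\<close> turn
    \<open>2 - 2 * q ^ Suc N\<close> into \<open>2 - 2 * q ^ Suc (Suc N)\<close>.\<close>
  have "(1 - q) * (\<Sum>j\<in>{- int N..int N}. exp (- c * \<bar>real_of_int j\<bar>)) \<le> 2 - 2 * q ^ Suc N"
  proof (induction N)
    case 0 then show ?case using q by simp
  next
    case (Suc N)
    have "{- int (Suc N)..int (Suc N)} = insert (- int (Suc N)) (insert (int (Suc N)) {- int N..int N})"
      by auto
    then have eq: "(\<Sum>j\<in>{- int (Suc N)..int (Suc N)}. exp (- c * \<bar>real_of_int j\<bar>))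
        = 2 * exp (- c * real (Suc N)) + (\<Sum>j\<in>{- int N..int N}. exp (- c * \<bar>real_of_int j\<bar>))"
      by simp
    have "exp (- c * real (Suc N)) = q ^ Suc N"
      unfolding q_def by (metis exp_of_nat_mult mult.commute)
    then show ?case unfolding eq distrib_left using Suc by (simp add: algebra_simps)
  qed
  also have "\<dots> \<le> 2" using q by simp
  finally show ?thesis using q unfolding q_def[symmetric] by (simp add: field_simps)
qed

text \<open>The sum of the absolute coordinates is at most the dimension times
  \<open>norm n\<close>, so after dividing the rate by the dimension the exponential is dominated by
  a product over coordinates. On a box the sum of products factors into one-dimensional geometric
  sums, which bounds all finite partial sums at once.\<close>

lemma summable_exp_lattice:
  fixes c :: real assumes c: "0 < c"
  shows "(\<lambda>n::'a::euclidean_space. exp (- c * norm n)) summable_on lattice"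
proof -
  define c' where "c' = c / DIM('a)"
  have c': "0 < c'" using c by (simp add: c'_def)
  define D where "D = (2 / (1 - exp (- c'))) ^ DIM('a)"
  have *: "sum (\<lambda>n::'a. exp (- c * norm n)) F \<le> D" if F: "finite F" "F \<subseteq> lattice" for F
  proof -
    define N where "N = nat \<lceil>\<Sum>n\<in>F. norm n\<rceil>"
    \<comment> \<open>Integer coordinates as an extensional function, so that the image of
      \<open>F\<close> lies in a \<open>PiE\<close> box and \<open>prod_sum_PiE\<close>
      applies.\<close>
    define G where "G n = (\<lambda>i\<in>Basis. \<lfloor>(n::'a) \<bullet> i\<rfloor>)" for n
    have fl: "of_int \<lfloor>n \<bullet> i\<rfloor> = n \<bullet> i" if "n \<in> lattice" "i \<in> Basis" for n i :: 'a
      using that by (simp add: lattice_def)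
    have "norm n \<le> real N" if "n \<in> F" for n
      using member_le_sum[OF that, of norm] F(1) unfolding N_def by (simp add: le_nat_iff) linarith
    then have bd: "\<bar>n \<bullet> i\<bar> \<le> real N" if "n \<in> F" "i \<in> Basis" for n i
      using that Basis_le_norm[of i n] by force
    have GN: "\<bar>\<lfloor>n \<bullet> i\<rfloor>\<bar> \<le> int N" if "n \<in> F" "i \<in> Basis" for n i
      using bd[OF that] fl[of n i] that F(2) by linarith
    have GP: "G ` F \<subseteq> PiE Basis (\<lambda>_. {- int N..int N})"
      using GN unfolding G_def by (force simp: abs_le_iff)
    have inj: "inj_on G F"
    proof (rule inj_onI)
      fix n m assume nm: "n \<in> F" "m \<in> F" "G n = G m"
      have "n \<bullet> i = m \<bullet> i" if i: "i \<in> Basis" for i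
      proof -
        have "n \<in> lattice" "m \<in> lattice" using nm F(2) by auto
        moreover have "\<lfloor>n \<bullet> i\<rfloor> = \<lfloor>m \<bullet> i\<rfloor>"
          using fun_cong[OF nm(3), of i] i by (simp add: G_def)
        ultimately show ?thesis using fl[of n i] fl[of m i] i by metis
      qed
      then show "n = m" by (rule euclidean_eqI)
    qed
    have "exp (- c * norm n) \<le> (\<Prod>i\<in>Basis. exp (- c' * \<bar>real_of_int (G n i)\<bar>))" if n: "n \<in> F" for n
    proof -
      have "(\<Sum>i\<in>Basis. \<bar>n \<bullet> i\<bar>) \<le> (\<Sum>i\<in>(Basis::'a set). norm n)"
        by (intro sum_mono) (simp add: Basis_le_norm)
      then have "c' * (\<Sum>i\<in>Basis. \<bar>n \<bullet> i\<bar>) \<le> c * norm n"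
        using c unfolding c'_def by (simp add: field_simps)
      moreover have "(\<Prod>i\<in>Basis. exp (- c' * \<bar>real_of_int (G n i)\<bar>)) = exp (- c' * (\<Sum>i\<in>Basis. \<bar>n \<bullet> i\<bar>))"
        using n F(2) by (simp add: exp_sum[symmetric] sum_negf sum_distrib_left G_def fl subset_iff)
      ultimately show ?thesis by simp
    qed
    then have "sum (\<lambda>n. exp (- c * norm n)) F \<le> (\<Sum>n\<in>F. \<Prod>i\<in>Basis. exp (- c' * \<bar>real_of_int (G n i)\<bar>))"
      by (rule sum_mono)
    also have "\<dots> = (\<Sum>g\<in>G ` F. \<Prod>i\<in>Basis. exp (- c' * \<bar>real_of_int (g i)\<bar>))"
      by (simp add: sum.reindex[OF inj])
    also have "\<dots> \<le> (\<Sum>g\<in>PiE (Basis::'a set) (\<lambda>_. {- int N..int N}). \<Prod>i\<in>Basis. exp (- c' * \<bar>real_of_int (g i)\<bar>))"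
    proof (rule sum_mono2)
      show "finite (PiE (Basis::'a set) (\<lambda>_. {- int N..int N}))" by (rule finite_PiE) auto
      show "G ` F \<subseteq> PiE Basis (\<lambda>_. {- int N..int N})" by (rule GP)
    qed (simp add: prod_nonneg)
    also have "\<dots> = (\<Prod>i\<in>(Basis::'a set). \<Sum>j\<in>{- int N..int N}. exp (- c' * \<bar>real_of_int j\<bar>))"
      by (rule prod_sum_PiE[symmetric]) auto
    also have "\<dots> \<le> (\<Prod>i\<in>(Basis::'a set). 2 / (1 - exp (- c')))"
      by (intro prod_mono conjI sum_nonneg sum_exp_int_le[OF c']) auto
    finally show ?thesis by (simp add: D_def)
  qed
  show ?thesis
    by (rule nonneg_bounded_partial_sums_imp_summable_on[where C=D])
       (use * in \<open>auto intro!: eventually_finite_subsets_at_top_weakI\<close>)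
qed

text \<open>A single term of the exponential series is below the whole sum.\<close>

lemma power_le_exp:
  fixes c :: real assumes "0 < c"
  shows "\<exists>C. \<forall>r\<ge>0. r ^ k * exp (- c * r) \<le> C"
proof -
  have "r ^ k * exp (- c * r) \<le> fact k / c ^ k" if r: "0 \<le> r" for r
  proof -
    have "(c * r) ^ k / fact k \<le> exp (c * r)"
    proof -
      have "(\<Sum>j\<in>{k}. (c * r) ^ j /\<^sub>R fact j) \<le> (\<Sum>j. (c * r) ^ j /\<^sub>R fact j)"
        by (rule sum_le_suminf[OF summable_exp_generic]) (use assms r in auto)
      then show ?thesis unfolding exp_def by (simp add: divide_inverse mult.commute)
    qed
    then show ?thesis using assms by (simp add: exp_minus field_simps power_mult_distrib)
  qed
  then show ?thesis by blast
qed

lemma summable_power_exp_lattice: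
  fixes c :: real assumes c: "0 < c"
  shows "(\<lambda>n::'a::euclidean_space. norm n ^ k * exp (- c * norm n)) summable_on lattice"
proof -
  \<comment> \<open>Half of the decay absorbs the power, the other half is left for
    summability.\<close>
  obtain C where C: "\<And>r. r \<ge> 0 \<Longrightarrow> r ^ k * exp (- (c/2) * r) \<le> C"
    using power_le_exp[of "c/2" k] c by auto
  have "(\<lambda>n::'a. C * exp (- (c/2) * norm n)) summable_on lattice"
    by (intro summable_on_cmult_right summable_exp_lattice) (use c in auto)
  then show ?thesis
  proof (rule summable_on_comparison_test)
    fix n :: 'a
    have "norm n ^ k * exp (- c * norm n) = (norm n ^ k * exp (- (c/2) * norm n)) * exp (- (c/2) * norm n)"
      by (simp add: mult.assoc flip: exp_add)
    also have "\<dots> \<le> C * exp (- (c/2) * norm n)"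
      using C[of "norm n"] by (intro mult_right_mono) auto
    finally show "norm n ^ k * exp (- c * norm n) \<le> C * exp (- (c/2) * norm n)" .
  qed auto
qed

section \<open>Absolutely convergent Fourier series\<close>

abbreviation asum :: "('a::euclidean_space \<Rightarrow> complex) \<Rightarrow> bool" where
  "asum c \<equiv> (\<lambda>n. norm (c n)) summable_on lattice"

definition fc :: "('a::euclidean_space \<Rightarrow> real) \<Rightarrow> 'a \<Rightarrow> complex" where
  "fc f n = (\<integral>y. complex_of_real (f y) * cnj (ec n y) \<partial>torus_measure)"

text \<open>Asking for \<open>complex_of_real (F x)\<close> builds reality of the sum into the
  predicate; Hermitian symmetry of \<open>c\<close> then follows in \<open>fser_uminus\<close>.
  Values of \<open>c\<close> off the lattice are unconstrained, hence
  \<open>fser_cong\<close>.\<close>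

definition fser :: "('a::euclidean_space \<Rightarrow> complex) \<Rightarrow> ('a \<Rightarrow> real) \<Rightarrow> bool" where
  "fser c F \<longleftrightarrow> asum c \<and> (\<forall>x. ((\<lambda>n. c n * ec n x) has_sum complex_of_real (F x)) lattice)"

lemma bij_betw_uminus_lattice: "bij_betw uminus lattice lattice"
  by (rule bij_betw_byWitness[where f'=uminus]) auto

lemma norm_integral_le:
  fixes f :: "'a \<Rightarrow> 'b::{banach, second_countable_topology}"
  assumes "integrable M f" "integrable M g" "\<And>x. x \<in> space M \<Longrightarrow> norm (f x) \<le> g x"
  shows "norm (\<integral>x. f x \<partial>M) \<le> (\<integral>x. g x \<partial>M)"
proof -
  have "(\<integral>x. norm (f x) \<partial>M) \<le> (\<integral>x. g x \<partial>M)"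
    by (rule integral_mono) (use assms in auto)
  then show ?thesis using integral_norm_bound[of M f] by linarith
qed

text \<open>By the Weierstrass test the series converges uniformly, hence to a continuous function,
  and a uniform limit may be integrated against an L1 function. The general bounded
  \<open>\<phi> n\<close> serves both \<open>ec n\<close> and its conjugate, which appears when the
  kernel is expanded at \<open>x - y\<close>.\<close>

lemma swap_integral:
  fixes \<phi> :: "'a::euclidean_space \<Rightarrow> 'a \<Rightarrow> complex"
  assumes c: "asum c" and \<phi>: "\<And>n y. norm (\<phi> n y) \<le> 1" "\<And>n. continuous_on UNIV (\<phi> n)"
    and H: "\<And>y. ((\<lambda>n. c n * \<phi> n y) has_sum H y) lattice"
    and g: "integrable torus_measure g"
  shows "continuous_on UNIV H"
    and "((\<lambda>n. c n * (\<integral>y. \<phi> n y * g y \<partial>torus_measure)) has_sum (\<integral>y. H y * g y \<partial>torus_measure)) lattice"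
proof -
  have unif: "uniform_limit UNIV (\<lambda>X y. \<Sum>n\<in>X. c n * \<phi> n y) H (finite_subsets_at_top lattice)"
    by (rule Weierstrass_m_test_general'[where M="\<lambda>n. norm (c n)"])
       (use c \<phi> H in \<open>auto simp: norm_mult intro!: mult_left_le\<close>)
  show contH: "continuous_on UNIV H"
    by (rule uniform_limit_theorem[OF _ unif])
       (auto intro!: always_eventually continuous_intros \<phi>)
  have bH: "norm (H y) \<le> infsum (\<lambda>n. norm (c n)) lattice" for y
    by (rule norm_infsum_le[OF H[of y]]) (use c \<phi> in \<open>auto simp: norm_mult intro!: mult_left_le has_sum_infsum\<close>)
  have g': "g \<in> borel_measurable torus_measure" using g by simp
  have m\<phi>: "\<phi> n \<in> borel_measurable torus_measure" for n
    by (intro continuous_measurable_torus \<phi>)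
  have mH: "H \<in> borel_measurable torus_measure" by (intro continuous_measurable_torus contH)
  have i\<phi>: "integrable torus_measure (\<lambda>y. \<phi> n y * g y)" for n
    by (rule Bochner_Integration.integrable_bound[OF g])
       (use \<phi>(1) m\<phi> g' in \<open>auto simp: norm_mult intro!: mult_left_le_one_le\<close>)
  have iH: "integrable torus_measure (\<lambda>y. H y * g y)"
    by (rule Bochner_Integration.integrable_bound[where f="\<lambda>y. infsum (\<lambda>n. norm (c n)) lattice * norm (g y)"])
       (use bH mH g g' in \<open>auto simp: norm_mult intro!: mult_right_mono order_trans[OF bH abs_ge_self] 
          simp: abs_mult\<close>)
  show "((\<lambda>n. c n * (\<integral>y. \<phi> n y * g y \<partial>torus_measure)) has_sum (\<integral>y. H y * g y \<partial>torus_measure)) lattice"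
    unfolding has_sum_def
  proof (rule tendstoI)
    fix e :: real assume e: "0 < e"
    define G where "G = (\<integral>y. norm (g y) \<partial>torus_measure)"
    have G: "0 \<le> G" unfolding G_def by simp
    have "\<forall>\<^sub>F X in finite_subsets_at_top lattice. \<forall>y. dist (\<Sum>n\<in>X. c n * \<phi> n y) (H y) < e / (G + 1)"
      using uniform_limitD[OF unif, of "e / (G + 1)"] e G by simp
    then show "\<forall>\<^sub>F X in finite_subsets_at_top lattice.
        dist (\<Sum>n\<in>X. c n * (\<integral>y. \<phi> n y * g y \<partial>torus_measure)) (\<integral>y. H y * g y \<partial>torus_measure) < e"
    proof (rule eventually_mono)
      fix X assume X: "\<forall>y. dist (\<Sum>n\<in>X. c n * \<phi> n y) (H y) < e / (G + 1)"
      have eq: "(\<Sum>n\<in>X. c n * (\<integral>y. \<phi> n y * g y \<partial>torus_measure)) - (\<integral>y. H y * g y \<partial>torus_measure)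
          = (\<integral>y. (\<Sum>n\<in>X. c n * (\<phi> n y * g y)) - H y * g y \<partial>torus_measure)"
        using i\<phi> iH by (simp add: Bochner_Integration.integral_sum Bochner_Integration.integral_diff)
      have "norm (\<dots>) \<le> (\<integral>y. e / (G + 1) * norm (g y) \<partial>torus_measure)"
      proof (rule norm_integral_le)
        fix y
        have "(\<Sum>n\<in>X. c n * (\<phi> n y * g y)) - H y * g y = ((\<Sum>n\<in>X. c n * \<phi> n y) - H y) * g y"
          by (simp add: sum_distrib_right left_diff_distrib mult.assoc)
        then show "norm ((\<Sum>n\<in>X. c n * (\<phi> n y * g y)) - H y * g y) \<le> e / (G + 1) * norm (g y)"
          using mult_right_mono[OF less_imp_le[OF X[rule_format, of y]], of "norm (g y)"]
          by (simp add: norm_mult dist_norm)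
      qed (use i\<phi> iH g in auto)
      also have "\<dots> = e / (G + 1) * G" by (simp add: G_def)
      also have "\<dots> < e" using e G by (simp add: field_simps)
      finally show "dist (\<Sum>n\<in>X. c n * (\<integral>y. \<phi> n y * g y \<partial>torus_measure)) (\<integral>y. H y * g y \<partial>torus_measure) < e"
        using eq by (simp add: dist_norm)
    qed
  qed
qed

text \<open>Conjugating the sum amounts to reindexing it by the negation of the lattice, so it
  equals its own conjugate.\<close>

lemma fserI_real:
  assumes c: "asum c" and herm: "\<And>n. n \<in> lattice \<Longrightarrow> c (- n) = cnj (c n)"
  shows "fser c (\<lambda>x. Re (\<Sum>\<^sub>\<infinity>n\<in>lattice. c n * ec n x))"
  unfolding fser_def
proof (intro conjI allI c)
  fix x
  let ?S = "\<Sum>\<^sub>\<infinity>n\<in>lattice. c n * ec n x"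
  have "(\<lambda>n. c n * ec n x) summable_on lattice"
    by (rule Infinite_Sum.abs_summable_summable) (use c in \<open>simp add: norm_mult\<close>)
  then have s: "((\<lambda>n. c n * ec n x) has_sum ?S) lattice" by simp
  have "cnj ?S = (\<Sum>\<^sub>\<infinity>n\<in>lattice. cnj (c n * ec n x))" by (simp only: infsum_cnj)
  also have "\<dots> = (\<Sum>\<^sub>\<infinity>n\<in>lattice. c (- n) * ec (- n) x)"
    by (rule infsum_cong) (simp add: herm ec_minus)
  also have "\<dots> = ?S"
    by (rule infsum_reindex_bij_betw[OF bij_betw_uminus_lattice, of "\<lambda>n. c n * ec n x"])
  finally have "?S = complex_of_real (Re ?S)" by (simp add: complex_eq_iff)
  then show "((\<lambda>n. c n * ec n x) has_sum complex_of_real (Re ?S)) lattice" using s by simp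
qed

lemma fser_cong:
  assumes "fser c F" "\<And>n. n \<in> lattice \<Longrightarrow> c n = d n" shows "fser d F"
  using assms unfolding fser_def
  by (metis (mono_tags, lifting) has_sum_cong summable_on_cong)

lemma fser_unique: "fser c F \<Longrightarrow> fser c G \<Longrightarrow> F = G"
  unfolding fser_def by (metis ext has_sum_unique of_real_eq_iff)

lemma fser_add: "fser c F \<Longrightarrow> fser d G \<Longrightarrow> fser (\<lambda>n. c n + d n) (\<lambda>x. F x + G x)"
  unfolding fser_def
proof (intro conjI allI; elim conjE)
  assume "asum c" "asum d"
  then have "(\<lambda>n. norm (c n) + norm (d n)) summable_on lattice" by (rule summable_on_add)
  then show "asum (\<lambda>n. c n + d n)"
    using Infinite_Sum.abs_summable_on_comparison_test'[of "\<lambda>n. norm (c n) + norm (d n)" lattice "\<lambda>n. c n + d n"]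
    by (simp add: norm_triangle_ineq)
qed (use has_sum_add in \<open>fastforce simp: distrib_right\<close>)

lemma fser_cmult: "fser c F \<Longrightarrow> fser (\<lambda>n. of_real r * c n) (\<lambda>x. r * F x)"
  unfolding fser_def
  by (auto simp: norm_mult mult.assoc intro!: summable_on_cmult_right has_sum_cmult_right)

lemma fser_diff: "fser c F \<Longrightarrow> fser d G \<Longrightarrow> fser (\<lambda>n. c n - d n) (\<lambda>x. F x - G x)"
  using fser_add[of c F "\<lambda>n. of_real (-1) * d n" "\<lambda>x. -1 * G x"] fser_cmult[of d G "-1"] by simp

lemma fser_0: "fser (\<lambda>n. 0) (\<lambda>x. 0)"
  by (simp add: fser_def)

lemma fser_sum:
  assumes "finite I" "\<And>i. i \<in> I \<Longrightarrow> fser (c i) (F i)"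
  shows "fser (\<lambda>n. \<Sum>i\<in>I. c i n) (\<lambda>x. \<Sum>i\<in>I. F i x)"
  using assms by (induction I rule: finite_induct) (auto simp: fser_0 intro!: fser_add)

lemma fser_const: "fser (\<lambda>n. if n = 0 then of_real r else 0) (\<lambda>x. r)"
  unfolding fser_def
proof (intro conjI allI)
  show "asum (\<lambda>n. if n = 0 then complex_of_real r else 0)"
    by (rule finite_nonzero_values_imp_summable_on) (auto intro: finite_subset[of _ "{0}"])
  show "((\<lambda>n. (if n = 0 then complex_of_real r else 0) * ec n x) has_sum complex_of_real r) lattice" for x
    by (rule has_sum_finite_neutralI[where B="{0}"]) auto
qed

lemma fser_shift: "fser c F \<Longrightarrow> fser (\<lambda>n. c n * ec n h) (\<lambda>x. F (x + h))"
  unfolding fser_def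
proof (elim conjE, intro conjI allI)
  assume s: "\<forall>x. ((\<lambda>n. c n * ec n x) has_sum complex_of_real (F x)) lattice"
  show "((\<lambda>n. c n * ec n h * ec n x) has_sum complex_of_real (F (x + h))) lattice" for x
    using s[rule_format, of "x + h"] by (simp add: ec_add mult_ac)
qed (simp add: norm_mult)

lemma fser_continuous: "fser c F \<Longrightarrow> continuous_on UNIV F"
proof -
  assume F: "fser c F"
  have "continuous_on UNIV (\<lambda>x. complex_of_real (F x))"
    by (rule swap_integral(1)[where c=c and \<phi>=ec and g="\<lambda>_. 0"])
       (use F in \<open>auto simp: fser_def intro: continuous_intros\<close>)
  from continuous_on_Re[OF this] show ?thesis by simp
qed

lemma fser_integrable: "fser c F \<Longrightarrow> integrable torus_measure F"
  by (intro continuous_integrable_torus fser_continuous)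

lemma fser_bound: "fser c F \<Longrightarrow> \<bar>F x\<bar> \<le> infsum (\<lambda>n. norm (c n)) lattice"
proof -
  assume F: "fser c F"
  have "norm (complex_of_real (F x)) \<le> infsum (\<lambda>n. norm (c n)) lattice"
    by (rule norm_infsum_le[where f="\<lambda>n. c n * ec n x" and X=lattice])
       (use F in \<open>auto simp: fser_def norm_mult intro: has_sum_infsum\<close>)
  then show ?thesis by simp
qed

lemma fser_periodic: "fser c F \<Longrightarrow> periodic_fn F"
  unfolding periodic_fn_def
proof (intro allI ballI)
  fix x k assume F: "fser c F" and k: "k \<in> (lattice::'a set)"
  have "((\<lambda>n. c n * ec n (x + k)) has_sum complex_of_real (F (x + k))) lattice"
    using F by (simp add: fser_def)
  also have "?this \<longleftrightarrow> ((\<lambda>n. c n * ec n x) has_sum complex_of_real (F (x + k))) lattice"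
    by (rule has_sum_cong) (simp add: ec_add ec_lattice k)
  finally show "F (x + k) = F x"
    using F has_sum_unique unfolding fser_def by (metis of_real_eq_iff)
qed

lemma fc_integrable:
  assumes "integrable torus_measure f"
  shows "integrable torus_measure (\<lambda>y. complex_of_real (f y) * cnj (ec n y))"
proof (rule Bochner_Integration.integrable_bound[OF assms])
  have "f \<in> borel_measurable torus_measure" using assms by simp
  moreover have "(\<lambda>y. cnj (ec n y)) \<in> borel_measurable torus_measure"
    by (intro continuous_measurable_torus continuous_intros)
  ultimately show "(\<lambda>y. complex_of_real (f y) * cnj (ec n y)) \<in> borel_measurable torus_measure" by simp
qed (simp add: norm_mult)

lemma fc_norm_le: 
  assumes "integrable torus_measure f"
  shows "norm (fc f n) \<le> (\<integral>y. \<bar>f y\<bar> \<partial>torus_measure)"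
  unfolding fc_def by (rule norm_integral_le) (use fc_integrable assms in \<open>auto simp: norm_mult\<close>)

lemma fc_uminus: "integrable torus_measure f \<Longrightarrow> fc f (- n) = cnj (fc f n)"
  unfolding fc_def by (subst Bochner_Integration.integral_cnj[symmetric]) (simp add: ec_minus)

lemma fc_0: "integrable torus_measure f \<Longrightarrow> fc f 0 = of_real (\<integral>x. f x \<partial>torus_measure)"
  by (simp add: fc_def)

lemma fc_diff:
  assumes "integrable torus_measure f" "integrable torus_measure g"
  shows "fc (\<lambda>x. f x - g x) n = fc f n - fc g n"
  using fc_integrable[OF assms(1)] fc_integrable[OF assms(2)]
  by (simp add: fc_def left_diff_distrib)

lemma fc_shift:
  assumes "integrable torus_measure f" "periodic_fn f" "n \<in> lattice"
  shows "fc (\<lambda>x. f (x + h)) n = ec n h * fc f n"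
proof -
  let ?g = "\<lambda>y. complex_of_real (f y) * cnj (ec n y)"
  have "fc (\<lambda>x. f (x + h)) n = (\<integral>y. ec n h * ?g (y + h) \<partial>torus_measure)"
    unfolding fc_def by (rule Bochner_Integration.integral_cong) (auto simp: ec_add mult_ac)
  also have "\<dots> = ec n h * (\<integral>y. ?g (y + h) \<partial>torus_measure)" by simp
  also have "(\<integral>y. ?g (y + h) \<partial>torus_measure) = fc f n"
    unfolding fc_def
    by (rule integral_torus_shift)
       (use assms fc_integrable in \<open>auto simp: periodic_fn_def ec_add ec_lattice\<close>)
  finally show ?thesis .
qed

lemma fser_integral:
  assumes F: "fser c F" and g: "integrable torus_measure g"
  shows "((\<lambda>n. c n * cnj (fc g n)) has_sum complex_of_real (\<integral>x. F x * g x \<partial>torus_measure)) lattice"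
proof -
  have "((\<lambda>n. c n * (\<integral>y. ec n y * complex_of_real (g y) \<partial>torus_measure)) has_sum
      (\<integral>y. complex_of_real (F y) * complex_of_real (g y) \<partial>torus_measure)) lattice"
    by (rule swap_integral(2)) (use F g in \<open>auto simp: fser_def intro: continuous_intros\<close>)
  moreover have "(\<integral>y. ec n y * complex_of_real (g y) \<partial>torus_measure) = cnj (fc g n)" for n
    unfolding fc_def by (subst Bochner_Integration.integral_cnj[symmetric]) (simp add: mult.commute)
  moreover have "(\<integral>y. complex_of_real (F y) * complex_of_real (g y) \<partial>torus_measure)
      = complex_of_real (\<integral>x. F x * g x \<partial>torus_measure)"
    by (simp flip: of_real_mult)
  ultimately show ?thesis by simp
qed

text \<open>Termwise integration against a conjugate character leaves one term by orthogonality.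
  Together with \<open>fser_unique\<close> this lets functions and coefficients be exchanged
  freely.\<close>

lemma fser_fc:
  assumes F: "fser c F" and m: "m \<in> lattice"
  shows "fc F m = c m"
proof -
  have "((\<lambda>n. c n * (\<integral>y. ec n y * cnj (ec m y) \<partial>torus_measure)) has_sum
      (\<integral>y. complex_of_real (F y) * cnj (ec m y) \<partial>torus_measure)) lattice"
    by (rule swap_integral(2))
       (use F in \<open>auto simp: fser_def intro!: continuous_intros continuous_integrable_torus\<close>)
  moreover have "(\<integral>y. ec n y * cnj (ec m y) \<partial>torus_measure) = (if n = m then 1 else 0)" if "n \<in> lattice" for n
    using integral_ec[of "n - m"] lattice_diff[OF that m] by (cases "n = m") (simp_all add: ec_minus_diff)
  ultimately have "((\<lambda>n. c n * (if n = m then 1 else 0)) has_sum fc F m) lattice"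
    unfolding fc_def by (subst (asm) has_sum_cong) auto
  moreover have "((\<lambda>n. c n * (if n = m then 1 else 0)) has_sum c m) lattice"
    by (rule has_sum_finite_neutralI[where B="{m}"]) (use m in auto)
  ultimately show ?thesis using has_sum_unique by blast
qed

lemma fser_uminus: "fser c F \<Longrightarrow> n \<in> lattice \<Longrightarrow> c (- n) = cnj (c n)"
  using fser_fc fc_uminus[OF fser_integrable] by (metis lattice_minus)

lemma fser_parseval:
  assumes F: "fser c F"
  shows "((\<lambda>n. (norm (c n))\<^sup>2) has_sum (\<integral>x. (F x)\<^sup>2 \<partial>torus_measure)) lattice"
proof -
  have "((\<lambda>n. c n * cnj (fc F n)) has_sum complex_of_real (\<integral>x. F x * F x \<partial>torus_measure)) lattice"
    by (rule fser_integral[OF F fser_integrable[OF F]])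
  also have "?this \<longleftrightarrow> ((\<lambda>n. complex_of_real ((norm (c n))\<^sup>2)) has_sum complex_of_real (\<integral>x. F x * F x \<partial>torus_measure)) lattice"
    by (rule has_sum_cong) (simp only: fser_fc[OF F] complex_norm_square)
  finally show ?thesis unfolding has_sum_of_real_iff by (simp add: power2_eq_square)
qed

lemma ec_increment: "norm (ec n (h *\<^sub>R v) - 1 - h * (2 * pi * (n \<bullet> v)) * \<i>) \<le> (2 * pi * norm n * norm v * h)\<^sup>2 / 2"
proof -
  define \<theta> where "\<theta> = h * (2 * pi * (n \<bullet> v))"
  have "ec n (h *\<^sub>R v) = iexp \<theta>" by (simp add: ec_def \<theta>_def cis_conv_exp inner_commute mult_ac)
  then have "norm (ec n (h *\<^sub>R v) - 1 - \<theta> * \<i>) \<le> \<bar>\<theta>\<bar>\<^sup>2 / 2"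
    using iexp_approx1[of \<theta> 1] by (simp add: algebra_simps numeral_2_eq_2)
  also have "\<bar>\<theta>\<bar> \<le> \<bar>2 * pi * norm n * norm v * h\<bar>"
    unfolding \<theta>_def using Cauchy_Schwarz_ineq2[of n v] by (simp add: abs_mult mult_left_mono mult_ac)
  then have "\<bar>\<theta>\<bar>\<^sup>2 \<le> (2 * pi * norm n * norm v * h)\<^sup>2" by (simp add: abs_le_square_iff)
  finally show ?thesis by (simp add: \<theta>_def)
qed

text \<open>The symbol of differentiation along \<open>v\<close>, applied to the coefficient
  \<open>c n\<close>.\<close>

definition dcoef :: "'a::euclidean_space \<Rightarrow> ('a \<Rightarrow> complex) \<Rightarrow> 'a \<Rightarrow> complex" where
  "dcoef v c n = 2 * pi * (n \<bullet> v) * \<i> * c n"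

definition dseries :: "'a::euclidean_space \<Rightarrow> ('a \<Rightarrow> complex) \<Rightarrow> 'a \<Rightarrow> real" where
  "dseries v c x = Re (\<Sum>\<^sub>\<infinity>n\<in>lattice. dcoef v c n * ec n x)"

lemma norm_dcoef_le: "norm (dcoef v c n) \<le> 2 * pi * norm v * (norm n * norm (c n))"
  using mult_right_mono[OF Cauchy_Schwarz_ineq2[of n v], of "2 * pi * norm (c n)"]
  by (simp add: dcoef_def norm_mult mult_ac)

lemma fser_deriv:
  assumes F: "fser c F" and s1: "(\<lambda>n. norm n * norm (c n)) summable_on lattice"
  shows "fser (dcoef v c) (dseries v c)"
proof -
  have "asum (dcoef v c)"
    by (rule Infinite_Sum.abs_summable_on_comparison_test'[OF summable_on_cmult_right[OF s1]]) (rule norm_dcoef_le)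
  then show ?thesis unfolding dseries_def
    by (rule fserI_real) (simp add: dcoef_def fser_uminus[OF F])
qed

text \<open>Taylor expansion term by term. The point \<open>x\<close> enters only through unimodular
  factors, so the bound is uniform in \<open>x\<close>; this uniformity later gives convergence of
  difference quotients under the integral.\<close>

lemma dseries_increment:
  assumes F: "fser c F" and s1: "(\<lambda>n. norm n * norm (c n)) summable_on lattice"
    and s2: "(\<lambda>n. (norm n)\<^sup>2 * norm (c n)) summable_on lattice"
  shows "\<bar>F (x + h *\<^sub>R v) - F x - h * dseries v c x\<bar>
      \<le> (2 * pi * norm v)\<^sup>2 / 2 * (\<Sum>\<^sub>\<infinity>n\<in>lattice. (norm n)\<^sup>2 * norm (c n)) * h\<^sup>2"
proof -
  have "fser (\<lambda>n. c n * ec n (h *\<^sub>R v) - c n - of_real h * dcoef v c n)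
     (\<lambda>x. F (x + h *\<^sub>R v) - F x - h * dseries v c x)"
    by (intro fser_diff fser_shift fser_cmult F fser_deriv[OF F] s1)
  note ser = this
  then have s: "asum (\<lambda>n. c n * ec n (h *\<^sub>R v) - c n - of_real h * dcoef v c n)"
    by (simp add: fser_def)
  have "\<bar>F (x + h *\<^sub>R v) - F x - h * dseries v c x\<bar>
      \<le> (\<Sum>\<^sub>\<infinity>n\<in>lattice. norm (c n * ec n (h *\<^sub>R v) - c n - of_real h * dcoef v c n))"
    by (rule fser_bound[OF ser])
  also have "\<dots> \<le> (\<Sum>\<^sub>\<infinity>n\<in>lattice. ((2 * pi * norm v)\<^sup>2 / 2 * h\<^sup>2) * ((norm n)\<^sup>2 * norm (c n)))"
  proof (rule infsum_mono[OF s summable_on_cmult_right[OF s2]])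
    fix n
    have "norm (c n * ec n (h *\<^sub>R v) - c n - of_real h * dcoef v c n)
      = norm (c n) * norm (ec n (h *\<^sub>R v) - 1 - h * (2 * pi * (n \<bullet> v)) * \<i>)"
      by (subst norm_mult[symmetric]) (simp add: dcoef_def algebra_simps)
    also have "\<dots> \<le> norm (c n) * ((2 * pi * norm n * norm v * h)\<^sup>2 / 2)"
      by (intro mult_left_mono ec_increment) auto
    finally show "norm (c n * ec n (h *\<^sub>R v) - c n - of_real h * dcoef v c n)
      \<le> ((2 * pi * norm v)\<^sup>2 / 2 * h\<^sup>2) * ((norm n)\<^sup>2 * norm (c n))"
      by (simp add: power_mult_distrib mult_ac)
  qed
  also have "\<dots> = ((2 * pi * norm v)\<^sup>2 / 2 * h\<^sup>2) * (\<Sum>\<^sub>\<infinity>n\<in>lattice. (norm n)\<^sup>2 * norm (c n))"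
    by (rule infsum_cmult_right) (use s2 in auto)
  finally show ?thesis by (simp add: mult_ac)
qed

section \<open>The kernel as a Fourier multiplier\<close>

locale kernel_params =
  fixes a b :: real
  assumes a_nonneg: "a \<ge> 0" and b_nonneg: "b \<ge> 0" and ab: "(a, b) \<noteq> (0, 0)"
begin

text \<open>The decay rate in time of mode \<open>n\<close>, that is, the nonnegative root of the
  quadratic equation; for \<open>a = 0\<close> the equation becomes linear and has its own
  formula.\<close>

definition lm :: "'a::euclidean_space \<Rightarrow> real" where
  "lm n = (if a = 0 then (2 * pi * norm n)\<^sup>2 / b
     else (- b + sqrt (b\<^sup>2 + 16 * a * pi\<^sup>2 * (norm n)\<^sup>2)) / (2 * a))"

definition Pt :: "real \<Rightarrow> ('a::euclidean_space \<Rightarrow> real) \<Rightarrow> 'a \<Rightarrow> real" where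
  "Pt t f x = (\<integral>y. Re (Psi a b (x - y) t) * f y \<partial>torus_measure)"

lemma Psi_hat_lm: "Psi_hat a b n t = exp (- t * lm n)"
  by (simp add: Psi_hat_def lm_def)

lemma lm_quadratic: "a * (lm n)\<^sup>2 + b * lm n = (2 * pi * norm n)\<^sup>2"
proof (cases "a = 0")
  case True then show ?thesis unfolding lm_def using ab by simp
next
  case False
  define s where "s = sqrt (b\<^sup>2 + 16 * a * pi\<^sup>2 * (norm n)\<^sup>2)"
  have s: "s\<^sup>2 = b\<^sup>2 + 16 * a * pi\<^sup>2 * (norm n)\<^sup>2" unfolding s_def using a_nonneg by simp
  have "lm n = (- b + s) / (2 * a)" using False by (simp add: lm_def s_def)
  then have "a * (lm n)\<^sup>2 + b * lm n = (s\<^sup>2 - b\<^sup>2) / (4 * a)"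
  proof -
    assume l: "lm n = (- b + s) / (2 * a)"
    have "a * (lm n)\<^sup>2 = (s - b)\<^sup>2 / (4 * a)" "b * lm n = (2 * b * (s - b)) / (4 * a)"
      unfolding l using False by (simp_all add: power2_eq_square)
    then have "a * (lm n)\<^sup>2 + b * lm n = ((s - b)\<^sup>2 + 2 * b * (s - b)) / (4 * a)"
      by (simp add: add_divide_distrib)
    also have "(s - b)\<^sup>2 + 2 * b * (s - b) = s\<^sup>2 - b\<^sup>2" by (simp add: power2_eq_square algebra_simps)
    finally show ?thesis .
  qed
  then show ?thesis using s False by (simp add: power_mult_distrib)
qed

lemma lm_nonneg: "0 \<le> lm n"
proof (cases "a = 0")
  case True then show ?thesis unfolding lm_def using b_nonneg by simp
next
  case False
  have "b \<le> sqrt (b\<^sup>2 + 16 * a * pi\<^sup>2 * (norm n)\<^sup>2)"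
    using a_nonneg by (intro real_le_rsqrt) simp
  then show ?thesis using False a_nonneg by (simp add: lm_def)
qed

lemma lm_0 [simp]: "lm 0 = 0"
  using b_nonneg by (simp add: lm_def)

lemma lm_uminus [simp]: "lm (- n) = lm n"
  by (simp add: lm_def)

text \<open>Any positive constant with \<open>c0 \<le> 1\<close> and \<open>c0 * (a + b) < 1\<close>
  would do in \<open>lm_ge\<close>; this one satisfies both for all admissible parameters.\<close>

definition c0 :: real where "c0 = 1 / (1 + a + b)"

lemma c0_pos: "0 < c0" using a_nonneg b_nonneg by (simp add: c0_def)

text \<open>Suppose \<open>lm n\<close> were below \<open>c0 * \<xi>\<close>, where
  \<open>\<xi> = 2 * pi * norm n\<close> is at least 1. Then \<open>lm n\<close> and its square
  would both be at most \<open>c0 * \<xi>^2\<close>, and the quadratic equation would bound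
  \<open>\<xi>^2\<close> by \<open>c0 * (a + b) * \<xi>^2\<close>, which is smaller. Arguing from
  the equation treats \<open>a = 0\<close> and \<open>a > 0\<close> together. The linear growth
  makes all series at positive times converge.\<close>

lemma lm_ge:
  assumes n: "n \<in> lattice" shows "c0 * norm n \<le> lm n"
proof (cases "n = 0")
  case False
  define \<xi> where "\<xi> = 2 * pi * norm n"
  have n1: "1 \<le> norm n" using lattice_norm_ge_1[OF n False] .
  have "1 * norm n \<le> \<xi>" unfolding \<xi>_def using pi_gt3 by (intro mult_right_mono) auto
  then have n\<xi>: "norm n \<le> \<xi>" by simp
  then have \<xi>: "1 \<le> \<xi>" using n1 by linarith
  have c1: "c0 \<le> 1" "c0 * (a + b) < 1" using a_nonneg b_nonneg by (auto simp: c0_def field_simps)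
  have "c0 * \<xi> \<le> lm n"
  proof (rule ccontr)
    assume "\<not> ?thesis"
    then have l: "lm n < c0 * \<xi>" by simp
    have "(lm n)\<^sup>2 \<le> c0 * \<xi>\<^sup>2"
    proof -
      have "(lm n)\<^sup>2 \<le> (c0 * \<xi>)\<^sup>2" using l lm_nonneg[of n] by (intro power_mono) auto
      also have "\<dots> \<le> c0 * \<xi>\<^sup>2"
        unfolding power_mult_distrib using c1 c0_pos
        by (intro mult_right_mono) (simp_all add: power2_eq_square mult_left_le_one_le)
      finally show ?thesis .
    qed
    moreover have "lm n \<le> c0 * \<xi>\<^sup>2"
    proof -
      have "\<xi> * 1 \<le> \<xi> * \<xi>" using \<xi> by (intro mult_left_mono) auto
      then have "c0 * \<xi> \<le> c0 * \<xi>\<^sup>2" using c0_pos by (simp add: power2_eq_square)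
      then show ?thesis using l by linarith
    qed
    ultimately have "a * (lm n)\<^sup>2 + b * lm n \<le> a * (c0 * \<xi>\<^sup>2) + b * (c0 * \<xi>\<^sup>2)"
      using a_nonneg b_nonneg by (intro add_mono mult_left_mono)
    also have "\<dots> = (c0 * (a + b)) * \<xi>\<^sup>2" by (simp add: algebra_simps)
    also have "\<dots> < 1 * \<xi>\<^sup>2" using c1 \<xi> by (intro mult_strict_right_mono) auto
    finally show False using lm_quadratic[of n] by (simp add: \<xi>_def)
  qed
  then show ?thesis using mult_left_mono[OF n\<xi>, of c0] c0_pos by linarith
qed simp

text \<open>Counterpart of \<open>lm_ge\<close> from above: the maximal estimate meets the weight
  \<open>lm n / 2\<close> and has to absorb it into the Dirichlet energy.\<close>

lemma lm_le: "\<exists>C. \<forall>n\<in>lattice. lm n \<le> C * (norm n)\<^sup>2"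
proof -
  consider "a > 0" | "a = 0" "b > 0" using ab a_nonneg b_nonneg by fastforce
  then show ?thesis
  proof cases
    case 2
    then show ?thesis unfolding lm_def by (intro exI[of _ "(2 * pi)\<^sup>2 / b"]) (simp add: power_mult_distrib)
  next
    case 1
    have "lm n \<le> (1 + 4 * pi\<^sup>2 / a) * (norm n)\<^sup>2" if n: "n \<in> lattice" for n :: 'a
    proof (cases "n = 0")
      case False
      then have n1: "1 \<le> (norm n)\<^sup>2" using lattice_norm_ge_1[OF n] by simp
      have "a * (lm n)\<^sup>2 \<le> (2 * pi * norm n)\<^sup>2"
        using lm_quadratic[of n] mult_nonneg_nonneg[OF b_nonneg lm_nonneg[of n]] by linarith
      then have "(lm n)\<^sup>2 \<le> 4 * pi\<^sup>2 / a * (norm n)\<^sup>2" using 1 by (simp add: field_simps)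
      moreover have "lm n \<le> 1 + (lm n)\<^sup>2"
        using zero_le_power2[of "lm n - 1/2"] by (simp add: power2_eq_square algebra_simps)
      ultimately show ?thesis using n1 by (simp add: algebra_simps)
    qed simp
    then show ?thesis by blast
  qed
qed

lemma summable_exp_coeff:
  fixes c :: "'a::euclidean_space \<Rightarrow> complex"
  assumes t: "0 < t" and B: "\<And>n. n \<in> lattice \<Longrightarrow> norm (c n) \<le> B"
  shows "(\<lambda>n::'a::euclidean_space. norm n ^ k * norm (of_real (exp (- t * lm n)) * c n)) summable_on lattice"
proof -
  have "(\<lambda>n::'a. B * (norm n ^ k * exp (- (t * c0) * norm n))) summable_on lattice"
    by (intro summable_on_cmult_right summable_power_exp_lattice) (use t c0_pos in simp)
  then show ?thesis
  proof (rule summable_on_comparison_test)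
    fix n :: 'a assume n: "n \<in> lattice"
    have "exp (- t * lm n) \<le> exp (- (t * c0) * norm n)"
      using lm_ge[OF n] t by (simp add: mult.assoc)
    then have "exp (- t * lm n) * norm (c n) \<le> exp (- (t * c0) * norm n) * B"
      by (intro mult_mono B n) auto
    then have "norm n ^ k * (exp (- t * lm n) * norm (c n)) \<le> norm n ^ k * (exp (- (t * c0) * norm n) * B)"
      by (intro mult_left_mono) auto
    then show "norm n ^ k * norm (of_real (exp (- t * lm n)) * c n) \<le> B * (norm n ^ k * exp (- (t * c0) * norm n))"
      unfolding norm_mult norm_of_real abs_exp_cancel by (simp only: mult_ac)
  qed auto
qed

lemma asum_exp_coeff:
  fixes c :: "'a::euclidean_space \<Rightarrow> complex"
  assumes "0 < t" and "\<And>n. n \<in> lattice \<Longrightarrow> norm (c n) \<le> B"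
  shows "asum (\<lambda>n::'a::euclidean_space. of_real (exp (- t * lm n)) * c n)"
  using summable_exp_coeff[of t c B 0] assms by simp

lemma fser_Psi:
  assumes t: "0 < t"
  shows "fser (\<lambda>n::'a::euclidean_space. of_real (exp (- t * lm n))) (\<lambda>x. Re (Psi a b x t))"
proof -
  have "asum (\<lambda>n::'a. of_real (exp (- t * lm n)))"
    using asum_exp_coeff[of t "\<lambda>_::'a. 1" 1] t by simp
  from fserI_real[OF this] show ?thesis
    by (simp add: Psi_def Psi_hat_lm ec_def)
qed

definition Pc :: "real \<Rightarrow> ('a::euclidean_space \<Rightarrow> real) \<Rightarrow> 'a \<Rightarrow> complex" where
  "Pc t f n = of_real (exp (- t * lm n)) * fc f n"

text \<open>Expanding the kernel at \<open>x - y\<close> and integrating termwise against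
  \<open>f\<close> turns the convolution into a Fourier multiplier.\<close>

lemma fser_Pt:
  assumes t: "0 < t" and f: "integrable torus_measure f"
  shows "fser (Pc t f) (Pt t f)"
  unfolding fser_def
proof (intro conjI allI)
  show "asum (Pc t f)" unfolding Pc_def
    by (rule asum_exp_coeff[OF t fc_norm_le[OF f]])
  fix x
  let ?e = "\<lambda>n::'a. complex_of_real (exp (- t * lm n))"
  have "((\<lambda>n. (?e n * ec n x) * (\<integral>y. cnj (ec n y) * complex_of_real (f y) \<partial>torus_measure)) has_sum
      (\<integral>y. complex_of_real (Re (Psi a b (x - y) t)) * complex_of_real (f y) \<partial>torus_measure)) lattice"
  proof (rule swap_integral(2))
    show "asum (\<lambda>n. ?e n * ec n x)" using fser_Psi[OF t, where 'a='a] by (simp add: fser_def norm_mult)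
    show "((\<lambda>n. ?e n * ec n x * cnj (ec n y)) has_sum complex_of_real (Re (Psi a b (x - y) t))) lattice" for y
      using fser_Psi[OF t] unfolding fser_def mult.assoc ec_diff[symmetric] by blast
  qed (use f in \<open>auto intro: continuous_intros\<close>)
  moreover have "(\<integral>y. complex_of_real (Re (Psi a b (x - y) t)) * complex_of_real (f y) \<partial>torus_measure)
      = complex_of_real (Pt t f x)"
    unfolding Pt_def by (simp flip: of_real_mult)
  ultimately show "((\<lambda>n. Pc t f n * ec n x) has_sum complex_of_real (Pt t f x)) lattice"
    unfolding Pc_def fc_def by (simp add: mult_ac)
qed

end

section \<open>Positivity of the kernel\<close>

text \<open>A negative \<open>k\<close> would make \<open>f'\<close> negative just to the right of
  the critical point, so \<open>f\<close> would fall below its minimum.\<close>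

lemma local_min_deriv2:
  fixes f :: "real \<Rightarrow> real"
  assumes d: "0 < d" and f: "\<And>s. \<bar>s - s0\<bar> < d \<Longrightarrow> DERIV f s :> f' s" and k: "DERIV f' s0 :> k"
    and min: "\<And>s. \<bar>s - s0\<bar> < d \<Longrightarrow> f s0 \<le> f s"
  shows "f' s0 = 0" "0 \<le> k"
proof -
  show 0: "f' s0 = 0"
    using DERIV_local_min[OF f[of s0] d] d min by (simp add: abs_minus_commute)
  show "0 \<le> k"
  proof (rule ccontr)
    assume "\<not> 0 \<le> k"
    then obtain d' where d': "0 < d'" "\<And>h. 0 < h \<Longrightarrow> h < d' \<Longrightarrow> f' (s0 + h) < f' s0"
      using DERIV_neg_dec_right[OF k] by force
    define h where "h = min d d' / 2"
    have h: "0 < h" "h < d" "h < d'" using d d' by (auto simp: h_def min_def)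
    have "f (s0 + h) < f s0"
    proof (rule DERIV_neg_imp_decreasing_open[where a=s0 and b="s0 + h"])
      fix x assume x: "s0 < x" "x < s0 + h"
      then show "\<exists>y. DERIV f x :> y \<and> y < 0"
        using f[of x] d'(2)[of "x - s0"] h 0 by auto
    next
      show "continuous_on {s0..s0 + h} f"
        using DERIV_isCont[OF f] h by (auto intro!: continuous_at_imp_continuous_on)
    qed (use h in auto)
    then show False using min[of "s0 + h"] h by simp
  qed
qed

lemma exists_lattice_shift: "\<exists>k\<in>lattice. x - k \<in> cbox 0 (One::'a::euclidean_space)"
proof -
  define k :: 'a where "k = (\<Sum>i\<in>Basis. of_int \<lfloor>x \<bullet> i\<rfloor> *\<^sub>R i)"
  have k: "k \<bullet> i = of_int \<lfloor>x \<bullet> i\<rfloor>" if "i \<in> Basis" for i using that by (simp add: k_def)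
  have "k \<in> lattice" using k by (simp add: lattice_def)
  moreover have "x - k \<in> cbox 0 One"
    using k by (auto simp: mem_box inner_diff_left) linarith
  ultimately show ?thesis by blast
qed

lemma power2_norm_eq_sum: "(norm (x::'a::euclidean_space))\<^sup>2 = (\<Sum>i\<in>Basis. (x \<bullet> i)\<^sup>2)"
  unfolding power2_norm_eq_inner euclidean_inner[of x x] by (simp add: power2_eq_square)

text \<open>Half-open boxes make the count an exact power, so that in the Fejer argument the
  proportion of points near the faces can be computed.\<close>

lemma lattice_box:
  fixes p q :: int
  assumes "p \<le> q"
  defines "B \<equiv> {m::'a::euclidean_space \<in> lattice. \<forall>i\<in>Basis. of_int p \<le> m \<bullet> i \<and> m \<bullet> i < of_int q}"
  shows "finite B" "card B = nat (q - p) ^ DIM('a)"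
proof -
  define v :: "('a \<Rightarrow> int) \<Rightarrow> 'a" where "v g = (\<Sum>i\<in>Basis. of_int (g i) *\<^sub>R i)" for g
  have v: "v g \<bullet> i = of_int (g i)" if "i \<in> Basis" for g i using that by (simp add: v_def)
  have "bij_betw v (PiE (Basis::'a set) (\<lambda>_. {p..<q})) B"
  proof (rule bij_betwI')
    fix g h assume gh: "g \<in> PiE (Basis::'a set) (\<lambda>_. {p..<q})" "h \<in> PiE (Basis::'a set) (\<lambda>_. {p..<q})"
    show "(v g = v h) = (g = h)"
    proof
      assume eq: "v g = v h"
      show "g = h"
      proof (rule PiE_ext[OF gh])
        fix i :: 'a assume "i \<in> Basis"
        then show "g i = h i" using eq v[of i g] v[of i h] by simp
      qed
    qed simp
  next
    fix g assume "g \<in> PiE (Basis::'a set) (\<lambda>_. {p..<q})"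
    then show "v g \<in> B" by (auto simp: B_def lattice_def v PiE_def Pi_def)
  next
    fix m assume m: "m \<in> B"
    have fl: "of_int \<lfloor>m \<bullet> i\<rfloor> = m \<bullet> i" if "i \<in> Basis" for i using m that by (simp add: B_def lattice_def)
    have "m = v (\<lambda>i\<in>Basis. \<lfloor>m \<bullet> i\<rfloor>)"
      by (rule euclidean_eqI) (simp add: v fl)
    moreover have "(\<lambda>i\<in>Basis. \<lfloor>m \<bullet> i\<rfloor>) \<in> PiE (Basis::'a set) (\<lambda>_. {p..<q})"
      using m by (auto simp: B_def le_floor_iff floor_less_iff)
    ultimately show "\<exists>g\<in>PiE Basis (\<lambda>_. {p..<q}). m = v g" by blast
  qed
  moreover have "finite (PiE (Basis::'a set) (\<lambda>_. {p..<q}))" by (rule finite_PiE) auto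
  moreover have "card (PiE (Basis::'a set) (\<lambda>_. {p..<q})) = nat (q - p) ^ DIM('a)"
    by (simp add: card_PiE)
  ultimately show "finite B" "card B = nat (q - p) ^ DIM('a)"
    using bij_betw_finite bij_betw_same_card by metis+
qed

context kernel_params
begin

text \<open>Maximum principle for \<open>a u\<^sub>t\<^sub>t - b u\<^sub>t + \<Delta>u = 0\<close>: subtracting \<open>\<epsilon> exp (- t)\<close> makes the
  solution a strict supersolution for all admissible \<open>a\<close> and \<open>b\<close> at once.\<close>

lemma trig_max_principle:
  fixes \<nu> :: "'j \<Rightarrow> 'a::euclidean_space" and c :: "'j \<Rightarrow> complex"
  assumes J: "finite J" "\<And>j. j \<in> J \<Longrightarrow> \<nu> j \<in> lattice"
  defines "U \<equiv> \<lambda>x t. \<Sum>j\<in>J. Re (c j * ec (\<nu> j) x) * exp (- t * lm (\<nu> j))"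
  assumes U0: "\<And>x. 0 \<le> U x 0" and t1: "0 \<le> t1"
  shows "0 \<le> U x1 t1"
proof (rule ccontr)
  assume neg: "\<not> ?thesis"
  define \<delta> where "\<delta> = - U x1 t1"
  have \<delta>: "0 < \<delta>" using neg by (simp add: \<delta>_def)
  have per: "U (x + k) t = U x t" if "k \<in> lattice" for x k t
    unfolding U_def using that J(2) by (intro sum.cong) (auto simp: ec_add ec_lattice)
  \<comment> \<open>The spatial mean: nonnegative by \<open>U0\<close>, and the limit of
    \<open>U\<close> for large times, uniformly in space.\<close>
  define m where "m = (\<Sum>j\<in>J. if \<nu> j = 0 then Re (c j) else 0)"
  have intU: "(\<integral>x. U x 0 \<partial>torus_measure) = m"
  proof -
    have "(\<integral>x. Re (c j * ec (\<nu> j) x) \<partial>torus_measure) = (if \<nu> j = 0 then Re (c j) else 0)" if "j \<in> J" for j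
      using integral_ec[OF J(2)[OF that]] by (subst integral_Re) auto
    then show ?thesis unfolding U_def m_def
      by (subst Bochner_Integration.integral_sum) auto
  qed
  have m0: "0 \<le> m" unfolding intU[symmetric] by (intro integral_nonneg_AE always_eventually allI U0)
  have lim: "\<exists>T0. \<forall>t\<ge>T0. \<forall>x. m - \<delta> / 4 \<le> U x t"
  proof -
    define E where "E t = (\<Sum>j\<in>J. if \<nu> j = 0 then 0 else norm (c j) * exp (- t * lm (\<nu> j)))" for t
    have E: "(E \<longlongrightarrow> (\<Sum>j\<in>J. if \<nu> j = 0 then 0 else 0)) at_top" unfolding E_def
    proof (rule tendsto_sum)
      fix j assume j: "j \<in> J"
      have pos: "0 < lm (\<nu> j)" if "\<nu> j \<noteq> 0"
        using lm_ge[OF J(2)[OF j]] lattice_norm_ge_1[OF J(2)[OF j] that] c0_pos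
        by (smt (verit) mult_pos_pos)
      show "((\<lambda>t. if \<nu> j = 0 then 0 else norm (c j) * exp (- t * lm (\<nu> j))) \<longlongrightarrow> (if \<nu> j = 0 then 0 else 0)) at_top"
      proof (cases "\<nu> j = 0")
        case False
        with pos have "0 < lm (\<nu> j)" by simp
        then have "((\<lambda>t. norm (c j) * exp (- t * lm (\<nu> j))) \<longlongrightarrow> 0) at_top" by real_asymp
        then show ?thesis using False by simp
      qed simp
    qed
    then have "\<forall>\<^sub>F t in at_top. E t < \<delta> / 4" using \<delta> by (intro order_tendstoD(2)[OF E]) simp
    then obtain T0 where T0: "\<And>t. t \<ge> T0 \<Longrightarrow> E t < \<delta> / 4" by (auto simp: eventually_at_top_linorder)
    have "m - E t \<le> U x t" for x t
      unfolding m_def E_def U_def sum_subtractf[symmetric]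
    proof (rule sum_mono)
      fix j
      have "- norm (c j * ec (\<nu> j) x) \<le> Re (c j * ec (\<nu> j) x)"
        using complex_Re_le_cmod[of "- (c j * ec (\<nu> j) x)"] by simp
      then have "- norm (c j) * exp (- t * lm (\<nu> j)) \<le> Re (c j * ec (\<nu> j) x) * exp (- t * lm (\<nu> j))"
        by (intro mult_right_mono) (auto simp: norm_mult)
      then show "(if \<nu> j = 0 then Re (c j) else 0) - (if \<nu> j = 0 then 0 else norm (c j) * exp (- t * lm (\<nu> j)))
        \<le> Re (c j * ec (\<nu> j) x) * exp (- t * lm (\<nu> j))" by simp
    qed
    then show ?thesis using T0 by (intro exI[of _ T0]) (smt (verit))
  qed
  then obtain T0 where T0: "\<And>t x. t \<ge> T0 \<Longrightarrow> m - \<delta> / 4 \<le> U x t" by blast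
  define T where "T = max T0 t1"
  \<comment> \<open>A quarter of the depth \<delta>: at time 0 the perturbed function is at least
    -\<delta>/4 and at time \<open>T\<close> at least -\<delta>/2, so a minimum not above -\<delta>
    is attained strictly between.\<close>
  define \<epsilon> where "\<epsilon> = \<delta> / 4"
  have \<epsilon>: "0 < \<epsilon>" using \<delta> by (simp add: \<epsilon>_def)
  define w where "w x t = U x t - \<epsilon> * exp (- t)" for x t
  have "continuous_on (cbox 0 One \<times> {0..T}) (\<lambda>p. w (fst p) (snd p))"
    unfolding w_def U_def ec_def cis_conv_exp by (intro continuous_intros)
  moreover have "compact (cbox 0 (One::'a) \<times> {0..T})" by (intro compact_Times) auto
  moreover have "cbox 0 (One::'a) \<times> {0..T} \<noteq> {}" using t1 by (auto simp: T_def box_ne_empty)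
  ultimately obtain p where p: "p \<in> cbox 0 One \<times> {0..T}" 
    "\<And>q. q \<in> cbox 0 One \<times> {0..T} \<Longrightarrow> w (fst p) (snd p) \<le> w (fst q) (snd q)"
    using continuous_attains_inf by (metis (no_types, lifting))
  obtain x0 t0 where p_eq: "p = (x0, t0)" by (cases p)
  have t0: "0 \<le> t0" "t0 \<le> T" using p p_eq by auto
  \<comment> \<open>Periodicity extends the minimum from the compact cube to all of space, so the
    spatial second-derivative test applies even if \<open>x0\<close> lies on a face.\<close>
  have min: "w x0 t0 \<le> w x t" if "0 \<le> t" "t \<le> T" for x t
  proof -
    obtain k where k: "k \<in> lattice" "x - k \<in> cbox 0 One" using exists_lattice_shift by blast
    have "w x0 t0 \<le> w (x - k) t" using p(2)[of "(x - k, t)"] k that by (simp add: p_eq)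
    also have "\<dots> = w x t" using per[OF k(1), of "x - k" t] by (simp add: w_def)
    finally show ?thesis .
  qed
  have "w x0 t0 \<le> w x1 t1" using t1 by (intro min) (auto simp: T_def)
  also have "\<dots> \<le> - \<delta>" using \<epsilon> by (simp add: w_def \<delta>_def)
  finally have w0: "w x0 t0 \<le> - \<delta>" .
  have "exp (- t0) \<le> 1" using t0 by simp
  then have e1: "\<epsilon> * exp (- t0) \<le> \<delta> / 4" using \<epsilon> unfolding \<epsilon>_def by (simp add: mult_left_le)
  have "t0 \<noteq> 0" using w0 U0[of x0] \<delta> e1 by (auto simp: w_def)
  moreover have "t0 \<noteq> T" using w0 T0[of T x0] m0 \<delta> e1 by (auto simp: w_def T_def)
  ultimately have t0': "0 < t0" "t0 < T" using t0 by auto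
  define A where "A j = Re (c j * ec (\<nu> j) x0)" for j
  define Ex where "Ex j = exp (- t0 * lm (\<nu> j))" for j
  have time: "(\<Sum>j\<in>J. A j * (- lm (\<nu> j)) * Ex j) + \<epsilon> * exp (- t0) = 0"
    "0 \<le> (\<Sum>j\<in>J. A j * (lm (\<nu> j))\<^sup>2 * Ex j) - \<epsilon> * exp (- t0)"
  proof -
    define g where "g t = (\<Sum>j\<in>J. A j * (- lm (\<nu> j)) * exp (- t * lm (\<nu> j))) + \<epsilon> * exp (- t)" for t
    have d1: "DERIV (w x0) t :> g t" for t
      unfolding w_def[abs_def] U_def g_def A_def
      by (auto intro!: derivative_eq_intros simp: algebra_simps simp flip: sum_distrib_left intro!: sum.cong)
    have d2: "DERIV g t0 :> (\<Sum>j\<in>J. A j * (lm (\<nu> j))\<^sup>2 * Ex j) - \<epsilon> * exp (- t0)"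
      unfolding g_def[abs_def] Ex_def
      by (auto intro!: derivative_eq_intros simp: algebra_simps power2_eq_square intro!: sum.cong)
    have "w x0 t0 \<le> w x0 s" if "\<bar>s - t0\<bar> < min t0 (T - t0)" for s
      using that by (intro min) (auto simp: abs_less_iff)
    then have "g t0 = 0" "0 \<le> (\<Sum>j\<in>J. A j * (lm (\<nu> j))\<^sup>2 * Ex j) - \<epsilon> * exp (- t0)"
      using local_min_deriv2[of "min t0 (T - t0)" t0 "w x0" g, OF _ d1 d2] t0' by auto
    then show "(\<Sum>j\<in>J. A j * (- lm (\<nu> j)) * Ex j) + \<epsilon> * exp (- t0) = 0"
      "0 \<le> (\<Sum>j\<in>J. A j * (lm (\<nu> j))\<^sup>2 * Ex j) - \<epsilon> * exp (- t0)" by (auto simp: g_def Ex_def)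
  qed
  have space: "0 \<le> (\<Sum>j\<in>J. A j * (- (2 * pi * (\<nu> j \<bullet> i))\<^sup>2) * Ex j)" if i: "i \<in> Basis" for i
  proof -
    define B where "B j = Im (c j * ec (\<nu> j) x0)" for j
    define \<omega> where "\<omega> j = 2 * pi * (\<nu> j \<bullet> i)" for j
    define f where "f s = (\<Sum>j\<in>J. (A j * cos (\<omega> j * s) - B j * sin (\<omega> j * s)) * Ex j) - \<epsilon> * exp (- t0)" for s
    define f' where "f' s = (\<Sum>j\<in>J. (- A j * \<omega> j * sin (\<omega> j * s) - B j * \<omega> j * cos (\<omega> j * s)) * Ex j)" for s
    have fw: "f s = w (x0 + s *\<^sub>R i) t0" for s
    proof -
      have "Re (c j * ec (\<nu> j) (x0 + s *\<^sub>R i)) = A j * cos (\<omega> j * s) - B j * sin (\<omega> j * s)" for j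
        unfolding ec_add mult.assoc[symmetric] times_complex.simps A_def B_def
        by (simp add: ec_def \<omega>_def inner_commute mult_ac)
      then show ?thesis by (simp add: f_def w_def U_def Ex_def)
    qed
    have d1: "DERIV f s :> f' s" for s
      unfolding f_def[abs_def] f'_def
      by (auto intro!: derivative_eq_intros simp: algebra_simps intro!: sum.cong)
    have d2: "DERIV f' 0 :> (\<Sum>j\<in>J. A j * (- (\<omega> j)\<^sup>2) * Ex j)"
      unfolding f'_def[abs_def]
      by (auto intro!: derivative_eq_intros simp: algebra_simps power2_eq_square intro!: sum.cong)
    have "f 0 \<le> f s" for s unfolding fw using min[of t0] t0 by simp
    then show ?thesis
      using local_min_deriv2(2)[of 1 0 f f', OF _ d1 d2] by (simp add: \<omega>_def)
  qed
  have "0 \<le> (\<Sum>i\<in>Basis. \<Sum>j\<in>J. A j * (- (2 * pi * (\<nu> j \<bullet> i))\<^sup>2) * Ex j)"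
    by (rule sum_nonneg) (rule space)
  \<comment> \<open>At the minimum, \<open>a\<close> times the second time derivative minus
    \<open>b\<close> times the first plus the Laplacian of \<open>w\<close> is nonnegative. The
    contribution of \<open>U\<close> cancels mode by mode through \<open>lm_quadratic\<close>, and
    the perturbation leaves \<open>- (a + b) * \<epsilon> * exp (- t0)\<close>, which is
    negative.\<close>
  then have "0 \<le> a * ((\<Sum>j\<in>J. A j * (lm (\<nu> j))\<^sup>2 * Ex j) - \<epsilon> * exp (- t0))
      - b * ((\<Sum>j\<in>J. A j * (- lm (\<nu> j)) * Ex j) + \<epsilon> * exp (- t0))
      + (\<Sum>i\<in>Basis. \<Sum>j\<in>J. A j * (- (2 * pi * (\<nu> j \<bullet> i))\<^sup>2) * Ex j)"
    unfolding time(1) using mult_nonneg_nonneg[OF a_nonneg time(2)] by simp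
  also have "(\<Sum>i\<in>Basis. \<Sum>j\<in>J. A j * (- (2 * pi * (\<nu> j \<bullet> i))\<^sup>2) * Ex j)
      = (\<Sum>j\<in>J. A j * (- (a * (lm (\<nu> j))\<^sup>2 + b * lm (\<nu> j))) * Ex j)"
    unfolding lm_quadratic power_mult_distrib power2_norm_eq_sum
    by (subst sum.swap) (simp add: sum_distrib_left sum_distrib_right sum_negf mult_ac)
  also have "a * ((\<Sum>j\<in>J. A j * (lm (\<nu> j))\<^sup>2 * Ex j) - \<epsilon> * exp (- t0))
      - b * ((\<Sum>j\<in>J. A j * (- lm (\<nu> j)) * Ex j) + \<epsilon> * exp (- t0))
      + (\<Sum>j\<in>J. A j * (- (a * (lm (\<nu> j))\<^sup>2 + b * lm (\<nu> j))) * Ex j)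
      = - (a + b) * \<epsilon> * exp (- t0)
        + (\<Sum>j\<in>J. a * (A j * (lm (\<nu> j))\<^sup>2 * Ex j) - b * (A j * (- lm (\<nu> j)) * Ex j)
            + A j * (- (a * (lm (\<nu> j))\<^sup>2 + b * lm (\<nu> j))) * Ex j)"
    by (simp add: sum.distrib sum_subtractf sum_distrib_left algebra_simps)
  also have "\<dots> = - (a + b) * \<epsilon> * exp (- t0)"
    by (simp add: algebra_simps)
  finally have "0 \<le> - (a + b) * \<epsilon> * exp (- t0)" .
  then have "(a + b) * (\<epsilon> * exp (- t0)) \<le> 0" by (simp add: algebra_simps)
  moreover have "0 < a + b" using a_nonneg b_nonneg ab by (cases "a = 0") auto
  then have "0 < (a + b) * (\<epsilon> * exp (- t0))" using \<epsilon> by simp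
  ultimately show False by simp
qed

text \<open>The Fejer-type kernels \<open>\<bar>\<Sum>\<^bsub>m\<in>B\<^esub> e\<^sub>m\<bar>\<^sup>2 / card B\<close> over large boxes \<open>B\<close> are nonnegative
  and have Fourier coefficients tending to 1.\<close>

lemma Psi_nonneg:
  fixes x :: "'a::euclidean_space"
  assumes t: "0 < t" shows "0 \<le> Re (Psi a b x t)"
proof (rule ccontr)
  assume neg: "\<not> ?thesis"
  define \<delta> where "\<delta> = - Re (Psi a b x t)"
  have \<delta>: "0 < \<delta>" using neg by (simp add: \<delta>_def)
  define G where "G n = Re (ec n x) * exp (- t * lm n)" for n :: 'a
  have asum: "asum (\<lambda>n::'a. of_real (exp (- t * lm n)))" using fser_Psi[OF t, where 'a='a] by (simp add: fser_def)
  have "(\<lambda>n. norm (G n)) summable_on lattice"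
    by (rule summable_on_comparison_test[OF asum])
       (use abs_Re_le_cmod[of "ec _ x"] in \<open>auto simp: G_def abs_mult intro!: mult_left_le_one_le\<close>)
  then have Gs: "(\<lambda>n. \<bar>G n\<bar>) summable_on lattice" by simp
  define G1 where "G1 = infsum (\<lambda>n. \<bar>G n\<bar>) lattice"
  have hs: "(G has_sum - \<delta>) lattice"
  proof -
    have "((\<lambda>n. Re (of_real (exp (- t * lm n)) * ec n x)) has_sum Re (complex_of_real (Re (Psi a b x t)))) lattice"
      by (rule has_sum_Re) (use fser_Psi[OF t, where 'a='a] in \<open>simp add: fser_def\<close>)
    then show ?thesis by (simp add: G_def[abs_def] \<delta>_def mult.commute)
  qed
  from hs have "(sum G \<longlongrightarrow> - \<delta>) (finite_subsets_at_top lattice)" by (simp add: has_sum_def)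
  then have "\<forall>\<^sub>F X in finite_subsets_at_top lattice. sum G X < - (\<delta> / 2)"
    by (rule order_tendstoD(2)) (use \<delta> in simp)
  then obtain F where F: "finite F" "F \<subseteq> lattice"
    "\<And>X. finite X \<Longrightarrow> F \<subseteq> X \<Longrightarrow> X \<subseteq> lattice \<Longrightarrow> sum G X < - (\<delta> / 2)"
    unfolding eventually_finite_subsets_at_top by auto
  have G1: "sum G X \<le> G1" if "finite X" "X \<subseteq> lattice" for X
  proof -
    have "sum G X \<le> sum (\<lambda>n. \<bar>G n\<bar>) X" by (rule sum_mono) simp
    also have "\<dots> \<le> G1" unfolding G1_def by (rule finite_sum_le_infsum[OF Gs]) (use that in auto)
    finally show ?thesis .
  qed
  \<comment> \<open>Width of the margin: the translate of the large box by a point at least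
    \<open>L\<close> away from its faces still covers \<open>F\<close>.\<close>
  define L where "L = nat \<lceil>\<Sum>n\<in>F. norm n\<rceil>"
  have L: "\<bar>n \<bullet> i\<bar> \<le> real L" if "n \<in> F" "i \<in> Basis" for n i
  proof -
    have "norm n \<le> real L"
      using member_le_sum[OF that(1), of norm] F(1) unfolding L_def by (simp add: le_nat_iff) linarith
    then show ?thesis using Basis_le_norm[of i n] that by force
  qed
  define D where "D = DIM('a)"
  \<comment> \<open>The Fejer sum evolved to time \<open>t\<close> is nonnegative. Grouped by the
    second index, each \<open>m'\<close> in the inner box contributes at most -\<delta>/2, because
    its translate of \<open>B\<close> contains \<open>F\<close>; each of the remaining ones
    contributes at most \<open>G1\<close>.\<close>
  have key: "(real (N - 2 * L) ^ D) * (\<delta> / 2) \<le> (real N ^ D - real (N - 2 * L) ^ D) * G1" if N: "2 * L \<le> N" for N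
  proof -
    define B where "B = {m::'a \<in> lattice. \<forall>i\<in>Basis. of_int 0 \<le> m \<bullet> i \<and> m \<bullet> i < of_int (int N)}"
    define I where "I = {m::'a \<in> lattice. \<forall>i\<in>Basis. of_int (int L) \<le> m \<bullet> i \<and> m \<bullet> i < of_int (int (N - L))}"
    have B: "finite B" "card B = N ^ D" unfolding B_def D_def using lattice_box[of 0 "int N"] by auto
    have I: "finite I" "card I = (N - 2 * L) ^ D"
      unfolding I_def D_def using lattice_box[of "int L" "int (N - L)", where 'a='a] N by (auto simp: nat_diff_distrib nat_mult_distrib)
    have IB: "I \<subseteq> B" using N by (auto simp: I_def B_def of_nat_diff)
    have BL: "B \<subseteq> lattice" by (auto simp: B_def)
    \<comment> \<open>At time 0 this double sum is the squared modulus of a sum of characters, so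
      the maximum principle applies.\<close>
    have "0 \<le> (\<Sum>p\<in>B \<times> B. Re (1 * ec (fst p - snd p) x) * exp (- t * lm (fst p - snd p)))"
    proof (rule trig_max_principle[where \<nu>="\<lambda>p. fst p - snd p" and c="\<lambda>_. 1"])
      fix y
      have "(\<Sum>p\<in>B \<times> B. Re (1 * ec (fst p - snd p) y) * exp (- 0 * lm (fst p - snd p)))
        = Re (\<Sum>p\<in>B \<times> B. ec (fst p) y * cnj (ec (snd p) y))"
        by (simp add: ec_minus_diff)
      also have "(\<Sum>p\<in>B \<times> B. ec (fst p) y * cnj (ec (snd p) y)) = (\<Sum>m\<in>B. ec m y) * cnj (\<Sum>m\<in>B. ec m y)"
        by (simp add: sum_product sum.cartesian_product case_prod_beta)
      also have "\<dots> = of_real ((norm (\<Sum>m\<in>B. ec m y))\<^sup>2)" by (rule complex_norm_square[symmetric])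
      finally show "0 \<le> (\<Sum>p\<in>B \<times> B. Re (1 * ec (fst p - snd p) y) * exp (- 0 * lm (fst p - snd p)))" by simp
    qed (use B t BL lattice_diff in \<open>auto simp: subset_iff\<close>)
    also have "\<dots> = (\<Sum>p\<in>B \<times> B. G (fst p - snd p))" by (simp add: G_def)
    also have "\<dots> = (\<Sum>m'\<in>B. \<Sum>m\<in>B. G (m - m'))"
      by (subst sum.swap) (simp add: sum.cartesian_product case_prod_beta)
    also have "\<dots> = (\<Sum>m'\<in>B. sum G ((\<lambda>m. m - m') ` B))"
    proof (rule sum.cong[OF refl])
      fix m' :: 'a
      have "inj_on (\<lambda>m. m - m') B" by (simp add: inj_on_def)
      then show "(\<Sum>m\<in>B. G (m - m')) = sum G ((\<lambda>m. m - m') ` B)" by (simp add: sum.reindex)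
    qed
    also have "\<dots> = (\<Sum>m'\<in>I. sum G ((\<lambda>m. m - m') ` B)) + (\<Sum>m'\<in>B - I. sum G ((\<lambda>m. m - m') ` B))"
      by (rule sum.subset_diff[OF IB B(1), simplified add.commute])
    also have "\<dots> \<le> (\<Sum>m'\<in>I. - (\<delta> / 2)) + (\<Sum>m'\<in>B - I. G1)"
    proof (intro add_mono sum_mono)
      fix m' assume m': "m' \<in> I"
      have "F \<subseteq> (\<lambda>m. m - m') ` B"
      proof
        fix n assume n: "n \<in> F"
        have "n + m' \<in> B" unfolding B_def
        proof (intro CollectI conjI ballI)
          show "n + m' \<in> lattice" using n F m' by (auto simp: I_def)
          fix i :: 'a assume i: "i \<in> Basis"
          have "real L \<le> m' \<bullet> i" "m' \<bullet> i < real N - real L" using m' i N by (auto simp: I_def of_nat_diff)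
          then show "of_int 0 \<le> (n + m') \<bullet> i" "(n + m') \<bullet> i < of_int (int N)"
            using L[OF n i] by (auto simp: inner_add_left)
        qed
        then show "n \<in> (\<lambda>m. m - m') ` B" by (intro image_eqI[of _ _ "n + m'"]) auto
      qed
      then show "sum G ((\<lambda>m. m - m') ` B) \<le> - (\<delta> / 2)"
        using F(3)[of "(\<lambda>m. m - m') ` B"] B BL m' by (force simp: I_def)
    next
      fix m' assume m': "m' \<in> B - I"
      then show "sum G ((\<lambda>m. m - m') ` B) \<le> G1"
        by (intro G1) (use B BL m' in auto)
    qed
    also have "\<dots> = - (real (N - 2 * L) ^ D) * (\<delta> / 2) + (real N ^ D - real (N - 2 * L) ^ D) * G1"
    proof -
      have "real (card (B - I)) = real N ^ D - real (N - 2 * L) ^ D"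
        using card_Diff_subset[OF I(1) IB] card_mono[OF B(1) IB] B I by (simp add: of_nat_diff)
      then show ?thesis by (simp add: I)
    qed
    finally show ?thesis by simp
  qed
  \<comment> \<open>After division by \<open>real N ^ D\<close> the proportion of points in the
    margin tends to 0, and \<open>key\<close> becomes \<delta>/2 \<le> 0 in the limit.\<close>
  have lim: "(\<lambda>N. (real (N - 2 * L) / real N) ^ D) \<longlonglongrightarrow> 1 ^ D"
  proof (rule tendsto_power)
    have "(\<lambda>N. (real N - 2 * real L) / real N) \<longlonglongrightarrow> 1" by real_asymp
    then show "(\<lambda>N. real (N - 2 * L) / real N) \<longlonglongrightarrow> 1"
      by (rule Lim_transform_eventually)
         (use eventually_ge_at_top[of "2 * L"] in \<open>eventually_elim, simp add: of_nat_diff\<close>)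
  qed
  have "(\<lambda>N. ((real (N - 2 * L) / real N) ^ D) * (\<delta> / 2) - (1 - (real (N - 2 * L) / real N) ^ D) * G1)
      \<longlonglongrightarrow> 1 ^ D * (\<delta> / 2) - (1 - 1 ^ D) * G1"
    by (intro tendsto_intros lim)
  moreover have "\<forall>\<^sub>F N in sequentially. ((real (N - 2 * L) / real N) ^ D) * (\<delta> / 2) - (1 - (real (N - 2 * L) / real N) ^ D) * G1 \<le> 0"
    using eventually_ge_at_top[of "2 * L + 1"]
  proof eventually_elim
    case (elim N)
    then have "0 < real N ^ D" by simp
    then show ?case using key[of N] elim by (simp add: power_divide field_simps)
  qed
  ultimately have "1 ^ D * (\<delta> / 2) - (1 - 1 ^ D) * G1 \<le> 0"
    by (rule tendsto_upperbound) simp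
  then show False using \<delta> by simp
qed

end

section \<open>The semigroup\<close>

lemma AE_torus_interior: "AE x in torus_measure. x \<in> box 0 (One::'a::euclidean_space)"
proof -
  have "negligible (cbox 0 (One::'a) - box 0 One)" by (rule negligible_frontier_interval)
  then have "AE x in lebesgue. x \<notin> cbox 0 (One::'a) - box 0 One"
    by (intro AE_not_in) (simp add: negligible_iff_null_sets)
  then show ?thesis
    by (subst AE_restrict_space_iff) (auto elim: eventually_mono)
qed

lemma torus_bounded_convergence:
  fixes s :: "nat \<Rightarrow> 'a::euclidean_space \<Rightarrow> real"
  assumes "\<And>k. s k \<in> borel_measurable torus_measure" "f \<in> borel_measurable torus_measure"
    and "AE x in torus_measure. (\<lambda>k. s k x) \<longlonglongrightarrow> f x"
    and "\<And>k x. x \<in> cbox 0 One \<Longrightarrow> \<bar>s k x\<bar> \<le> B"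
  shows "(\<lambda>k. \<integral>x. s k x \<partial>torus_measure) \<longlonglongrightarrow> (\<integral>x. f x \<partial>torus_measure)"
  by (rule integral_dominated_convergence[where w="\<lambda>_. B"])
     (use assms in \<open>auto intro!: AE_I2\<close>)

lemma integrable_abs_cont_mult:
  fixes f g :: "'a::euclidean_space \<Rightarrow> real"
  assumes f: "integrable torus_measure f" and g: "g \<in> borel_measurable torus_measure"
    and B: "\<And>x. x \<in> cbox 0 One \<Longrightarrow> \<bar>g x\<bar> \<le> B"
  shows "integrable torus_measure (\<lambda>x. g x * f x)"
proof (rule Bochner_Integration.integrable_bound[where f="\<lambda>x. B * f x"])
  show "AE x in torus_measure. norm (g x * f x) \<le> norm (B * f x)"
    using B by (intro AE_I2) (auto simp: abs_mult intro!: mult_right_mono intro: order_trans[OF _ abs_ge_self])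
qed (use f g in auto)

lemma continuous_bounded_cube:
  fixes g :: "'a::euclidean_space \<Rightarrow> real"
  assumes "continuous_on UNIV g"
  shows "\<exists>B. \<forall>y\<in>cbox 0 One. \<bar>g y\<bar> \<le> B"
proof -
  have "compact (g ` cbox 0 One)"
    by (intro compact_continuous_image compact_cbox continuous_on_subset[OF assms]) auto
  then show ?thesis using compact_imp_bounded[of "g ` cbox 0 One"] by (auto simp: bounded_iff)
qed

definition clamp1 :: "real \<Rightarrow> real \<Rightarrow> real" where
  "clamp1 M y = max (- M) (min M y)"

lemma clamp1_abs_le: "0 \<le> M \<Longrightarrow> \<bar>clamp1 M y\<bar> \<le> M"
  by (auto simp: clamp1_def)

lemma clamp1_id: "\<bar>y\<bar> \<le> M \<Longrightarrow> clamp1 M y = y"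
  by (auto simp: clamp1_def)

lemma continuous_clamp1: "continuous_on UNIV f \<Longrightarrow> continuous_on UNIV (\<lambda>x. clamp1 M (f x))"
  unfolding clamp1_def by (intro continuous_intros)

lemma measurable_clamp1 [measurable]: "clamp1 M \<in> borel_measurable borel"
  unfolding clamp1_def[abs_def] by measurable

text \<open>After truncation the function is bounded. The definition of \<open>measurable_on\<close>
  supplies continuous functions converging to it almost everywhere, and clamping them to the same
  bound permits bounded convergence.\<close>

lemma continuous_dense_L1:
  fixes f :: "'a::euclidean_space \<Rightarrow> real"
  assumes f: "integrable torus_measure f" and e: "0 < e"
  shows "\<exists>g. continuous_on UNIV g \<and> (\<integral>x. \<bar>f x - g x\<bar> \<partial>torus_measure) < e"
proof -
  have fm [measurable]: "f \<in> borel_measurable torus_measure" using f by simp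
  have "(\<lambda>m. \<integral>x. \<bar>f x - clamp1 (real m) (f x)\<bar> \<partial>torus_measure) \<longlonglongrightarrow> (\<integral>x. 0 \<partial>(torus_measure::'a measure))"
  proof (rule integral_dominated_convergence[where w="\<lambda>x. \<bar>f x\<bar>"])
    show "AE x in torus_measure. (\<lambda>m. \<bar>f x - clamp1 (real m) (f x)\<bar>) \<longlonglongrightarrow> 0"
    proof (rule AE_I2, rule tendsto_eventually)
      fix x
      obtain N :: nat where "\<bar>f x\<bar> \<le> real N" using real_arch_simple by blast
      then have "\<bar>f x - clamp1 (real m) (f x)\<bar> = 0" if "N \<le> m" for m
        using that by (simp add: clamp1_id)
      then show "\<forall>\<^sub>F m in sequentially. \<bar>f x - clamp1 (real m) (f x)\<bar> = 0"
        unfolding eventually_sequentially by blast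
    qed
    show "AE x in torus_measure. norm \<bar>f x - clamp1 (real m) (f x)\<bar> \<le> \<bar>f x\<bar>" for m
      by (rule AE_I2) (auto simp: clamp1_def)
  qed (use f in auto)
  then have "\<forall>\<^sub>F m in sequentially. (\<integral>x. \<bar>f x - clamp1 (real m) (f x)\<bar> \<partial>torus_measure) < e / 2"
    by (intro order_tendstoD(2)) (use e in auto)
  then obtain m where m: "(\<integral>x. \<bar>f x - clamp1 (real m) (f x)\<bar> \<partial>torus_measure) < e / 2"
    by (auto simp: eventually_sequentially)
  define fm where "fm x = clamp1 (real m) (f x)" for x
  have fmm [measurable]: "fm \<in> borel_measurable torus_measure" unfolding fm_def[abs_def] by measurable
  have fmB: "\<bar>fm x\<bar> \<le> real m" for x unfolding fm_def by (rule clamp1_abs_le) simp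
  have "fm measurable_on cbox 0 One"
    using fmm by (subst measurable_on_iff_borel_measurable) auto
  then obtain N g where N: "negligible N" and g: "\<And>n. continuous_on UNIV (g n)"
    and lim: "\<And>x. x \<notin> N \<Longrightarrow> (\<lambda>n. g n x) \<longlonglongrightarrow> (if x \<in> cbox 0 One then fm x else 0)"
    unfolding measurable_on_def by blast
  have gc: "continuous_on UNIV (\<lambda>x. clamp1 (real m) (g n x))" for n by (intro continuous_clamp1 g)
  note [measurable] = continuous_measurable_torus[OF gc]
  have "(\<lambda>n. \<integral>x. \<bar>fm x - clamp1 (real m) (g n x)\<bar> \<partial>torus_measure) \<longlonglongrightarrow> (\<integral>x. 0 \<partial>(torus_measure::'a measure))"
  proof (rule torus_bounded_convergence[where B="2 * real m"])
    have "AE x in lebesgue. x \<notin> N" using N by (intro AE_not_in) (simp add: negligible_iff_null_sets)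
    then have "AE x in torus_measure. x \<notin> N"
      by (subst AE_restrict_space_iff) (auto elim: eventually_mono)
    moreover have "AE x in torus_measure. x \<in> cbox 0 (One::'a)" by (rule AE_I2) simp
    ultimately show "AE x in torus_measure. (\<lambda>n. \<bar>fm x - clamp1 (real m) (g n x)\<bar>) \<longlonglongrightarrow> 0"
    proof eventually_elim
      case (elim x)
      have "(\<lambda>n. clamp1 (real m) (g n x)) \<longlonglongrightarrow> clamp1 (real m) (fm x)"
        unfolding clamp1_def using lim[of x] elim by (intro tendsto_intros) auto
      then have "(\<lambda>n. \<bar>fm x - clamp1 (real m) (g n x)\<bar>) \<longlonglongrightarrow> \<bar>fm x - clamp1 (real m) (fm x)\<bar>"
        by (intro tendsto_intros)
      then show ?case using clamp1_id[OF fmB] by simp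
    qed
    show "\<bar>\<bar>fm x - clamp1 (real m) (g n x)\<bar>\<bar> \<le> 2 * real m" for n x
      using fmB[of x] clamp1_abs_le[of "real m" "g n x"] by simp
  qed auto
  then have "\<forall>\<^sub>F n in sequentially. (\<integral>x. \<bar>fm x - clamp1 (real m) (g n x)\<bar> \<partial>torus_measure) < e / 2"
    by (intro order_tendstoD(2)) (use e in auto)
  then obtain n where n: "(\<integral>x. \<bar>fm x - clamp1 (real m) (g n x)\<bar> \<partial>torus_measure) < e / 2"
    by (auto simp: eventually_sequentially)
  have i1: "integrable torus_measure fm" by (rule bounded_integrable_torus[where B="real m"]) (use fmB in auto)
  have i2: "integrable torus_measure (\<lambda>x. clamp1 (real m) (g n x))" by (rule continuous_integrable_torus[OF gc])
  have "(\<integral>x. \<bar>f x - clamp1 (real m) (g n x)\<bar> \<partial>torus_measure)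
      \<le> (\<integral>x. \<bar>f x - fm x\<bar> + \<bar>fm x - clamp1 (real m) (g n x)\<bar> \<partial>torus_measure)"
    by (rule integral_mono) (use f i1 i2 in auto)
  also have "\<dots> = (\<integral>x. \<bar>f x - fm x\<bar> \<partial>torus_measure) + (\<integral>x. \<bar>fm x - clamp1 (real m) (g n x)\<bar> \<partial>torus_measure)"
    by (rule Bochner_Integration.integral_add) (use f i1 i2 in auto)
  also have "\<dots> < e" using m n by (simp add: fm_def)
  finally show ?thesis using gc by blast
qed

text \<open>A test function in the manner of Korovkin: a trigonometric polynomial in
  \<open>y\<close>, nonnegative, zero only on the lattice translates of \<open>x\<close>, on which
  the multiplier acts explicitly.\<close>

definition trig_defect :: "'a::euclidean_space \<Rightarrow> 'a \<Rightarrow> real" where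
  "trig_defect x y = (\<Sum>i\<in>Basis. 1 - cos (2 * pi * ((y - x) \<bullet> i)))"

lemma continuous_trig_defect: "continuous_on UNIV (trig_defect x)"
  unfolding trig_defect_def by (intro continuous_intros)

text \<open>Near \<open>x\<close> continuity suffices; away from \<open>x\<close> the defect has a
  positive minimum on a compact set, and a large multiple of it dominates. The point is interior
  because, seen from a face, the defect also vanishes on the opposite face, while \<open>g\<close>
  is not assumed periodic.\<close>

lemma trig_defect_modulus:
  fixes g :: "'a::euclidean_space \<Rightarrow> real"
  assumes g: "continuous_on UNIV g" and x: "x \<in> box 0 One" and e: "0 < e"
  shows "\<exists>C. \<forall>y\<in>cbox 0 One. \<bar>g y - g x\<bar> \<le> e + C * trig_defect x y"
proof -
  have nonneg: "0 \<le> trig_defect x y" for y unfolding trig_defect_def by (intro sum_nonneg) simp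
  obtain \<delta> where \<delta>: "0 < \<delta>" "\<And>y. dist y x < \<delta> \<Longrightarrow> dist (g y) (g x) < e"
    using g e unfolding continuous_on_iff by (metis UNIV_I)
  obtain B where B: "\<And>y. y \<in> cbox 0 One \<Longrightarrow> \<bar>g y\<bar> \<le> B"
    using continuous_bounded_cube[OF g] by blast
  have xQ: "x \<in> cbox 0 One" using x box_subset_cbox by blast
  define K where "K = cbox 0 One - ball x \<delta>"
  have K: "compact K" unfolding K_def by (intro compact_diff compact_cbox open_ball)
  show ?thesis
  proof (cases "K = {}")
    case True
    then have "\<bar>g y - g x\<bar> \<le> e + 0 * trig_defect x y" if "y \<in> cbox 0 One" for y
      using that \<delta>(2)[of y] by (force simp: K_def dist_real_def dist_commute)
    then show ?thesis by blast
  next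
    case False
    obtain y0 where y0: "y0 \<in> K" "\<And>y. y \<in> K \<Longrightarrow> trig_defect x y0 \<le> trig_defect x y"
      using continuous_attains_inf[OF K False continuous_on_subset[OF continuous_trig_defect]] by blast
    have "trig_defect x y0 \<noteq> 0"
    proof
      assume "trig_defect x y0 = 0"
      then have z: "1 - cos (2 * pi * ((y0 - x) \<bullet> i)) = 0" if "i \<in> Basis" for i
        using that unfolding trig_defect_def by (subst (asm) sum_nonneg_eq_0_iff) auto
      have "(y0 - x) \<bullet> i = 0" if i: "i \<in> Basis" for i
      proof -
        obtain k :: int where "2 * pi * ((y0 - x) \<bullet> i) = of_int k * 2 * pi"
          using z[OF i] by (auto simp: cos_one_2pi_int)
        then have k: "(y0 - x) \<bullet> i = of_int k" by simp
        have "0 < x \<bullet> i" "x \<bullet> i < 1" using x i by (auto simp: mem_box)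
        moreover have "0 \<le> y0 \<bullet> i" "y0 \<bullet> i \<le> 1" using y0(1) i by (auto simp: K_def mem_box)
        ultimately have "\<bar>(y0 - x) \<bullet> i\<bar> < 1" by (simp add: inner_diff_left)
        then have "\<bar>real_of_int k\<bar> < 1" using k by simp
        then have "k = 0" by linarith
        then show ?thesis using k by simp
      qed
      then have "y0 - x = 0" using euclidean_all_zero_iff[of "y0 - x"] by blast
      then have "y0 = x" by simp
      then show False using y0(1) \<delta>(1) by (simp add: K_def)
    qed
    then have \<kappa>: "0 < trig_defect x y0" using nonneg[of y0] by simp
    define C where "C = 2 * B / trig_defect x y0"
    have C: "0 \<le> C" using B[OF xQ] \<kappa> by (simp add: C_def)
    have "\<bar>g y - g x\<bar> \<le> e + C * trig_defect x y" if y: "y \<in> cbox 0 One" for y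
    proof (cases "y \<in> K")
      case True
      have "\<bar>g y - g x\<bar> \<le> 2 * B" using B[OF y] B[OF xQ] by linarith
      also have "\<dots> = C * trig_defect x y0" using \<kappa> by (simp add: C_def)
      also have "\<dots> \<le> C * trig_defect x y" using C y0(2)[OF True] by (intro mult_left_mono)
      finally show ?thesis using e by simp
    next
      case False
      then have "dist y x < \<delta>" using y by (simp add: K_def dist_commute)
      then show ?thesis using \<delta>(2)[of y] mult_nonneg_nonneg[OF C nonneg[of y]] by (simp add: dist_real_def)
    qed
    then show ?thesis by blast
  qed
qed

text \<open>The two indicator terms stay separate so that \<open>m = 0\<close> is included: there
  they add up to \<open>Re z\<close>.\<close>

lemma fser_character:
  assumes m: "m \<in> lattice"
  shows "fser (\<lambda>n. (if n = m then z / 2 else 0) + (if n = - m then cnj z / 2 else 0)) (\<lambda>x. Re (z * ec m x))"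
  unfolding fser_def
proof (intro conjI allI)
  let ?c = "\<lambda>n. (if n = m then z / 2 else 0) + (if n = - m then cnj z / 2 else 0)"
  show "asum ?c"
    by (rule finite_nonzero_values_imp_summable_on) (auto intro: finite_subset[of _ "{m, - m}"])
  fix x
  have 1: "((\<lambda>n. (if n = m then z / 2 else 0) * ec n x) has_sum (z / 2 * ec m x)) lattice"
    by (rule has_sum_finite_neutralI[where B="{m}"]) (use m in auto)
  have 2: "((\<lambda>n. (if n = - m then cnj z / 2 else 0) * ec n x) has_sum (cnj z / 2 * ec (- m) x)) lattice"
    by (rule has_sum_finite_neutralI[where B="{- m}"]) (use m in auto)
  have "z / 2 * ec m x + cnj z / 2 * ec (- m) x = of_real (Re (z * ec m x))"
    by (simp add: ec_minus complex_eq_iff field_simps)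
  then show "((\<lambda>n. ?c n * ec n x) has_sum of_real (Re (z * ec m x))) lattice"
    using has_sum_add[OF 1 2] by (simp add: distrib_right)
qed

text \<open>One null sequence for both smoothing times and mesh sizes. Its reciprocals are integers,
  so that in \<open>circ_var_nabh_le\<close> the translates by multiples of \<open>eta k\<close>
  close up around the circle.\<close>

definition eta :: "nat \<Rightarrow> real" where "eta k = 1 / real (Suc k)"

lemma eta_pos [simp]: "0 < eta k" by (simp add: eta_def)

lemma eta_tendsto: "eta \<longlonglongrightarrow> 0"
  unfolding eta_def using LIMSEQ_inverse_real_of_nat by (simp add: inverse_eq_divide)

context kernel_params
begin

lemma continuous_Psi: "0 < t \<Longrightarrow> continuous_on UNIV (\<lambda>y::'a::euclidean_space. Re (Psi a b (x - y) t))"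
  by (rule continuous_on_compose2[OF fser_continuous[OF fser_Psi]]) (auto intro: continuous_intros)

text \<open>A bound for the sup norm of the kernel. The type argument fixes the dimension, which is
  visible neither in \<open>t\<close> nor in the value.\<close>

definition Cb :: "'a::euclidean_space itself \<Rightarrow> real \<Rightarrow> real" where
  "Cb _ t = (\<Sum>\<^sub>\<infinity>n\<in>(lattice::'a set). exp (- t * lm n))"

lemma summable_exp_lm: "0 < t \<Longrightarrow> (\<lambda>n::'a::euclidean_space. exp (- t * lm n)) summable_on lattice"
  using fser_Psi[of t, where 'a='a] by (simp add: fser_def)

lemma Cb_nonneg: "0 \<le> Cb TYPE('a::euclidean_space) t"
  unfolding Cb_def by (intro infsum_nonneg) simp

lemma Cb_antimono: "0 < s \<Longrightarrow> s \<le> t \<Longrightarrow> Cb TYPE('a::euclidean_space) t \<le> Cb TYPE('a) s"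
  unfolding Cb_def by (intro infsum_mono summable_exp_lm) (auto simp: lm_nonneg mult_right_mono)

lemma Psi_bound: "0 < t \<Longrightarrow> \<bar>Re (Psi a b (x::'a::euclidean_space) t)\<bar> \<le> Cb TYPE('a) t"
  using fser_bound[OF fser_Psi, of t x] by (simp add: Cb_def)

lemma Pt_integrable:
  assumes "0 < t" "integrable torus_measure f"
  shows "integrable torus_measure (\<lambda>y. Re (Psi a b (x - y) t) * f y)"
  by (rule integrable_abs_cont_mult[OF assms(2)])
     (use continuous_measurable_torus[OF continuous_Psi] Psi_bound assms in auto)

lemma Pt_cong_AE:
  assumes "0 < t" "integrable torus_measure f" "integrable torus_measure g" "AE y in torus_measure. f y = g y"
  shows "Pt t f = Pt t g"
  unfolding Pt_def
proof (rule ext, rule integral_cong_AE)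
  show "AE y in torus_measure. Re (Psi a b (x - y) t) * f y = Re (Psi a b (x - y) t) * g y" for x
    using assms(4) by eventually_elim simp
qed (use Pt_integrable[OF assms(1)] assms in auto)

lemma Pt_cmult: "Pt t (\<lambda>y. r * f y) x = r * Pt t f x"
proof -
  have "Pt t (\<lambda>y. r * f y) x = (\<integral>y. r * (Re (Psi a b (x - y) t) * f y) \<partial>torus_measure)"
    unfolding Pt_def by (simp only: mult.left_commute)
  then show ?thesis by (simp add: Pt_def)
qed

lemma Pt_add:
  assumes "0 < t" "integrable torus_measure f" "integrable torus_measure g"
  shows "Pt t (\<lambda>y. f y + g y) x = Pt t f x + Pt t g x"
  using Pt_integrable[OF assms(1,2)] Pt_integrable[OF assms(1,3)] by (simp add: Pt_def distrib_left)

lemma Pt_diff: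
  assumes "0 < t" "integrable torus_measure f" "integrable torus_measure g"
  shows "Pt t (\<lambda>y. f y - g y) x = Pt t f x - Pt t g x"
  using Pt_integrable[OF assms(1,2)] Pt_integrable[OF assms(1,3)] by (simp add: Pt_def right_diff_distrib)

lemma Pt_sum:
  assumes "0 < t" "\<And>i. i \<in> I \<Longrightarrow> integrable torus_measure (f i)"
  shows "Pt t (\<lambda>y. \<Sum>i\<in>I. f i y) x = (\<Sum>i\<in>I. Pt t (f i) x)"
  unfolding Pt_def sum_distrib_left
  by (rule Bochner_Integration.integral_sum) (rule Pt_integrable[OF assms(1) assms(2)])

lemma Pt_mono:
  assumes "0 < t" "integrable torus_measure f" "integrable torus_measure g"
    and "\<And>y. y \<in> cbox 0 One \<Longrightarrow> f y \<le> g y"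
  shows "Pt t f x \<le> Pt t g x"
  unfolding Pt_def
  by (rule integral_mono) (use Pt_integrable assms Psi_nonneg in \<open>auto intro!: mult_left_mono\<close>)

lemma Pt_abs:
  assumes "0 < t" "integrable torus_measure f"
  shows "\<bar>Pt t f x\<bar> \<le> Pt t (\<lambda>y. \<bar>f y\<bar>) x"
  using Pt_mono[OF assms(1), of f "\<lambda>y. \<bar>f y\<bar>" x] Pt_mono[OF assms(1), of "\<lambda>y. -1 * f y" "\<lambda>y. \<bar>f y\<bar>" x]
    Pt_cmult[of t "-1" f x] assms by (auto simp: abs_le_iff)

lemma fser_Pt_fser:
  assumes "0 < t" "fser c F"
  shows "fser (\<lambda>n. of_real (exp (- t * lm n)) * c n) (Pt t F)"
  by (rule fser_cong[OF fser_Pt[OF assms(1) fser_integrable[OF assms(2)]]])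
     (simp add: Pc_def fser_fc[OF assms(2)])

lemma Pt_const: "0 < t \<Longrightarrow> Pt t (\<lambda>_. r) = (\<lambda>_::'a::euclidean_space. r)"
  using fser_Pt_fser[OF _ fser_const[of r, where 'a='a], of t]
  by (intro fser_unique[OF _ fser_const]) (auto elim!: fser_cong)

lemma Pt_character:
  assumes t: "0 < t" and m: "m \<in> lattice"
  shows "Pt t (\<lambda>x. Re (z * ec m x)) x = exp (- t * lm m) * Re (z * ec m x)"
proof -
  have "fser (\<lambda>n. of_real (exp (- t * lm n)) * ((if n = m then z / 2 else 0) + (if n = - m then cnj z / 2 else 0)))
     (Pt t (\<lambda>x. Re (z * ec m x)))"
    by (rule fser_Pt_fser[OF t fser_character[OF m]])
  then have "fser (\<lambda>n. of_real (exp (- t * lm m)) * ((if n = m then z / 2 else 0) + (if n = - m then cnj z / 2 else 0)))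
     (Pt t (\<lambda>x. Re (z * ec m x)))"
    by (rule fser_cong) auto
  from fser_unique[OF this fser_cmult[OF fser_character[OF m]]] show ?thesis by (rule fun_cong)
qed

lemma integrable_Pt: "0 < t \<Longrightarrow> integrable torus_measure f \<Longrightarrow> integrable torus_measure (Pt t f)"
  by (rule fser_integrable[OF fser_Pt])

lemma continuous_Pt: "0 < t \<Longrightarrow> integrable torus_measure f \<Longrightarrow> continuous_on UNIV (Pt t f)"
  by (rule fser_continuous[OF fser_Pt])

lemma periodic_Pt: "0 < t \<Longrightarrow> integrable torus_measure f \<Longrightarrow> periodic_fn (Pt t f)"
  by (rule fser_periodic[OF fser_Pt])

lemma fc_Pt: "0 < t \<Longrightarrow> integrable torus_measure f \<Longrightarrow> n \<in> lattice \<Longrightarrow> fc (Pt t f) n = of_real (exp (- t * lm n)) * fc f n"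
  by (simp add: fser_fc[OF fser_Pt] Pc_def)

lemma integral_Pt:
  assumes "0 < t" "integrable torus_measure f"
  shows "(\<integral>x. Pt t f x \<partial>torus_measure) = (\<integral>x. f x \<partial>torus_measure)"
  using fc_Pt[OF assms, of 0] fc_0[OF integrable_Pt[OF assms]] fc_0[OF assms(2)] by simp

lemma Pt_shift:
  assumes "0 < t" "integrable torus_measure f" "periodic_fn f"
  shows "Pt t (\<lambda>y. f (y + h)) x = Pt t f (x + h)"
proof -
  have "fser (Pc t (\<lambda>y. f (y + h))) (Pt t (\<lambda>y. f (y + h)))"
    by (intro fser_Pt integrable_torus_shift assms)
  moreover have "fser (Pc t (\<lambda>y. f (y + h))) (\<lambda>x. Pt t f (x + h))"
    by (rule fser_cong[OF fser_shift[OF fser_Pt[OF assms(1,2)]]]) (simp add: Pc_def fc_shift assms mult_ac)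
  ultimately show ?thesis using fser_unique by metis
qed

lemma Pt_bound:
  assumes "0 < t" "f \<in> borel_measurable torus_measure" "\<And>y. y \<in> cbox 0 One \<Longrightarrow> \<bar>f y\<bar> \<le> B"
  shows "\<bar>Pt t f x\<bar> \<le> B"
proof -
  have f: "integrable torus_measure f" using assms by (intro torus.integrable_const_bound[of _ B]) auto
  have "\<bar>Pt t f x\<bar> \<le> Pt t (\<lambda>y. \<bar>f y\<bar>) x" by (rule Pt_abs[OF assms(1) f])
  also have "\<dots> \<le> Pt t (\<lambda>_. B) x" by (rule Pt_mono) (use assms f in auto)
  finally show ?thesis by (simp add: Pt_const assms)
qed

lemma Pt_bound_L1:
  fixes f :: "'a::euclidean_space \<Rightarrow> real"
  assumes "0 < t" "integrable torus_measure f"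
  shows "\<bar>Pt t f x\<bar> \<le> Cb TYPE('a) t * (\<integral>y. \<bar>f y\<bar> \<partial>torus_measure)"
proof -
  have "norm (Pt t f x) \<le> (\<integral>y. Cb TYPE('a) t * \<bar>f y\<bar> \<partial>torus_measure)"
    unfolding Pt_def
    by (rule norm_integral_le) (use Pt_integrable assms Psi_bound in \<open>auto simp: abs_mult intro!: mult_right_mono\<close>)
  then show ?thesis by simp
qed

lemma Pt_L1_contraction:
  assumes "0 < t" "integrable torus_measure f"
  shows "(\<integral>x. \<bar>Pt t f x\<bar> \<partial>torus_measure) \<le> (\<integral>x. \<bar>f x\<bar> \<partial>torus_measure)"
proof -
  have "(\<integral>x. \<bar>Pt t f x\<bar> \<partial>torus_measure) \<le> (\<integral>x. Pt t (\<lambda>y. \<bar>f y\<bar>) x \<partial>torus_measure)"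
    by (rule integral_mono) (use Pt_abs[OF assms] integrable_Pt[OF assms] integrable_Pt[of t "\<lambda>y. \<bar>f y\<bar>"] assms in auto)
  also have "\<dots> = (\<integral>x. \<bar>f x\<bar> \<partial>torus_measure)" by (rule integral_Pt) (use assms in auto)
  finally show ?thesis .
qed

lemma Pt_trig_defect:
  fixes x :: "'a::euclidean_space"
  assumes t: "0 < t"
  shows "Pt t (trig_defect x) x = (\<Sum>i\<in>(Basis::'a set). 1 - exp (- t * lm i))"
proof -
  have i: "i \<in> lattice" if "i \<in> Basis" for i :: 'a using lattice_of_int_Basis[OF that, of 1] by simp
  have eq: "1 - cos (2 * pi * ((y - x) \<bullet> i)) = 1 - Re (cnj (ec i x) * ec i y)" for y i :: 'a
    by (simp add: ec_def cis_cnj cis_mult inner_diff_left right_diff_distrib)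
  have int: "integrable torus_measure (\<lambda>y. Re (cnj (ec i x) * ec i y))" for i :: 'a
    by (intro continuous_integrable_torus continuous_intros)
  have "Pt t (\<lambda>y. \<Sum>i\<in>Basis. 1 - Re (cnj (ec i x) * ec i y)) x
     = (\<Sum>i\<in>Basis. Pt t (\<lambda>y. 1 - Re (cnj (ec i x) * ec i y)) x)"
    by (rule Pt_sum[OF t]) (use int in auto)
  also have "\<dots> = (\<Sum>i\<in>(Basis::'a set). 1 - exp (- t * lm i))"
  proof (rule sum.cong[OF refl])
    fix i :: 'a assume "i \<in> Basis"
    have "Pt t (\<lambda>y. 1 - Re (cnj (ec i x) * ec i y)) x = Pt t (\<lambda>_. 1) x - Pt t (\<lambda>y. Re (cnj (ec i x) * ec i y)) x"
      by (rule Pt_diff[OF t]) (use int in auto)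
    also have "\<dots> = 1 - exp (- t * lm i)"
      using Pt_character[OF t i[OF \<open>i \<in> Basis\<close>], of "cnj (ec i x)" x] by (simp add: Pt_const t)
    finally show "Pt t (\<lambda>y. 1 - Re (cnj (ec i x) * ec i y)) x = 1 - exp (- t * lm i)" .
  qed
  finally show ?thesis unfolding trig_defect_def[abs_def] eq .
qed

text \<open>Korovkin's argument: positivity and preservation of constants reduce the error at
  \<open>x\<close> to the action on \<open>trig_defect\<close>, whose value
  \<open>1 - exp (- t * lm i)\<close> per coordinate vanishes as \<open>t\<close> tends to
  0.\<close>

lemma Pt_tendsto_modulus:
  fixes f :: "'a::euclidean_space \<Rightarrow> real"
  assumes f: "integrable torus_measure f"
    and mod: "\<And>e. 0 < e \<Longrightarrow> \<exists>C. \<forall>y\<in>cbox 0 One. \<bar>f y - f x\<bar> \<le> e + C * trig_defect x y"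
  shows "(\<lambda>k. Pt (eta k) f x) \<longlonglongrightarrow> f x"
proof (rule LIMSEQ_I)
  fix e :: real assume e: "0 < e"
  obtain C where C: "\<And>y. y \<in> cbox 0 One \<Longrightarrow> \<bar>f y - f x\<bar> \<le> e / 2 + C * trig_defect x y"
    using mod[of "e / 2"] e by auto
  have int: "integrable torus_measure (trig_defect x)"
    by (intro continuous_integrable_torus continuous_trig_defect)
  have bd: "\<bar>Pt t f x - f x\<bar> \<le> e / 2 + C * (\<Sum>i\<in>(Basis::'a set). 1 - exp (- t * lm i))" if t: "0 < t" for t
  proof -
    have "Pt t f x - f x = Pt t (\<lambda>y. f y - f x) x" using Pt_diff[OF t f, of "\<lambda>_. f x" x] fun_cong[OF Pt_const[OF t, of "f x"], of x] by simp
    also have "\<bar>\<dots>\<bar> \<le> Pt t (\<lambda>y. \<bar>f y - f x\<bar>) x" by (rule Pt_abs[OF t]) (use f in auto)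
    also have "\<dots> \<le> Pt t (\<lambda>y. e / 2 + C * trig_defect x y) x"
      by (rule Pt_mono[OF t]) (use f int C in auto)
    also have "\<dots> = e / 2 + C * (\<Sum>i\<in>(Basis::'a set). 1 - exp (- t * lm i))"
      using Pt_add[OF t, of "\<lambda>_. e/2" "\<lambda>y. C * trig_defect x y" x] int
      by (simp add: Pt_const t Pt_cmult Pt_trig_defect)
    finally show ?thesis .
  qed
  have "(\<lambda>k. e / 2 + C * (\<Sum>i\<in>(Basis::'a set). 1 - exp (- eta k * lm i)))
      \<longlonglongrightarrow> e / 2 + C * (\<Sum>i\<in>(Basis::'a set). 1 - exp (- 0 * lm i))"
    by (intro tendsto_intros eta_tendsto)
  then have "\<forall>\<^sub>F k in sequentially. e / 2 + C * (\<Sum>i\<in>(Basis::'a set). 1 - exp (- eta k * lm i)) < e"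
    by (rule order_tendstoD(2)) (use e in simp)
  then have "\<forall>\<^sub>F k in sequentially. norm (Pt (eta k) f x - f x) < e"
    by eventually_elim (use bd[OF eta_pos] in \<open>auto intro: le_less_trans\<close>)
  then show "\<exists>no. \<forall>n\<ge>no. norm (Pt (eta n) f x - f x) < e" by (simp add: eventually_sequentially)
qed

text \<open>A translation moves the point to the centre of the cube, since
  \<open>trig_defect_modulus\<close> is available at interior points only.\<close>

lemma Pt_tendsto_continuous:
  assumes g: "continuous_on UNIV g" and per: "periodic_fn g"
  shows "(\<lambda>k. Pt (eta k) g x) \<longlonglongrightarrow> g (x :: 'a::euclidean_space)"
proof -
  define p :: 'a where "p = (1/2) *\<^sub>R One"
  have p: "p \<in> box 0 One" by (simp add: p_def mem_box)
  define f where "f y = g (y + (x - p))" for y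
  have f: "continuous_on UNIV f" unfolding f_def
    by (rule continuous_on_compose2[OF g]) (auto intro: continuous_intros)
  have "(\<lambda>k. Pt (eta k) f p) \<longlonglongrightarrow> f p"
    by (rule Pt_tendsto_modulus[OF continuous_integrable_torus[OF f]]) (rule trig_defect_modulus[OF f p])
  moreover have "Pt (eta k) f p = Pt (eta k) g x" for k
    unfolding f_def using Pt_shift[OF eta_pos continuous_integrable_torus[OF g] per] by simp
  ultimately show ?thesis by (simp add: f_def)
qed

text \<open>Density combined with L1 contraction. The continuous approximant need not be periodic,
  so its pointwise convergence is used only in the interior of the cube, which has full
  measure.\<close>

lemma Pt_tendsto_L1:
  fixes f :: "'a::euclidean_space \<Rightarrow> real"
  assumes f: "integrable torus_measure f"
  shows "(\<lambda>k. \<integral>x. \<bar>Pt (eta k) f x - f x\<bar> \<partial>torus_measure) \<longlonglongrightarrow> 0"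
proof (rule LIMSEQ_I)
  fix e :: real assume e: "0 < e"
  obtain g where g: "continuous_on UNIV g" "(\<integral>x. \<bar>f x - g x\<bar> \<partial>torus_measure) < e / 3"
    using continuous_dense_L1[OF f, of "e / 3"] e by auto
  have gi: "integrable torus_measure g" by (rule continuous_integrable_torus[OF g(1)])
  obtain B where B: "\<And>y. y \<in> cbox 0 One \<Longrightarrow> \<bar>g y\<bar> \<le> B"
    using continuous_bounded_cube[OF g(1)] by blast
  have "(\<lambda>k. \<integral>x. \<bar>Pt (eta k) g x - g x\<bar> \<partial>torus_measure) \<longlonglongrightarrow> (\<integral>x. 0 \<partial>(torus_measure::'a measure))"
  proof (rule torus_bounded_convergence[where B="2 * B"])
    show "AE x in torus_measure. (\<lambda>k. \<bar>Pt (eta k) g x - g x\<bar>) \<longlonglongrightarrow> 0"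
      using AE_torus_interior
    proof eventually_elim
      case (elim x)
      have "(\<lambda>k. Pt (eta k) g x) \<longlonglongrightarrow> g x"
        by (rule Pt_tendsto_modulus[OF gi]) (rule trig_defect_modulus[OF g(1) elim])
      then show ?case using LIM_zero tendsto_rabs_zero by blast
    qed
    show "\<bar>\<bar>Pt (eta k) g x - g x\<bar>\<bar> \<le> 2 * B" if "x \<in> cbox 0 One" for k x
    proof -
      have "\<bar>Pt (eta k) g x\<bar> \<le> B" by (rule Pt_bound[OF eta_pos]) (use B gi in auto)
      then show ?thesis using B[OF that] by linarith
    qed
  qed (use integrable_Pt[OF eta_pos gi] gi in auto)
  then have "\<forall>\<^sub>F k in sequentially. (\<integral>x. \<bar>Pt (eta k) g x - g x\<bar> \<partial>torus_measure) < e / 3"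
    by (intro order_tendstoD(2)) (use e in auto)
  then have "\<forall>\<^sub>F k in sequentially. norm ((\<integral>x. \<bar>Pt (eta k) f x - f x\<bar> \<partial>torus_measure) - 0) < e"
  proof eventually_elim
    case (elim k)
    note iP = integrable_Pt[OF eta_pos[of k]]
    have "(\<integral>x. \<bar>Pt (eta k) f x - f x\<bar> \<partial>torus_measure)
        \<le> (\<integral>x. \<bar>Pt (eta k) (\<lambda>x. f x - g x) x\<bar> + \<bar>Pt (eta k) g x - g x\<bar> + \<bar>f x - g x\<bar> \<partial>torus_measure)"
    proof (rule integral_mono)
      fix x
      show "\<bar>Pt (eta k) f x - f x\<bar> \<le> \<bar>Pt (eta k) (\<lambda>x. f x - g x) x\<bar> + \<bar>Pt (eta k) g x - g x\<bar> + \<bar>f x - g x\<bar>"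
        using Pt_diff[OF eta_pos[of k] f gi, of x] by linarith
    qed (use f gi iP[OF f] iP[OF gi] iP[of "\<lambda>x. f x - g x"] in auto)
    also have "\<dots> = (\<integral>x. \<bar>Pt (eta k) (\<lambda>x. f x - g x) x\<bar> \<partial>torus_measure)
        + (\<integral>x. \<bar>Pt (eta k) g x - g x\<bar> \<partial>torus_measure) + (\<integral>x. \<bar>f x - g x\<bar> \<partial>torus_measure)"
      using f gi iP[OF f] iP[OF gi] iP[of "\<lambda>x. f x - g x"] by simp
    also have "\<dots> < e" using Pt_L1_contraction[OF eta_pos[of k], of "\<lambda>x. f x - g x"] f gi g(2) elim by simp
    finally show ?case by simp
  qed
  then show "\<exists>no. \<forall>n\<ge>no. norm ((\<integral>x. \<bar>Pt (eta n) f x - f x\<bar> \<partial>torus_measure) - 0) < e"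
    by (simp add: eventually_sequentially)
qed

text \<open>All regularisations of the difference vanish, and they converge to it in L1.\<close>

lemma fc_eq_imp_AE_eq:
  fixes f g :: "'a::euclidean_space \<Rightarrow> real"
  assumes f: "integrable torus_measure f" and g: "integrable torus_measure g"
    and eq: "\<And>n. n \<in> lattice \<Longrightarrow> fc f n = fc g n"
  shows "AE x in torus_measure. f x = g x"
proof -
  define h where "h x = f x - g x" for x
  have h: "integrable torus_measure h" unfolding h_def using f g by simp
  have z: "fc h n = 0" if "n \<in> lattice" for n unfolding h_def using eq[OF that] fc_diff[OF f g] by simp
  have "Pt (eta k) h = (\<lambda>_. 0)" for k
    by (rule fser_unique[OF _ fser_0], rule fser_cong[OF fser_Pt[OF eta_pos h]]) (simp add: Pc_def z)
  then have "(\<integral>x. \<bar>h x\<bar> \<partial>torus_measure) = 0"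
    using Pt_tendsto_L1[OF h] by (simp add: LIMSEQ_const_iff)
  then have "AE x in torus_measure. \<bar>h x\<bar> = 0"
    using h by (subst (asm) integral_nonneg_eq_0_iff_AE) auto
  then show ?thesis by eventually_elim (simp add: h_def)
qed

end

section \<open>Weak gradients in terms of Fourier coefficients\<close>

lemma char_has_derivative:
  "((\<lambda>x. Re (z * ec n x)) has_derivative (\<lambda>h. (h \<bullet> n) * Re (2 * pi * \<i> * z * ec n x))) (at x)"
proof -
  have "(\<lambda>x. Re (z * ec n x)) = (\<lambda>x. Re z * cos (2 * pi * (x \<bullet> n)) - Im z * sin (2 * pi * (x \<bullet> n)))"
    by (simp add: ec_def)
  moreover have "((\<lambda>x. Re z * cos (2 * pi * (x \<bullet> n)) - Im z * sin (2 * pi * (x \<bullet> n))) has_derivative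
      (\<lambda>h. (h \<bullet> n) * Re (2 * pi * \<i> * z * ec n x))) (at x)"
    by (auto intro!: derivative_eq_intros simp: ec_def algebra_simps)
  ultimately show ?thesis by simp
qed

lemma pd_char: "pd i (\<lambda>x. Re (z * ec n x)) = (\<lambda>x. Re ((2 * pi * (n \<bullet> i) * \<i> * z) * ec n x))"
proof
  fix x
  show "pd i (\<lambda>x. Re (z * ec n x)) x = Re ((2 * pi * (n \<bullet> i) * \<i> * z) * ec n x)"
    unfolding pd_def frechet_derivative_at[OF char_has_derivative, symmetric]
    by (simp add: inner_commute algebra_simps)
qed

text \<open>A partial derivative of such a function has the same form with another \<open>z\<close>.
  These are the test functions that read off Fourier coefficients from the weak formulation.\<close>

lemma smooth_char: "smooth_fn (\<lambda>x. Re (z * ec n x))"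
proof -
  have "\<exists>w. foldr pd l (\<lambda>x. Re (z * ec n x)) = (\<lambda>x. Re (w * ec n x))" for l
  proof (induction l)
    case Nil show ?case by (rule exI[of _ z]) simp
  next
    case (Cons i l)
    then obtain w where w: "foldr pd l (\<lambda>x. Re (z * ec n x)) = (\<lambda>x. Re (w * ec n x))" by blast
    show ?case
      by (rule exI[of _ "2 * pi * (n \<bullet> i) * \<i> * w"]) (simp only: foldr.simps o_apply w pd_char)
  qed
  then show ?thesis unfolding smooth_fn_def
    by (metis char_has_derivative differentiable_def)
qed

lemma integral_char:
  assumes u: "integrable torus_measure u"
  shows "(\<integral>x. u x * Re (z * ec n x) \<partial>torus_measure) = Re (z * cnj (fc u n))"
proof -
  have i: "integrable torus_measure (\<lambda>x. z * cnj (complex_of_real (u x) * cnj (ec n x)))"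
    by (intro integrable_mult_right integrable_bounded_linear[OF bounded_linear_cnj] fc_integrable u)
  have "Re (z * cnj (fc u n)) = Re (\<integral>x. z * cnj (complex_of_real (u x) * cnj (ec n x)) \<partial>torus_measure)"
    by (simp only: fc_def integral_mult_right_zero Bochner_Integration.integral_cnj)
  also have "\<dots> = (\<integral>x. Re (z * cnj (complex_of_real (u x) * cnj (ec n x))) \<partial>torus_measure)"
    by (rule integral_Re[OF i, symmetric])
  also have "\<dots> = (\<integral>x. u x * Re (z * ec n x) \<partial>torus_measure)"
    by (rule Bochner_Integration.integral_cong) (auto simp: algebra_simps)
  finally show ?thesis ..
qed

lemma complex_eq_of_Re_mult:
  assumes "\<And>z. Re (z * w) = Re (z * w')" shows "w = w'"
  using assms[of 1] assms[of \<i>] by (simp add: complex_eq_iff)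

text \<open>The test functions are real, so the complex identity is recovered by letting the factor
  \<open>z\<close> vary.\<close>

lemma weak_grad_fc:
  fixes u :: "'a::euclidean_space \<Rightarrow> real"
  assumes w: "weak_grad u g" and i: "i \<in> Basis" and n: "n \<in> lattice"
  shows "fc (\<lambda>x. g x \<bullet> i) n = 2 * pi * (n \<bullet> i) * \<i> * fc u n"
proof -
  have u: "integrable torus_measure u" and g: "integrable torus_measure (\<lambda>x. g x \<bullet> i)"
    using w i by (auto simp: weak_grad_def)
  have "Re (z * (2 * pi * (n \<bullet> i) * \<i> * cnj (fc u n))) = Re (z * (- cnj (fc (\<lambda>x. g x \<bullet> i) n)))" for z
  proof -
    have "periodic_fn (\<lambda>x. Re (z * ec n x))" using periodic_ec[OF n] by (rule periodic_fn_compose)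
    then have "(\<integral>x. u x * Re ((2 * pi * (n \<bullet> i) * \<i> * z) * ec n x) \<partial>torus_measure)
        = - (\<integral>x. (g x \<bullet> i) * Re (z * ec n x) \<partial>torus_measure)"
      using w[unfolded weak_grad_def, THEN conjunct2, THEN conjunct2, rule_format, OF conjI[OF smooth_char] i]
      unfolding pd_char by blast
    then show ?thesis unfolding integral_char[OF u] integral_char[OF g] by (simp add: algebra_simps)
  qed
  from complex_eq_of_Re_mult[OF this]
  have "cnj (fc (\<lambda>x. g x \<bullet> i) n) = cnj (2 * pi * (n \<bullet> i) * \<i> * fc u n)" by simp
  then show ?thesis by (simp only: complex_cnj_cancel_iff)
qed

lemma eta_neq_0 [simp]: "eta k \<noteq> 0"
  using eta_pos[of k] by linarith

lemma abs_eta [simp]: "\<bar>eta k\<bar> = eta k"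
  by (rule abs_of_pos[OF eta_pos])

lemma eta_nonneg [simp]: "0 \<le> eta k"
  by (rule less_imp_le[OF eta_pos])

lemma eta_le_1: "eta k \<le> 1" by (simp add: eta_def)

lemma ec_difference_quotient: "(\<lambda>k. (ec n (eta k *\<^sub>R i) - 1) / eta k) \<longlonglongrightarrow> 2 * pi * (n \<bullet> i) * \<i>"
proof (rule Lim_transform)
  let ?C = "(2 * pi * norm n * norm i)\<^sup>2 / 2"
  show "(\<lambda>k. 2 * pi * (n \<bullet> i) * \<i>) \<longlonglongrightarrow> 2 * pi * (n \<bullet> i) * \<i>" by simp
  show "(\<lambda>k. (ec n (eta k *\<^sub>R i) - 1) / eta k - 2 * pi * (n \<bullet> i) * \<i>) \<longlonglongrightarrow> 0"
  proof (rule Lim_null_comparison)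
    show "(\<lambda>k. ?C * eta k) \<longlonglongrightarrow> 0" using tendsto_mult_right_zero[OF eta_tendsto] by blast
    show "\<forall>\<^sub>F k in sequentially. norm ((ec n (eta k *\<^sub>R i) - 1) / eta k - 2 * pi * (n \<bullet> i) * \<i>) \<le> ?C * eta k"
    proof (rule always_eventually, rule allI)
      fix k
      have "(ec n (eta k *\<^sub>R i) - 1) / eta k - 2 * pi * (n \<bullet> i) * \<i>
        = (ec n (eta k *\<^sub>R i) - 1 - eta k * (2 * pi * (n \<bullet> i)) * \<i>) / eta k"
        using eta_pos[of k] by (simp add: diff_divide_distrib)
      then have "norm ((ec n (eta k *\<^sub>R i) - 1) / eta k - 2 * pi * (n \<bullet> i) * \<i>)
        \<le> ((2 * pi * norm n * norm i * eta k)\<^sup>2 / 2) / eta k"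
        using divide_right_mono[OF ec_increment[of n "eta k" i], of "eta k"] by (simp add: norm_divide)
      also have "\<dots> = ?C * eta k" using eta_pos[of k] by (simp add: power2_eq_square)
      finally show "norm ((ec n (eta k *\<^sub>R i) - 1) / eta k - 2 * pi * (n \<bullet> i) * \<i>) \<le> ?C * eta k" .
    qed
  qed
qed

text \<open>Integration by parts is replaced by a limit of difference quotients, whose coefficients
  are known exactly from \<open>fc_shift\<close>; the mean value theorem dominates the
  quotients.\<close>

lemma fc_pd:
  fixes \<phi> :: "'a::euclidean_space \<Rightarrow> real"
  assumes d: "\<And>x. \<phi> differentiable at x" and c: "continuous_on UNIV (pd i \<phi>)"
    and per: "periodic_fn \<phi>" and i: "i \<in> Basis" and n: "n \<in> lattice"
  shows "fc (pd i \<phi>) n = 2 * pi * (n \<bullet> i) * \<i> * fc \<phi> n"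
proof -
  have cont: "continuous_on UNIV \<phi>"
    by (intro continuous_at_imp_continuous_on ballI differentiable_imp_continuous_within d)
  have \<phi>: "integrable torus_measure \<phi>" by (rule continuous_integrable_torus[OF cont])
  have line: "((\<lambda>s. \<phi> (x + s *\<^sub>R i)) has_real_derivative pd i \<phi> (x + s *\<^sub>R i)) (at s)" for x s
  proof -
    have "(\<phi> has_derivative frechet_derivative \<phi> (at (x + s *\<^sub>R i))) (at (x + s *\<^sub>R i))"
      using d frechet_derivative_works by blast
    then have "((\<lambda>s. \<phi> (x + s *\<^sub>R i)) has_derivative (\<lambda>h. frechet_derivative \<phi> (at (x + s *\<^sub>R i)) (h *\<^sub>R i))) (at s)"
      by (rule has_derivative_compose[rotated]) (auto intro!: derivative_eq_intros)
    moreover have "(\<lambda>h. frechet_derivative \<phi> (at (x + s *\<^sub>R i)) (h *\<^sub>R i)) = (\<lambda>h. pd i \<phi> (x + s *\<^sub>R i) * h)"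
      unfolding pd_def using linear_cmul[OF linear_frechet_derivative[OF d]] by (auto simp: mult.commute)
    ultimately show ?thesis by (simp add: has_field_derivative_def)
  qed
  \<comment> \<open>The intermediate point of the mean value theorem may leave the unit cube, hence
    the cube of side 2.\<close>
  have "compact (pd i \<phi> ` cbox 0 (2 *\<^sub>R One))"
    by (intro compact_continuous_image compact_cbox continuous_on_subset[OF c]) auto
  then obtain B where B: "\<And>y. y \<in> cbox 0 (2 *\<^sub>R One) \<Longrightarrow> \<bar>pd i \<phi> y\<bar> \<le> B"
    using compact_imp_bounded[of "pd i \<phi> ` cbox 0 (2 *\<^sub>R One)"] by (auto simp: bounded_iff)
  define q where "q k x = (\<phi> (x + eta k *\<^sub>R i) - \<phi> x) / eta k" for k x
  have qB: "\<bar>q k x\<bar> \<le> B" if x: "x \<in> cbox 0 One" for k x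
  proof -
    obtain z where z: "0 < z" "z < eta k" "\<phi> (x + eta k *\<^sub>R i) - \<phi> (x + 0 *\<^sub>R i) = (eta k - 0) * pd i \<phi> (x + z *\<^sub>R i)"
      using MVT2[of 0 "eta k" "\<lambda>s. \<phi> (x + s *\<^sub>R i)" "\<lambda>s. pd i \<phi> (x + s *\<^sub>R i)"] line by auto
    then have "q k x = pd i \<phi> (x + z *\<^sub>R i)" by (simp add: q_def)
    moreover have "x + z *\<^sub>R i \<in> cbox 0 (2 *\<^sub>R One)"
      using x z eta_le_1[of k] i by (auto simp: mem_box inner_add_left inner_Basis)
    ultimately show ?thesis using B by simp
  qed
  have qlim: "(\<lambda>k. q k x) \<longlonglongrightarrow> pd i \<phi> x" for x
  proof -
    have "((\<lambda>h. (\<phi> (x + (0 + h) *\<^sub>R i) - \<phi> (x + 0 *\<^sub>R i)) / h) \<longlongrightarrow> pd i \<phi> (x + 0 *\<^sub>R i)) (at 0)"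
      using line[of x 0] unfolding DERIV_def .
    moreover have "filterlim eta (at 0) sequentially"
      using eta_tendsto eta_pos by (auto simp: filterlim_at less_imp_neq[symmetric] intro!: always_eventually)
    ultimately show ?thesis unfolding q_def using filterlim_compose by fastforce
  qed
  have qi: "integrable torus_measure (q k)" for k
    unfolding q_def using \<phi> integrable_torus_shift[OF per \<phi>] by simp
  have "(\<lambda>k. \<integral>x. complex_of_real (q k x) * cnj (ec n x) \<partial>torus_measure) \<longlonglongrightarrow> fc (pd i \<phi>) n"
    unfolding fc_def
  proof (rule integral_dominated_convergence[where w="\<lambda>_. B"])
    show "(\<lambda>x. complex_of_real (q k x) * cnj (ec n x)) \<in> borel_measurable torus_measure" for k
      by (rule borel_measurable_integrable[OF fc_integrable[OF qi]])
    show "(\<lambda>x. complex_of_real (pd i \<phi> x) * cnj (ec n x)) \<in> borel_measurable torus_measure"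
      by (rule borel_measurable_integrable[OF fc_integrable[OF continuous_integrable_torus[OF c]]])
    show "AE x in torus_measure. (\<lambda>k. complex_of_real (q k x) * cnj (ec n x)) \<longlonglongrightarrow> complex_of_real (pd i \<phi> x) * cnj (ec n x)"
      by (intro AE_I2 tendsto_intros qlim)
    show "AE x in torus_measure. norm (complex_of_real (q k x) * cnj (ec n x)) \<le> B" for k
      by (intro AE_I2) (simp add: norm_mult qB)
  qed simp
  moreover have "(\<integral>x. complex_of_real (q k x) * cnj (ec n x) \<partial>torus_measure) = (ec n (eta k *\<^sub>R i) - 1) / eta k * fc \<phi> n" for k
  proof -
    have "(\<integral>x. complex_of_real (q k x) * cnj (ec n x) \<partial>torus_measure)
      = (\<integral>x. complex_of_real (\<phi> (x + eta k *\<^sub>R i) - \<phi> x) * cnj (ec n x) / eta k \<partial>torus_measure)"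
      by (simp add: q_def)
    also have "\<dots> = fc (\<lambda>x. \<phi> (x + eta k *\<^sub>R i) - \<phi> x) n / eta k"
      unfolding fc_def by (rule integral_divide_zero)
    also have "\<dots> = (ec n (eta k *\<^sub>R i) - 1) / eta k * fc \<phi> n"
      using fc_diff[OF integrable_torus_shift[OF per \<phi>] \<phi>] fc_shift[OF \<phi> per n]
      by (simp add: left_diff_distrib diff_divide_distrib)
    finally show ?thesis .
  qed
  ultimately have "(\<lambda>k. (ec n (eta k *\<^sub>R i) - 1) / eta k * fc \<phi> n) \<longlonglongrightarrow> fc (pd i \<phi>) n" by simp
  moreover have "(\<lambda>k. (ec n (eta k *\<^sub>R i) - 1) / eta k * fc \<phi> n) \<longlonglongrightarrow> 2 * pi * (n \<bullet> i) * \<i> * fc \<phi> n"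
    by (intro tendsto_mult_right ec_difference_quotient)
  ultimately show ?thesis using LIMSEQ_unique by blast
qed

context kernel_params
begin

lemma integral_Pt_tendsto:
  assumes g: "integrable torus_measure g" and \<phi>: "continuous_on UNIV \<phi>" "periodic_fn \<phi>"
  shows "(\<lambda>k. \<integral>x. Pt (eta k) \<phi> x * g x \<partial>torus_measure) \<longlonglongrightarrow> (\<integral>x. \<phi> x * g x \<partial>torus_measure)"
proof -
  obtain B where B: "\<And>y. y \<in> cbox 0 One \<Longrightarrow> \<bar>\<phi> y\<bar> \<le> B" using continuous_bounded_cube[OF \<phi>(1)] by blast
  have \<phi>i: "integrable torus_measure \<phi>" by (rule continuous_integrable_torus[OF \<phi>(1)])
  have PB: "\<bar>Pt (eta k) \<phi> x\<bar> \<le> B" for k x by (rule Pt_bound) (use B \<phi>i in auto)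
  show ?thesis
  proof (rule integral_dominated_convergence[where w="\<lambda>x. B * \<bar>g x\<bar>"])
    show "AE x in torus_measure. (\<lambda>k. Pt (eta k) \<phi> x * g x) \<longlonglongrightarrow> \<phi> x * g x"
      by (intro AE_I2 tendsto_intros Pt_tendsto_continuous \<phi>)
    show "AE x in torus_measure. norm (Pt (eta k) \<phi> x * g x) \<le> B * \<bar>g x\<bar>" for k
      using PB by (intro AE_I2) (auto simp: abs_mult intro!: mult_right_mono)
  qed (use g \<phi>i integrable_Pt[OF eta_pos \<phi>i] in auto)
qed

text \<open>Converse of \<open>weak_grad_fc\<close>. The test function is regularised first, so that
  both sides become absolutely convergent sums that agree term by term; continuity and periodicity
  of the test function and of its derivative then allow the regularisation to be removed.\<close>

lemma weak_gradI:
  fixes u :: "'a::euclidean_space \<Rightarrow> real"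
  assumes u: "integrable torus_measure u" and g: "\<And>i. i \<in> Basis \<Longrightarrow> integrable torus_measure (\<lambda>x. g x \<bullet> i)"
    and fc: "\<And>i n. i \<in> Basis \<Longrightarrow> n \<in> lattice \<Longrightarrow> fc (\<lambda>x. g x \<bullet> i) n = 2 * pi * (n \<bullet> i) * \<i> * fc u n"
  shows "weak_grad u g"
  unfolding weak_grad_def
proof (intro conjI ballI allI impI u g)
  fix \<phi> :: "'a \<Rightarrow> real" and i :: 'a
  assume \<phi>: "smooth_fn \<phi> \<and> periodic_fn \<phi>" and i: "i \<in> Basis"
  have d: "\<phi> differentiable at x" for x using \<phi> unfolding smooth_fn_def by (metis empty_subsetI foldr.simps(1) id_apply list.set(1))
  have d2: "pd i \<phi> differentiable at x" for x
    using \<phi>[unfolded smooth_fn_def, THEN conjunct1, rule_format, of "[i]"] i by simp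
  have c: "continuous_on UNIV \<phi>" "continuous_on UNIV (pd i \<phi>)"
    by (intro continuous_at_imp_continuous_on ballI differentiable_imp_continuous_within d d2)+
  have per: "periodic_fn (pd i \<phi>)" unfolding periodic_fn_def
  proof (intro allI ballI)
    fix x k :: 'a assume k: "k \<in> lattice"
    have eq: "(\<lambda>x. \<phi> (x + k)) = \<phi>" using \<phi> k by (auto simp: periodic_fn_def)
    have "(\<phi> has_derivative frechet_derivative \<phi> (at (x + k))) (at (x + k))"
      using d frechet_derivative_works by blast
    then have "((\<lambda>x. \<phi> (x + k)) has_derivative (\<lambda>h. frechet_derivative \<phi> (at (x + k)) h)) (at x)"
      by (rule has_derivative_compose[rotated]) (auto intro!: derivative_eq_intros)
    then show "pd i \<phi> (x + k) = pd i \<phi> x"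
      unfolding eq pd_def using frechet_derivative_at by metis
  qed
  have \<phi>i: "integrable torus_measure \<phi>" "integrable torus_measure (pd i \<phi>)"
    using c by (auto intro: continuous_integrable_torus)
  have "(\<integral>x. Pt (eta k) (pd i \<phi>) x * u x \<partial>torus_measure) = - (\<integral>x. Pt (eta k) \<phi> x * (g x \<bullet> i) \<partial>torus_measure)" for k
  proof -
    have 1: "((\<lambda>n. Pc (eta k) (pd i \<phi>) n * cnj (fc u n)) has_sum complex_of_real (\<integral>x. Pt (eta k) (pd i \<phi>) x * u x \<partial>torus_measure)) lattice"
      by (intro fser_integral fser_Pt eta_pos \<phi>i u)
    have "((\<lambda>n. - (Pc (eta k) \<phi> n * cnj (fc (\<lambda>x. g x \<bullet> i) n))) has_sum - complex_of_real (\<integral>x. Pt (eta k) \<phi> x * (g x \<bullet> i) \<partial>torus_measure)) lattice"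
      by (intro has_sum_uminusI fser_integral fser_Pt eta_pos \<phi>i g i)
    also have "?this \<longleftrightarrow> ((\<lambda>n. Pc (eta k) (pd i \<phi>) n * cnj (fc u n)) has_sum - complex_of_real (\<integral>x. Pt (eta k) \<phi> x * (g x \<bullet> i) \<partial>torus_measure)) lattice"
      by (rule has_sum_cong) (use \<phi> in \<open>simp add: Pc_def fc[OF i] fc_pd[OF d c(2) _ i]\<close>)
    finally have "complex_of_real (\<integral>x. Pt (eta k) (pd i \<phi>) x * u x \<partial>torus_measure)
        = complex_of_real (- (\<integral>x. Pt (eta k) \<phi> x * (g x \<bullet> i) \<partial>torus_measure))"
      using has_sum_unique[OF 1] by simp
    then show ?thesis by (simp only: of_real_eq_iff)
  qed
  moreover have "(\<lambda>k. \<integral>x. Pt (eta k) (pd i \<phi>) x * u x \<partial>torus_measure) \<longlonglongrightarrow> (\<integral>x. pd i \<phi> x * u x \<partial>torus_measure)"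
    by (intro integral_Pt_tendsto u c per)
  moreover have "(\<lambda>k. - (\<integral>x. Pt (eta k) \<phi> x * (g x \<bullet> i) \<partial>torus_measure)) \<longlonglongrightarrow> - (\<integral>x. \<phi> x * (g x \<bullet> i) \<partial>torus_measure)"
    by (intro tendsto_minus integral_Pt_tendsto g i c) (use \<phi> in auto)
  ultimately have "(\<integral>x. pd i \<phi> x * u x \<partial>torus_measure) = - (\<integral>x. \<phi> x * (g x \<bullet> i) \<partial>torus_measure)"
    by (simp add: LIMSEQ_unique)
  then show "(\<integral>x. u x * pd i \<phi> x \<partial>torus_measure) = - (\<integral>x. (g x \<bullet> i) * \<phi> x \<partial>torus_measure)"
    by (simp only: mult.commute)
qed

lemma weak_grad_unique:
  fixes u :: "'a::euclidean_space \<Rightarrow> real"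
  assumes "weak_grad u g" "weak_grad u g'"
  shows "AE x in torus_measure. g x = g' x"
proof -
  have "AE x in torus_measure. g x \<bullet> i = g' x \<bullet> i" if i: "i \<in> Basis" for i
  proof (rule fc_eq_imp_AE_eq)
    show "fc (\<lambda>x. g x \<bullet> i) n = fc (\<lambda>x. g' x \<bullet> i) n" if "n \<in> lattice" for n
      using weak_grad_fc[OF assms(1) i that] weak_grad_fc[OF assms(2) i that] by simp
  qed (use assms i in \<open>auto simp: weak_grad_def\<close>)
  then have "AE x in torus_measure. \<forall>i\<in>Basis. g x \<bullet> i = g' x \<bullet> i"
    by (intro AE_finite_allI) auto
  then show ?thesis by eventually_elim (rule euclidean_eqI, blast)
qed

lemma weak_grad_measurable:
  assumes "weak_grad u g" shows "g \<in> borel_measurable torus_measure"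
proof -
  have "(\<lambda>x. g x \<bullet> i) \<in> borel_measurable torus_measure" if "i \<in> Basis" for i
    using assms that by (auto simp: weak_grad_def)
  then show ?thesis by (subst borel_measurable_euclidean_space) blast
qed

section \<open>Convex integrands of the gradient\<close>

text \<open>The gradient of \<open>Pt t f\<close>, available for every integrable \<open>f\<close>;
  bounds uniform in \<open>t\<close> stand in for bounds on a gradient of \<open>f\<close>
  itself.\<close>

definition grad :: "real \<Rightarrow> ('a::euclidean_space \<Rightarrow> real) \<Rightarrow> 'a \<Rightarrow> 'a" where
  "grad t f x = (\<Sum>i\<in>Basis. dseries i (Pc t f) x *\<^sub>R i)"

end

definition nabh :: "real \<Rightarrow> ('a::euclidean_space \<Rightarrow> real) \<Rightarrow> 'a \<Rightarrow> 'a" where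
  "nabh h F x = (\<Sum>i\<in>Basis. ((F (x + h *\<^sub>R i) - F x) / h) *\<^sub>R i)"

text \<open>Subgradients provide Jensen's inequality for the averages \<open>Pt t\<close>;
  monotonicity in the absolute coordinates handles the passage from \<open>u\<close> to its absolute
  value.\<close>

definition nice :: "('a::euclidean_space \<Rightarrow> real) \<Rightarrow> bool" where
  "nice \<Theta> \<longleftrightarrow> continuous_on UNIV \<Theta> \<and> (\<forall>\<xi>. 0 \<le> \<Theta> \<xi>) \<and> (\<forall>\<xi>. \<exists>s. \<forall>\<zeta>. \<Theta> \<xi> + s \<bullet> (\<zeta> - \<xi>) \<le> \<Theta> \<zeta>)
     \<and> (\<forall>\<xi> \<zeta>. (\<forall>i\<in>Basis. \<bar>\<xi> \<bullet> i\<bar> \<le> \<bar>\<zeta> \<bullet> i\<bar>) \<longrightarrow> \<Theta> \<xi> \<le> \<Theta> \<zeta>)"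

definition trunc :: "real \<Rightarrow> 'a::euclidean_space \<Rightarrow> real" where
  "trunc M \<xi> = max 0 (norm \<xi> - M)"

lemma norm_le_componentwise_abs:
  fixes \<xi> \<zeta> :: "'a::euclidean_space"
  assumes "\<forall>i\<in>Basis. \<bar>\<xi> \<bullet> i\<bar> \<le> \<bar>\<zeta> \<bullet> i\<bar>" shows "norm \<xi> \<le> norm \<zeta>"
  using norm_le_componentwise assms by blast

lemma nice_trunc: "nice (trunc M)"
  unfolding nice_def
proof (intro conjI allI impI)
  show "continuous_on UNIV (trunc M :: 'a \<Rightarrow> real)" unfolding trunc_def[abs_def] by (intro continuous_intros)
  show "\<exists>s. \<forall>\<zeta>. trunc M \<xi> + s \<bullet> (\<zeta> - \<xi>) \<le> trunc M \<zeta>" for \<xi> :: 'a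
  \<comment> \<open>The origin lies above the threshold only for negative \<open>M\<close>; as the
    vertex of the cone it has subgradient 0, while other points above the threshold have
    \<open>sgn \<xi>\<close>.\<close>
  proof (cases "norm \<xi> \<le> M \<or> \<xi> = 0")
    case True
    show ?thesis
    proof (cases "norm \<xi> \<le> M")
      case True then show ?thesis by (intro exI[of _ 0]) (auto simp: trunc_def)
    next
      case False then show ?thesis using \<open>norm \<xi> \<le> M \<or> \<xi> = 0\<close> by (intro exI[of _ 0]) (auto simp: trunc_def le_max_iff_disj)
    qed
  next
    case False
    then have "sgn \<xi> \<bullet> (\<zeta> - \<xi>) \<le> norm \<zeta> - norm \<xi>" for \<zeta>
    proof -
      have "sgn \<xi> \<bullet> \<zeta> \<le> norm (sgn \<xi>) * norm \<zeta>" by (rule norm_cauchy_schwarz)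
      then have "sgn \<xi> \<bullet> \<zeta> \<le> norm \<zeta>" using False by (simp add: norm_sgn)
      moreover have "sgn \<xi> \<bullet> \<xi> = norm \<xi>"
        using False by (simp add: sgn_div_norm dot_square_norm power2_eq_square)
      ultimately show ?thesis by (simp add: inner_diff_right)
    qed
    then have "trunc M \<xi> + sgn \<xi> \<bullet> (\<zeta> - \<xi>) \<le> trunc M \<zeta>" for \<zeta>
      using False unfolding trunc_def by (smt (verit, best))
    then show ?thesis by blast
  qed
next
  fix \<xi> \<zeta> :: 'a
  assume "\<forall>i\<in>Basis. \<bar>\<xi> \<bullet> i\<bar> \<le> \<bar>\<zeta> \<bullet> i\<bar>"
  then show "trunc M \<xi> \<le> trunc M \<zeta>" using norm_le_componentwise_abs by (force simp: trunc_def)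
qed (simp add: trunc_def)

lemma nice_square: "nice (\<lambda>\<xi>::'a::euclidean_space. (norm \<xi>)\<^sup>2)"
  unfolding nice_def
proof (intro conjI allI impI)
  show "continuous_on UNIV (\<lambda>\<xi>::'a. (norm \<xi>)\<^sup>2)" by (intro continuous_intros)
  show "\<exists>s. \<forall>\<zeta>. (norm \<xi>)\<^sup>2 + s \<bullet> (\<zeta> - \<xi>) \<le> (norm \<zeta>)\<^sup>2" for \<xi> :: 'a
  proof (intro exI[of _ "2 *\<^sub>R \<xi>"] allI)
    fix \<zeta>
    have "0 \<le> (norm (\<zeta> - \<xi>))\<^sup>2" by simp
    then show "(norm \<xi>)\<^sup>2 + (2 *\<^sub>R \<xi>) \<bullet> (\<zeta> - \<xi>) \<le> (norm \<zeta>)\<^sup>2"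
      unfolding power2_norm_eq_inner by (simp add: inner_diff_left inner_diff_right inner_commute)
  qed
next
  fix \<xi> \<zeta> :: 'a
  assume "\<forall>i\<in>Basis. \<bar>\<xi> \<bullet> i\<bar> \<le> \<bar>\<zeta> \<bullet> i\<bar>"
  then show "(norm \<xi>)\<^sup>2 \<le> (norm \<zeta>)\<^sup>2" using norm_le_componentwise_abs by (intro power_mono) auto
qed simp

lemma nice_bounded:
  assumes "nice \<Theta>" shows "\<exists>B. \<forall>\<xi>. norm \<xi> \<le> R \<longrightarrow> \<bar>\<Theta> \<xi>\<bar> \<le> B"
proof -
  have "compact (\<Theta> ` cball 0 R)"
    by (intro compact_continuous_image compact_cball) (use assms in \<open>auto simp: nice_def intro: continuous_on_subset\<close>)
  then have "bounded (\<Theta> ` cball 0 R)" by (rule compact_imp_bounded)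
  then obtain B where "\<forall>\<xi>\<in>cball 0 R. \<bar>\<Theta> \<xi>\<bar> \<le> B" by (auto simp: bounded_iff)
  then show ?thesis by (intro exI[of _ B]) simp
qed

lemma nice_measurable:
  assumes "nice \<Theta>" "V \<in> borel_measurable torus_measure"
  shows "(\<lambda>x. \<Theta> (V x)) \<in> borel_measurable torus_measure"
proof -
  have "\<Theta> \<in> borel_measurable borel" using assms(1) unfolding nice_def by (intro borel_measurable_continuous_onI) auto
  then show ?thesis using assms(2) by (rule measurable_compose[rotated])
qed

lemma nice_integrable:
  assumes "nice \<Theta>" "V \<in> borel_measurable torus_measure" "\<And>x. norm (V x) \<le> R"
  shows "integrable torus_measure (\<lambda>x. \<Theta> (V x))"
proof -
  obtain B where "\<And>\<xi>. norm \<xi> \<le> R \<Longrightarrow> \<bar>\<Theta> \<xi>\<bar> \<le> B" using nice_bounded[OF assms(1)] by blast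
  then have "norm (\<Theta> (V x)) \<le> B" for x using assms(3) by simp
  then show ?thesis by (rule bounded_integrable_torus[OF nice_measurable[OF assms(1,2)]])
qed

lemma nice_convergence:
  fixes V :: "nat \<Rightarrow> 'a::euclidean_space \<Rightarrow> 'a"
  assumes n: "nice \<Theta>" and V: "\<And>k. V k \<in> borel_measurable torus_measure" "W \<in> borel_measurable torus_measure"
    and R: "\<And>k x. norm (V k x) \<le> R" and lim: "\<And>x. (\<lambda>k. V k x) \<longlonglongrightarrow> W x"
  shows "(\<lambda>k. \<integral>x. \<Theta> (V k x) \<partial>torus_measure) \<longlonglongrightarrow> (\<integral>x. \<Theta> (W x) \<partial>torus_measure)"
proof -
  obtain B where "\<And>\<xi>. norm \<xi> \<le> R \<Longrightarrow> \<bar>\<Theta> \<xi>\<bar> \<le> B" using nice_bounded[OF n] by blast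
  moreover have "(\<lambda>k. \<Theta> (V k x)) \<longlonglongrightarrow> \<Theta> (W x)" for x
  proof -
    have "continuous (at (W x)) \<Theta>" using n by (auto simp: nice_def continuous_on_eq_continuous_at)
    then show ?thesis using lim[of x] by (rule isCont_tendsto_compose)
  qed
  ultimately show ?thesis
    using R by (intro torus_bounded_convergence[where B=B] nice_measurable[OF n] V) auto
qed

lemma nabh_inner: "i \<in> Basis \<Longrightarrow> nabh h F x \<bullet> i = (F (x + h *\<^sub>R i) - F x) / h"
  by (simp add: nabh_def)

lemma norm_sum_Basis_le:
  assumes "\<And>i. i \<in> Basis \<Longrightarrow> \<bar>c i\<bar> \<le> B"
  shows "norm (\<Sum>i\<in>(Basis::'a::euclidean_space set). c i *\<^sub>R i) \<le> real DIM('a) * B"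
proof -
  have "norm (\<Sum>i\<in>(Basis::'a set). c i *\<^sub>R i) \<le> (\<Sum>i\<in>(Basis::'a set). \<bar>c i\<bar>)"
    by (rule order_trans[OF norm_sum]) simp
  also have "\<dots> \<le> (\<Sum>i\<in>(Basis::'a set). B)" by (rule sum_mono) (rule assms)
  finally show ?thesis by simp
qed

lemma periodic_measurable_shift:
  fixes w :: "'a::euclidean_space \<Rightarrow> real"
  assumes "periodic_fn w" "w \<in> borel_measurable torus_measure" "\<And>x. \<bar>w x\<bar> \<le> B"
  shows "integrable torus_measure w" "integrable torus_measure (\<lambda>x. w (x + h))"
proof -
  show i: "integrable torus_measure w" by (rule bounded_integrable_torus) (use assms in auto)
  show "integrable torus_measure (\<lambda>x. w (x + h))" by (rule integrable_torus_shift[OF assms(1) i])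
qed

lemma nabh_facts:
  fixes w :: "'a::euclidean_space \<Rightarrow> real"
  assumes per: "periodic_fn w" and m: "w \<in> borel_measurable torus_measure" and B: "\<And>x. \<bar>w x\<bar> \<le> B" and h: "0 < h"
  shows "nabh h w \<in> borel_measurable torus_measure" "norm (nabh h w x) \<le> real DIM('a) * (2 * B / h)"
proof -
  note i = periodic_measurable_shift[OF per m B]
  show "nabh h w \<in> borel_measurable torus_measure" unfolding nabh_def[abs_def]
  proof (intro borel_measurable_sum borel_measurable_scaleR borel_measurable_const borel_measurable_divide borel_measurable_diff m)
    show "(\<lambda>x. w (x + h *\<^sub>R i)) \<in> borel_measurable torus_measure" for i using i(2) by blast
  qed
  show "norm (nabh h w x) \<le> real DIM('a) * (2 * B / h)" unfolding nabh_def
  proof (rule norm_sum_Basis_le)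
    fix i :: 'a
    have "\<bar>w (x + h *\<^sub>R i) - w x\<bar> \<le> 2 * B" using B[of "x + h *\<^sub>R i"] B[of x] by linarith
    then show "\<bar>(w (x + h *\<^sub>R i) - w x) / h\<bar> \<le> 2 * B / h" using h by (simp add: divide_right_mono)
  qed
qed

context kernel_params
begin

text \<open>A supporting hyperplane at the averaged vector lies below \<Theta>; averaging it with
  the positive kernel, which preserves constants, gives the claim.\<close>

lemma Jensen_Pt:
  fixes G :: "'a::euclidean_space \<Rightarrow> 'a"
  assumes n: "nice \<Theta>" and t: "0 < t" and G: "\<And>i. i \<in> Basis \<Longrightarrow> integrable torus_measure (\<lambda>x. G x \<bullet> i)"
    and TG: "integrable torus_measure (\<lambda>x. \<Theta> (G x))"
  shows "\<Theta> (\<Sum>i\<in>Basis. Pt t (\<lambda>y. G y \<bullet> i) x *\<^sub>R i) \<le> Pt t (\<lambda>y. \<Theta> (G y)) x"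
proof -
  define v where "v = (\<Sum>i\<in>Basis. Pt t (\<lambda>y. G y \<bullet> i) x *\<^sub>R i)"
  obtain s where s: "\<And>\<zeta>. \<Theta> v + s \<bullet> (\<zeta> - v) \<le> \<Theta> \<zeta>" using n unfolding nice_def by blast
  have sd: "s \<bullet> (\<zeta> - v) = (\<Sum>i\<in>Basis. (s \<bullet> i) * (\<zeta> \<bullet> i - v \<bullet> i))" for \<zeta>
    using euclidean_inner[of s "\<zeta> - v"] by (simp add: inner_diff_left)
  have vi: "v \<bullet> i = Pt t (\<lambda>y. G y \<bullet> i) x" if "i \<in> Basis" for i using that by (simp add: v_def)
  have int: "integrable torus_measure (\<lambda>y. (s \<bullet> i) * (G y \<bullet> i - v \<bullet> i))" if "i \<in> Basis" for i
    using G[OF that] by simp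
  have "Pt t (\<lambda>y. \<Theta> v + (\<Sum>i\<in>Basis. (s \<bullet> i) * (G y \<bullet> i - v \<bullet> i))) x
      = Pt t (\<lambda>y. \<Theta> v) x + Pt t (\<lambda>y. \<Sum>i\<in>Basis. (s \<bullet> i) * (G y \<bullet> i - v \<bullet> i)) x"
    by (rule Pt_add[OF t]) (use int in auto)
  also have "Pt t (\<lambda>y. \<Sum>i\<in>Basis. (s \<bullet> i) * (G y \<bullet> i - v \<bullet> i)) x
      = (\<Sum>i\<in>Basis. Pt t (\<lambda>y. (s \<bullet> i) * (G y \<bullet> i - v \<bullet> i)) x)"
    by (rule Pt_sum[OF t int])
  also have "\<dots> = 0"
  proof (rule sum.neutral, rule ballI)
    fix i :: 'a assume i: "i \<in> Basis"
    show "Pt t (\<lambda>y. (s \<bullet> i) * (G y \<bullet> i - v \<bullet> i)) x = 0"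
      using Pt_diff[OF t G[OF i], of "\<lambda>_. v \<bullet> i" x] fun_cong[OF Pt_const[OF t, of "v \<bullet> i"], of x] vi[OF i]
      by (simp add: Pt_cmult)
  qed
  also have "Pt t (\<lambda>y. \<Theta> v) x = \<Theta> v" by (simp add: Pt_const t)
  finally have "\<Theta> v = Pt t (\<lambda>y. \<Theta> v + (\<Sum>i\<in>Basis. (s \<bullet> i) * (G y \<bullet> i - v \<bullet> i))) x" by simp
  also have "\<dots> \<le> Pt t (\<lambda>y. \<Theta> (G y)) x"
    by (rule Pt_mono[OF t _ TG])
       (intro Bochner_Integration.integrable_add Bochner_Integration.integrable_sum int, use s in \<open>auto simp flip: sd\<close>)
  finally show ?thesis by (simp add: v_def)
qed

lemma Jensen_integral:
  fixes G :: "'a::euclidean_space \<Rightarrow> 'a"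
  assumes n: "nice \<Theta>" and t: "0 < t" and G: "\<And>i. i \<in> Basis \<Longrightarrow> integrable torus_measure (\<lambda>x. G x \<bullet> i)"
    and TG: "integrable torus_measure (\<lambda>x. \<Theta> (G x))"
  shows "(\<integral>x. \<Theta> (\<Sum>i\<in>Basis. Pt t (\<lambda>y. G y \<bullet> i) x *\<^sub>R i) \<partial>torus_measure) \<le> (\<integral>x. \<Theta> (G x) \<partial>torus_measure)"
proof -
  have "continuous_on UNIV (\<lambda>x. \<Sum>i\<in>Basis. Pt t (\<lambda>y. G y \<bullet> i) x *\<^sub>R i)"
    by (intro continuous_intros continuous_Pt t G)
  then have "continuous_on UNIV (\<lambda>x. \<Theta> (\<Sum>i\<in>Basis. Pt t (\<lambda>y. G y \<bullet> i) x *\<^sub>R i))"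
    by (rule continuous_on_compose2[of UNIV \<Theta>, rotated]) (use n in \<open>auto simp: nice_def\<close>)
  then have "(\<integral>x. \<Theta> (\<Sum>i\<in>Basis. Pt t (\<lambda>y. G y \<bullet> i) x *\<^sub>R i) \<partial>torus_measure) \<le> (\<integral>x. Pt t (\<lambda>y. \<Theta> (G y)) x \<partial>torus_measure)"
    by (intro integral_mono Jensen_Pt[OF n t G TG] continuous_integrable_torus integrable_Pt[OF t TG])
  also have "\<dots> = (\<integral>x. \<Theta> (G x) \<partial>torus_measure)" by (rule integral_Pt[OF t TG])
  finally show ?thesis .
qed

lemma nabh_Pt:
  fixes w :: "'a::euclidean_space \<Rightarrow> real"
  assumes t: "0 < t" and w: "integrable torus_measure w" and per: "periodic_fn w"
  shows "nabh h (Pt t w) x = (\<Sum>i\<in>Basis. Pt t (\<lambda>y. nabh h w y \<bullet> i) x *\<^sub>R i)"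
  unfolding nabh_def[of h "Pt t w"]
proof (rule sum.cong[OF refl])
  fix i :: 'a assume i: "i \<in> Basis"
  have "Pt t (\<lambda>y. nabh h w y \<bullet> i) x = Pt t (\<lambda>y. (1/h) * (w (y + h *\<^sub>R i) - w y)) x"
    using i by (simp add: nabh_inner)
  also have "\<dots> = (1/h) * (Pt t (\<lambda>y. w (y + h *\<^sub>R i)) x - Pt t w x)"
    unfolding Pt_cmult by (subst Pt_diff[OF t]) (use w integrable_torus_shift[OF per w] in auto)
  also have "\<dots> = (Pt t w (x + h *\<^sub>R i) - Pt t w x) / h" by (simp add: Pt_shift[OF t w per])
  finally show "((Pt t w (x + h *\<^sub>R i) - Pt t w x) / h) *\<^sub>R i = Pt t (\<lambda>y. nabh h w y \<bullet> i) x *\<^sub>R i" by simp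
qed

lemma nabh_Pt_le:
  fixes w :: "'a::euclidean_space \<Rightarrow> real"
  assumes n: "nice \<Theta>" and t: "0 < t" and h: "0 < h"
    and per: "periodic_fn w" and m: "w \<in> borel_measurable torus_measure" and B: "\<And>x. \<bar>w x\<bar> \<le> B"
  shows "(\<integral>x. \<Theta> (nabh h (Pt t w) x) \<partial>torus_measure) \<le> (\<integral>x. \<Theta> (nabh h w x) \<partial>torus_measure)"
proof -
  note w = periodic_measurable_shift[OF per m B]
  show ?thesis unfolding nabh_Pt[OF t w(1) per]
    by (rule Jensen_integral[OF n t])
       (use w nice_integrable[OF n nabh_facts[OF per m B h]] in \<open>auto simp: nabh_inner\<close>)
qed

lemma summable_Pc: "0 < t \<Longrightarrow> integrable torus_measure f \<Longrightarrow> (\<lambda>n. norm n ^ k * norm (Pc t f n)) summable_on lattice"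
  unfolding Pc_def by (rule summable_exp_coeff[OF _ fc_norm_le])

lemma fser_dseries:
  assumes "0 < t" "integrable torus_measure f"
  shows "fser (dcoef v (Pc t f)) (dseries v (Pc t f))"
  by (rule fser_deriv[OF fser_Pt[OF assms]]) (use summable_Pc[OF assms, of 1] in simp)

text \<open>A sup bound for the gradient of the kernel: through it, \<open>grad t\<close> maps L1
  into bounded functions.\<close>

definition Cb1 :: "'a::euclidean_space itself \<Rightarrow> real \<Rightarrow> real" where
  "Cb1 _ t = (\<Sum>\<^sub>\<infinity>n\<in>(lattice::'a set). 2 * pi * norm n * exp (- t * lm n))"

lemma dseries_bound:
  fixes f :: "'a::euclidean_space \<Rightarrow> real"
  assumes t: "0 < t" and f: "integrable torus_measure f"
  shows "\<bar>dseries v (Pc t f) x\<bar> \<le> norm v * Cb1 TYPE('a) t * (\<integral>x. \<bar>f x\<bar> \<partial>torus_measure)"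
proof -
  let ?I = "\<integral>x. \<bar>f x\<bar> \<partial>torus_measure"
  have s: "(\<lambda>n::'a. 2 * pi * norm n * exp (- t * lm n)) summable_on lattice"
    using summable_on_cmult_right[OF summable_exp_coeff[OF t, of "\<lambda>_::'a. 1" 1 1], of "2 * pi"]
    by (simp add: mult.assoc)
  have "\<bar>dseries v (Pc t f) x\<bar> \<le> (\<Sum>\<^sub>\<infinity>n\<in>lattice. norm (dcoef v (Pc t f) n))"
    by (rule fser_bound[OF fser_dseries[OF t f]])
  also have "\<dots> \<le> (\<Sum>\<^sub>\<infinity>n\<in>(lattice::'a set). (norm v * ?I) * (2 * pi * norm n * exp (- t * lm n)))"
  proof (rule infsum_mono)
    show "(\<lambda>n. norm (dcoef v (Pc t f) n)) summable_on lattice" using fser_dseries[OF t f] by (auto simp: fser_def)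
    show "(\<lambda>n::'a. (norm v * ?I) * (2 * pi * norm n * exp (- t * lm n))) summable_on lattice"
      by (rule summable_on_cmult_right[OF s])
    fix n :: 'a
    have "norm (dcoef v (Pc t f) n) \<le> 2 * pi * norm v * (norm n * (exp (- t * lm n) * ?I))"
      by (rule order_trans[OF norm_dcoef_le])
         (auto simp: Pc_def norm_mult intro!: mult_left_mono fc_norm_le f)
    then show "norm (dcoef v (Pc t f) n) \<le> (norm v * ?I) * (2 * pi * norm n * exp (- t * lm n))"
      by (simp add: mult_ac)
  qed
  also have "\<dots> = (norm v * ?I) * Cb1 TYPE('a) t" unfolding Cb1_def by (rule infsum_cmult_right) (use s in auto)
  finally show ?thesis by (simp add: mult_ac)
qed

lemma dseries_Pc_diff:
  assumes "0 < t" "integrable torus_measure f" "integrable torus_measure g"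
  shows "dseries v (Pc t (\<lambda>x. f x - g x)) x = dseries v (Pc t f) x - dseries v (Pc t g) x"
proof -
  have "fser (dcoef v (Pc t (\<lambda>x. f x - g x))) (\<lambda>x. dseries v (Pc t f) x - dseries v (Pc t g) x)"
    by (rule fser_cong[OF fser_diff[OF fser_dseries[OF assms(1,2)] fser_dseries[OF assms(1,3)]]])
       (simp add: dcoef_def Pc_def fc_diff[OF assms(2,3)] algebra_simps)
  from fser_unique[OF fser_dseries this] assms show ?thesis by (auto dest: fun_cong)
qed

lemma continuous_dseries: "0 < t \<Longrightarrow> integrable torus_measure f \<Longrightarrow> continuous_on UNIV (dseries v (Pc t f))"
  by (rule fser_continuous[OF fser_dseries])

lemma continuous_grad: "0 < t \<Longrightarrow> integrable torus_measure f \<Longrightarrow> continuous_on UNIV (grad t f)"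
  unfolding grad_def[abs_def] by (intro continuous_intros continuous_dseries)

lemma measurable_grad: "0 < t \<Longrightarrow> integrable torus_measure f \<Longrightarrow> grad t f \<in> borel_measurable torus_measure"
  by (rule continuous_measurable_torus[OF continuous_grad])

lemma grad_inner: "i \<in> Basis \<Longrightarrow> grad t f x \<bullet> i = dseries i (Pc t f) x"
  by (simp add: grad_def)

lemma Pt_increment:
  fixes f :: "'a::euclidean_space \<Rightarrow> real"
  assumes t: "0 < t" and f: "integrable torus_measure f"
  shows "\<exists>K. \<forall>x h. \<bar>Pt t f (x + h *\<^sub>R v) - Pt t f x - h * dseries v (Pc t f) x\<bar> \<le> K * h\<^sup>2"
  using dseries_increment[OF fser_Pt[OF t f], of _ _ v] summable_Pc[OF t f, of 1] summable_Pc[OF t f, of 2]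
  by (intro exI[of _ "(2 * pi * norm v)\<^sup>2 / 2 * (\<Sum>\<^sub>\<infinity>n\<in>lattice. (norm n)\<^sup>2 * norm (Pc t f n))"]) simp

lemma nabh_Pt_tendsto:
  fixes f :: "'a::euclidean_space \<Rightarrow> real"
  assumes n: "nice \<Theta>" and t: "0 < t" and f: "integrable torus_measure f"
  shows "(\<lambda>k. \<integral>x. \<Theta> (nabh (eta k) (Pt t f) x) \<partial>torus_measure) \<longlonglongrightarrow> (\<integral>x. \<Theta> (grad t f x) \<partial>torus_measure)"
proof -
  have "\<forall>i. \<exists>K. \<forall>x h. \<bar>Pt t f (x + h *\<^sub>R i) - Pt t f x - h * dseries i (Pc t f) x\<bar> \<le> K * h\<^sup>2"
    using Pt_increment[OF t f] by blast
  then obtain K where K: "\<And>i x h. \<bar>Pt t f (x + h *\<^sub>R i) - Pt t f x - h * dseries i (Pc t f) x\<bar> \<le> K i * h\<^sup>2"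
    by metis
  have Kq: "\<bar>(Pt t f (x + eta k *\<^sub>R i) - Pt t f x) / eta k - dseries i (Pc t f) x\<bar> \<le> K i * eta k" for i x k
  proof -
    have "(Pt t f (x + eta k *\<^sub>R i) - Pt t f x) / eta k - dseries i (Pc t f) x
        = (Pt t f (x + eta k *\<^sub>R i) - Pt t f x - eta k * dseries i (Pc t f) x) / eta k"
      using eta_pos[of k] by (simp add: diff_divide_distrib)
    then have "\<bar>(Pt t f (x + eta k *\<^sub>R i) - Pt t f x) / eta k - dseries i (Pc t f) x\<bar> \<le> K i * (eta k)\<^sup>2 / eta k"
      using divide_right_mono[OF K[of x "eta k" i], of "eta k"] by simp
    then show ?thesis using eta_pos[of k] by (simp add: power2_eq_square)
  qed
  have K0: "0 \<le> K i" for i using K[of 0 1 i] by simp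
  define D where "D = Cb1 TYPE('a) t * (\<integral>x. \<bar>f x\<bar> \<partial>torus_measure)"
  define R where "R = D + (\<Sum>i\<in>(Basis::'a set). K i)"
  have R: "\<bar>(Pt t f (x + eta k *\<^sub>R i) - Pt t f x) / eta k\<bar> \<le> R" if i: "i \<in> Basis" for i x k
  proof -
    have "K i * eta k \<le> K i" using K0 eta_le_1[of k] eta_pos[of k] by (simp add: mult_left_le)
    moreover have "K i \<le> (\<Sum>i\<in>(Basis::'a set). K i)" using i K0 by (intro member_le_sum) auto
    moreover have "\<bar>dseries i (Pc t f) x\<bar> \<le> D" using dseries_bound[OF t f, of i x] i by (simp add: D_def)
    ultimately show ?thesis unfolding R_def using Kq[of x k i] by linarith
  qed
  have cP: "continuous_on UNIV (Pt t f)" by (rule continuous_Pt[OF t f])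
  show ?thesis
  proof (rule nice_convergence[OF n])
    show "nabh (eta k) (Pt t f) \<in> borel_measurable torus_measure" for k
      unfolding nabh_def[abs_def]
      by (intro continuous_measurable_torus continuous_intros continuous_on_compose2[OF cP]) (use eta_pos[of k] in auto)
    show "grad t f \<in> borel_measurable torus_measure" by (rule measurable_grad[OF t f])
    show "norm (nabh (eta k) (Pt t f) x) \<le> real DIM('a) * R" for k x
      unfolding nabh_def by (rule norm_sum_Basis_le) (rule R)
    show "(\<lambda>k. nabh (eta k) (Pt t f) x) \<longlonglongrightarrow> grad t f x" for x
      unfolding nabh_def grad_def
    proof (intro tendsto_intros)
      fix i :: 'a
      show "(\<lambda>k. (Pt t f (x + eta k *\<^sub>R i) - Pt t f x) / eta k) \<longlonglongrightarrow> dseries i (Pc t f) x"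
      proof (rule Lim_transform[OF tendsto_const], rule Lim_null_comparison)
        show "\<forall>\<^sub>F k in sequentially. norm ((Pt t f (x + eta k *\<^sub>R i) - Pt t f x) / eta k - dseries i (Pc t f) x) \<le> K i * eta k"
          using Kq by (intro always_eventually) simp
        show "(\<lambda>k. K i * eta k) \<longlonglongrightarrow> 0" using tendsto_mult_right_zero[OF eta_tendsto] by blast
      qed
    qed
  qed
qed

text \<open>For fixed \<open>t\<close> the gradient of the smoothed function is bounded, uniformly
  in space, by the L1 norm, so convergence in L1 is enough and no derivative of \<open>w k\<close>
  enters.\<close>

lemma grad_tendsto_L1:
  fixes f :: "'a::euclidean_space \<Rightarrow> real"
  assumes n: "nice \<Theta>" and t: "0 < t" and f: "integrable torus_measure f" and w: "\<And>k. integrable torus_measure (w k)"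
    and lim: "(\<lambda>k. \<integral>x. \<bar>w k x - f x\<bar> \<partial>torus_measure) \<longlonglongrightarrow> 0"
  shows "(\<lambda>k. grad t (w k) x) \<longlonglongrightarrow> grad t f x"
    and "(\<lambda>k. \<integral>x. \<Theta> (grad t (w k) x) \<partial>torus_measure) \<longlonglongrightarrow> (\<integral>x. \<Theta> (grad t f x) \<partial>torus_measure)"
proof -
  define I where "I k = (\<integral>x. \<bar>w k x - f x\<bar> \<partial>torus_measure)" for k
  define C where "C = Cb1 TYPE('a) t"
  have b: "\<bar>dseries i (Pc t (w k)) x - dseries i (Pc t f) x\<bar> \<le> C * I k" if "i \<in> Basis" for i x k
    using dseries_bound[OF t, of "\<lambda>x. w k x - f x" i x] dseries_Pc_diff[OF t w f, of i k x] w f that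
    by (simp add: C_def I_def)
  show *: "(\<lambda>k. grad t (w k) x) \<longlonglongrightarrow> grad t f x" for x
    unfolding grad_def
  proof (intro tendsto_intros tendsto_sum)
    fix i :: 'a assume i: "i \<in> Basis"
    show "(\<lambda>k. dseries i (Pc t (w k)) x) \<longlonglongrightarrow> dseries i (Pc t f) x"
    proof (rule Lim_transform[OF tendsto_const], rule Lim_null_comparison)
      show "\<forall>\<^sub>F k in sequentially. norm (dseries i (Pc t (w k)) x - dseries i (Pc t f) x) \<le> C * I k"
        using b i by (intro always_eventually) simp
      show "(\<lambda>k. C * I k) \<longlonglongrightarrow> 0" using tendsto_mult_right_zero[OF lim] by (simp add: I_def)
    qed
  qed
  have "Bseq I" by (rule convergent_imp_Bseq[OF convergentI]) (use lim in \<open>simp add: I_def[abs_def]\<close>)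
  then obtain J where J: "\<And>k. \<bar>I k\<bar> \<le> J" unfolding Bseq_def by auto
  have C0: "0 \<le> C" unfolding C_def Cb1_def by (intro infsum_nonneg) simp
  define R where "R = C * (\<integral>x. \<bar>f x\<bar> \<partial>torus_measure) + C * J"
  have R: "\<bar>dseries i (Pc t (w k)) x\<bar> \<le> R" if i: "i \<in> Basis" for i x k
  proof -
    have "C * I k \<le> C * J" using C0 J[of k] by (intro mult_left_mono) auto
    then show ?thesis using b[OF i, of k x] dseries_bound[OF t f, of i x] i by (simp add: R_def C_def)
  qed
  show "(\<lambda>k. \<integral>x. \<Theta> (grad t (w k) x) \<partial>torus_measure) \<longlonglongrightarrow> (\<integral>x. \<Theta> (grad t f x) \<partial>torus_measure)"
  proof (rule nice_convergence[OF n measurable_grad[OF t w] measurable_grad[OF t f] _ *])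
    show "norm (grad t (w k) x) \<le> real DIM('a) * R" for k x
      unfolding grad_def by (rule norm_sum_Basis_le) (rule R)
  qed
qed

lemma grad_weak_grad:
  fixes u :: "'a::euclidean_space \<Rightarrow> real"
  assumes t: "0 < t" and w: "weak_grad u g"
  shows "grad t u x = (\<Sum>i\<in>Basis. Pt t (\<lambda>y. g y \<bullet> i) x *\<^sub>R i)"
  unfolding grad_def
proof (rule sum.cong[OF refl])
  fix i :: 'a assume i: "i \<in> Basis"
  have u: "integrable torus_measure u" and g: "integrable torus_measure (\<lambda>x. g x \<bullet> i)"
    using w i by (auto simp: weak_grad_def)
  have "fser (dcoef i (Pc t u)) (Pt t (\<lambda>y. g y \<bullet> i))"
    by (rule fser_cong[OF fser_Pt[OF t g]]) (simp add: dcoef_def Pc_def weak_grad_fc[OF w i])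
  from fser_unique[OF fser_dseries[OF t u] this]
  show "dseries i (Pc t u) x *\<^sub>R i = Pt t (\<lambda>y. g y \<bullet> i) x *\<^sub>R i" by simp
qed

text \<open>Smoothing makes the difference quotients converge to a gradient, and by Jensen it does
  not increase their energy. Thus a bound on increments of a merely bounded function becomes one on
  \<open>grad t\<close>.\<close>

lemma grad_Pt_le_of_nabh:
  fixes w :: "'a::euclidean_space \<Rightarrow> real"
  assumes n: "nice \<Theta>" and t: "0 < t"
    and per: "periodic_fn w" and m: "w \<in> borel_measurable torus_measure" and B: "\<And>x. \<bar>w x\<bar> \<le> B"
    and le: "\<And>k. (\<integral>x. \<Theta> (nabh (eta k) w x) \<partial>torus_measure) \<le> J k" and J: "J \<longlonglongrightarrow> K"
  shows "(\<integral>x. \<Theta> (grad t w x) \<partial>torus_measure) \<le> K"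
proof (rule LIMSEQ_le[OF nabh_Pt_tendsto[OF n t] J])
  show "integrable torus_measure w" by (rule periodic_measurable_shift[OF per m B])
  show "\<exists>N. \<forall>k\<ge>N. (\<integral>x. \<Theta> (nabh (eta k) (Pt t w) x) \<partial>torus_measure) \<le> J k"
    using order_trans[OF nabh_Pt_le[OF n t eta_pos per m B] le] by blast
qed

lemma nice_nabh_abs: "nice \<Theta> \<Longrightarrow> 0 < h \<Longrightarrow> \<Theta> (nabh h (\<lambda>x. \<bar>w x\<bar>) x) \<le> \<Theta> (nabh h w x)"
  unfolding nice_def by (auto simp: nabh_inner divide_right_mono)

text \<open>A chain rule for the absolute value is avoided: it is applied to a regularisation, where
  taking absolute values can only shrink increments, and the resulting bound is passed to the L1
  limit.\<close>

lemma grad_abs_le: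
  fixes u :: "'a::euclidean_space \<Rightarrow> real"
  assumes n: "nice \<Theta>" and t: "0 < t" and w: "weak_grad u g" and Tg: "integrable torus_measure (\<lambda>x. \<Theta> (g x))"
  shows "(\<integral>x. \<Theta> (grad t (\<lambda>x. \<bar>u x\<bar>) x) \<partial>torus_measure) \<le> (\<integral>x. \<Theta> (g x) \<partial>torus_measure)"
proof -
  have u: "integrable torus_measure u" and g: "\<And>i. i \<in> Basis \<Longrightarrow> integrable torus_measure (\<lambda>x. g x \<bullet> i)"
    using w by (auto simp: weak_grad_def)
  define v where "v k x = \<bar>Pt (eta k) u x\<bar>" for k x
  note iP = integrable_Pt[OF eta_pos u] and pP = periodic_Pt[OF eta_pos u] and BP = Pt_bound_L1[OF eta_pos u]
  define Bk where "Bk k = Cb TYPE('a) (eta k) * (\<integral>y. \<bar>u y\<bar> \<partial>torus_measure)" for k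
  have vB: "\<bar>v k x\<bar> \<le> Bk k" for k x unfolding v_def Bk_def using BP[of k x] by simp
  have perv: "periodic_fn (v k)" for k unfolding v_def by (rule periodic_fn_compose[OF pP])
  have mv: "v k \<in> borel_measurable torus_measure" for k unfolding v_def using iP[of k] by simp
  have iv: "integrable torus_measure (v k)" for k unfolding v_def using iP[of k] by simp
  have "(\<integral>x. \<Theta> (grad t (v k) x) \<partial>torus_measure) \<le> (\<integral>x. \<Theta> (g x) \<partial>torus_measure)" for k
  proof -
    have "(\<integral>x. \<Theta> (grad t (v k) x) \<partial>torus_measure) \<le> (\<integral>x. \<Theta> (grad (eta k) u x) \<partial>torus_measure)"
    proof (rule grad_Pt_le_of_nabh[OF n t perv mv vB _ nabh_Pt_tendsto[OF n eta_pos u]])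
      fix j
      show "(\<integral>x. \<Theta> (nabh (eta j) (v k) x) \<partial>torus_measure) \<le> (\<integral>x. \<Theta> (nabh (eta j) (Pt (eta k) u) x) \<partial>torus_measure)"
      proof (rule integral_mono)
        show "integrable torus_measure (\<lambda>x. \<Theta> (nabh (eta j) (v k) x))"
          by (rule nice_integrable[OF n nabh_facts[OF perv mv vB eta_pos]])
        show "integrable torus_measure (\<lambda>x. \<Theta> (nabh (eta j) (Pt (eta k) u) x))"
          by (rule nice_integrable[OF n nabh_facts[OF pP _ BP eta_pos]]) (use iP in auto)
      qed (unfold v_def, rule nice_nabh_abs[OF n eta_pos])
    qed
    also have "\<dots> \<le> (\<integral>x. \<Theta> (g x) \<partial>torus_measure)"
      unfolding grad_weak_grad[OF eta_pos w] by (rule Jensen_integral[OF n eta_pos g Tg])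
    finally show ?thesis .
  qed
  moreover have "(\<lambda>k. \<integral>x. \<Theta> (grad t (v k) x) \<partial>torus_measure) \<longlonglongrightarrow> (\<integral>x. \<Theta> (grad t (\<lambda>x. \<bar>u x\<bar>) x) \<partial>torus_measure)"
  proof (rule grad_tendsto_L1(2)[OF n t _ iv])
    show "(\<lambda>k. \<integral>x. \<bar>v k x - \<bar>u x\<bar>\<bar> \<partial>torus_measure) \<longlonglongrightarrow> 0"
    proof (rule tendsto_sandwich[OF _ _ tendsto_const Pt_tendsto_L1[OF u]])
      show "\<forall>\<^sub>F k in sequentially. (\<integral>x. \<bar>v k x - \<bar>u x\<bar>\<bar> \<partial>torus_measure) \<le> (\<integral>x. \<bar>Pt (eta k) u x - u x\<bar> \<partial>torus_measure)"
        by (intro always_eventually allI integral_mono) (use iv iP u in \<open>auto simp: v_def\<close>)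
    qed simp
  qed (use u in auto)
  ultimately show ?thesis by (intro LIMSEQ_le_const2) auto
qed

end

section \<open>Weak gradients from uniform integrability\<close>

lemma Fatou_le:
  fixes \<phi> :: "nat \<Rightarrow> 'a \<Rightarrow> real"
  assumes i: "\<And>k. integrable M (\<phi> k)" and nn: "\<And>k x. x \<in> space M \<Longrightarrow> 0 \<le> \<phi> k x" and m: "\<psi> \<in> borel_measurable M"
    and lim: "AE x in M. (\<lambda>k. \<phi> k x) \<longlonglongrightarrow> \<psi> x" and C: "\<And>k. (\<integral>x. \<phi> k x \<partial>M) \<le> C"
  shows "integrable M \<psi>" "(\<integral>x. \<psi> x \<partial>M) \<le> C"
proof -
  have "0 \<le> (\<integral>x. \<phi> 0 x \<partial>M)" by (rule integral_nonneg_AE[OF AE_I2]) (rule nn)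
  then have C0: "0 \<le> C" using C[of 0] by linarith
  have nn\<psi>: "AE x in M. 0 \<le> \<psi> x"
    using lim AE_space
  proof eventually_elim
    case (elim x) show ?case by (rule LIMSEQ_le_const[OF elim(1)]) (use elim nn in auto)
  qed
  have "(\<integral>\<^sup>+x. ennreal (\<psi> x) \<partial>M) = (\<integral>\<^sup>+x. liminf (\<lambda>k. ennreal (\<phi> k x)) \<partial>M)"
  proof (rule nn_integral_cong_AE)
    show "AE x in M. ennreal (\<psi> x) = liminf (\<lambda>k. ennreal (\<phi> k x))"
      using lim
    proof eventually_elim
      case (elim x)
      show ?case
        by (rule lim_imp_Liminf[OF _ tendsto_ennrealI[OF elim], symmetric]) simp
    qed
  qed
  also have "\<dots> \<le> liminf (\<lambda>k. \<integral>\<^sup>+x. ennreal (\<phi> k x) \<partial>M)"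
    by (rule nn_integral_liminf) (use i in auto)
  also have "\<dots> \<le> ennreal C"
  proof (rule Liminf_le)
    show "\<forall>\<^sub>F k in sequentially. (\<integral>\<^sup>+x. ennreal (\<phi> k x) \<partial>M) \<le> ennreal C"
      using i nn C by (intro always_eventually) (simp add: nn_integral_eq_integral AE_I2 ennreal_leI)
  qed simp
  finally have le: "(\<integral>\<^sup>+x. ennreal (\<psi> x) \<partial>M) \<le> ennreal C" .
  then have "(\<integral>\<^sup>+x. ennreal (\<psi> x) \<partial>M) < \<infinity>" using ennreal_less_top le_less_trans by (metis infinity_ennreal_def)
  then show int: "integrable M \<psi>" using m nn\<psi> by (intro integrableI_nonneg) auto
  show "(\<integral>x. \<psi> x \<partial>M) \<le> C"
    using le C0 unfolding nn_integral_eq_integral[OF int nn\<psi>] by (simp add: ennreal_le_iff)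
qed

text \<open>A subsequence with geometrically small gaps has an almost everywhere absolutely
  convergent telescoping series; Fatou turns the Cauchy bound into convergence in mean.\<close>

lemma L1_complete:
  fixes f :: "nat \<Rightarrow> 'a \<Rightarrow> real"
  assumes i: "\<And>k. integrable M (f k)"
    and C: "\<And>e. 0 < e \<Longrightarrow> \<exists>N. \<forall>k\<ge>N. \<forall>l\<ge>N. (\<integral>x. \<bar>f k x - f l x\<bar> \<partial>M) \<le> e"
  shows "\<exists>g. integrable M g \<and> (\<lambda>k. \<integral>x. \<bar>f k x - g x\<bar> \<partial>M) \<longlonglongrightarrow> 0"
proof -
  have "\<forall>n. \<exists>N. \<forall>k\<ge>N. \<forall>l\<ge>N. (\<integral>x. \<bar>f k x - f l x\<bar> \<partial>M) \<le> (1/2) ^ n" by (intro allI C) simp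
  then obtain N where N: "\<And>n k l. N n \<le> k \<Longrightarrow> N n \<le> l \<Longrightarrow> (\<integral>x. \<bar>f k x - f l x\<bar> \<partial>M) \<le> (1/2::real) ^ n"
    by metis
  \<comment> \<open>Adding up the thresholds makes \<open>r\<close> increasing and at least
    \<open>N n\<close> without a recursive choice.\<close>
  define r where "r n = n + (\<Sum>j\<le>n. N j)" for n
  have "N n \<le> (\<Sum>j\<le>n. N j)" for n by (rule member_le_sum) auto
  then have rN: "N n \<le> r n" for n unfolding r_def by (rule trans_le_add2)
  have rmono: "r n \<le> r (Suc n)" for n unfolding r_def by simp
  define d where "d n x = f (r (Suc n)) x - f (r n) x" for n x
  have id: "integrable M (d n)" for n unfolding d_def using i by simp
  have dle: "(\<integral>x. \<bar>d n x\<bar> \<partial>M) \<le> (1/2) ^ n" for n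
    unfolding d_def using rN[of n] rmono[of n] by (intro N) auto
  have "(\<integral>\<^sup>+x. (\<Sum>n. ennreal \<bar>d n x\<bar>) \<partial>M) = (\<Sum>n. \<integral>\<^sup>+x. ennreal \<bar>d n x\<bar> \<partial>M)"
    by (rule nn_integral_suminf) (use id in auto)
  also have "\<dots> \<le> (\<Sum>n. ennreal ((1/2) ^ n))"
    by (rule suminf_le) (use id dle in \<open>auto simp: nn_integral_eq_integral intro!: ennreal_leI\<close>)
  also have "\<dots> = ennreal (\<Sum>n. (1/2) ^ n)"
    by (rule suminf_ennreal2) (auto intro: summable_geometric)
  finally have "(\<integral>\<^sup>+x. (\<Sum>n. ennreal \<bar>d n x\<bar>) \<partial>M) \<noteq> \<infinity>" by (auto simp: top_unique)
  then have "AE x in M. (\<Sum>n. ennreal \<bar>d n x\<bar>) \<noteq> \<infinity>"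
    by (rule nn_integral_noteq_infinite[rotated]) (use id in auto)
  then have conv: "AE x in M. convergent (\<lambda>n. f (r n) x)"
  proof eventually_elim
    case (elim x)
    have "summable (\<lambda>n. \<bar>d n x\<bar>)" by (rule summable_suminf_not_top) (use elim in auto)
    then have "summable (\<lambda>n. d n x)" by (rule summable_rabs_cancel)
    then have "convergent (\<lambda>n. \<Sum>j<n. d j x)" by (simp add: summable_iff_convergent)
    also have "(\<lambda>n. \<Sum>j<n. d j x) = (\<lambda>n. f (r n) x - f (r 0) x)"
      unfolding d_def using sum_lessThan_telescope[of "\<lambda>n. f (r n) x"] by simp
    finally have "convergent (\<lambda>n. (f (r n) x - f (r 0) x) + f (r 0) x)"
      by (intro convergent_add convergent_const)
    then show ?case by simp
  qed
  define g where "g x = lim (\<lambda>n. f (r n) x)" for x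
  have gm [measurable]: "g \<in> borel_measurable M" unfolding g_def using i by (intro borel_measurable_lim_metric) auto
  have lim: "AE x in M. (\<lambda>n. f (r n) x) \<longlonglongrightarrow> g x"
    using conv by eventually_elim (simp add: g_def convergent_LIMSEQ_iff)
  have key: "integrable M (\<lambda>x. \<bar>f k x - g x\<bar>)" "(\<integral>x. \<bar>f k x - g x\<bar> \<partial>M) \<le> e"
    if "\<And>l. L \<le> l \<Longrightarrow> (\<integral>x. \<bar>f k x - f l x\<bar> \<partial>M) \<le> e" for k e L
  proof -
    have r: "n \<le> r n" for n by (simp add: r_def)
    have Lk: "(\<integral>x. \<bar>f k x - f (r (n + L)) x\<bar> \<partial>M) \<le> e" for n
      using that[of "r (n + L)"] r[of "n + L"] by simp
    have "AE x in M. (\<lambda>n. \<bar>f k x - f (r (n + L)) x\<bar>) \<longlonglongrightarrow> \<bar>f k x - g x\<bar>"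
      using lim
    proof eventually_elim
      case (elim x)
      show ?case by (intro tendsto_intros LIMSEQ_ignore_initial_segment[OF elim])
    qed
    note F = Fatou_le[where \<phi>="\<lambda>n x. \<bar>f k x - f (r (n + L)) x\<bar>" and M=M, OF _ _ _ this Lk]
    show "integrable M (\<lambda>x. \<bar>f k x - g x\<bar>)" "(\<integral>x. \<bar>f k x - g x\<bar> \<partial>M) \<le> e"
      by (rule F; use i in auto)+
  qed
  obtain N1 where N1: "\<And>k l. N1 \<le> k \<Longrightarrow> N1 \<le> l \<Longrightarrow> (\<integral>x. \<bar>f k x - f l x\<bar> \<partial>M) \<le> 1"
    using C[of 1] by auto
  have "integrable M (\<lambda>x. \<bar>f N1 x - g x\<bar>)" by (rule key(1)[of N1 N1 1]) (rule N1, auto)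
  then have "integrable M (\<lambda>x. f N1 x - g x)" using i gm by (subst (asm) integrable_abs_iff) auto
  then have "integrable M (\<lambda>x. f N1 x - (f N1 x - g x))" by (rule Bochner_Integration.integrable_diff[OF i])
  then have "integrable M g" by simp
  moreover have "(\<lambda>k. \<integral>x. \<bar>f k x - g x\<bar> \<partial>M) \<longlonglongrightarrow> 0"
  proof (rule LIMSEQ_I)
    fix e :: real assume e: "0 < e"
    obtain L where L: "\<And>k l. L \<le> k \<Longrightarrow> L \<le> l \<Longrightarrow> (\<integral>x. \<bar>f k x - f l x\<bar> \<partial>M) \<le> e / 2" using C[of "e / 2"] e by auto
    have "norm ((\<integral>x. \<bar>f k x - g x\<bar> \<partial>M) - 0) < e" if "L \<le> k" for k
      using key(2)[of L k "e / 2"] L[OF that] e by simp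
    then show "\<exists>no. \<forall>n\<ge>no. norm ((\<integral>x. \<bar>f n x - g x\<bar> \<partial>M) - 0) < e" by blast
  qed
  ultimately show ?thesis by blast
qed

text \<open>The Huber function: the square on [-M, M], continued linearly with slope of modulus
  \<open>2 * M\<close> outside. It is convex with derivative \<open>2 * clamp1 M y\<close>, and its
  linear growth makes it usable for functions controlled only in L1.\<close>

definition huber :: "real \<Rightarrow> real \<Rightarrow> real" where
  "huber M y = 2 * clamp1 M y * y - (clamp1 M y)\<^sup>2"

text \<open>The convexity gap controls the square of the clamped difference. What remains is the
  variational inequality of \<open>clamp1 M\<close>, the nearest-point projection onto
  [-M, M].\<close>

lemma huber_convex:
  assumes "0 \<le> M"
  shows "huber M x + 2 * clamp1 M x * (y - x) + (clamp1 M x - clamp1 M y)\<^sup>2 \<le> huber M y"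
proof -
  have "0 \<le> (clamp1 M y - clamp1 M x) * (y - clamp1 M y)"
  proof (cases "\<bar>y\<bar> \<le> M")
    case True then show ?thesis by (simp add: clamp1_id)
  next
    case False
    then show ?thesis using clamp1_abs_le[OF assms, of x] assms
      by (cases "y > 0") (auto simp: clamp1_def intro: mult_nonneg_nonneg mult_nonpos_nonpos)
  qed
  then show ?thesis by (simp add: huber_def power2_eq_square algebra_simps)
qed

lemma huber_subgradient:
  assumes "0 \<le> M" shows "huber M x + 2 * clamp1 M x * (y - x) \<le> huber M y"
  using huber_convex[OF assms, of x y] zero_le_power2[of "clamp1 M x - clamp1 M y"] by linarith

lemma huber_lipschitz:
  assumes "0 \<le> M" shows "huber M x - huber M y \<le> 2 * M * \<bar>x - y\<bar>"
proof -
  have "clamp1 M x * (x - y) \<le> \<bar>clamp1 M x\<bar> * \<bar>x - y\<bar>" by (metis abs_ge_self abs_mult)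
  also have "\<dots> \<le> M * \<bar>x - y\<bar>" by (intro mult_right_mono clamp1_abs_le assms) simp
  finally show ?thesis using huber_subgradient[OF assms, of x y] by (simp add: algebra_simps)
qed

lemma huber_le: "0 \<le> M \<Longrightarrow> huber M y \<le> 2 * M * \<bar>y\<bar>"
  using huber_lipschitz[of M y 0] by (simp add: huber_def clamp1_def)

lemma continuous_huber: "continuous_on UNIV f \<Longrightarrow> continuous_on UNIV (\<lambda>x. huber M (f x))"
  unfolding huber_def by (intro continuous_intros continuous_clamp1)

lemma abs_diff_clamp1: "0 \<le> M \<Longrightarrow> \<bar>y - clamp1 M y\<bar> = max 0 (\<bar>y\<bar> - M)"
  by (auto simp: clamp1_def)

section \<open>Compactness in L1 of the smoothed derivatives\<close>

context kernel_params
begin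

lemma Pt_dseries:
  assumes "0 < s" "0 < t" "integrable torus_measure f"
  shows "Pt s (dseries v (Pc t f)) = dseries v (Pc (s + t) f)"
proof (rule fser_unique)
  show "fser (dcoef v (Pc (s + t) f)) (dseries v (Pc (s + t) f))" by (rule fser_dseries) (use assms in auto)
  show "fser (dcoef v (Pc (s + t) f)) (Pt s (dseries v (Pc t f)))"
  proof (rule fser_cong[OF fser_Pt_fser[OF assms(1) fser_dseries[OF assms(2,3)]]])
    fix n :: 'a
    have "exp (- s * lm n) * exp (- t * lm n) = exp (- (s + t) * lm n)"
      by (simp add: algebra_simps flip: exp_add)
    then have "complex_of_real (exp (- (s + t) * lm n)) = of_real (exp (- s * lm n)) * of_real (exp (- t * lm n))"
      by (simp only: of_real_mult[symmetric])
    then show "complex_of_real (exp (- s * lm n)) * dcoef v (Pc t f) n = dcoef v (Pc (s + t) f) n"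
      by (simp only: dcoef_def Pc_def mult_ac)
  qed
qed

lemma huber_Jensen:
  fixes h :: "'a::euclidean_space \<Rightarrow> real"
  assumes M: "0 \<le> M" and s: "0 < s" and h: "continuous_on UNIV h"
  shows "(\<integral>x. huber M (Pt s h x) \<partial>torus_measure) \<le> (\<integral>x. huber M (h x) \<partial>torus_measure)"
proof -
  have hi: "integrable torus_measure h" by (rule continuous_integrable_torus[OF h])
  have ji: "integrable torus_measure (\<lambda>x. huber M (h x))" by (intro continuous_integrable_torus continuous_huber h)
  have "huber M (Pt s h x) \<le> Pt s (\<lambda>y. huber M (h y)) x" for x
  proof -
    define v c where "v = Pt s h x" and "c = 2 * clamp1 M v"
    have "Pt s (\<lambda>y. (huber M v - c * v) + c * h y) x = Pt s (\<lambda>y::'a. huber M v - c * v) x + Pt s (\<lambda>y. c * h y) x"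
      by (rule Pt_add[OF s]) (use hi in auto)
    also have "\<dots> = huber M v" by (simp add: Pt_const[OF s] Pt_cmult v_def)
    finally have "huber M v = Pt s (\<lambda>y. (huber M v - c * v) + c * h y) x" ..
    also have "\<dots> \<le> Pt s (\<lambda>y. huber M (h y)) x"
    proof (rule Pt_mono[OF s _ ji])
      fix y
      show "(huber M v - c * v) + c * h y \<le> huber M (h y)"
        using huber_subgradient[OF M, of v "h y"] by (simp add: c_def algebra_simps)
    qed (use hi in auto)
    finally show ?thesis by (simp add: v_def)
  qed
  then have "(\<integral>x. huber M (Pt s h x) \<partial>torus_measure) \<le> (\<integral>x. Pt s (\<lambda>y. huber M (h y)) x \<partial>torus_measure)"
    by (intro integral_mono continuous_integrable_torus continuous_huber continuous_Pt s hi integrable_Pt ji)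
  also have "\<dots> = (\<integral>x. huber M (h x) \<partial>torus_measure)" by (rule integral_Pt[OF s ji])
  finally show ?thesis .
qed

text \<open>A monotonicity argument takes the place of weak compactness. The Huber integrals
  \<open>A k\<close> increase, because the derivative at a larger time is an average of the one at a
  smaller time, and they are bounded, so they converge. Strong convexity at midpoints then makes the
  clamped derivatives Cauchy in L2, and \<open>UI\<close> accounts for what the clamping
  removes.\<close>

lemma dseries_Cauchy_L1:
  fixes f :: "'a::euclidean_space \<Rightarrow> real"
  assumes f: "integrable torus_measure f"
    and UI: "\<And>e. 0 < e \<Longrightarrow> \<exists>M\<ge>0. \<forall>t>0. (\<integral>x. max 0 (\<bar>dseries i (Pc t f) x\<bar> - M) \<partial>torus_measure) \<le> e"
    and e: "0 < e"
  shows "\<exists>N. \<forall>k\<ge>N. \<forall>l\<ge>N. (\<integral>x. \<bar>dseries i (Pc (eta k) f) x - dseries i (Pc (eta l) f) x\<bar> \<partial>torus_measure) \<le> e"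
proof -
  define D where "D t = dseries i (Pc t f)" for t
  have cD: "continuous_on UNIV (D t)" if "0 < t" for t unfolding D_def by (rule continuous_dseries[OF that f])
  have iD: "integrable torus_measure (D t)" if "0 < t" for t by (rule continuous_integrable_torus[OF cD[OF that]])
  have PD: "Pt s (D t) = D (s + t)" if "0 < s" "0 < t" for s t unfolding D_def by (rule Pt_dseries[OF that f])
  obtain M where M: "0 \<le> M" and tail: "\<And>t. 0 < t \<Longrightarrow> (\<integral>x. max 0 (\<bar>D t x\<bar> - M) \<partial>torus_measure) \<le> e / 4"
    using UI[of "e / 4"] e unfolding D_def by auto
  have ct: "continuous_on UNIV (\<lambda>x. max 0 (\<bar>D t x\<bar> - M))" if "0 < t" for t by (intro continuous_intros cD that)
  have ck: "continuous_on UNIV (\<lambda>x. clamp1 M (D t x))" if "0 < t" for t by (intro continuous_clamp1 cD that)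
  define A where "A k = (\<integral>x. huber M (D (eta k) x) \<partial>torus_measure)" for k
  have Abd: "A k \<le> 2 * M * (M + e / 4)" for k
  proof -
    have "(\<integral>x. \<bar>D (eta k) x\<bar> \<partial>torus_measure) \<le> (\<integral>x. M + max 0 (\<bar>D (eta k) x\<bar> - M) \<partial>torus_measure)"
      by (intro integral_mono continuous_integrable_torus continuous_intros cD eta_pos) auto
    also have "\<dots> = M + (\<integral>x. max 0 (\<bar>D (eta k) x\<bar> - M) \<partial>torus_measure)"
      using continuous_integrable_torus[OF ct[OF eta_pos]] by simp
    also have "\<dots> \<le> M + e / 4" using tail[OF eta_pos] by simp
    finally have "2 * M * (\<integral>x. \<bar>D (eta k) x\<bar> \<partial>torus_measure) \<le> 2 * M * (M + e / 4)" using M by (intro mult_left_mono) auto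
    moreover have "A k \<le> (\<integral>x. 2 * M * \<bar>D (eta k) x\<bar> \<partial>torus_measure)" unfolding A_def
      by (intro integral_mono huber_le M continuous_integrable_torus continuous_huber continuous_intros cD eta_pos)
    ultimately show ?thesis by simp
  qed
  have Amono: "A k \<le> A l" if "k \<le> l" for k l
  proof (cases "k = l")
    case False
    then have s: "0 < eta k - eta l" using that by (simp add: eta_def divide_strict_left_mono)
    then have "D (eta k) = Pt (eta k - eta l) (D (eta l))" using PD[OF s eta_pos[of l]] by simp
    then show ?thesis unfolding A_def using huber_Jensen[OF M s cD[OF eta_pos[of l]]] by simp
  qed simp
  then have "mono A" by (rule monoI)
  then obtain Ainf where Ainf: "A \<longlonglongrightarrow> Ainf" "\<And>k. A k \<le> Ainf"
    using incseq_convergent[of A] Abd by metis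
  \<comment> \<open>The L1 effect of a further smoothing by \<open>eta k\<close> after time
    \<open>eta m\<close>; it vanishes as \<open>k\<close> grows with \<open>m\<close> fixed.\<close>
  define E where "E m k = (\<integral>x. \<bar>D (eta k + eta m) x - D (eta m) x\<bar> \<partial>torus_measure)" for m k
  have E: "(\<lambda>k. E m k) \<longlonglongrightarrow> 0" for m
    using Pt_tendsto_L1[OF iD[OF eta_pos[of m]]] PD[OF eta_pos eta_pos[of m]] by (simp add: E_def)
  \<comment> \<open>The midpoint \<open>h\<close> of two derivatives has Huber integral at least
    \<open>A m\<close> up to the errors \<open>E m k\<close> and \<open>E m l\<close>: smoothing it
    for time \<open>eta m\<close> lowers the integral and brings both halves close to
    \<open>D (eta m)\<close>. Convexity at \<open>h\<close> then bounds the clamped difference by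
    the remaining excess \<open>Ainf - A m\<close>.\<close>
  have main: "(\<integral>x. (clamp1 M (D (eta k) x) - clamp1 M (D (eta l) x))\<^sup>2 \<partial>torus_measure) \<le> 4 * (Ainf - A m) + 4 * M * (E m k + E m l)"
    for k l m
  proof -
    define h where "h x = (1/2) * (D (eta k) x + D (eta l) x)" for x
    have ch: "continuous_on UNIV h" unfolding h_def by (intro continuous_intros cD eta_pos)
    have ih: "integrable torus_measure (\<lambda>x. huber M (h x))" by (intro continuous_integrable_torus continuous_huber ch)
    have iA: "integrable torus_measure (\<lambda>x. huber M (D (eta k) x))" for k
      by (intro continuous_integrable_torus continuous_huber cD eta_pos)
    have cs: "continuous_on UNIV (\<lambda>x. (clamp1 M (D (eta k) x) - clamp1 M (D (eta l) x))\<^sup>2)"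
      by (intro continuous_intros ck eta_pos)
    have "(clamp1 M (D (eta k) x) - clamp1 M (D (eta l) x))\<^sup>2
        \<le> 2 * (huber M (D (eta k) x) + huber M (D (eta l) x) - 2 * huber M (h x))" for x
    proof -
      let ?p = "clamp1 M (D (eta k) x)" and ?q = "clamp1 M (D (eta l) x)" and ?r = "clamp1 M (h x)"
      have dh: "D (eta k) x - h x = - (D (eta l) x - h x)" by (simp add: h_def field_simps)
      have dk: "2 * ?r * (D (eta k) x - h x) = - (2 * ?r * (D (eta l) x - h x))"
        unfolding dh by (rule mult_minus_right)
      have S: "(?r - ?p)\<^sup>2 + (?r - ?q)\<^sup>2 \<le> huber M (D (eta k) x) + huber M (D (eta l) x) - 2 * huber M (h x)"
        using dk huber_convex[OF M, of "h x" "D (eta k) x"] huber_convex[OF M, of "h x" "D (eta l) x"] by linarith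
      have "(?p - ?q)\<^sup>2 \<le> 2 * ((?r - ?p)\<^sup>2 + (?r - ?q)\<^sup>2)"
        using zero_le_power2[of "(?r - ?p) + (?r - ?q)"] by (simp add: power2_eq_square algebra_simps)
      also have "\<dots> \<le> 2 * (huber M (D (eta k) x) + huber M (D (eta l) x) - 2 * huber M (h x))"
        by (rule mult_left_mono[OF S]) simp
      finally show ?thesis .
    qed
    then have "(\<integral>x. (clamp1 M (D (eta k) x) - clamp1 M (D (eta l) x))\<^sup>2 \<partial>torus_measure)
        \<le> (\<integral>x. 2 * (huber M (D (eta k) x) + huber M (D (eta l) x) - 2 * huber M (h x)) \<partial>torus_measure)"
      by (intro integral_mono) (use iA ih continuous_integrable_torus[OF cs] in auto)
    also have "\<dots> = 2 * (A k + A l - 2 * (\<integral>x. huber M (h x) \<partial>torus_measure))"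
      using iA ih by (simp add: A_def)
    finally have 1: "(\<integral>x. (clamp1 M (D (eta k) x) - clamp1 M (D (eta l) x))\<^sup>2 \<partial>torus_measure)
        \<le> 2 * (A k + A l - 2 * (\<integral>x. huber M (h x) \<partial>torus_measure))" .
    let ?D = "\<lambda>x. (1/2) * (D (eta k + eta m) x + D (eta l + eta m) x)"
    have Ph: "Pt (eta m) h = ?D"
    proof
      fix x
      have "Pt (eta m) h x = (1/2) * (Pt (eta m) (D (eta k)) x + Pt (eta m) (D (eta l)) x)"
        unfolding h_def Pt_cmult by (subst Pt_add) (use iD in auto)
      then show "Pt (eta m) h x = ?D x" by (simp add: PD add.commute)
    qed
    have cD2: "continuous_on UNIV (D (eta k + eta m))" for k by (intro cD add_pos_pos eta_pos)
    have iE: "integrable torus_measure (\<lambda>x. \<bar>D (eta k + eta m) x - D (eta m) x\<bar>)" for k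
      by (intro continuous_integrable_torus continuous_intros cD2 cD eta_pos)
    have "A m \<le> (\<integral>x. huber M (?D x) + M * (\<bar>D (eta k + eta m) x - D (eta m) x\<bar> + \<bar>D (eta l + eta m) x - D (eta m) x\<bar>) \<partial>torus_measure)"
      unfolding A_def
    proof (rule integral_mono)
      fix x
      have "huber M (D (eta m) x) - huber M (?D x) \<le> 2 * M * \<bar>D (eta m) x - ?D x\<bar>" by (rule huber_lipschitz[OF M])
      also have "\<bar>D (eta m) x - ?D x\<bar> \<le> (1/2) * (\<bar>D (eta k + eta m) x - D (eta m) x\<bar> + \<bar>D (eta l + eta m) x - D (eta m) x\<bar>)"
        by (auto simp: field_simps)
      then have "2 * M * \<bar>D (eta m) x - ?D x\<bar> \<le> 2 * M * ((1/2) * (\<bar>D (eta k + eta m) x - D (eta m) x\<bar> + \<bar>D (eta l + eta m) x - D (eta m) x\<bar>))"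
        using M by (intro mult_left_mono) auto
      finally show "huber M (D (eta m) x) \<le> huber M (?D x) + M * (\<bar>D (eta k + eta m) x - D (eta m) x\<bar> + \<bar>D (eta l + eta m) x - D (eta m) x\<bar>)"
        by simp
    qed (intro iA continuous_integrable_torus continuous_intros continuous_huber cD2 cD eta_pos)+
    also have "\<dots> = (\<integral>x. huber M (?D x) \<partial>torus_measure) + M * (E m k + E m l)"
      unfolding E_def using iE[of k] iE[of l]
      by (subst Bochner_Integration.integral_add)
         (auto intro!: continuous_integrable_torus continuous_intros continuous_huber cD2)
    also have "(\<integral>x. huber M (?D x) \<partial>torus_measure) \<le> (\<integral>x. huber M (h x) \<partial>torus_measure)"
      using huber_Jensen[OF M eta_pos[of m] ch] unfolding Ph .
    finally have 2: "A m - M * (E m k + E m l) \<le> (\<integral>x. huber M (h x) \<partial>torus_measure)" by simp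
    have arith: "y \<le> 4 * (c - a) + 4 * q"
      if "y \<le> 2 * (p1 + p2 - 2 * z)" "a - q \<le> z" "p1 \<le> c" "p2 \<le> c" for y p1 p2 z a q c :: real
      using that unfolding right_diff_distrib distrib_left by linarith
    show ?thesis using arith[OF 1 2 Ainf(2) Ainf(2)] by (simp only: mult.assoc)
  qed
  \<comment> \<open>With \<delta> = e/2 the two tails contribute e/4 each, and the weighted bound
    \<open>zz\<close> contributes \<delta>/2 twice.\<close>
  define \<delta> where "\<delta> = e / 2"
  have \<delta>: "0 < \<delta>" using e by (simp add: \<delta>_def)
  have "\<forall>\<^sub>F m in sequentially. Ainf - \<delta>\<^sup>2 / 8 < A m" by (rule order_tendstoD(1)[OF Ainf(1)]) (use \<delta> in simp)
  then obtain m where "Ainf - \<delta>\<^sup>2 / 8 < A m" unfolding eventually_sequentially by blast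
  then have m: "4 * (Ainf - A m) \<le> \<delta>\<^sup>2 / 2" by (simp add: field_simps)
  have "(\<lambda>k. M * E m k) \<longlonglongrightarrow> 0" using tendsto_mult_right_zero[OF E] by blast
  then have "\<forall>\<^sub>F k in sequentially. M * E m k < \<delta>\<^sup>2 / 16" by (rule order_tendstoD(2)) (use \<delta> in simp)
  then obtain N where N: "\<And>k. N \<le> k \<Longrightarrow> M * E m k < \<delta>\<^sup>2 / 16" unfolding eventually_sequentially by blast
  have "(\<integral>x. \<bar>D (eta k) x - D (eta l) x\<bar> \<partial>torus_measure) \<le> e" if kl: "N \<le> k" "N \<le> l" for k l
  proof -
    let ?z = "\<lambda>x. clamp1 M (D (eta k) x) - clamp1 M (D (eta l) x)"
    have sq: "(\<integral>x. (?z x)\<^sup>2 \<partial>torus_measure) \<le> \<delta>\<^sup>2"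
      using main[of k l m] N[OF kl(1)] N[OF kl(2)] m by (simp add: algebra_simps)
    have cz: "continuous_on UNIV (\<lambda>x. (?z x)\<^sup>2)" by (intro continuous_intros ck eta_pos)
    have zz: "\<bar>z\<bar> \<le> z\<^sup>2 / (2 * \<delta>) + \<delta> / 2" for z :: real
    proof -
      have "0 \<le> (\<bar>z\<bar> - \<delta>)\<^sup>2" by simp
      then have "2 * \<delta> * \<bar>z\<bar> \<le> z\<^sup>2 + \<delta>\<^sup>2" by (simp add: power2_eq_square algebra_simps)
      then show ?thesis using \<delta> by (simp add: field_simps power2_eq_square)
    qed
    let ?t = "\<lambda>k x. max 0 (\<bar>D (eta k) x\<bar> - M)"
    have it: "integrable torus_measure (?t k)" for k by (rule continuous_integrable_torus[OF ct[OF eta_pos]])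
    have iz: "integrable torus_measure (\<lambda>x. (?z x)\<^sup>2)" by (rule continuous_integrable_torus[OF cz])
    have "(\<integral>x. \<bar>D (eta k) x - D (eta l) x\<bar> \<partial>torus_measure)
        \<le> (\<integral>x. ?t k x + ?t l x + ((?z x)\<^sup>2 / (2 * \<delta>) + \<delta> / 2) \<partial>torus_measure)"
    proof (rule integral_mono)
      fix x
      have "\<bar>D (eta k) x - D (eta l) x\<bar> \<le> \<bar>D (eta k) x - clamp1 M (D (eta k) x)\<bar> + \<bar>D (eta l) x - clamp1 M (D (eta l) x)\<bar> + \<bar>?z x\<bar>"
        by linarith
      then show "\<bar>D (eta k) x - D (eta l) x\<bar> \<le> ?t k x + ?t l x + ((?z x)\<^sup>2 / (2 * \<delta>) + \<delta> / 2)"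
        using zz[of "?z x"] unfolding abs_diff_clamp1[OF M] by linarith
    qed (use iD it iz in auto)
    also have "\<dots> = (\<integral>x. ?t k x \<partial>torus_measure) + (\<integral>x. ?t l x \<partial>torus_measure) + ((\<integral>x. (?z x)\<^sup>2 \<partial>torus_measure) / (2 * \<delta>) + \<delta> / 2)"
      using it iz by simp
    also have "\<dots> \<le> e / 4 + e / 4 + (\<delta>\<^sup>2 / (2 * \<delta>) + \<delta> / 2)"
      using \<delta> sq by (intro add_mono tail eta_pos divide_right_mono) auto
    also have "\<dots> = e" using \<delta> by (simp add: power2_eq_square) (simp add: \<delta>_def)
    finally show ?thesis .
  qed
  then show ?thesis unfolding D_def by blast
qed

text \<open>The gradients at times \<open>eta k\<close> converge in L1, and Fourier coefficients
  identify the limit as the weak gradient. The second property records that every energy bound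
  uniform in \<open>t\<close> descends to this same \<open>g\<close>, by Fatou along an almost
  everywhere convergent subsequence.\<close>

lemma weak_grad_exists:
  fixes f :: "'a::euclidean_space \<Rightarrow> real"
  assumes f: "integrable torus_measure f"
    and UI: "\<And>e. 0 < e \<Longrightarrow> \<exists>M\<ge>0. \<forall>t>0. (\<integral>x. trunc M (grad t f x) \<partial>torus_measure) \<le> e"
  obtains g where "weak_grad f g"
    and "\<And>\<Theta> C. nice \<Theta> \<Longrightarrow> (\<And>t. 0 < t \<Longrightarrow> (\<integral>x. \<Theta> (grad t f x) \<partial>torus_measure) \<le> C) \<Longrightarrow>
           integrable torus_measure (\<lambda>x. \<Theta> (g x)) \<and> (\<integral>x. \<Theta> (g x) \<partial>torus_measure) \<le> C"
proof -
  have "\<exists>h. integrable torus_measure h \<and> (\<lambda>k. \<integral>x. \<bar>dseries i (Pc (eta k) f) x - h x\<bar> \<partial>torus_measure) \<longlonglongrightarrow> 0"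
    if i: "i \<in> Basis" for i :: 'a
  proof (rule L1_complete)
    show "integrable torus_measure (dseries i (Pc (eta k) f))" for k
      by (intro continuous_integrable_torus continuous_dseries eta_pos f)
    show "\<exists>N. \<forall>k\<ge>N. \<forall>l\<ge>N. (\<integral>x. \<bar>dseries i (Pc (eta k) f) x - dseries i (Pc (eta l) f) x\<bar> \<partial>torus_measure) \<le> e"
      if "0 < e" for e
    proof (rule dseries_Cauchy_L1[OF f _ that])
      fix e :: real assume "0 < e"
      from UI[OF this] obtain M where M: "0 \<le> M" "\<And>t. 0 < t \<Longrightarrow> (\<integral>x. trunc M (grad t f x) \<partial>torus_measure) \<le> e" by blast
      have "(\<integral>x. max 0 (\<bar>dseries i (Pc t f) x\<bar> - M) \<partial>torus_measure) \<le> e" if t: "0 < t" for t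
      proof -
        have "(\<integral>x. max 0 (\<bar>dseries i (Pc t f) x\<bar> - M) \<partial>torus_measure) \<le> (\<integral>x. trunc M (grad t f x) \<partial>torus_measure)"
        proof (rule integral_mono)
          show "max 0 (\<bar>dseries i (Pc t f) x\<bar> - M) \<le> trunc M (grad t f x)" for x
            using Basis_le_norm[OF i, of "grad t f x"] by (simp add: trunc_def grad_inner[OF i])
        qed (auto simp: trunc_def intro!: continuous_integrable_torus continuous_intros continuous_dseries continuous_grad t f)
        then show ?thesis using M(2)[OF t] by linarith
      qed
      then show "\<exists>M\<ge>0. \<forall>t>0. (\<integral>x. max 0 (\<bar>dseries i (Pc t f) x\<bar> - M) \<partial>torus_measure) \<le> e" using M(1) by blast
    qed
  qed
  then have "\<forall>i\<in>(Basis::'a set). \<exists>h. integrable torus_measure h \<and> (\<lambda>k. \<integral>x. \<bar>dseries i (Pc (eta k) f) x - h x\<bar> \<partial>torus_measure) \<longlonglongrightarrow> 0"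
    by blast
  from bchoice[OF this] obtain h where h: "\<And>i. i \<in> (Basis::'a set) \<Longrightarrow> integrable torus_measure (h i)"
    "\<And>i. i \<in> (Basis::'a set) \<Longrightarrow> (\<lambda>k. \<integral>x. \<bar>dseries i (Pc (eta k) f) x - h i x\<bar> \<partial>torus_measure) \<longlonglongrightarrow> 0"
    by blast
  define g where "g x = (\<Sum>i\<in>Basis. h i x *\<^sub>R i)" for x
  have gi: "g x \<bullet> i = h i x" if "i \<in> Basis" for x i using that by (simp add: g_def)
  have iD: "integrable torus_measure (dseries i (Pc (eta k) f))" for i k
    by (intro continuous_integrable_torus continuous_dseries eta_pos f)
  have wg: "weak_grad f g"
  proof (rule weak_gradI[OF f])
    show "integrable torus_measure (\<lambda>x. g x \<bullet> i)" if "i \<in> Basis" for i using h(1)[OF that] by (simp add: gi that)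
    fix i n :: 'a assume i: "i \<in> Basis" and n: "n \<in> lattice"
    have "(\<lambda>k. fc (dseries i (Pc (eta k) f)) n) \<longlonglongrightarrow> fc (h i) n"
    proof (rule Lim_transform[OF tendsto_const], rule Lim_null_comparison)
      show "\<forall>\<^sub>F k in sequentially. norm (fc (dseries i (Pc (eta k) f)) n - fc (h i) n)
          \<le> (\<integral>x. \<bar>dseries i (Pc (eta k) f) x - h i x\<bar> \<partial>torus_measure)"
      proof (rule always_eventually, rule allI)
        fix k
        show "norm (fc (dseries i (Pc (eta k) f)) n - fc (h i) n)
          \<le> (\<integral>x. \<bar>dseries i (Pc (eta k) f) x - h i x\<bar> \<partial>torus_measure)"
          unfolding fc_diff[OF iD h(1)[OF i], symmetric] by (rule fc_norm_le) (use iD h(1)[OF i] in auto)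
      qed
    qed (rule h(2)[OF i])
    moreover have "(\<lambda>k. fc (dseries i (Pc (eta k) f)) n) \<longlonglongrightarrow> 2 * pi * (n \<bullet> i) * \<i> * (complex_of_real (exp (- 0 * lm n)) * fc f n)"
      unfolding fser_fc[OF fser_dseries[OF eta_pos f] n] dcoef_def Pc_def
      by (intro tendsto_intros eta_tendsto)
    ultimately show "fc (\<lambda>x. g x \<bullet> i) n = 2 * pi * (n \<bullet> i) * \<i> * fc f n"
      using LIMSEQ_unique by (fastforce simp: gi i)
  qed
  define u where "u k x = (\<Sum>i\<in>Basis. \<bar>dseries i (Pc (eta k) f) x - h i x\<bar>)" for k x
  have iu: "integrable torus_measure (u k)" for k
    unfolding u_def using iD h(1) by (intro Bochner_Integration.integrable_sum) auto
  have "(\<lambda>k. \<Sum>i\<in>(Basis::'a set). \<integral>x. \<bar>dseries i (Pc (eta k) f) x - h i x\<bar> \<partial>torus_measure) \<longlonglongrightarrow> (\<Sum>i\<in>(Basis::'a set). 0)"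
    by (intro tendsto_sum h(2))
  moreover have "(\<integral>x. norm (u k x) \<partial>torus_measure) = (\<Sum>i\<in>(Basis::'a set). \<integral>x. \<bar>dseries i (Pc (eta k) f) x - h i x\<bar> \<partial>torus_measure)" for k
    unfolding u_def using iD h(1) by (simp add: Bochner_Integration.integral_sum sum_nonneg)
  ultimately have "(\<lambda>k. \<integral>x. norm (u k x) \<partial>torus_measure) \<longlonglongrightarrow> 0" by simp
  from tendsto_L1_AE_subseq[OF iu this] obtain r :: "nat \<Rightarrow> nat" where
    r: "AE x in torus_measure. (\<lambda>n. u (r n) x) \<longlonglongrightarrow> 0" by blast
  have AEg: "AE x in torus_measure. (\<lambda>n. grad (eta (r n)) f x) \<longlonglongrightarrow> g x"
    using r
  proof eventually_elim
    case (elim x)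
    show ?case unfolding grad_def g_def
    proof (intro tendsto_intros)
      fix i :: 'a assume i: "i \<in> Basis"
      show "(\<lambda>n. dseries i (Pc (eta (r n)) f) x) \<longlonglongrightarrow> h i x"
      proof (rule Lim_transform[OF tendsto_const], rule Lim_null_comparison[OF _ elim])
        show "\<forall>\<^sub>F n in sequentially. norm (dseries i (Pc (eta (r n)) f) x - h i x) \<le> u (r n) x"
          unfolding u_def real_norm_def by (intro always_eventually allI member_le_sum i) auto
      qed
    qed
  qed
  show thesis
  proof (rule that[OF wg])
    fix \<Theta> :: "'a \<Rightarrow> real" and C
    assume n: "nice \<Theta>" and C: "\<And>t. 0 < t \<Longrightarrow> (\<integral>x. \<Theta> (grad t f x) \<partial>torus_measure) \<le> C"
    have "AE x in torus_measure. (\<lambda>k. \<Theta> (grad (eta (r k)) f x)) \<longlonglongrightarrow> \<Theta> (g x)"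
      using AEg
    proof eventually_elim
      case (elim x)
      have "continuous (at (g x)) \<Theta>" using n by (auto simp: nice_def continuous_on_eq_continuous_at)
      then show ?case using elim by (rule isCont_tendsto_compose)
    qed
    moreover have "integrable torus_measure (\<lambda>x. \<Theta> (grad (eta (r k)) f x))" for k
    proof (rule continuous_integrable_torus)
      show "continuous_on UNIV (\<lambda>x. \<Theta> (grad (eta (r k)) f x))"
        by (rule continuous_on_compose2[of UNIV \<Theta>, OF _ continuous_grad[OF eta_pos f]]) (use n in \<open>auto simp: nice_def\<close>)
    qed
    ultimately show "integrable torus_measure (\<lambda>x. \<Theta> (g x)) \<and> (\<integral>x. \<Theta> (g x) \<partial>torus_measure) \<le> C"
      using Fatou_le[of torus_measure "\<lambda>k x. \<Theta> (grad (eta (r k)) f x)" "\<lambda>x. \<Theta> (g x)" C]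
        nice_measurable[OF n weak_grad_measurable[OF wg]] C[OF eta_pos] n
      unfolding nice_def by blast
  qed
qed

end

section \<open>The truncated maximal function\<close>

lemma DERIV_of_quadratic_error:
  fixes \<phi> :: "real \<Rightarrow> real"
  assumes r: "0 < r" and K: "\<And>h. \<bar>h\<bar> < r \<Longrightarrow> \<bar>\<phi> (s + h) - \<phi> s - h * d\<bar> \<le> K * h\<^sup>2"
  shows "DERIV \<phi> s :> d"
  unfolding DERIV_def
proof (rule Lim_transform[OF tendsto_const], rule Lim_null_comparison)
  show "\<forall>\<^sub>F h in at 0. norm ((\<phi> (s + h) - \<phi> s) / h - d) \<le> K * \<bar>h\<bar>"
    unfolding eventually_at
  proof (intro exI[of _ r] conjI r ballI impI)
    fix h :: real assume h: "h \<noteq> 0 \<and> dist h 0 < r"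
    have "(\<phi> (s + h) - \<phi> s) / h - d = (\<phi> (s + h) - \<phi> s - h * d) / h" using h by (simp add: diff_divide_distrib)
    then have "norm ((\<phi> (s + h) - \<phi> s) / h - d) = \<bar>\<phi> (s + h) - \<phi> s - h * d\<bar> / \<bar>h\<bar>" by simp
    also have "\<dots> \<le> K * h\<^sup>2 / \<bar>h\<bar>" using K[of h] h by (intro divide_right_mono) auto
    also have "\<dots> = K * \<bar>h\<bar>" by (subst power2_abs[symmetric]) (simp only: power2_eq_square times_divide_eq_right[symmetric] nonzero_mult_div_cancel_right abs_eq_0 h, use h in simp)
    finally show "norm ((\<phi> (s + h) - \<phi> s) / h - d) \<le> K * \<bar>h\<bar>" .
  qed
  have "((\<lambda>h::real. K * \<bar>h\<bar>) \<longlongrightarrow> K * \<bar>0\<bar>) (at 0)" by (intro tendsto_intros)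
  then show "((\<lambda>h::real. K * \<bar>h\<bar>) \<longlongrightarrow> 0) (at 0)" by simp
qed

lemma exp_quadratic_error: "\<bar>exp y - 1 - y\<bar> \<le> y\<^sup>2 / 2 * exp \<bar>y\<bar>" for y :: real
proof -
  obtain t where t: "\<bar>t\<bar> \<le> \<bar>y\<bar>" "exp y = (\<Sum>m<2. y ^ m / fact m) + exp t / fact 2 * y ^ 2"
    using Maclaurin_exp_le[of y 2] by blast
  then have eq: "exp y - 1 - y = exp t * (y\<^sup>2 / 2)" by (simp add: numeral_2_eq_2)
  have "\<bar>exp y - 1 - y\<bar> = exp t * (y\<^sup>2 / 2)" unfolding eq by (rule abs_of_nonneg) simp
  also have "\<dots> \<le> exp \<bar>y\<bar> * (y\<^sup>2 / 2)" using t(1) by (intro mult_right_mono) auto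
  finally show ?thesis by (simp only: mult.commute)
qed

text \<open>The cubic term of the Taylor polynomial of \<open>iexp\<close> is imaginary, so the real
  part already has an error of fourth order.\<close>

lemma cos_quartic_error: "\<bar>2 * cos \<theta> - 2 + \<theta>\<^sup>2\<bar> \<le> \<theta> ^ 4 / 12" for \<theta> :: real
proof -
  have "norm (iexp \<theta> - (\<Sum>k\<le>3. (\<i> * \<theta>) ^ k / fact k)) \<le> \<bar>\<theta>\<bar> ^ 4 / fact 4"
    using iexp_approx1[of \<theta> 3] by simp
  then have "\<bar>Re (iexp \<theta> - (\<Sum>k\<le>3. (\<i> * \<theta>) ^ k / fact k))\<bar> \<le> \<bar>\<theta>\<bar> ^ 4 / fact 4"
    using abs_Re_le_cmod order_trans by blast
  moreover have "Re (iexp \<theta> - (\<Sum>k\<le>3. (\<i> * \<theta>) ^ k / fact k)) = cos \<theta> - 1 + \<theta>\<^sup>2 / 2"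
  proof -
    have "(\<i> * complex_of_real \<theta>) ^ 2 = - complex_of_real (\<theta>\<^sup>2)" by (simp add: power_mult_distrib)
    moreover have "(\<i> * complex_of_real \<theta>) ^ 3 = - \<i> * complex_of_real (\<theta> ^ 3)"
      unfolding power_mult_distrib by (simp add: power3_eq_cube[of \<i>])
    ultimately have "(\<Sum>k\<le>3. (\<i> * complex_of_real \<theta>) ^ k / fact k)
      = 1 + \<i> * \<theta> + (- complex_of_real (\<theta>\<^sup>2)) / 2 + (- \<i> * complex_of_real (\<theta> ^ 3)) / 6"
      by (simp add: eval_nat_numeral(3) fact_numeral atMost_Suc numeral_3_eq_3 numeral_2_eq_2 add_ac)
    then show ?thesis by (simp add: cis_conv_exp[symmetric] flip: of_real_power)
  qed
  moreover have "\<bar>\<theta>\<bar> ^ 4 / fact 4 = \<theta> ^ 4 / 24" by (simp add: fact_numeral)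
  ultimately have "\<bar>cos \<theta> - 1 + \<theta>\<^sup>2 / 2\<bar> \<le> \<theta> ^ 4 / 24" by (simp only:)
  moreover have "2 * cos \<theta> - 2 + \<theta>\<^sup>2 = 2 * (cos \<theta> - 1 + \<theta>\<^sup>2 / 2)" by simp
  ultimately show ?thesis unfolding abs_le_iff by linarith
qed

context kernel_params
begin

lemma Pt_has_derivative:
  fixes f :: "'a::euclidean_space \<Rightarrow> real"
  assumes t: "0 < t" and f: "integrable torus_measure f"
  shows "((\<lambda>s. Pt t f (x + s *\<^sub>R v)) has_real_derivative dseries v (Pc t f) (x + s *\<^sub>R v)) (at s)"
proof -
  obtain K where K: "\<And>x h. \<bar>Pt t f (x + h *\<^sub>R v) - Pt t f x - h * dseries v (Pc t f) x\<bar> \<le> K * h\<^sup>2"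
    using Pt_increment[OF t f, of v] by blast
  show ?thesis
  proof (rule DERIV_of_quadratic_error[of 1])
    show "\<bar>Pt t f (x + (s + h) *\<^sub>R v) - Pt t f (x + s *\<^sub>R v) - h * dseries v (Pc t f) (x + s *\<^sub>R v)\<bar> \<le> K * h\<^sup>2" for h
      using K[of "x + s *\<^sub>R v" h] by (simp add: algebra_simps)
  qed simp
qed

lemma Pt_lipschitz_of_deriv_bound:
  fixes f :: "'a::euclidean_space \<Rightarrow> real"
  assumes t: "0 < t" and f: "integrable torus_measure f" and L: "\<And>y. \<bar>dseries v (Pc t f) y\<bar> \<le> L"
  shows "\<bar>Pt t f (x + v) - Pt t f x\<bar> \<le> L"
proof -
  obtain z where "Pt t f (x + 1 *\<^sub>R v) - Pt t f (x + 0 *\<^sub>R v) = (1 - 0) * dseries v (Pc t f) (x + z *\<^sub>R v)"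
    using MVT2[of 0 1 "\<lambda>s. Pt t f (x + s *\<^sub>R v)" "\<lambda>s. dseries v (Pc t f) (x + s *\<^sub>R v)"]
      Pt_has_derivative[OF t f] by auto
  then show ?thesis using L by simp
qed

lemma summable_lm_power:
  assumes t: "0 < t" and B: "\<And>n. n \<in> lattice \<Longrightarrow> norm (c n) \<le> B"
  shows "(\<lambda>n::'a::euclidean_space. lm n ^ k * exp (- t * lm n) * norm (c n :: complex)) summable_on lattice"
proof -
  obtain C where C: "\<And>r. 0 \<le> r \<Longrightarrow> r ^ k * exp (- (t/2) * r) \<le> C" using power_le_exp[of "t/2" k] t by auto
  have C0: "0 \<le> C" using order_trans[OF _ C[of 0]] by simp
  have "(\<lambda>n::'a. (C * B) * exp (- (t/2) * lm n)) summable_on lattice"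
    by (intro summable_on_cmult_right summable_exp_lm) (use t in simp)
  then show ?thesis
  proof (rule summable_on_comparison_test)
    fix n :: 'a assume n: "n \<in> lattice"
    have "lm n ^ k * exp (- t * lm n) = (lm n ^ k * exp (- (t/2) * lm n)) * exp (- (t/2) * lm n)"
      by (simp add: mult.assoc flip: exp_add)
    also have "\<dots> \<le> C * exp (- (t/2) * lm n)" using C[OF lm_nonneg] by (intro mult_right_mono) auto
    finally have A: "lm n ^ k * exp (- t * lm n) \<le> C * exp (- (t/2) * lm n)" .
    have "lm n ^ k * exp (- t * lm n) * norm (c n) \<le> (C * exp (- (t/2) * lm n)) * B"
      by (rule mult_mono[OF A B[OF n]]) (use C0 in auto)
    then show "lm n ^ k * exp (- t * lm n) * norm (c n) \<le> (C * B) * exp (- (t/2) * lm n)" by (simp add: mult_ac)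
  qed (simp add: lm_nonneg)
qed

text \<open>Up to the sign (-1)^k, the k-th time derivative of \<open>Pt t f\<close>.\<close>

definition Tk :: "nat \<Rightarrow> ('a::euclidean_space \<Rightarrow> real) \<Rightarrow> real \<Rightarrow> 'a \<Rightarrow> real" where
  "Tk k f t x = Re (\<Sum>\<^sub>\<infinity>n\<in>lattice. (of_real (lm n ^ k * exp (- t * lm n)) * fc f n) * ec n x)"

lemma fser_Tk:
  assumes "0 < t" "integrable torus_measure f"
  shows "fser (\<lambda>n. of_real (lm n ^ k * exp (- t * lm n)) * fc f n) (Tk k f t)"
  unfolding Tk_def[abs_def]
proof (rule fserI_real)
  show "asum (\<lambda>n. of_real (lm n ^ k * exp (- t * lm n)) * fc f n)"
    using summable_lm_power[OF assms(1) fc_norm_le[OF assms(2)], of k]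
    by (simp add: norm_mult norm_power lm_nonneg abs_mult)
qed (simp add: fc_uminus[OF assms(2)])

lemma Tk_0: "0 < t \<Longrightarrow> integrable torus_measure f \<Longrightarrow> Tk 0 f t = Pt t f"
  using fser_unique[OF fser_Tk[of t f 0] fser_cong[OF fser_Pt]] by (simp add: Pc_def)

lemma Tk_deriv:
  fixes f :: "'a::euclidean_space \<Rightarrow> real"
  assumes t: "0 < t" and f: "integrable torus_measure f"
  shows "DERIV (\<lambda>t. Tk k f t x) t :> - Tk (Suc k) f t x"
proof (rule DERIV_of_quadratic_error)
  \<comment> \<open>Since \<open>\<bar>h\<bar>\<close> is below \<open>t / 2\<close>, half of the
    decay pays for the factor \<open>exp \<bar>h * l\<bar>\<close> in the Taylor remainder,
    uniformly in \<open>h\<close>.\<close>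
  let ?E = "\<lambda>n::'a. lm n ^ (k + 2) * exp (- (t/2) * lm n) * norm (fc f n)"
  have s: "?E summable_on lattice" by (rule summable_lm_power) (use t fc_norm_le[OF f] in auto)
  show "0 < t / 2" using t by simp
  fix h assume h: "\<bar>h\<bar> < t / 2"
  let ?c = "\<lambda>n::'a. of_real (lm n ^ k * exp (- (t + h) * lm n)) * fc f n - of_real (lm n ^ k * exp (- t * lm n)) * fc f n
      - of_real h * (of_real (-1) * (of_real (lm n ^ Suc k * exp (- t * lm n)) * fc f n))"
  have ser: "fser ?c (\<lambda>x. Tk k f (t + h) x - Tk k f t x - h * (-1 * Tk (Suc k) f t x))"
    using h t by (intro fser_diff fser_cmult fser_Tk f) (auto simp: abs_less_iff)
  have "\<bar>Tk k f (t + h) x - Tk k f t x - h * (-1 * Tk (Suc k) f t x)\<bar> \<le> (\<Sum>\<^sub>\<infinity>n\<in>lattice. norm (?c n))"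
    by (rule fser_bound[OF ser])
  also have "\<dots> \<le> (\<Sum>\<^sub>\<infinity>n\<in>lattice. h\<^sup>2 / 2 * ?E n)"
  proof (rule infsum_mono[OF _ summable_on_cmult_right[OF s]])
    show "asum ?c" using ser by (simp add: fser_def)
    fix n :: 'a
    define l where "l = lm n"
    have l: "0 \<le> l" by (simp add: l_def lm_nonneg)
    have "?c n = of_real (l ^ k * exp (- t * l) * (exp (- h * l) - 1 - (- h * l))) * fc f n"
    proof -
      have "exp (- (t + h) * l) = exp (- t * l) * exp (- h * l)" by (simp add: algebra_simps flip: exp_add)
      then show ?thesis unfolding l_def[symmetric] by (simp add: algebra_simps)
    qed
    then have "norm (?c n) = l ^ k * exp (- t * l) * \<bar>exp (- h * l) - 1 - (- h * l)\<bar> * norm (fc f n)"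
      using l by (simp only: norm_mult norm_of_real abs_mult abs_exp_cancel) simp
    also have "\<dots> \<le> l ^ k * exp (- t * l) * ((- h * l)\<^sup>2 / 2 * exp \<bar>- h * l\<bar>) * norm (fc f n)"
      using l by (intro mult_right_mono mult_left_mono exp_quadratic_error) auto
    also have "\<dots> \<le> l ^ k * ((h * l)\<^sup>2 / 2 * exp (- (t/2) * l)) * norm (fc f n)"
    proof -
      have "\<bar>h * l\<bar> \<le> t / 2 * l" unfolding abs_mult using h l by (intro mult_mono) auto
      then have "exp (- t * l) * exp \<bar>h * l\<bar> \<le> exp (- (t/2) * l)" unfolding exp_add[symmetric] by simp
      then have "(h * l)\<^sup>2 / 2 * (exp (- t * l) * exp \<bar>h * l\<bar>) \<le> (h * l)\<^sup>2 / 2 * exp (- (t/2) * l)" by (intro mult_left_mono) auto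
      then have "exp (- t * l) * ((- h * l)\<^sup>2 / 2 * exp \<bar>- h * l\<bar>) \<le> (h * l)\<^sup>2 / 2 * exp (- (t/2) * l)" by (simp add: mult_ac)
      then show ?thesis unfolding mult.assoc[of "l ^ k"] using l by (intro mult_right_mono mult_left_mono) auto
    qed
    also have "\<dots> = h\<^sup>2 / 2 * ?E n" unfolding l_def[symmetric] by (simp add: power_mult_distrib power_add power2_eq_square mult_ac)
    finally show "norm (?c n) \<le> h\<^sup>2 / 2 * ?E n" .
  qed
  also have "\<dots> = h\<^sup>2 / 2 * (\<Sum>\<^sub>\<infinity>n\<in>lattice. ?E n)" by (rule infsum_cmult_right) (use s in auto)
  finally show "\<bar>Tk k f (t + h) x - Tk k f t x - h * (- Tk (Suc k) f t x)\<bar> \<le> (\<Sum>\<^sub>\<infinity>n\<in>lattice. ?E n) / 2 * h\<^sup>2"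
    by (simp add: mult_ac)
qed

text \<open>This is \<open>h^2\<close> times the usual discrete Laplacian; left undivided, it needs
  no exception at \<open>h = 0\<close>.\<close>

definition sdiff :: "real \<Rightarrow> ('a::euclidean_space \<Rightarrow> real) \<Rightarrow> 'a \<Rightarrow> real" where
  "sdiff h F x = (\<Sum>i\<in>Basis. F (x + h *\<^sub>R i) + F (x - h *\<^sub>R i) - 2 * F x)"

text \<open>Since \<open>a \<lambda>\<^sup>2 + b \<lambda> = 4\<pi>\<^sup>2\<bar>n\<bar>\<^sup>2\<close>, the sum \<open>a Tk 2 + b Tk 1\<close> is minus the Laplacian.\<close>

lemma sdiff_Pt:
  fixes f :: "'a::euclidean_space \<Rightarrow> real"
  assumes e: "0 < e" and f: "integrable torus_measure f"
  shows "\<exists>C\<ge>0. \<forall>t\<ge>e. \<forall>h x. sdiff h (Pt t f) x \<ge> - (h\<^sup>2 * (a * Tk 2 f t x + b * Tk 1 f t x)) - C * h ^ 4"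
proof -
  define I where "I = (\<integral>x. \<bar>f x\<bar> \<partial>torus_measure)"
  define d where "d = real DIM('a)"
  \<comment> \<open>A majorant taken at the earliest time \<open>e\<close>, so that the resulting
    \<open>C\<close> serves all later times.\<close>
  let ?E = "\<lambda>n::'a. norm n ^ 4 * norm (complex_of_real (exp (- e * lm n)) * 1)"
  have s: "?E summable_on lattice" by (rule summable_exp_coeff[OF e, where B=1]) simp
  define C where "C = d * (2 * pi) ^ 4 / 12 * I * (\<Sum>\<^sub>\<infinity>n\<in>lattice. ?E n)"
  have I0: "0 \<le> I" by (simp add: I_def)
  have C0: "0 \<le> C" unfolding C_def d_def using I0 by (intro mult_nonneg_nonneg infsum_nonneg) auto
  have main: "sdiff h (Pt t f) x \<ge> - (h\<^sup>2 * (a * Tk 2 f t x + b * Tk 1 f t x)) - C * h ^ 4" if te: "e \<le> t" for t h x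
  proof -
    have t: "0 < t" using te e by simp
    let ?p = "Pc t f" and ?q = "\<lambda>k (n::'a). of_real (lm n ^ k * exp (- t * lm n)) * fc f n"
    let ?c = "\<lambda>n::'a. (\<Sum>i\<in>Basis. ?p n * ec n (h *\<^sub>R i) + ?p n * ec n (- h *\<^sub>R i) - of_real 2 * ?p n)
        + of_real (h\<^sup>2) * (of_real a * ?q 2 n + of_real b * ?q 1 n)"
    note P = fser_Pt[OF t f]
    have "fser ?c (\<lambda>x. (\<Sum>i\<in>Basis. Pt t f (x + h *\<^sub>R i) + Pt t f (x + - h *\<^sub>R i) - 2 * Pt t f x)
        + h\<^sup>2 * (a * Tk 2 f t x + b * Tk 1 f t x))"
      by (intro fser_add fser_sum fser_diff fser_shift fser_cmult P fser_Tk t f) auto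
    then have ser: "fser ?c (\<lambda>x. sdiff h (Pt t f) x + h\<^sup>2 * (a * Tk 2 f t x + b * Tk 1 f t x))"
      by (simp add: sdiff_def)
    have "\<bar>sdiff h (Pt t f) x + h\<^sup>2 * (a * Tk 2 f t x + b * Tk 1 f t x)\<bar> \<le> (\<Sum>\<^sub>\<infinity>n\<in>lattice. norm (?c n))"
      by (rule fser_bound[OF ser])
    also have "\<dots> \<le> (\<Sum>\<^sub>\<infinity>n\<in>lattice. (d * (2 * pi) ^ 4 / 12 * I * h ^ 4) * ?E n)"
    proof (rule infsum_mono[OF _ summable_on_cmult_right[OF s]])
      show "asum ?c" using ser by (simp add: fser_def)
      fix n :: 'a
      define \<theta> where "\<theta> i = 2 * pi * h * (n \<bullet> i)" for i
      have ecs: "ec n (h *\<^sub>R i) + ec n (- h *\<^sub>R i) = of_real (2 * cos (\<theta> i))" for i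
        by (simp add: ec_def \<theta>_def complex_eq_iff inner_commute mult_ac)
      have "(\<Sum>i\<in>Basis. ?p n * ec n (h *\<^sub>R i) + ?p n * ec n (- h *\<^sub>R i) - of_real 2 * ?p n)
          = ?p n * of_real (\<Sum>i\<in>Basis. 2 * cos (\<theta> i) - 2)"
      proof -
        have "?p n * ec n (h *\<^sub>R i) + ?p n * ec n (- h *\<^sub>R i) - of_real 2 * ?p n = ?p n * of_real (2 * cos (\<theta> i) - 2)" for i
          unfolding of_real_diff ecs[symmetric] by (simp add: algebra_simps)
        then show ?thesis by (simp only: of_real_sum sum_distrib_left)
      qed
      moreover have "of_real (h\<^sup>2) * (of_real a * ?q 2 n + of_real b * ?q 1 n) = ?p n * of_real (\<Sum>i\<in>Basis. (\<theta> i)\<^sup>2)"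
      proof -
        \<comment> \<open>The quadratic equation for \<open>lm n\<close> makes the second-order part
          of the cosine expansion cancel against the time derivatives; only the quartic remainder
          survives.\<close>
        have "h\<^sup>2 * (a * (lm n)\<^sup>2 + b * lm n) = (\<Sum>i\<in>Basis. (\<theta> i)\<^sup>2)"
          unfolding lm_quadratic power_mult_distrib power2_norm_eq_sum \<theta>_def by (simp add: sum_distrib_left mult_ac)
        then have "?p n * of_real (\<Sum>i\<in>Basis. (\<theta> i)\<^sup>2) = ?p n * of_real (h\<^sup>2 * (a * (lm n)\<^sup>2 + b * lm n))" by (simp only:)
        also have "\<dots> = of_real (h\<^sup>2) * (of_real a * ?q 2 n + of_real b * ?q 1 n)"
          by (simp add: Pc_def algebra_simps)
        finally show ?thesis ..
      qed
      ultimately have "?c n = ?p n * of_real ((\<Sum>i\<in>Basis. 2 * cos (\<theta> i) - 2) + (\<Sum>i\<in>Basis. (\<theta> i)\<^sup>2))"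
        by (simp only: of_real_add distrib_left)
      also have "(\<Sum>i\<in>Basis. 2 * cos (\<theta> i) - 2) + (\<Sum>i\<in>Basis. (\<theta> i)\<^sup>2) = (\<Sum>i\<in>Basis. 2 * cos (\<theta> i) - 2 + (\<theta> i)\<^sup>2)"
        by (rule sum.distrib[symmetric])
      finally have "norm (?c n) = norm (?p n) * \<bar>\<Sum>i\<in>Basis. 2 * cos (\<theta> i) - 2 + (\<theta> i)\<^sup>2\<bar>"
        by (simp only: norm_mult norm_of_real)
      also have "\<dots> \<le> (exp (- e * lm n) * I) * (d * ((2 * pi * norm n * h) ^ 4 / 12))"
      proof (rule mult_mono)
        have "exp (- t * lm n) * norm (fc f n) \<le> exp (- e * lm n) * I"
          unfolding I_def using te lm_nonneg[of n] by (intro mult_mono fc_norm_le f) (auto simp: mult_right_mono)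
        then show "norm (?p n) \<le> exp (- e * lm n) * I" by (simp add: Pc_def norm_mult)
        have "\<bar>\<Sum>i\<in>Basis. 2 * cos (\<theta> i) - 2 + (\<theta> i)\<^sup>2\<bar> \<le> (\<Sum>i\<in>(Basis::'a set). (2 * pi * norm n * h) ^ 4 / 12)"
        proof (rule order_trans[OF sum_abs sum_mono])
          fix i :: 'a assume "i \<in> Basis"
          then have "\<bar>\<theta> i\<bar> \<le> \<bar>2 * pi * norm n * h\<bar>"
            unfolding \<theta>_def using Basis_le_norm[of i n] by (simp add: abs_mult mult_left_mono mult_ac)
          then have "\<bar>\<theta> i\<bar> ^ 4 \<le> \<bar>2 * pi * norm n * h\<bar> ^ 4" by (intro power_mono) auto
          then have "\<theta> i ^ 4 \<le> (2 * pi * norm n * h) ^ 4" by (simp add: power_even_abs)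
          then show "\<bar>2 * cos (\<theta> i) - 2 + (\<theta> i)\<^sup>2\<bar> \<le> (2 * pi * norm n * h) ^ 4 / 12"
            using cos_quartic_error[of "\<theta> i"] by linarith
        qed
        then show "\<bar>\<Sum>i\<in>Basis. 2 * cos (\<theta> i) - 2 + (\<theta> i)\<^sup>2\<bar> \<le> d * ((2 * pi * norm n * h) ^ 4 / 12)"
          by (simp add: d_def)
      qed (use I0 in auto)
      also have "\<dots> = (d * (2 * pi) ^ 4 / 12 * I * h ^ 4) * ?E n"
        by (simp add: power_mult_distrib mult_ac)
      finally show "norm (?c n) \<le> (d * (2 * pi) ^ 4 / 12 * I * h ^ 4) * ?E n" .
    qed
    also have "\<dots> = (d * (2 * pi) ^ 4 / 12 * I * h ^ 4) * (\<Sum>\<^sub>\<infinity>n\<in>lattice. ?E n)"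
      by (rule infsum_cmult_right) (use s in auto)
    also have "\<dots> = C * h ^ 4" by (simp add: C_def mult_ac)
    finally show ?thesis by (simp add: abs_le_iff)
  qed
  show ?thesis using C0 main by blast
qed

section \<open>Suprema over times bounded away from zero\<close>

definition us :: "real \<Rightarrow> ('a::euclidean_space \<Rightarrow> real) \<Rightarrow> 'a \<Rightarrow> real" where
  "us e f x = (SUP t\<in>{e..}. Pt t f x)"

lemma Pt_bound_ge:
  fixes f :: "'a::euclidean_space \<Rightarrow> real"
  assumes "0 < e" "e \<le> t" "integrable torus_measure f"
  shows "\<bar>Pt t f x\<bar> \<le> Cb TYPE('a) e * (\<integral>y. \<bar>f y\<bar> \<partial>torus_measure)"
  using Pt_bound_L1[of t f x] Cb_antimono[OF assms(1,2), where 'a='a] assms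
    mult_right_mono[of "Cb TYPE('a) t" "Cb TYPE('a) e" "\<integral>y. \<bar>f y\<bar> \<partial>torus_measure"] by auto

lemma us_upper:
  fixes f :: "'a::euclidean_space \<Rightarrow> real"
  assumes "0 < e" "e \<le> t" "integrable torus_measure f"
  shows "Pt t f x \<le> us e f x"
  unfolding us_def
proof (rule cSUP_upper)
  show "bdd_above ((\<lambda>t. Pt t f x) ` {e..})"
    using Pt_bound_ge[OF assms(1) _ assms(3), of _ x] by (intro bdd_aboveI2[where M="Cb TYPE('a) e * (\<integral>y. \<bar>f y\<bar> \<partial>torus_measure)"]) (auto simp: abs_le_iff)
qed (use assms in auto)

lemma us_least: "(\<And>t. e \<le> t \<Longrightarrow> Pt t f x \<le> z) \<Longrightarrow> us e f x \<le> z"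
  unfolding us_def by (rule cSUP_least) auto

lemma us_bound:
  fixes f :: "'a::euclidean_space \<Rightarrow> real"
  assumes "0 < e" "integrable torus_measure f"
  shows "\<bar>us e f x\<bar> \<le> Cb TYPE('a) e * (\<integral>y. \<bar>f y\<bar> \<partial>torus_measure)"
proof -
  have "us e f x \<le> Cb TYPE('a) e * (\<integral>y. \<bar>f y\<bar> \<partial>torus_measure)"
    by (rule us_least) (use Pt_bound_ge[OF assms(1) _ assms(2), of _ x] in \<open>auto simp: abs_le_iff\<close>)
  then show ?thesis using us_upper[OF assms(1) order_refl assms(2), of x] Pt_bound_ge[OF assms(1) order_refl assms(2), of x] by linarith
qed

lemma us_periodic: "0 < e \<Longrightarrow> integrable torus_measure f \<Longrightarrow> periodic_fn (us e f)"
  unfolding periodic_fn_def us_def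
  using periodic_Pt[unfolded periodic_fn_def, rule_format, of _ f] by (intro allI ballI SUP_cong) auto

lemma us_lipschitz:
  assumes "0 < e" "integrable torus_measure f" and L: "\<And>t x. e \<le> t \<Longrightarrow> \<bar>Pt t f (x + v) - Pt t f x\<bar> \<le> L"
  shows "\<bar>us e f (x + v) - us e f x\<bar> \<le> L"
proof -
  have "us e f (x + v) \<le> us e f x + L"
  proof (rule us_least)
    fix t assume t: "e \<le> t"
    show "Pt t f (x + v) \<le> us e f x + L" using L[OF t, of x] us_upper[OF assms(1) t assms(2), of x] by linarith
  qed
  moreover have "us e f x \<le> us e f (x + v) + L"
  proof (rule us_least)
    fix t assume t: "e \<le> t"
    show "Pt t f x \<le> us e f (x + v) + L" using L[OF t, of x] us_upper[OF assms(1) t assms(2), of "x + v"] by linarith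
  qed
  ultimately show ?thesis by linarith
qed

text \<open>For times at least \<open>e\<close> the spatial derivatives are uniformly bounded, and a
  common Lipschitz constant survives the supremum.\<close>

lemma us_continuous:
  fixes f :: "'a::euclidean_space \<Rightarrow> real"
  assumes e: "0 < e" and f: "integrable torus_measure f"
  shows "continuous_on UNIV (us e f)"
proof -
  define L where "L = Cb1 TYPE('a) e * (\<integral>x. \<bar>f x\<bar> \<partial>torus_measure)"
  have bd: "\<bar>Pt t f (x + v) - Pt t f x\<bar> \<le> norm v * L" if "e \<le> t" for t v x
  proof (rule Pt_lipschitz_of_deriv_bound[OF _ f])
    show "0 < t" using that e by simp
    have Cb1m: "Cb1 TYPE('a) t \<le> Cb1 TYPE('a) e"
      unfolding Cb1_def
    proof (rule infsum_mono)
      have s: "(\<lambda>n::'a. 2 * pi * norm n * exp (- r * lm n)) summable_on lattice" if "0 < r" for r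
        using summable_on_cmult_right[OF summable_exp_coeff[OF that, of "\<lambda>_::'a. 1" 1 1], of "2 * pi"]
        by (simp add: mult.assoc)
      show "(\<lambda>n::'a. 2 * pi * norm n * exp (- t * lm n)) summable_on lattice" 
        "(\<lambda>n::'a. 2 * pi * norm n * exp (- e * lm n)) summable_on lattice"
        using s \<open>0 < t\<close> e by auto
      show "2 * pi * norm n * exp (- t * lm n) \<le> 2 * pi * norm n * exp (- e * lm n)" for n :: 'a
        using \<open>e \<le> t\<close> lm_nonneg[of n] by (intro mult_left_mono) (auto simp: mult_right_mono)
    qed
    show "\<bar>dseries v (Pc t f) y\<bar> \<le> norm v * L" for y
    proof -
      have "\<bar>dseries v (Pc t f) y\<bar> \<le> norm v * (Cb1 TYPE('a) t * (\<integral>x. \<bar>f x\<bar> \<partial>torus_measure))"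
        using dseries_bound[OF \<open>0 < t\<close> f, of v y] by (simp add: mult.assoc)
      also have "\<dots> \<le> norm v * L" unfolding L_def using Cb1m by (intro mult_left_mono mult_right_mono) auto
      finally show ?thesis .
    qed
  qed
  have L0: "0 \<le> L" unfolding L_def Cb1_def by (intro mult_nonneg_nonneg infsum_nonneg) auto
  have "\<bar>us e f y - us e f x\<bar> \<le> L * dist y x" for x y
    using us_lipschitz[OF e f, of "y - x" "norm (y - x) * L" x] bd by (simp add: dist_norm mult.commute)
  then have "L-lipschitz_on UNIV (us e f)" using L0 by (intro lipschitz_onI) (auto simp: dist_real_def)
  then show ?thesis by (rule lipschitz_on_continuous_on)
qed

text \<open>Every mode other than the mean decays at rate at least \<open>c0\<close>. One unit of
  time is set aside to keep the series summable, hence the factor \<open>t - 1\<close>.\<close>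

lemma Pt_tendsto_mean:
  fixes f :: "'a::euclidean_space \<Rightarrow> real"
  assumes f: "integrable torus_measure f"
  shows "((\<lambda>t. Pt t f x) \<longlongrightarrow> (\<integral>y. f y \<partial>torus_measure)) at_top"
proof -
  define m where "m = (\<integral>y. f y \<partial>torus_measure)"
  define I where "I = (\<integral>y. \<bar>f y\<bar> \<partial>torus_measure)"
  have bd: "\<bar>Pt t f x - m\<bar> \<le> exp (- (t - 1) * c0) * (Cb TYPE('a) 1 * I)" if t: "1 \<le> t" for t
  proof -
    have t0: "0 < t" using t by simp
    let ?c = "\<lambda>n::'a. Pc t f n - (if n = 0 then of_real m else 0)"
    have ser: "fser ?c (\<lambda>x. Pt t f x - m)" by (intro fser_diff fser_Pt fser_const t0 f)
    have s: "(\<lambda>n::'a. exp (- 1 * lm n)) summable_on lattice" by (rule summable_exp_lm) simp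
    have "\<bar>Pt t f x - m\<bar> \<le> (\<Sum>\<^sub>\<infinity>n\<in>lattice. norm (?c n))" by (rule fser_bound[OF ser])
    also have "\<dots> \<le> (\<Sum>\<^sub>\<infinity>n\<in>(lattice::'a set). (exp (- (t - 1) * c0) * I) * exp (- 1 * lm n))"
    proof (rule infsum_mono[OF _ summable_on_cmult_right[OF s]])
      show "asum ?c" using ser by (simp add: fser_def)
      fix n :: 'a assume n: "n \<in> lattice"
      show "norm (?c n) \<le> (exp (- (t - 1) * c0) * I) * exp (- 1 * lm n)"
      proof (cases "n = 0")
        case True
        then show ?thesis using fc_0[OF f] by (simp add: Pc_def m_def I_def)
      next
        case False
        have "c0 * 1 \<le> c0 * norm n" using lattice_norm_ge_1[OF n False] c0_pos by (intro mult_left_mono) auto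
        then have "c0 \<le> lm n" using lm_ge[OF n] by simp
        then have "(t - 1) * c0 \<le> (t - 1) * lm n" using t by (intro mult_left_mono) auto
        then have "exp (- t * lm n) \<le> exp (- (t - 1) * c0) * exp (- 1 * lm n)"
          unfolding exp_add[symmetric] by (simp add: algebra_simps)
        then have "exp (- t * lm n) * norm (fc f n) \<le> (exp (- (t - 1) * c0) * exp (- 1 * lm n)) * I"
          unfolding I_def by (intro mult_mono fc_norm_le f) auto
        then show ?thesis using False by (simp add: Pc_def norm_mult mult_ac)
      qed
    qed
    also have "\<dots> = (exp (- (t - 1) * c0) * I) * Cb TYPE('a) 1"
      unfolding Cb_def by (rule infsum_cmult_right) (use s in auto)
    finally show ?thesis by (simp add: mult_ac)
  qed
  have lim: "((\<lambda>t. exp (- (t - 1) * c0) * (Cb TYPE('a) 1 * I)) \<longlongrightarrow> 0) at_top"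
    using c0_pos by real_asymp
  show ?thesis unfolding m_def[symmetric]
  proof (rule Lim_transform[OF tendsto_const], rule Lim_null_comparison[OF _ lim])
    show "\<forall>\<^sub>F t in at_top. norm (Pt t f x - m) \<le> exp (- (t - 1) * c0) * (Cb TYPE('a) 1 * I)"
      using eventually_ge_at_top[of 1] by eventually_elim (use bd in simp)
  qed
qed

lemma us_ge_mean:
  assumes "0 < e" "integrable torus_measure f"
  shows "(\<integral>y. f y \<partial>torus_measure) \<le> us e f x"
proof (rule tendsto_upperbound[OF Pt_tendsto_mean[OF assms(2)]])
  show "\<forall>\<^sub>F t in at_top. Pt t f x \<le> us e f x"
    using eventually_ge_at_top[of e] by eventually_elim (use us_upper assms in auto)
qed simp

text \<open>The dichotomy behind the theorem: where the maximal function is detached from \<open>Pt e f\<close>, the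
  supremum is attained at an interior time, where \<open>u\<^sub>t = 0\<close> and \<open>u\<^sub>t\<^sub>t \<le> 0\<close>, so \<open>\<Delta>u \<ge> 0\<close> by the
  equation (or it is the limit at infinite time, the global minimum).\<close>

lemma us_detached:
  fixes f :: "'a::euclidean_space \<Rightarrow> real"
  assumes e: "0 < e" and f: "integrable torus_measure f"
  shows "\<exists>C\<ge>0. \<forall>x. us e f x = Pt e f x \<or> (\<forall>h. - C * h ^ 4 \<le> sdiff h (us e f) x)"
proof -
  obtain C where C: "0 \<le> C"
    "\<And>t h x. e \<le> t \<Longrightarrow> sdiff h (Pt t f) x \<ge> - (h\<^sup>2 * (a * Tk 2 f t x + b * Tk 1 f t x)) - C * h ^ 4"
    using sdiff_Pt[OF e f] by blast
  define m where "m = (\<integral>y. f y \<partial>torus_measure)"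
  have C4: "0 \<le> C * h ^ 4" for h using C(1) by (intro mult_nonneg_nonneg) auto
  have "us e f x = Pt e f x \<or> (\<forall>h. - C * h ^ 4 \<le> sdiff h (us e f) x)" for x
  \<comment> \<open>Only here may the supremum be approached solely at infinite time. As the mean is
    a lower bound for the whole function, \<open>x\<close> is then a minimum point and the second
    differences are nonnegative.\<close>
  proof (cases "us e f x = m")
    case True
    have "0 \<le> sdiff h (us e f) x" for h unfolding sdiff_def
    proof (rule sum_nonneg)
      fix i :: 'a
      show "0 \<le> us e f (x + h *\<^sub>R i) + us e f (x - h *\<^sub>R i) - 2 * us e f x"
        using us_ge_mean[OF e f, of "x + h *\<^sub>R i"] us_ge_mean[OF e f, of "x - h *\<^sub>R i"] True by (simp add: m_def)
    qed
    then show ?thesis using C4 by (smt (verit) mult_minus_left)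
  next
    case False
    then have gt: "m < us e f x" using us_ge_mean[OF e f, of x] by (simp add: m_def)
    \<comment> \<open>A level strictly between the mean and the supremum: from \<open>T0\<close> on
      the solution stays below it, so the supremum is attained on a compact time interval.\<close>
    define z where "z = (m + us e f x) / 2"
    have z: "m < z" "z < us e f x" using gt by (auto simp: z_def)
    have "\<forall>\<^sub>F t in at_top. Pt t f x < z"
      by (rule order_tendstoD(2)[OF Pt_tendsto_mean[OF f]]) (use z in \<open>simp add: m_def\<close>)
    then obtain T0 where T0: "\<And>t. T0 \<le> t \<Longrightarrow> Pt t f x < z" by (auto simp: eventually_at_top_linorder)
    define T where "T = max T0 (e + 1)"
    have d0: "DERIV (\<lambda>t. Pt t f x) t :> - Tk 1 f t x" if "0 < t" for t
    proof (rule has_field_derivative_transform_within[OF _ that])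
      show "DERIV (\<lambda>t. Tk 0 f t x) t :> - Tk 1 f t x" using Tk_deriv[OF that f, of 0 x] by simp
      fix s assume "dist s t < t"
      then have "0 < s" by (simp add: dist_real_def)
      then show "Tk 0 f s x = Pt s f x" by (simp add: Tk_0 f)
    qed simp
    have "continuous_on {e..T} (\<lambda>t. Pt t f x)"
      using DERIV_isCont[OF d0] e by (auto intro!: continuous_at_imp_continuous_on)
    moreover have "{e..T} \<noteq> {}" by (simp add: T_def)
    ultimately obtain t0 where t0: "t0 \<in> {e..T}" "\<And>t. t \<in> {e..T} \<Longrightarrow> Pt t f x \<le> Pt t0 f x"
      using continuous_attains_sup[of "{e..T}" "\<lambda>t. Pt t f x"] by blast
    have "us e f x \<le> max (Pt t0 f x) z"
    proof (rule us_least)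
      fix t assume "e \<le> t"
      then show "Pt t f x \<le> max (Pt t0 f x) z"
      proof (cases "t \<le> T")
        case True then show ?thesis using t0(2)[of t] \<open>e \<le> t\<close> by (auto simp: le_max_iff_disj)
      next
        case False
        then have "T0 \<le> t" by (simp add: T_def)
        from T0[OF this] show ?thesis by (simp add: le_max_iff_disj)
      qed
    qed
    then have us_eq: "us e f x = Pt t0 f x" using z us_upper[OF e _ f, of t0 x] t0(1) by auto
    show ?thesis
    proof (cases "t0 = e")
      case True then show ?thesis using us_eq by simp
    next
      case False
      have t0e: "e < t0" "0 < t0" using False t0(1) e by auto
      have lmax: "Pt t f x \<le> Pt t0 f x" if "e \<le> t" for t using us_upper[OF e that f, of x] us_eq by simp
      \<comment> \<open>Here \<open>Tk 1\<close> is minus the first time derivative and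
        \<open>Tk 2\<close> is the second one.\<close>
      have "Tk 1 f t0 x = 0" "0 \<le> - Tk 2 f t0 x"
      proof -
        have D1: "DERIV (\<lambda>t. - Pt t f x) t :> Tk 1 f t x" if "\<bar>t - t0\<bar> < t0 - e" for t
          using DERIV_minus[OF d0[of t]] that e by (simp add: abs_less_iff)
        have D2: "DERIV (\<lambda>t. Tk 1 f t x) t0 :> - Tk 2 f t0 x"
          using Tk_deriv[OF t0e(2) f, of 1 x] by (simp add: numeral_2_eq_2)
        have mn: "- Pt t0 f x \<le> - Pt t f x" if "\<bar>t - t0\<bar> < t0 - e" for t
          using lmax[of t] that by (simp add: abs_less_iff)
        show "Tk 1 f t0 x = 0" "0 \<le> - Tk 2 f t0 x"
          using local_min_deriv2[of "t0 - e" t0 "\<lambda>t. - Pt t f x" "\<lambda>t. Tk 1 f t x", OF _ D1 D2 mn] t0e by auto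
      qed
      then have "0 \<le> - (h\<^sup>2 * (a * Tk 2 f t0 x + b * Tk 1 f t0 x))" for h
        using a_nonneg by (simp add: mult_nonneg_nonpos mult_nonneg_nonpos2)
      then have low: "- C * h ^ 4 \<le> sdiff h (Pt t0 f) x" for h
        using C(2)[of t0 h x] t0e by (smt (verit) mult_minus_left)
      \<comment> \<open>\<open>Pt t0 f\<close> lies below the supremum and touches it at
        \<open>x\<close>, so its second differences there are the smaller ones.\<close>
      have "sdiff h (Pt t0 f) x \<le> sdiff h (us e f) x" for h
        unfolding sdiff_def us_eq by (intro sum_mono diff_right_mono add_mono us_upper e f) (use t0e in auto)
      then show ?thesis using low order_trans by blast
    qed
  qed
  then show ?thesis using C(1) by blast
qed

end

section \<open>Energy comparison on the detachment set\<close>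

lemma continuous_shift: 
  fixes F :: "'a::real_normed_vector \<Rightarrow> 'b::topological_space"
  assumes "continuous_on UNIV F" shows "continuous_on UNIV (\<lambda>x. F (x + v))" "continuous_on UNIV (\<lambda>x. F (x - v))"
  by (rule continuous_on_compose2[OF assms]; auto intro: continuous_intros)+

text \<open>Summation by parts: translation invariance moves the increment of \<open>w\<close> onto
  the flux. The function \<open>p\<close> will be the identity for the square and a rescaled
  smoothed subgradient for the truncations.\<close>

lemma integral_increment_product:
  fixes F w :: "'a::euclidean_space \<Rightarrow> real"
  assumes F: "continuous_on UNIV F" "periodic_fn F" and w: "continuous_on UNIV w" "periodic_fn w"
    and p: "continuous_on UNIV p"
  shows "(\<integral>x. p (F (x + v) - F x) * (w (x + v) - w x) \<partial>torus_measure)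
    = (\<integral>x. (p (F x - F (x - v)) - p (F (x + v) - F x)) * w x \<partial>torus_measure)"
proof -
  define q where "q x = p (F x - F (x - v)) * w x" for x
  define r where "r x = p (F (x + v) - F x) * w x" for x
  have cp: "continuous_on UNIV (\<lambda>x. p (G x))" if "continuous_on UNIV G" for G :: "'a \<Rightarrow> real"
    by (rule continuous_on_compose2[OF p that]) auto
  have cq: "continuous_on UNIV q" unfolding q_def by (intro continuous_intros cp continuous_shift F w)
  have cr: "continuous_on UNIV r" unfolding r_def by (intro continuous_intros cp continuous_shift F w)
  have pq: "periodic_fn q" unfolding q_def periodic_fn_def
  proof (intro allI ballI)
    fix x k :: 'a assume k: "k \<in> lattice"
    have "F (x + k - v) = F (x - v)" using F(2) k unfolding periodic_fn_def by (metis add_diff_eq diff_add_eq)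
    then show "p (F (x + k) - F (x + k - v)) * w (x + k) = p (F x - F (x - v)) * w x"
      using F(2) w(2) k by (simp add: periodic_fn_def)
  qed
  note iq = continuous_integrable_torus[OF cq] and ir = continuous_integrable_torus[OF cr]
  have "(\<integral>x. p (F (x + v) - F x) * (w (x + v) - w x) \<partial>torus_measure) = (\<integral>x. q (x + v) - r x \<partial>torus_measure)"
    by (rule Bochner_Integration.integral_cong) (auto simp: q_def r_def algebra_simps)
  also have "\<dots> = (\<integral>x. q x \<partial>torus_measure) - (\<integral>x. r x \<partial>torus_measure)"
    using integrable_torus_shift[OF pq iq] ir by (simp add: integral_torus_shift[OF pq iq])
  also have "\<dots> = (\<integral>x. q x - r x \<partial>torus_measure)" using iq ir by simp
  also have "\<dots> = (\<integral>x. (p (F x - F (x - v)) - p (F (x + v) - F x)) * w x \<partial>torus_measure)"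
    by (simp add: q_def r_def left_diff_distrib)
  finally show ?thesis .
qed

lemma norm_nabh_square:
  assumes "0 < h"
  shows "(norm (nabh h F x))\<^sup>2 = (\<Sum>i\<in>Basis. (F (x + h *\<^sub>R i) - F x)\<^sup>2) / h\<^sup>2"
  unfolding power2_norm_eq_sum by (simp add: nabh_inner power_divide sum_divide_distrib)

lemma measure_unit_interval [simp]: "measure (lebesgue_on {0..1::real}) {0..1} = 1"
  using torus_measure_UNIV[where 'a=real] by simp

section \<open>A smoothed positive part\<close>

definition ramp :: "real \<Rightarrow> real \<Rightarrow> real" where
  "ramp \<delta> y = max 0 (min 1 (y / \<delta>))"

text \<open>The supremum of \<open>c * y - \<delta> * c^2 / 2\<close> over \<open>c\<close> in
  [0, 1], attained at \<open>c = ramp \<delta> y\<close>. It is a convex function with slope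
  \<open>ramp \<delta> y\<close>, within \<delta>/2 of the positive part.\<close>

definition softpos :: "real \<Rightarrow> real \<Rightarrow> real" where
  "softpos \<delta> y = ramp \<delta> y * y - \<delta> * (ramp \<delta> y)\<^sup>2 / 2"

lemma softpos_ge:
  assumes \<delta>: "0 < \<delta>" and c: "0 \<le> c" "c \<le> 1"
  shows "c * y - \<delta> * c\<^sup>2 / 2 \<le> softpos \<delta> y"
proof -
  define r where "r = ramp \<delta> y"
  \<comment> \<open>The difference of the two sides factors in this way; the three cases are the
    flat, the quadratic and the linear part of the function.\<close>
  have "0 \<le> (r - c) * (y - \<delta> * (r + c) / 2)"
  proof -
    consider "y \<le> 0" | "0 < y" "y < \<delta>" | "\<delta> \<le> y" by linarith
    then show ?thesis
    proof cases
      case 1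
      have "y / \<delta> \<le> 0" by (rule divide_nonpos_pos[OF 1 \<delta>])
      then have r0: "r = 0" unfolding r_def ramp_def by linarith
      have "0 \<le> \<delta> * c" using \<delta> c by simp
      then have "y - \<delta> * (0 + c) / 2 \<le> 0" unfolding add_0 using 1 by linarith
      then show ?thesis unfolding r0 using c by (intro mult_nonpos_nonpos) auto
    next
      case 2
      then have "r = y / \<delta>" by (auto simp: r_def ramp_def)
      then have "y = \<delta> * r" using \<delta> by simp
      then have eq: "(r - c) * (y - \<delta> * (r + c) / 2) = \<delta> / 2 * (r - c)\<^sup>2"
        by (simp add: power2_eq_square field_simps)
      show ?thesis unfolding eq using \<delta> by simp
    next
      case 3
      then have r: "r = 1" using \<delta> by (simp add: r_def ramp_def)
      have "\<delta> * (1 + c) / 2 \<le> \<delta>" using \<delta> c by simp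
      then show ?thesis using 3 c unfolding r by (intro mult_nonneg_nonneg) auto
    qed
  qed
  then show ?thesis unfolding softpos_def r_def[symmetric] by (simp add: power2_eq_square field_simps)
qed

lemma ramp_range: "0 \<le> ramp \<delta> y" "ramp \<delta> y \<le> 1"
  by (auto simp: ramp_def)

lemma softpos_subgradient: "0 < \<delta> \<Longrightarrow> softpos \<delta> x + ramp \<delta> x * (y - x) \<le> softpos \<delta> y"
  using softpos_ge[of \<delta> "ramp \<delta> x" y] ramp_range[of \<delta> x] by (simp add: softpos_def algebra_simps)

lemma softpos_bounds:
  assumes "0 < \<delta>" shows "max 0 y - \<delta> / 2 \<le> softpos \<delta> y" "softpos \<delta> y \<le> max 0 y"
proof -
  show "max 0 y - \<delta> / 2 \<le> softpos \<delta> y"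
    using softpos_ge[OF assms, of 1 y] softpos_ge[OF assms, of 0 y] assms by auto
  have "ramp \<delta> y * y \<le> max 0 y"
    using ramp_range[of \<delta> y] by (cases "0 \<le> y") (auto simp: mult_left_le_one_le mult_nonneg_nonpos)
  moreover have "0 \<le> \<delta> * (ramp \<delta> y)\<^sup>2 / 2" using assms by simp
  ultimately show "softpos \<delta> y \<le> max 0 y" unfolding softpos_def by linarith
qed

lemma ramp_increment:
  assumes "0 < \<delta>" "x - y \<le> \<kappa>" "0 \<le> \<kappa>" shows "ramp \<delta> x - ramp \<delta> y \<le> \<kappa> / \<delta>"
proof -
  have "x / \<delta> - y / \<delta> \<le> \<kappa> / \<delta>" using assms by (simp add: divide_right_mono flip: diff_divide_distrib)
  moreover have "0 \<le> \<kappa> / \<delta>" using assms by simp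
  ultimately show ?thesis unfolding ramp_def by linarith
qed

lemma continuous_ramp: "0 < \<delta> \<Longrightarrow> continuous_on UNIV f \<Longrightarrow> continuous_on UNIV (\<lambda>x. ramp \<delta> (f x))"
  unfolding ramp_def by (intro continuous_intros) auto

lemma nabh_real: "nabh h F x = (F (x + h) - F x) / h" for F :: "real \<Rightarrow> real"
  by (simp add: nabh_def)

context kernel_params
begin

text \<open>Isolates the input that depends on the dimension: the square satisfies it always, the
  truncations on the circle. The defect \<open>J\<close> may depend on \<open>e\<close> and
  \<open>f\<close> but has to vanish with the mesh size.\<close>

definition energy_comparison :: "('a::euclidean_space \<Rightarrow> real) \<Rightarrow> ('a \<Rightarrow> real) \<Rightarrow> bool" where
  "energy_comparison \<Theta> f \<longleftrightarrow> (\<forall>e>0. \<exists>J. J \<longlonglongrightarrow> 0 \<and> (\<forall>k.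
     (\<integral>x. \<Theta> (nabh (eta k) (us e f) x) \<partial>torus_measure) \<le> (\<integral>x. \<Theta> (nabh (eta k) (Pt e f) x) \<partial>torus_measure) + J k))"

lemma us_facts:
  fixes f :: "'a::euclidean_space \<Rightarrow> real"
  assumes e: "0 < e" and f: "integrable torus_measure f"
  obtains C B where "0 \<le> C" "0 \<le> B" "\<And>x. 0 \<le> us e f x - Pt e f x" "\<And>x. us e f x - Pt e f x \<le> B"
    "\<And>x h. - sdiff h (us e f) x * (us e f x - Pt e f x) \<le> C * h ^ 4 * (us e f x - Pt e f x)"
    "\<And>x h. us e f x - Pt e f x = 0 \<or> - C * h ^ 4 \<le> sdiff h (us e f) x"
proof -
  obtain C where C: "0 \<le> C" "\<And>x. us e f x = Pt e f x \<or> (\<forall>h. - C * h ^ 4 \<le> sdiff h (us e f) x)"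
    using us_detached[OF e f] by blast
  define B where "B = 2 * (Cb TYPE('a) e * (\<integral>y. \<bar>f y\<bar> \<partial>torus_measure))"
  have B0: "0 \<le> B" unfolding B_def using Cb_nonneg by (intro mult_nonneg_nonneg) auto
  have w0: "0 \<le> us e f x - Pt e f x" for x using us_upper[OF e order_refl f, of x] by simp
  have wB: "us e f x - Pt e f x \<le> B" for x
    using us_bound[OF e f, of x] Pt_bound_ge[OF e order_refl f, of x] unfolding B_def by linarith
  have det: "us e f x - Pt e f x = 0 \<or> - C * h ^ 4 \<le> sdiff h (us e f) x" for x h using C(2)[of x] by auto
  have "- sdiff h (us e f) x * (us e f x - Pt e f x) \<le> C * h ^ 4 * (us e f x - Pt e f x)" for x h
    using det[of x h]
  proof
    assume "- C * h ^ 4 \<le> sdiff h (us e f) x"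
    then show ?thesis using w0[of x] by (intro mult_right_mono) auto
  qed simp
  from that[OF C(1) B0 w0 wB this det] show thesis .
qed

text \<open>With \<open>w = A - V\<close>, the squared increments of \<open>V\<close> are those of
  \<open>A\<close>, minus twice the product of the increments of \<open>A\<close> and
  \<open>w\<close>, plus a square. Only the product has to be bounded: summation by parts turns its
  integral into that of \<open>- sdiff h A x * w x\<close>, at most \<open>C * h ^ 4 * B\<close>.
  Division by \<open>h^2\<close> leaves a defect of order \<open>h^2\<close>.\<close>

lemma energy_comparison_square:
  fixes f :: "'a::euclidean_space \<Rightarrow> real"
  assumes f: "integrable torus_measure f"
  shows "energy_comparison (\<lambda>\<xi>. (norm \<xi>)\<^sup>2) f"
  unfolding energy_comparison_def
proof (intro allI impI)
  fix e :: real assume e: "0 < e"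
  define A V w where "A = us e f" and "V = Pt e f" and "w x = us e f x - Pt e f x" for x
  obtain C B where C: "0 \<le> C" and B: "0 \<le> B" and w0: "\<And>x. 0 \<le> w x" and wB: "\<And>x. w x \<le> B"
    and det: "\<And>x h. - sdiff h A x * w x \<le> C * h ^ 4 * w x"
    using us_facts[OF e f] unfolding A_def V_def w_def by metis
  have cA: "continuous_on UNIV A" and pA: "periodic_fn A" and cV: "continuous_on UNIV V" and pV: "periodic_fn V"
    unfolding A_def V_def by (intro us_continuous us_periodic continuous_Pt periodic_Pt e f)+
  have w_eq: "w = (\<lambda>x. A x - V x)" by (simp add: w_def[abs_def] A_def V_def)
  have cw: "continuous_on UNIV w" and pw: "periodic_fn w"
    using cA cV pA pV unfolding w_eq by (auto simp: periodic_fn_def intro: continuous_intros)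
  have "(\<integral>x. (norm (nabh h A x))\<^sup>2 \<partial>torus_measure) \<le> (\<integral>x. (norm (nabh h V x))\<^sup>2 \<partial>torus_measure) + 2 * C * B * h\<^sup>2"
    if h: "0 < h" for h
  proof -
    let ?d = "\<lambda>F i x. F (x + h *\<^sub>R i) - F x"
    have cs: "continuous_on UNIV (sdiff h A)" unfolding sdiff_def[abs_def] by (intro continuous_intros continuous_shift cA)
    have "(\<Sum>i\<in>Basis. \<integral>x. ?d A i x * ?d w i x \<partial>torus_measure)
        = (\<Sum>i\<in>Basis. \<integral>x. ((A x - A (x - h *\<^sub>R i)) - (A (x + h *\<^sub>R i) - A x)) * w x \<partial>torus_measure)"
      by (rule sum.cong[OF refl]) (rule integral_increment_product[OF cA pA cw pw, of "\<lambda>x. x"], auto intro: continuous_intros)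
    also have "\<dots> = (\<integral>x. (\<Sum>i\<in>Basis. ((A x - A (x - h *\<^sub>R i)) - (A (x + h *\<^sub>R i) - A x)) * w x) \<partial>torus_measure)"
      by (rule Bochner_Integration.integral_sum[symmetric]) (intro continuous_integrable_torus continuous_intros continuous_shift cA cw)
    also have "\<dots> = (\<integral>x. - sdiff h A x * w x \<partial>torus_measure)"
    proof (rule Bochner_Integration.integral_cong[OF refl])
      fix x
      show "(\<Sum>i\<in>Basis. ((A x - A (x - h *\<^sub>R i)) - (A (x + h *\<^sub>R i) - A x)) * w x) = - sdiff h A x * w x"
        unfolding sdiff_def sum_negf[symmetric] sum_distrib_right by (rule sum.cong[OF refl]) (simp add: algebra_simps)
    qed
    also have "\<dots> \<le> (\<integral>x. C * h ^ 4 * B \<partial>(torus_measure::'a measure))"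
    proof (rule integral_mono)
      show "- sdiff h A x * w x \<le> C * h ^ 4 * B" for x
        using det[of h x] mult_left_mono[OF wB[of x], of "C * h ^ 4"] C by simp
    qed (intro continuous_integrable_torus continuous_intros cs cw)+
    also have "\<dots> = C * h ^ 4 * B" by simp
    finally have S: "(\<Sum>i\<in>Basis. \<integral>x. ?d A i x * ?d w i x \<partial>torus_measure) \<le> C * h ^ 4 * B" .
    have iV: "integrable torus_measure (\<lambda>x. (norm (nabh h V x))\<^sup>2)" and iA: "integrable torus_measure (\<lambda>x. (norm (nabh h A x))\<^sup>2)"
      unfolding norm_nabh_square[OF h] by (intro continuous_integrable_torus continuous_intros continuous_shift cA cV, simp add: h less_imp_neq[symmetric])+
    have ic: "integrable torus_measure (\<lambda>x. ?d A i x * ?d w i x)" for i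
      by (intro continuous_integrable_torus continuous_intros continuous_shift cA cw)
    have "(\<integral>x. (norm (nabh h A x))\<^sup>2 \<partial>torus_measure)
        \<le> (\<integral>x. (norm (nabh h V x))\<^sup>2 + (2 / h\<^sup>2) * (\<Sum>i\<in>Basis. ?d A i x * ?d w i x) \<partial>torus_measure)"
    proof (rule integral_mono[OF iA])
      show "integrable torus_measure (\<lambda>x. (norm (nabh h V x))\<^sup>2 + (2 / h\<^sup>2) * (\<Sum>i\<in>Basis. ?d A i x * ?d w i x))"
        using iV ic by simp
      fix x
      have "(\<Sum>i\<in>Basis. (?d A i x)\<^sup>2) \<le> (\<Sum>i\<in>Basis. (?d V i x)\<^sup>2 + 2 * (?d A i x * ?d w i x))"
      proof (rule sum_mono)
        fix i :: 'a
        have "?d V i x = ?d A i x - ?d w i x" by (simp add: w_eq)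
        then have "(?d V i x)\<^sup>2 + 2 * (?d A i x * ?d w i x) = (?d A i x)\<^sup>2 + (?d w i x)\<^sup>2"
          by (simp only: power2_eq_square) (simp add: algebra_simps)
        then show "(?d A i x)\<^sup>2 \<le> (?d V i x)\<^sup>2 + 2 * (?d A i x * ?d w i x)" by simp
      qed
      then have "(\<Sum>i\<in>Basis. (?d A i x)\<^sup>2) / h\<^sup>2 \<le> (\<Sum>i\<in>Basis. (?d V i x)\<^sup>2 + 2 * (?d A i x * ?d w i x)) / h\<^sup>2"
        by (intro divide_right_mono) auto
      then show "(norm (nabh h A x))\<^sup>2 \<le> (norm (nabh h V x))\<^sup>2 + (2 / h\<^sup>2) * (\<Sum>i\<in>Basis. ?d A i x * ?d w i x)"
        unfolding norm_nabh_square[OF h] by (simp add: sum.distrib sum_distrib_left[symmetric] add_divide_distrib)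
    qed
    also have "\<dots> = (\<integral>x. (norm (nabh h V x))\<^sup>2 \<partial>torus_measure) + (2 / h\<^sup>2) * (\<Sum>i\<in>Basis. \<integral>x. ?d A i x * ?d w i x \<partial>torus_measure)"
      using iV ic by (simp add: Bochner_Integration.integral_sum)
    also have "\<dots> \<le> (\<integral>x. (norm (nabh h V x))\<^sup>2 \<partial>torus_measure) + (2 / h\<^sup>2) * (C * h ^ 4 * B)"
      by (intro add_left_mono mult_left_mono S) auto
    also have "(2 / h\<^sup>2) * (C * h ^ 4 * B) = 2 * C * B * h\<^sup>2" using h by (simp add: power2_eq_square power4_eq_xxxx)
    finally show ?thesis .
  qed
  moreover have "(\<lambda>k. 2 * C * B * (eta k)\<^sup>2) \<longlonglongrightarrow> 2 * C * B * 0\<^sup>2" by (intro tendsto_intros eta_tendsto)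
  ultimately show "\<exists>J. J \<longlonglongrightarrow> 0 \<and> (\<forall>k. (\<integral>x. (norm (nabh (eta k) (us e f) x))\<^sup>2 \<partial>torus_measure)
      \<le> (\<integral>x. (norm (nabh (eta k) (Pt e f) x))\<^sup>2 \<partial>torus_measure) + J k)"
    unfolding A_def V_def by (intro exI[of _ "\<lambda>k. 2 * C * B * (eta k)\<^sup>2"]) auto
qed

text \<open>The subgradient of a truncation jumps, so it is smoothed at width \<open>h\<close>. This
  costs \<open>h\<close> in the integrand and makes the flux Lipschitz with constant of order
  \<open>1 / h\<close>: a slope difference of at most \<open>C * h ^ 3\<close> becomes a flux
  increment of order \<open>h^2\<close>. The final division by \<open>h\<close> leaves a defect of
  order \<open>h\<close>.\<close>

lemma energy_comparison_trunc:
  fixes f :: "real \<Rightarrow> real"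
  assumes f: "integrable torus_measure f" and M: "0 \<le> M"
  shows "energy_comparison (trunc M) f"
  unfolding energy_comparison_def
proof (intro allI impI)
  fix e :: real assume e: "0 < e"
  define A V w where "A = us e f" and "V = Pt e f" and "w x = us e f x - Pt e f x" for x
  obtain C B where C: "0 \<le> C" and B: "0 \<le> B" and w0: "\<And>x. 0 \<le> w x" and wB: "\<And>x. w x \<le> B"
    and det: "\<And>x h. w x = 0 \<or> - C * h ^ 4 \<le> sdiff h A x"
    using us_facts[OF e f] unfolding A_def V_def w_def by metis
  have cA: "continuous_on UNIV A" and pA: "periodic_fn A" and cV: "continuous_on UNIV V" and pV: "periodic_fn V"
    unfolding A_def V_def by (intro us_continuous us_periodic continuous_Pt periodic_Pt e f)+
  have w_eq: "w = (\<lambda>x. A x - V x)" by (simp add: w_def[abs_def] A_def V_def)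
  have cw: "continuous_on UNIV w" and pw: "periodic_fn w"
    using cA cV pA pV unfolding w_eq by (auto simp: periodic_fn_def intro: continuous_intros)
  have "(\<integral>x. trunc M (nabh h A x) \<partial>torus_measure) \<le> (\<integral>x. trunc M (nabh h V x) \<partial>torus_measure) + (h + 2 * C * B * h)"
    if h: "0 < h" for h
  proof -
    let ?d = "\<lambda>F x. F (x + h) - F x"
    \<comment> \<open>On the line the truncation is a sum of two positive parts; \<Phi> smooths
      both, and \<psi> is the corresponding subgradient.\<close>
    define \<Phi> where "\<Phi> \<xi> = softpos h (\<xi> - M) + softpos h (- \<xi> - M)" for \<xi>
    define \<psi> where "\<psi> \<xi> = ramp h (\<xi> - M) - ramp h (- \<xi> - M)" for \<xi>
    have tr: "trunc M \<xi> = max 0 (\<xi> - M) + max 0 (- \<xi> - M)" for \<xi> :: real using M by (auto simp: trunc_def)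
    have \<Phi>: "trunc M \<xi> - h \<le> \<Phi> \<xi>" "\<Phi> \<xi> \<le> trunc M \<xi>" for \<xi>
      using softpos_bounds[OF h, of "\<xi> - M"] softpos_bounds[OF h, of "- \<xi> - M"] unfolding \<Phi>_def tr by linarith+
    have sub: "\<Phi> \<alpha> + \<psi> \<alpha> * (\<beta> - \<alpha>) \<le> \<Phi> \<beta>" for \<alpha> \<beta>
      using softpos_subgradient[OF h, of "\<alpha> - M" "\<beta> - M"] softpos_subgradient[OF h, of "- \<alpha> - M" "- \<beta> - M"]
      by (simp add: \<Phi>_def \<psi>_def algebra_simps)
    have \<psi>inc: "\<psi> \<alpha> - \<psi> \<beta> \<le> 2 * C * h\<^sup>2" if "\<alpha> - \<beta> \<le> C * h ^ 3" for \<alpha> \<beta>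
    proof -
      have "0 \<le> C * h ^ 3" using C h by simp
      then have "\<psi> \<alpha> - \<psi> \<beta> \<le> C * h ^ 3 / h + C * h ^ 3 / h"
        using ramp_increment[OF h, of "\<alpha> - M" "\<beta> - M" "C * h ^ 3"] ramp_increment[OF h, of "- \<beta> - M" "- \<alpha> - M" "C * h ^ 3"] that
        unfolding \<psi>_def by linarith
      then show ?thesis using h by (simp add: power2_eq_square power3_eq_cube)
    qed
    have c\<psi>: "continuous_on UNIV (\<lambda>y. \<psi> (y / h))" unfolding \<psi>_def
      by (intro continuous_intros continuous_ramp h) (use h in auto)
    have c\<psi>2: "continuous_on UNIV (\<lambda>x. \<psi> (G x / h))" if "continuous_on UNIV G" for G :: "real \<Rightarrow> real"
      by (rule continuous_on_compose2[OF c\<psi> that]) auto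
    have "(\<integral>x. \<psi> (?d A x / h) * ?d w x \<partial>torus_measure)
        = (\<integral>x. (\<psi> ((A x - A (x - h)) / h) - \<psi> (?d A x / h)) * w x \<partial>torus_measure)"
      by (rule integral_increment_product[OF cA pA cw pw c\<psi>])
    also have "\<dots> \<le> (\<integral>x. 2 * C * h\<^sup>2 * B \<partial>(torus_measure::real measure))"
    proof (rule integral_mono)
      fix x
      show "(\<psi> ((A x - A (x - h)) / h) - \<psi> (?d A x / h)) * w x \<le> 2 * C * h\<^sup>2 * B"
        using det[of x h]
      proof
        assume "- C * h ^ 4 \<le> sdiff h A x"
        then have "((A x - A (x - h)) - ?d A x) \<le> C * h ^ 4" by (simp add: sdiff_def)
        then have "((A x - A (x - h)) - ?d A x) / h \<le> C * h ^ 4 / h" using h by (intro divide_right_mono) auto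
        also have "C * h ^ 4 / h = C * h ^ 3" using h by (simp add: power4_eq_xxxx power3_eq_cube)
        finally have "(A x - A (x - h)) / h - ?d A x / h \<le> C * h ^ 3" unfolding diff_divide_distrib .
        from \<psi>inc[OF this] have "(\<psi> ((A x - A (x - h)) / h) - \<psi> (?d A x / h)) * w x \<le> (2 * C * h\<^sup>2) * w x"
          using w0[of x] by (rule mult_right_mono)
        also have "\<dots> \<le> 2 * C * h\<^sup>2 * B" using wB[of x] C by (intro mult_left_mono) auto
        finally show ?thesis .
      qed (use C B in simp)
    qed (intro continuous_integrable_torus continuous_intros c\<psi>2 continuous_shift cA cw)+
    also have "\<dots> = 2 * C * h\<^sup>2 * B" by simp
    finally have S: "(\<integral>x. \<psi> (?d A x / h) * ?d w x \<partial>torus_measure) \<le> 2 * C * h\<^sup>2 * B" .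
    have i\<psi>: "integrable torus_measure (\<lambda>x. \<psi> (?d A x / h) * ?d w x)"
      by (intro continuous_integrable_torus continuous_intros c\<psi>2 continuous_shift cA cw)
    have iT: "integrable torus_measure (\<lambda>x. trunc M (nabh h F x))" if "continuous_on UNIV F" for F :: "real \<Rightarrow> real"
      unfolding nabh_real trunc_def by (intro continuous_integrable_torus continuous_intros continuous_shift that) (use h in auto)
    have "(\<integral>x. trunc M (nabh h A x) \<partial>torus_measure)
        \<le> (\<integral>x. (trunc M (nabh h V x) + h) + (1/h) * (\<psi> (?d A x / h) * ?d w x) \<partial>torus_measure)"
    proof (rule integral_mono[OF iT[OF cA]])
      show "integrable torus_measure (\<lambda>x. (trunc M (nabh h V x) + h) + (1/h) * (\<psi> (?d A x / h) * ?d w x))"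
        using iT[OF cV] i\<psi> by simp
      fix x
      have "?d V x / h - ?d A x / h = - (?d w x / h)" by (simp add: w_eq diff_divide_distrib add_divide_distrib)
      then have "\<Phi> (?d A x / h) - \<psi> (?d A x / h) * (?d w x / h) \<le> \<Phi> (?d V x / h)"
        using sub[of "?d A x / h" "?d V x / h"] by simp
      then show "trunc M (nabh h A x) \<le> (trunc M (nabh h V x) + h) + (1/h) * (\<psi> (?d A x / h) * ?d w x)"
        using \<Phi>(1)[of "?d A x / h"] \<Phi>(2)[of "?d V x / h"] unfolding nabh_real by (simp add: field_simps)
    qed
    also have "\<dots> = (\<integral>x. trunc M (nabh h V x) \<partial>torus_measure) + h + (1/h) * (\<integral>x. \<psi> (?d A x / h) * ?d w x \<partial>torus_measure)"
      using iT[OF cV] i\<psi> by simp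
    also have "\<dots> \<le> (\<integral>x. trunc M (nabh h V x) \<partial>torus_measure) + h + (1/h) * (2 * C * h\<^sup>2 * B)"
      using h by (intro add_left_mono mult_left_mono S) auto
    also have "\<dots> = (\<integral>x. trunc M (nabh h V x) \<partial>torus_measure) + (h + 2 * C * B * h)"
      using h by (simp add: power2_eq_square)
    finally show ?thesis .
  qed
  moreover have "(\<lambda>k. eta k + 2 * C * B * eta k) \<longlonglongrightarrow> 0 + 2 * C * B * 0" by (intro tendsto_intros eta_tendsto)
  ultimately show "\<exists>J. J \<longlonglongrightarrow> 0 \<and> (\<forall>k. (\<integral>x. trunc M (nabh (eta k) (us e f) x) \<partial>torus_measure)
      \<le> (\<integral>x. trunc M (nabh (eta k) (Pt e f) x) \<partial>torus_measure) + J k)"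
    unfolding A_def V_def by (intro exI[of _ "\<lambda>k. eta k + 2 * C * B * eta k"]) auto
qed

lemma grad_us_le:
  fixes f :: "'a::euclidean_space \<Rightarrow> real"
  assumes n: "nice \<Theta>" and ec: "energy_comparison \<Theta> f" and f: "integrable torus_measure f" and e: "0 < e" and t: "0 < t"
  shows "(\<integral>x. \<Theta> (grad t (us e f) x) \<partial>torus_measure) \<le> (\<integral>x. \<Theta> (grad e f x) \<partial>torus_measure)"
proof -
  obtain J where J: "J \<longlonglongrightarrow> 0" "\<And>k. (\<integral>x. \<Theta> (nabh (eta k) (us e f) x) \<partial>torus_measure)
      \<le> (\<integral>x. \<Theta> (nabh (eta k) (Pt e f) x) \<partial>torus_measure) + J k"
    using ec e unfolding energy_comparison_def by blast
  have "(\<lambda>k. (\<integral>x. \<Theta> (nabh (eta k) (Pt e f) x) \<partial>torus_measure) + J k) \<longlonglongrightarrow> (\<integral>x. \<Theta> (grad e f x) \<partial>torus_measure) + 0"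
    by (intro tendsto_add nabh_Pt_tendsto n e f J)
  then show ?thesis
    by (intro grad_Pt_le_of_nabh[OF n t us_periodic[OF e f] continuous_measurable_torus[OF us_continuous[OF e f]]
          us_bound[OF e f] J(2)]) simp
qed

section \<open>The full maximal function\<close>

lemma ustar_Pt: "ustar a b u x = (SUP t\<in>{0<..}. ereal (Pt t (\<lambda>y. \<bar>u y\<bar>) x))"
  by (simp add: ustar_def Pt_def)

text \<open>Real-valued form for integration. Where \<open>ustar\<close> is infinite the conversion
  gives 0, so finiteness is proved or assumed wherever the value matters.\<close>

definition Umax :: "('a::euclidean_space \<Rightarrow> real) \<Rightarrow> 'a \<Rightarrow> real" where
  "Umax u x = real_of_ereal (ustar a b u x)"

context
  fixes u f :: "'a::euclidean_space \<Rightarrow> real"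
  assumes u: "integrable torus_measure u" and f_def: "f = (\<lambda>y. \<bar>u y\<bar>)"
begin

lemma f_integrable: "integrable torus_measure f"
  using u by (simp add: f_def)

text \<open>Replaces an uncountable supremum by an increasing sequence of continuous functions;
  measurability and the limit passages rest on this.\<close>

lemma ustar_us: "ustar a b u x = (SUP k. ereal (us (eta k) f x))"
proof (rule antisym)
  show "ustar a b u x \<le> (SUP k. ereal (us (eta k) f x))" unfolding ustar_Pt f_def[symmetric]
  proof (rule SUP_least)
    fix t :: real assume "t \<in> {0<..}"
    then have "\<forall>\<^sub>F k in sequentially. eta k < t" by (intro order_tendstoD(2)[OF eta_tendsto]) simp
    then obtain k where "eta k < t" by (auto simp: eventually_sequentially)
    then have "Pt t f x \<le> us (eta k) f x" by (intro us_upper f_integrable) auto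
    then show "ereal (Pt t f x) \<le> (SUP k. ereal (us (eta k) f x))" by (intro SUP_upper2[of k]) auto
  qed
  show "(SUP k. ereal (us (eta k) f x)) \<le> ustar a b u x"
  proof (rule SUP_least)
    fix k
    have le: "ereal (Pt t f x) \<le> ustar a b u x" if "0 < t" for t
      unfolding ustar_Pt f_def[symmetric] using that by (intro SUP_upper) simp
    show "ereal (us (eta k) f x) \<le> ustar a b u x"
    proof (cases "ustar a b u x")
      case (real r)
      have "us (eta k) f x \<le> r"
      proof (rule us_least)
        fix t assume "eta k \<le> t"
        then have "0 < t" using eta_pos[of k] by linarith
        from le[OF this] show "Pt t f x \<le> r" using real by simp
      qed
      then show ?thesis using real by simp
    next
      case MInf then show ?thesis using le[of 1] by simp
    qed simp
  qed
qed

lemma us_eta_mono: "k \<le> l \<Longrightarrow> us (eta k) f x \<le> us (eta l) f x"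
proof (rule us_least)
  fix t assume "k \<le> l" "eta k \<le> t"
  moreover have "eta l \<le> eta k" using \<open>k \<le> l\<close> by (simp add: eta_def frac_le)
  ultimately show "Pt t f x \<le> us (eta l) f x" by (intro us_upper f_integrable) auto
qed

lemma Umax_measurable: "Umax u \<in> borel_measurable torus_measure"
proof -
  have "(\<lambda>x. ereal (us (eta k) f x)) \<in> borel_measurable torus_measure" for k
    using continuous_measurable_torus[OF us_continuous[OF eta_pos f_integrable]] by simp
  then have "(\<lambda>x. ustar a b u x) \<in> borel_measurable torus_measure"
    unfolding ustar_us by (intro borel_measurable_SUP) auto
  then show ?thesis unfolding Umax_def[abs_def] by measurable
qed

lemma Umax_periodic: "periodic_fn (Umax u)"
  using us_periodic[OF eta_pos f_integrable] unfolding periodic_fn_def Umax_def ustar_us by simp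

lemma us_le_Umax:
  assumes "ustar a b u x < \<infinity>" shows "us (eta k) f x \<le> Umax u x" "(\<lambda>k. us (eta k) f x) \<longlonglongrightarrow> Umax u x"
proof -
  have ge: "ereal (us (eta k) f x) \<le> ustar a b u x" for k unfolding ustar_us by (rule SUP_upper) simp
  then have fin: "ustar a b u x = ereal (Umax u x)"
    unfolding Umax_def using assms by (cases "ustar a b u x") (use ge[of 0] in auto)
  then show "us (eta k) f x \<le> Umax u x" using ge[of k] by simp
  have "(\<lambda>k. ereal (us (eta k) f x)) \<longlonglongrightarrow> (SUP k. ereal (us (eta k) f x))"
    by (rule LIMSEQ_SUP) (auto simp: incseq_def us_eta_mono)
  then show "(\<lambda>k. us (eta k) f x) \<longlonglongrightarrow> Umax u x" using fin unfolding ustar_us by simp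
qed

lemma ustar_finite:
  assumes "\<And>t. 0 < t \<Longrightarrow> Pt t f x \<le> r"
  shows "ustar a b u x < \<infinity>" "Umax u x \<le> r"
proof -
  have le: "ustar a b u x \<le> ereal r" unfolding ustar_Pt f_def[symmetric] by (rule SUP_least) (use assms in auto)
  then show fin: "ustar a b u x < \<infinity>" by (auto simp: le_less_trans)
  have "ereal (us (eta 0) f x) \<le> ustar a b u x" unfolding ustar_us by (rule SUP_upper) simp
  then show "Umax u x \<le> r" unfolding Umax_def using le by (cases "ustar a b u x") auto
qed

lemma Umax_ge_mean:
  assumes "ustar a b u x < \<infinity>" shows "(\<integral>y. f y \<partial>torus_measure) \<le> Umax u x"
  using us_le_Umax(1)[OF assms, of 0] us_ge_mean[OF eta_pos[of 0] f_integrable, of x] by linarith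

text \<open>The increasing convergence is dominated by \<open>Umax u x - us (eta 0) f x\<close>,
  hence takes place in L1, which is all that \<open>grad_tendsto_L1\<close> asks for.\<close>

lemma grad_Umax_le:
  assumes fin: "AE x in torus_measure. ustar a b u x < \<infinity>" and U: "integrable torus_measure (Umax u)"
    and n: "nice \<Theta>" and ec: "energy_comparison \<Theta> f" and C: "\<And>e. 0 < e \<Longrightarrow> (\<integral>x. \<Theta> (grad e f x) \<partial>torus_measure) \<le> C"
    and t: "0 < t"
  shows "(\<integral>x. \<Theta> (grad t (Umax u) x) \<partial>torus_measure) \<le> C"
proof (rule LIMSEQ_le_const2)
  have ius: "integrable torus_measure (us (eta k) f)" for k
    by (intro continuous_integrable_torus us_continuous eta_pos f_integrable)
  have "(\<lambda>k. \<integral>x. \<bar>us (eta k) f x - Umax u x\<bar> \<partial>torus_measure) \<longlonglongrightarrow> (\<integral>x. 0 \<partial>(torus_measure::'a measure))"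
  proof (rule integral_dominated_convergence[where w="\<lambda>x. Umax u x - us (eta 0) f x"])
    show "AE x in torus_measure. (\<lambda>k. \<bar>us (eta k) f x - Umax u x\<bar>) \<longlonglongrightarrow> 0"
      using fin
    proof eventually_elim
      case (elim x)
      show ?case using LIM_zero[OF us_le_Umax(2)[OF elim]] tendsto_rabs_zero by blast
    qed
    show "AE x in torus_measure. norm \<bar>us (eta k) f x - Umax u x\<bar> \<le> Umax u x - us (eta 0) f x" for k
      using fin
    proof eventually_elim
      case (elim x)
      show ?case using us_le_Umax(1)[OF elim, of k] us_eta_mono[of 0 k x] by simp
    qed
  qed (use U ius Umax_measurable in auto)
  then have "(\<lambda>k. \<integral>x. \<bar>us (eta k) f x - Umax u x\<bar> \<partial>torus_measure) \<longlonglongrightarrow> 0" by simp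
  from grad_tendsto_L1(2)[OF n t U ius this]
  show "(\<lambda>k. \<integral>x. \<Theta> (grad t (us (eta k) f) x) \<partial>torus_measure) \<longlonglongrightarrow> (\<integral>x. \<Theta> (grad t (Umax u) x) \<partial>torus_measure)" .
  show "\<exists>N. \<forall>k\<ge>N. (\<integral>x. \<Theta> (grad t (us (eta k) f) x) \<partial>torus_measure) \<le> C"
    using order_trans[OF grad_us_le[OF n ec f_integrable eta_pos t] C[OF eta_pos]] by blast
qed

end

end

section \<open>Lebesgue norms from truncated integrals\<close>

text \<open>Taylor's formula at 0 with integral remainder: the weight is the second derivative of
  \<open>M powr P\<close>, integrated against the truncation at level \<open>M\<close>.\<close>

lemma nn_integral_powr_layer:
  fixes y P :: real
  assumes y: "0 \<le> y" and P: "1 < P"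
  shows "(\<integral>\<^sup>+M. ennreal (indicator {0..} M * (P * (P - 1) * M powr (P - 2)) * max 0 (y - M)) \<partial>lborel) = ennreal (y powr P)"
proof (rule nn_integral_has_integral_lborel)
  define \<phi> where "\<phi> M = P * (P - 1) * M powr (P - 2) * (y - M)" for M
  \<comment> \<open>An antiderivative of \<phi> on the open interval. For \<open>P < 2\<close> the
    weight is singular at 0, where only continuity of \<open>F\<close> is used.\<close>
  define F where "F M = P * y * M powr (P - 1) - (P - 1) * M powr P" for M
  have "(\<phi> has_integral (F y - F 0)) {0..y}"
  proof (rule fundamental_theorem_of_calculus_interior[OF y])
    show "continuous_on {0..y} F" unfolding F_def
      by (intro continuous_intros continuous_on_powr') (use P in auto)
    fix x assume x: "x \<in> {0<..<y}"
    have d1: "DERIV (\<lambda>M. M powr (P - 1)) x :> (P - 1) * x powr (P - 2)"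
      and d2: "DERIV (\<lambda>M. M powr P) x :> P * x powr (P - 1)"
      using has_real_derivative_powr[of x "P - 1"] has_real_derivative_powr[of x P] x by auto
    have "x powr (P - 1) = x * x powr (P - 2)" using powr_mult_base[of x "P - 2"] x by simp
    then have "P * y * ((P - 1) * x powr (P - 2)) - (P - 1) * (P * x powr (P - 1)) = \<phi> x"
      by (simp add: \<phi>_def algebra_simps)
    then have "DERIV F x :> \<phi> x"
      using DERIV_diff[OF DERIV_cmult[OF d1, of "P * y"] DERIV_cmult[OF d2, of "P - 1"]] unfolding F_def by simp
    then show "(F has_vector_derivative \<phi> x) (at x)" by (simp add: has_real_derivative_iff_has_vector_derivative)
  qed
  also have "F y - F 0 = y powr P"
    using y P by (cases "y = 0") (auto simp: F_def powr_diff field_simps)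
  finally have "((\<lambda>M. if M \<in> {0..y} then \<phi> M else 0) has_integral (y powr P)) UNIV"
    by (subst has_integral_restrict_UNIV)
  also have "(\<lambda>M. if M \<in> {0..y} then \<phi> M else 0) = (\<lambda>M. indicator {0..} M * (P * (P - 1) * M powr (P - 2)) * max 0 (y - M))"
    by (auto simp: \<phi>_def indicator_def fun_eq_iff)
  finally show "((\<lambda>M. indicator {0..} M * (P * (P - 1) * M powr (P - 2)) * max 0 (y - M)) has_integral (y powr P)) UNIV" .
  show "0 \<le> indicator {0..} M * (P * (P - 1) * M powr (P - 2)) * max 0 (y - M)" for M
    using P by (auto simp: indicator_def)
qed measurable

text \<open>By Tonelli the moment of order \<open>P\<close> is a positive superposition of truncated
  integrals, so a comparison at all levels is inherited.\<close>

lemma powr_integral_le: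
  fixes G G0 :: "'a::euclidean_space \<Rightarrow> real"
  assumes G: "integrable torus_measure G" "\<And>x. 0 \<le> G x" and G0: "integrable torus_measure G0" "\<And>x. 0 \<le> G0 x"
    and le: "\<And>M. 0 \<le> M \<Longrightarrow> (\<integral>x. max 0 (G x - M) \<partial>torus_measure) \<le> (\<integral>x. max 0 (G0 x - M) \<partial>torus_measure)"
    and P: "1 < P" and int: "integrable torus_measure (\<lambda>x. G0 x powr P)"
  shows "integrable torus_measure (\<lambda>x. G x powr P)" "(\<integral>x. G x powr P \<partial>torus_measure) \<le> (\<integral>x. G0 x powr P \<partial>torus_measure)"
proof -
  interpret pair: pair_sigma_finite "torus_measure :: 'a measure" "lborel :: real measure"
    by (simp add: pair_sigma_finite_def torus.sigma_finite_measure_axioms lborel.sigma_finite_measure_axioms)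
  define w where "w M = indicator {0..} M * (P * (P - 1) * M powr (P - 2))" for M :: real
  have w0: "0 \<le> w M" for M using P by (auto simp: w_def indicator_def)
  have wm [measurable]: "w \<in> borel_measurable borel" unfolding w_def[abs_def] by measurable
  have layer: "(\<integral>\<^sup>+x. ennreal (H x powr P) \<partial>torus_measure) = (\<integral>\<^sup>+M. ennreal (w M * (\<integral>x. max 0 (H x - M) \<partial>torus_measure)) \<partial>lborel)"
    if H: "integrable torus_measure H" "\<And>x. 0 \<le> H x" for H :: "'a \<Rightarrow> real"
  proof -
    have [measurable]: "H \<in> borel_measurable torus_measure" using H by simp
    have "(\<integral>\<^sup>+x. ennreal (H x powr P) \<partial>torus_measure) = (\<integral>\<^sup>+x. \<integral>\<^sup>+M. ennreal (w M * max 0 (H x - M)) \<partial>lborel \<partial>torus_measure)"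
      unfolding w_def by (simp add: nn_integral_powr_layer[OF H(2) P])
    also have "\<dots> = (\<integral>\<^sup>+M. \<integral>\<^sup>+x. ennreal (w M * max 0 (H x - M)) \<partial>torus_measure \<partial>lborel)"
      by (rule pair.Fubini'[symmetric]) measurable
    also have "\<dots> = (\<integral>\<^sup>+M. ennreal (w M * (\<integral>x. max 0 (H x - M) \<partial>torus_measure)) \<partial>lborel)"
    proof (rule nn_integral_cong)
      fix M
      have "integrable torus_measure (\<lambda>x. max 0 (H x - M))" using H(1) by (intro integrable_max) auto
      then show "(\<integral>\<^sup>+x. ennreal (w M * max 0 (H x - M)) \<partial>torus_measure) = ennreal (w M * (\<integral>x. max 0 (H x - M) \<partial>torus_measure))"
        using w0[of M] by (subst nn_integral_eq_integral) auto
    qed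
    finally show ?thesis .
  qed
  have "(\<integral>\<^sup>+x. ennreal (G x powr P) \<partial>torus_measure) \<le> (\<integral>\<^sup>+x. ennreal (G0 x powr P) \<partial>torus_measure)"
    unfolding layer[OF G] layer[OF G0]
  proof (rule nn_integral_mono, rule ennreal_leI)
    fix M :: real
    show "w M * (\<integral>x. max 0 (G x - M) \<partial>torus_measure) \<le> w M * (\<integral>x. max 0 (G0 x - M) \<partial>torus_measure)"
    proof (cases "0 \<le> M")
      case True then show ?thesis by (intro mult_left_mono le w0)
    qed (simp add: w_def)
  qed
  also have "\<dots> = ennreal (\<integral>x. G0 x powr P \<partial>torus_measure)" by (rule nn_integral_eq_integral[OF int]) simp
  finally have *: "(\<integral>\<^sup>+x. ennreal (G x powr P) \<partial>torus_measure) \<le> ennreal (\<integral>x. G0 x powr P \<partial>torus_measure)" .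
  have [measurable]: "G \<in> borel_measurable torus_measure" using G by simp
  show i: "integrable torus_measure (\<lambda>x. G x powr P)"
    by (rule integrableI_nonneg) (use * in \<open>auto intro: le_less_trans simp: ennreal_less_top\<close>)
  show "(\<integral>x. G x powr P \<partial>torus_measure) \<le> (\<integral>x. G0 x powr P \<partial>torus_measure)"
    using * nn_integral_eq_integral[OF i] by (simp add: ennreal_le_iff)
qed

section \<open>Essential suprema and comparison of norms\<close>

lemma esssup_abs_le_iff:
  fixes f :: "'a::euclidean_space \<Rightarrow> real"
  assumes f: "f \<in> borel_measurable torus_measure"
  shows "esssup torus_measure (\<lambda>x. ereal \<bar>f x\<bar>) \<le> ereal L \<longleftrightarrow> (AE x in torus_measure. \<bar>f x\<bar> \<le> L)"
proof
  assume le: "esssup torus_measure (\<lambda>x. ereal \<bar>f x\<bar>) \<le> ereal L"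
  show "AE x in torus_measure. \<bar>f x\<bar> \<le> L"
    using esssup_AE[of "\<lambda>x. ereal \<bar>f x\<bar>" torus_measure]
  proof eventually_elim
    case (elim x) then show ?case using order_trans[OF elim le] by simp
  qed
next
  assume "AE x in torus_measure. \<bar>f x\<bar> \<le> L"
  then show "esssup torus_measure (\<lambda>x. ereal \<bar>f x\<bar>) \<le> ereal L"
    using f by (intro esssup_I) auto
qed

lemma esssup_abs_nonneg:
  fixes f :: "'a::euclidean_space \<Rightarrow> real"
  assumes f: "f \<in> borel_measurable torus_measure"
  shows "0 \<le> esssup torus_measure (\<lambda>x. ereal \<bar>f x\<bar>)"
proof -
  have "esssup (torus_measure :: 'a measure) (\<lambda>x. 0 :: ereal) = 0"
    using torus.emeasure_space_1[where 'a='a] by (intro esssup_const) simp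
  moreover have "esssup (torus_measure :: 'a measure) (\<lambda>x. 0 :: ereal) \<le> esssup torus_measure (\<lambda>x. ereal \<bar>f x\<bar>)"
    by (rule esssup_mono) auto
  ultimately show ?thesis by simp
qed

lemma Lp_mem_infinity_iff:
  fixes f :: "'a::euclidean_space \<Rightarrow> real"
  shows "Lp_mem \<infinity> f \<longleftrightarrow> f \<in> borel_measurable torus_measure \<and> (\<exists>L\<ge>0. AE x in torus_measure. \<bar>f x\<bar> \<le> L)"
proof (cases "f \<in> borel_measurable torus_measure")
  case True
  have "esssup torus_measure (\<lambda>x. ereal \<bar>f x\<bar>) < \<infinity> \<longleftrightarrow> (\<exists>L\<ge>0. AE x in torus_measure. \<bar>f x\<bar> \<le> L)"
  proof
    assume "esssup torus_measure (\<lambda>x. ereal \<bar>f x\<bar>) < \<infinity>"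
    then obtain L where L: "esssup torus_measure (\<lambda>x. ereal \<bar>f x\<bar>) = ereal L"
      using esssup_abs_nonneg[OF True] by (cases "esssup torus_measure (\<lambda>x. ereal \<bar>f x\<bar>)") auto
    then show "\<exists>L\<ge>0. AE x in torus_measure. \<bar>f x\<bar> \<le> L"
      using esssup_abs_le_iff[OF True, of L] esssup_abs_nonneg[OF True] by auto
  next
    assume "\<exists>L\<ge>0. AE x in torus_measure. \<bar>f x\<bar> \<le> L"
    then show "esssup torus_measure (\<lambda>x. ereal \<bar>f x\<bar>) < \<infinity>"
      using esssup_abs_le_iff[OF True] by (metis ereal_less(3) infinity_ereal_def le_less_trans less_ereal.simps(4))
  qed
  then show ?thesis using True by (simp add: Lp_mem_def)
qed (simp add: Lp_mem_def)

lemma Lp_norm_infinity_mono: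
  fixes f g :: "'a::euclidean_space \<Rightarrow> real"
  assumes f: "f \<in> borel_measurable torus_measure" and g: "Lp_mem \<infinity> g"
    and le: "\<And>L. 0 \<le> L \<Longrightarrow> AE x in torus_measure. \<bar>g x\<bar> \<le> L \<Longrightarrow> AE x in torus_measure. \<bar>f x\<bar> \<le> L"
  shows "Lp_norm \<infinity> f \<le> Lp_norm \<infinity> g"
proof -
  have gm: "g \<in> borel_measurable torus_measure" and fin: "esssup torus_measure (\<lambda>x. ereal \<bar>g x\<bar>) < \<infinity>"
    using g by (auto simp: Lp_mem_def)
  obtain L where L: "esssup torus_measure (\<lambda>x. ereal \<bar>g x\<bar>) = ereal L"
    using esssup_abs_nonneg[OF gm] fin by (cases "esssup torus_measure (\<lambda>x. ereal \<bar>g x\<bar>)") auto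
  have "0 \<le> L" using esssup_abs_nonneg[OF gm] L by simp
  moreover have "AE x in torus_measure. \<bar>g x\<bar> \<le> L" using esssup_abs_le_iff[OF gm, of L] L by simp
  ultimately have "esssup torus_measure (\<lambda>x. ereal \<bar>f x\<bar>) \<le> ereal L" unfolding esssup_abs_le_iff[OF f] by (rule le)
  then show ?thesis using esssup_abs_nonneg[OF f] L
    by (cases "esssup torus_measure (\<lambda>x. ereal \<bar>f x\<bar>)") (auto simp: Lp_norm_def)
qed

lemma Lp_mem_bounded:
  fixes f :: "'a::euclidean_space \<Rightarrow> real"
  assumes f: "f \<in> borel_measurable torus_measure" and B: "\<And>x. \<bar>f x\<bar> \<le> B"
  shows "Lp_mem p f"
proof (cases "p = \<infinity>")
  case True
  have "0 \<le> B" using B[of 0] by linarith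
  then show ?thesis unfolding True Lp_mem_infinity_iff using f B by auto
next
  case False
  have "integrable torus_measure (\<lambda>x. \<bar>f x\<bar> powr enn2real p)"
    by (rule bounded_integrable_torus[where B="B powr enn2real p"]) (use f B in \<open>auto intro: powr_mono2\<close>)
  then show ?thesis using False f by (simp add: Lp_mem_def)
qed

lemma Lp_norm_cong_AE:
  fixes f g :: "'a::euclidean_space \<Rightarrow> real"
  assumes "f \<in> borel_measurable torus_measure" "g \<in> borel_measurable torus_measure" "AE x in torus_measure. f x = g x"
  shows "Lp_norm p f = Lp_norm p g"
proof -
  have "esssup torus_measure (\<lambda>x. ereal \<bar>f x\<bar>) = esssup torus_measure (\<lambda>x. ereal \<bar>g x\<bar>)"
    by (rule esssup_AE_cong) (use assms in auto)
  moreover have "(\<integral>x. \<bar>f x\<bar> powr enn2real p \<partial>torus_measure) = (\<integral>x. \<bar>g x\<bar> powr enn2real p \<partial>torus_measure)"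
    by (rule integral_cong_AE) (use assms in auto)
  ultimately show ?thesis by (simp add: Lp_norm_def)
qed

lemma trunc_integral_zero_iff:
  fixes g :: "'a::euclidean_space \<Rightarrow> 'a"
  assumes "integrable torus_measure (\<lambda>x. trunc L (g x))"
  shows "(\<integral>x. trunc L (g x) \<partial>torus_measure) \<le> 0 \<longleftrightarrow> (AE x in torus_measure. norm (g x) \<le> L)"
proof -
  have nn: "0 \<le> (\<integral>x. trunc L (g x) \<partial>torus_measure)" by (rule integral_nonneg_AE) (simp add: trunc_def)
  have "(\<integral>x. trunc L (g x) \<partial>torus_measure) = 0 \<longleftrightarrow> (AE x in torus_measure. trunc L (g x) = 0)"
    by (rule integral_nonneg_eq_0_iff_AE[OF assms]) (simp add: trunc_def)
  also have "\<dots> \<longleftrightarrow> (AE x in torus_measure. norm (g x) \<le> L)" by (rule AE_cong) (auto simp: trunc_def max_def)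
  finally show ?thesis using nn by linarith
qed

text \<open>The truncated integrals control every norm: level 0 gives \<open>p = 1\<close>, the
  layer formula gives finite \<open>p > 1\<close>, and a bound \<open>L\<close> holds almost
  everywhere exactly when the truncation at \<open>L\<close> has integral 0.\<close>

lemma Lp_of_trunc:
  fixes g g0 :: "'a::euclidean_space \<Rightarrow> 'a"
  assumes g: "integrable torus_measure (\<lambda>x. norm (g x))" and g0: "integrable torus_measure (\<lambda>x. norm (g0 x))"
    and gm: "g \<in> borel_measurable torus_measure" "g0 \<in> borel_measurable torus_measure"
    and le: "\<And>M. 0 \<le> M \<Longrightarrow> (\<integral>x. trunc M (g x) \<partial>torus_measure) \<le> (\<integral>x. trunc M (g0 x) \<partial>torus_measure)"
    and p: "1 \<le> p" and mem: "Lp_mem p (\<lambda>x. norm (g0 x))"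
  shows "Lp_mem p (\<lambda>x. norm (g x))" "Lp_norm p (\<lambda>x. norm (g x)) \<le> Lp_norm p (\<lambda>x. norm (g0 x))"
proof -
  have nm: "(\<lambda>x. norm (g x)) \<in> borel_measurable torus_measure" using gm by simp
  have it: "integrable torus_measure (\<lambda>x. trunc M (h x))" if "integrable torus_measure (\<lambda>x. norm (h x))" for h :: "'a \<Rightarrow> 'a" and M
    unfolding trunc_def using that by (intro integrable_max) auto
  consider "p = \<infinity>" | "p = 1" | "p \<noteq> \<infinity>" "1 < enn2real p"
  proof -
    assume a: "p = \<infinity> \<Longrightarrow> thesis" "p = 1 \<Longrightarrow> thesis" "p \<noteq> \<infinity> \<Longrightarrow> 1 < enn2real p \<Longrightarrow> thesis"
    show thesis
    proof (cases "p = \<infinity> \<or> p = 1")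
      case False
      then obtain r where r: "p = ennreal r" "0 \<le> r" by (cases p) auto
      then have "1 < r" using p False by (auto simp: ennreal_1[symmetric] simp del: ennreal_1)
      then show thesis using a(3) r False by simp
    qed (use a in auto)
  qed
  then have "Lp_mem p (\<lambda>x. norm (g x)) \<and> Lp_norm p (\<lambda>x. norm (g x)) \<le> Lp_norm p (\<lambda>x. norm (g0 x))"
  proof cases
    case 1
    have tr: "AE x in torus_measure. \<bar>norm (g x)\<bar> \<le> L" if L: "0 \<le> L" "AE x in torus_measure. \<bar>norm (g0 x)\<bar> \<le> L" for L
    proof -
      have "(\<integral>x. trunc L (g0 x) \<partial>torus_measure) \<le> 0" using L trunc_integral_zero_iff[OF it[OF g0]] by simp
      then have "(\<integral>x. trunc L (g x) \<partial>torus_measure) \<le> 0" using le[OF L(1)] by linarith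
      then show ?thesis using trunc_integral_zero_iff[OF it[OF g]] by simp
    qed
    have mem': "Lp_mem \<infinity> (\<lambda>x. norm (g0 x))" using mem 1 by simp
    obtain L where "0 \<le> L" "AE x in torus_measure. \<bar>norm (g0 x)\<bar> \<le> L" using mem' unfolding Lp_mem_infinity_iff by blast
    then have "Lp_mem \<infinity> (\<lambda>x. norm (g x))" unfolding Lp_mem_infinity_iff using tr nm by blast
    then show ?thesis unfolding 1 using Lp_norm_infinity_mono[OF nm mem' tr] by blast
  next
    case 2
    have "(\<integral>x. norm (g x) \<partial>torus_measure) \<le> (\<integral>x. norm (g0 x) \<partial>torus_measure)" using le[of 0] by (simp add: trunc_def)
    then show ?thesis unfolding 2 using nm g by (simp add: Lp_mem_def Lp_norm_def)
  next
    case 3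
    have int: "integrable torus_measure (\<lambda>x. norm (g0 x) powr enn2real p)" using mem 3 by (simp add: Lp_mem_def)
    have *: "integrable torus_measure (\<lambda>x. norm (g x) powr enn2real p)"
      "(\<integral>x. norm (g x) powr enn2real p \<partial>torus_measure) \<le> (\<integral>x. norm (g0 x) powr enn2real p \<partial>torus_measure)"
      by (rule powr_integral_le[OF g _ g0 _ _ 3(2) int]; use le in \<open>simp add: trunc_def\<close>)+
    have "0 \<le> (\<integral>x. norm (g x) powr enn2real p \<partial>torus_measure)" by (rule integral_nonneg_AE) simp
    then show ?thesis using 3 nm * by (simp add: Lp_mem_def Lp_norm_def powr_mono2)
  qed
  then show "Lp_mem p (\<lambda>x. norm (g x))" "Lp_norm p (\<lambda>x. norm (g x)) \<le> Lp_norm p (\<lambda>x. norm (g0 x))" by auto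
qed

lemma weak_grad_norm_integrable:
  fixes u :: "'a::euclidean_space \<Rightarrow> real"
  assumes "weak_grad u g" "g \<in> borel_measurable torus_measure"
  shows "integrable torus_measure (\<lambda>x. norm (g x))"
proof (rule Bochner_Integration.integrable_bound[where f="\<lambda>x. \<Sum>i\<in>Basis. \<bar>g x \<bullet> i\<bar>"])
  show "integrable torus_measure (\<lambda>x. \<Sum>i\<in>Basis. \<bar>g x \<bullet> i\<bar>)"
    using assms(1) by (intro Bochner_Integration.integrable_sum) (auto simp: weak_grad_def)
  show "AE x in torus_measure. norm (norm (g x)) \<le> norm (\<Sum>i\<in>Basis. \<bar>g x \<bullet> i\<bar>)"
    using norm_le_l1 by (intro AE_I2) (simp add: sum_nonneg abs_of_nonneg)
qed (use assms(2) in simp)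

section \<open>One dimension\<close>

lemma lattice_real_iff: "(k::real) \<in> lattice \<longleftrightarrow> k \<in> \<int>"
  by (simp add: lattice_def)

context kernel_params
begin

lemma grad_real: "grad t f x = dseries 1 (Pc t f) x" for f :: "real \<Rightarrow> real"
  by (simp add: grad_def)

text \<open>Each increment is an integral of the derivative, and the arcs of the partition fill one
  period.\<close>

lemma Pt_variation:
  fixes f :: "real \<Rightarrow> real"
  assumes t: "0 < t" and f: "integrable torus_measure f"
    and x: "\<And>i. i < n \<Longrightarrow> x i < x (Suc i)" "x n = x 0 + 1"
  shows "(\<Sum>i<n. \<bar>Pt t f (x (Suc i)) - Pt t f (x i)\<bar>) \<le> (\<integral>y. trunc 0 (grad t f y) \<partial>torus_measure)"
proof -
  define D where "D = dseries 1 (Pc t f)"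
  have cD: "continuous_on S D" for S using continuous_dseries[OF t f, of 1] unfolding D_def by (rule continuous_on_subset) simp
  have cA: "continuous_on S (\<lambda>y. \<bar>D y\<bar>)" for S by (intro continuous_intros cD)
  have pA: "periodic_fn (\<lambda>y. \<bar>D y\<bar>)" unfolding D_def
    using fser_periodic[OF fser_dseries[OF t f]] by (rule periodic_fn_compose)
  have iA: "integrable torus_measure (\<lambda>y. \<bar>D y\<bar>)" by (rule continuous_integrable_torus[OF cA])
  have DF: "(Pt t f has_vector_derivative D y) (at y within S)" for y S
    using Pt_has_derivative[OF t f, of 0 1 y]
    by (simp add: D_def has_real_derivative_iff_has_vector_derivative has_vector_derivative_at_within)
  have step: "\<bar>Pt t f q - Pt t f p\<bar> \<le> integral {p..q} (\<lambda>y. \<bar>D y\<bar>)" if "p \<le> q" for p q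
  proof -
    have I: "(D has_integral (Pt t f q - Pt t f p)) {p..q}"
      by (rule fundamental_theorem_of_calculus[OF that]) (rule DF)
    have "norm (integral {p..q} D) \<le> integral {p..q} (\<lambda>y. \<bar>D y\<bar>)"
      by (rule integral_norm_bound_integral) (auto intro: integrable_continuous_real cD cA)
    then show ?thesis using integral_unique[OF I] by simp
  qed
  have "x 0 \<le> x k \<and> (\<Sum>i<k. integral {x i..x (Suc i)} (\<lambda>y. \<bar>D y\<bar>)) = integral {x 0..x k} (\<lambda>y. \<bar>D y\<bar>)" if "k \<le> n" for k
    using that
  proof (induction k)
    case (Suc k)
    then have IH: "x 0 \<le> x k" "(\<Sum>i<k. integral {x i..x (Suc i)} (\<lambda>y. \<bar>D y\<bar>)) = integral {x 0..x k} (\<lambda>y. \<bar>D y\<bar>)"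
      and lt: "x k < x (Suc k)" using x(1)[of k] by auto
    have "integral {x 0..x k} (\<lambda>y. \<bar>D y\<bar>) + integral {x k..x (Suc k)} (\<lambda>y. \<bar>D y\<bar>) = integral {x 0..x (Suc k)} (\<lambda>y. \<bar>D y\<bar>)"
      by (rule Henstock_Kurzweil_Integration.integral_combine) (use IH lt in \<open>auto intro: integrable_continuous_real cA\<close>)
    then show ?case using IH lt by simp
  qed simp
  from this[of n] have sum_eq: "(\<Sum>i<n. integral {x i..x (Suc i)} (\<lambda>y. \<bar>D y\<bar>)) = integral {x 0..x 0 + 1} (\<lambda>y. \<bar>D y\<bar>)"
    using x(2) by simp
  have "((\<lambda>y. \<bar>D (y + x 0)\<bar>) has_integral (\<integral>y. \<bar>D (y + x 0)\<bar> \<partial>torus_measure)) (cbox 0 One)"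
    by (rule has_integral_integral_lebesgue_on[OF integrable_torus_shift[OF pA iA]]) simp
  then have "((\<lambda>y. \<bar>D (y + x 0)\<bar>) has_integral (\<integral>y. \<bar>D y\<bar> \<partial>torus_measure)) {0..1}"
    unfolding integral_torus_shift[OF pA iA] by simp
  then have "((\<lambda>y. \<bar>D y\<bar>) has_integral (\<integral>y. \<bar>D y\<bar> \<partial>torus_measure)) {0 + x 0..1 + x 0}"
    unfolding has_integral_shift_Icc_real[symmetric] by (simp add: o_def add.commute)
  then have "integral {x 0..x 0 + 1} (\<lambda>y. \<bar>D y\<bar>) = (\<integral>y. \<bar>D y\<bar> \<partial>torus_measure)"
    by (simp add: integral_unique add.commute)
  moreover have "(\<Sum>i<n. \<bar>Pt t f (x (Suc i)) - Pt t f (x i)\<bar>) \<le> (\<Sum>i<n. integral {x i..x (Suc i)} (\<lambda>y. \<bar>D y\<bar>))"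
    by (intro sum_mono step) (use x(1) in \<open>auto intro: less_imp_le\<close>)
  ultimately show ?thesis using sum_eq by (simp add: trunc_def grad_real D_def)
qed

text \<open>Two points cut the circle into two arcs, so the variation bounds the difference of the
  values; averaging over the second point compares with the mean.\<close>

lemma Pt_oscillation:
  fixes f :: "real \<Rightarrow> real"
  assumes t: "0 < t" and f: "integrable torus_measure f"
  shows "\<bar>Pt t f x - (\<integral>y. f y \<partial>torus_measure)\<bar> \<le> (\<integral>y. trunc 0 (grad t f y) \<partial>torus_measure)"
proof -
  let ?A = "\<integral>y. trunc 0 (grad t f y) \<partial>torus_measure"
  have A0: "0 \<le> ?A" by (rule integral_nonneg_AE) (simp add: trunc_def)
  have osc: "\<bar>Pt t f x - Pt t f y\<bar> \<le> ?A" for y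
  proof -
    \<comment> \<open>The representative of \<open>y\<close> in \<open>[x, x + 1)\<close>, so that
      it fits into a partition starting at \<open>x\<close>.\<close>
    define y' where "y' = y - of_int \<lfloor>y - x\<rfloor>"
    have "Pt t f (y' + of_int \<lfloor>y - x\<rfloor>) = Pt t f y'"
      by (rule periodic_Pt[OF t f, unfolded periodic_fn_def, rule_format]) (simp add: lattice_real_iff)
    then have y': "Pt t f y = Pt t f y'" by (simp add: y'_def)
    have "x \<le> y'" "y' < x + 1" unfolding y'_def by linarith+
    show ?thesis
    proof (cases "x = y'")
      case False
      define z where "z i = (if i = 0 then x else if i = 1 then y' else x + 1)" for i :: nat
      have "(\<Sum>i<2. \<bar>Pt t f (z (Suc i)) - Pt t f (z i)\<bar>) \<le> ?A"
      proof (rule Pt_variation[OF t f])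
        show "z i < z (Suc i)" if "i < 2" for i
        proof -
          have "i = 0 \<or> i = 1" using that by linarith
          then show ?thesis
          proof
            assume "i = 0"
            then show ?thesis using False \<open>x \<le> y'\<close> by (simp add: z_def)
          next
            assume "i = 1"
            then show ?thesis using \<open>y' < x + 1\<close> by (simp add: z_def)
          qed
        qed
      qed (simp add: z_def)
      then have "\<bar>Pt t f y' - Pt t f x\<bar> + \<bar>Pt t f (x + 1) - Pt t f y'\<bar> \<le> ?A"
        by (simp add: z_def numeral_2_eq_2)
      then show ?thesis using y' by linarith
    qed (use y' A0 in simp)
  qed
  have iP: "integrable torus_measure (Pt t f)" by (rule integrable_Pt[OF t f])
  have c: "(\<integral>y. r \<partial>(torus_measure :: real measure)) = r" for r :: real by simp
  have e: "Pt t f x - (\<integral>y. f y \<partial>torus_measure) = (\<integral>y. Pt t f x - Pt t f y \<partial>torus_measure)"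
    using iP integral_Pt[OF t f] by (simp add: Bochner_Integration.integral_diff)
  have "norm (\<integral>y. Pt t f x - Pt t f y \<partial>torus_measure) \<le> (\<integral>y. ?A \<partial>(torus_measure :: real measure))"
  proof (rule norm_integral_le)
    show "integrable torus_measure (\<lambda>y. Pt t f x - Pt t f y)" using iP by (intro Bochner_Integration.integrable_diff) simp_all
    show "integrable (torus_measure :: real measure) (\<lambda>y. ?A)" by simp
    show "\<And>y. norm (Pt t f x - Pt t f y) \<le> ?A" unfolding real_norm_def by (rule osc)
  qed
  then show ?thesis unfolding c real_norm_def e .
qed

lemma Umax_bounded_real:
  fixes u :: "real \<Rightarrow> real"
  assumes u: "integrable torus_measure u"
    and K: "\<And>t. 0 < t \<Longrightarrow> (\<integral>y. trunc 0 (grad t (\<lambda>y. \<bar>u y\<bar>) y) \<partial>torus_measure) \<le> K"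
  shows "ustar a b u x < \<infinity>" "\<bar>Umax u x\<bar> \<le> (\<integral>y. \<bar>u y\<bar> \<partial>torus_measure) + K" "integrable torus_measure (Umax u)"
proof -
  let ?m = "\<integral>y. \<bar>u y\<bar> \<partial>torus_measure"
  have i: "integrable torus_measure (\<lambda>y. \<bar>u y\<bar>)" using u by simp
  have K0: "0 \<le> K" by (rule order_trans[OF _ K[of 1]]) (auto simp: trunc_def intro!: integral_nonneg_AE)
  have m0: "0 \<le> ?m" by simp
  have le: "Pt t (\<lambda>y. \<bar>u y\<bar>) x \<le> ?m + K" if "0 < t" for t x
    using Pt_oscillation[OF that i, of x] K[OF that] by linarith
  have fin: "ustar a b u x < \<infinity>" and up: "Umax u x \<le> ?m + K" for x
    using ustar_finite[OF u refl, of x "?m + K"] le by auto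
  have bd: "\<bar>Umax u x\<bar> \<le> ?m + K" for x
    using up[of x] Umax_ge_mean[OF u refl fin, of x] m0 K0 by linarith
  show "ustar a b u x < \<infinity>" "\<bar>Umax u x\<bar> \<le> ?m + K" by (rule fin bd)+
  show "integrable torus_measure (Umax u)"
    by (rule bounded_integrable_torus[OF Umax_measurable[OF u refl]]) (use bd in simp)
qed

text \<open>The truncated integrals of the fixed function \<open>g0\<close> tend to 0 as the level
  grows. As they dominate those of the smoothed maximal function, they supply the hypothesis of
  \<open>weak_grad_exists\<close>; level 0 bounds the variation and hence the maximal function
  itself.\<close>

lemma Umax_sobolev_real:
  fixes u :: "real \<Rightarrow> real"
  assumes w: "weak_grad u g0"
  shows "ustar a b u x < \<infinity>"
    and "\<exists>B. \<forall>x. \<bar>Umax u x\<bar> \<le> B"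
    and "\<exists>g. weak_grad (Umax u) g \<and> (\<forall>M\<ge>0. (\<integral>x. trunc M (g x) \<partial>torus_measure) \<le> (\<integral>x. trunc M (g0 x) \<partial>torus_measure))"
proof -
  have u: "integrable torus_measure u" using w by (simp add: weak_grad_def)
  have g0m: "g0 \<in> borel_measurable torus_measure" by (rule weak_grad_measurable[OF w])
  have g0i: "integrable torus_measure (\<lambda>x. norm (g0 x))" by (rule weak_grad_norm_integrable[OF w g0m])
  have it: "integrable torus_measure (\<lambda>x. trunc M (g0 x))" for M
    unfolding trunc_def using g0i by (intro integrable_max) auto
  have K: "(\<integral>y. trunc M (grad t (\<lambda>y. \<bar>u y\<bar>) y) \<partial>torus_measure) \<le> (\<integral>x. trunc M (g0 x) \<partial>torus_measure)" if "0 < t" for t M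
    by (rule grad_abs_le[OF nice_trunc that w it])
  note bd = Umax_bounded_real[OF u K]
  show "ustar a b u x < \<infinity>" by (rule bd(1))
  show "\<exists>B. \<forall>x. \<bar>Umax u x\<bar> \<le> B" using bd(2) by blast
  have G: "(\<integral>x. trunc M (grad t (Umax u) x) \<partial>torus_measure) \<le> (\<integral>x. trunc M (g0 x) \<partial>torus_measure)" if "0 \<le> M" "0 < t" for M t
  proof (rule grad_Umax_le[OF u refl _ bd(3) nice_trunc _ K that(2)])
    show "AE x in torus_measure. ustar a b u x < \<infinity>" using bd(1) by simp
    show "energy_comparison (trunc M) (\<lambda>y. \<bar>u y\<bar>)" by (rule energy_comparison_trunc) (use u that in auto)
  qed
  have UI: "\<exists>M\<ge>0. \<forall>t>0. (\<integral>x. trunc M (grad t (Umax u) x) \<partial>torus_measure) \<le> e" if e: "0 < e" for e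
  proof -
    have "(\<lambda>k. \<integral>x. trunc (real k) (g0 x) \<partial>torus_measure) \<longlonglongrightarrow> (\<integral>x. 0 \<partial>(torus_measure :: real measure))"
    proof (rule integral_dominated_convergence[where w="\<lambda>x. norm (g0 x)"])
      show "AE x in torus_measure. (\<lambda>k. trunc (real k) (g0 x)) \<longlonglongrightarrow> 0"
      proof (rule AE_I2, rule tendsto_eventually)
        fix x
        obtain N :: nat where "norm (g0 x) \<le> real N" using real_arch_simple by blast
        then have "trunc (real k) (g0 x) = 0" if "N \<le> k" for k using that by (simp add: trunc_def)
        then show "\<forall>\<^sub>F k in sequentially. trunc (real k) (g0 x) = 0" unfolding eventually_sequentially by blast
      qed
    qed (use it g0i in \<open>auto simp: trunc_def\<close>)
    then have "\<forall>\<^sub>F k in sequentially. (\<integral>x. trunc (real k) (g0 x) \<partial>torus_measure) < e" by (intro order_tendstoD(2)) (use e in auto)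
    then obtain k where k: "(\<integral>x. trunc (real k) (g0 x) \<partial>torus_measure) < e" by (auto simp: eventually_sequentially)
    show ?thesis
    proof (intro exI[of _ "real k"] conjI allI impI)
      fix t :: real assume "0 < t"
      then show "(\<integral>x. trunc (real k) (grad t (Umax u) x) \<partial>torus_measure) \<le> e" using G[of "real k" t] k by simp
    qed simp
  qed
  obtain g where g: "weak_grad (Umax u) g"
    "\<And>\<Theta> C. nice \<Theta> \<Longrightarrow> (\<And>t. 0 < t \<Longrightarrow> (\<integral>x. \<Theta> (grad t (Umax u) x) \<partial>torus_measure) \<le> C) \<Longrightarrow>
           integrable torus_measure (\<lambda>x. \<Theta> (g x)) \<and> (\<integral>x. \<Theta> (g x) \<partial>torus_measure) \<le> C"
    using weak_grad_exists[OF bd(3) UI] by blast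
  show "\<exists>g. weak_grad (Umax u) g \<and> (\<forall>M\<ge>0. (\<integral>x. trunc M (g x) \<partial>torus_measure) \<le> (\<integral>x. trunc M (g0 x) \<partial>torus_measure))"
    using g(1) g(2)[OF nice_trunc G] by blast
qed

lemma Umax_Lp_real:
  fixes u :: "real \<Rightarrow> real"
  assumes p: "1 \<le> p" and s: "sobolev p u"
  shows "AE x in torus_measure. ustar a b u x < \<infinity>" "sobolev p (Umax u)" "Lp_mem \<infinity> (Umax u)"
    and "\<And>g0 g. weak_grad u g0 \<Longrightarrow> weak_grad (Umax u) g \<Longrightarrow> Lp_norm p (\<lambda>x. norm (g x)) \<le> Lp_norm p (\<lambda>x. norm (g0 x))"
proof -
  obtain h0 where h0: "weak_grad u h0" "Lp_mem p (\<lambda>x. norm (h0 x))" using s by (auto simp: sobolev_def)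
  have u: "integrable torus_measure u" using h0 by (simp add: weak_grad_def)
  obtain B where B: "\<And>x. \<bar>Umax u x\<bar> \<le> B" using Umax_sobolev_real(2)[OF h0(1)] by blast
  obtain h where h: "weak_grad (Umax u) h" "\<And>M. 0 \<le> M \<Longrightarrow> (\<integral>x. trunc M (h x) \<partial>torus_measure) \<le> (\<integral>x. trunc M (h0 x) \<partial>torus_measure)"
    using Umax_sobolev_real(3)[OF h0(1)] by blast
  have m: "h0 \<in> borel_measurable torus_measure" "h \<in> borel_measurable torus_measure"
    using weak_grad_measurable h0 h by blast+
  note L = Lp_of_trunc[OF weak_grad_norm_integrable[OF h(1) m(2)] weak_grad_norm_integrable[OF h0(1) m(1)] m(2,1) h(2) p h0(2)]
  note Um = Umax_measurable[OF u refl]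
  show "AE x in torus_measure. ustar a b u x < \<infinity>" using Umax_sobolev_real(1)[OF h0(1)] by simp
  show "sobolev p (Umax u)" unfolding sobolev_def using Lp_mem_bounded[OF Um B] h(1) L(1) by blast
  show "Lp_mem \<infinity> (Umax u)" by (rule Lp_mem_bounded[OF Um B])
  fix g0 g assume g0: "weak_grad u g0" and g: "weak_grad (Umax u) g"
  have "Lp_norm p (\<lambda>x. norm (g x)) = Lp_norm p (\<lambda>x. norm (h x))"
    by (rule Lp_norm_cong_AE) (use weak_grad_measurable[OF g] m weak_grad_unique[OF g h(1)] in \<open>auto elim: eventually_mono\<close>)
  moreover have "Lp_norm p (\<lambda>x. norm (g0 x)) = Lp_norm p (\<lambda>x. norm (h0 x))"
    by (rule Lp_norm_cong_AE) (use weak_grad_measurable[OF g0] m weak_grad_unique[OF g0 h0(1)] in \<open>auto elim: eventually_mono\<close>)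
  ultimately show "Lp_norm p (\<lambda>x. norm (g x)) \<le> Lp_norm p (\<lambda>x. norm (g0 x))" using L(2) by simp
qed

end

section \<open>Square-integrability of the maximal function\<close>

lemma has_sum_finite_sum:
  fixes f :: "'i \<Rightarrow> 'b \<Rightarrow> 'c::topological_comm_monoid_add"
  assumes "finite I" "\<And>i. i \<in> I \<Longrightarrow> (f i has_sum s i) A"
  shows "((\<lambda>n. \<Sum>i\<in>I. f i n) has_sum (\<Sum>i\<in>I. s i)) A"
  using assms by (induction I rule: finite_induct) (auto intro: has_sum_add)

text \<open>Discrete form of integrating the derivative of a square: each difference of squares is a
  product, split by Young's inequality with weights \<open>1 / \<tau>\<close> and \<tau>. The
  summands are nonnegative, so one sum over all steps will dominate every \<open>k\<close>.\<close>

lemma square_telescope_le: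
  fixes G :: "nat \<Rightarrow> real"
  assumes \<tau>: "0 < \<tau>" and k: "k \<le> N"
  shows "(G k)\<^sup>2 \<le> (G N)\<^sup>2 + (\<Sum>j=k..<N. (G j - G (Suc j))\<^sup>2 / \<tau> + \<tau> * (G j + G (Suc j))\<^sup>2) / 2"
proof -
  have st: "(G j)\<^sup>2 - (G (Suc j))\<^sup>2 \<le> ((G j - G (Suc j))\<^sup>2 / \<tau> + \<tau> * (G j + G (Suc j))\<^sup>2) / 2" for j
  proof -
    define x y where "x = (G j - G (Suc j)) / sqrt \<tau>" and "y = sqrt \<tau> * (G j + G (Suc j))"
    have "2 * (x * y) \<le> x\<^sup>2 + y\<^sup>2" using sum_squares_bound[of x y] by (simp add: mult.assoc)
    moreover have "x * y = (G j)\<^sup>2 - (G (Suc j))\<^sup>2"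
    proof -
      have "x * y = (G j - G (Suc j)) * (G j + G (Suc j))" using \<tau> by (simp add: x_def y_def)
      then show ?thesis by (simp add: power2_eq_square algebra_simps)
    qed
    moreover have "x\<^sup>2 = (G j - G (Suc j))\<^sup>2 / \<tau>" "y\<^sup>2 = \<tau> * (G j + G (Suc j))\<^sup>2"
      using \<tau> by (simp_all add: x_def y_def power_divide power_mult_distrib)
    ultimately show ?thesis by simp
  qed
  have "(G k)\<^sup>2 - (G N)\<^sup>2 = (\<Sum>j=k..<N. (G j)\<^sup>2 - (G (Suc j))\<^sup>2)"
    using sum_Suc_diff'[OF k, of "\<lambda>j. - (G j)\<^sup>2"] by simp
  also have "\<dots> \<le> (\<Sum>j=k..<N. ((G j - G (Suc j))\<^sup>2 / \<tau> + \<tau> * (G j + G (Suc j))\<^sup>2) / 2)"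
    by (rule sum_mono) (rule st)
  finally show ?thesis by (simp add: sum_divide_distrib)
qed

text \<open>The discrete energy of a single mode \<open>exp (- l * t)\<close> sampled with step
  \<tau>, bounded uniformly in \<tau> and \<open>N\<close>. Geometric summation reduces it to
  \<open>1 - q \<le> \<tau> * l\<close> and \<open>\<tau> * l * q \<le> 1 - q\<close>.\<close>

lemma exp_telescope_sum_le:
  fixes \<tau> l :: real
  assumes \<tau>: "0 < \<tau>" and l: "0 < l" and q: "q = exp (- \<tau> * l)" and N: "1 \<le> N"
  shows "(q ^ N)\<^sup>2 + (\<Sum>j=1..<N. (q ^ j - q ^ Suc j)\<^sup>2 / \<tau> + \<tau> * (q ^ j + q ^ Suc j)\<^sup>2) / 2 \<le> 1 + l / 2 + 1 / l"
proof -
  have q0: "0 < q" and q1: "q < 1" using \<tau> l by (simp_all add: q)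
  have qa: "1 - q \<le> \<tau> * l" using exp_ge_add_one_self[of "- \<tau> * l"] by (simp add: q)
  have qb: "\<tau> * l * q \<le> 1 - q"
  proof -
    have "(1 + \<tau> * l) * q \<le> exp (\<tau> * l) * q" using q0 exp_ge_add_one_self[of "\<tau> * l"] by (intro mult_right_mono) auto
    also have "\<dots> = 1" by (simp add: q exp_minus)
    finally show ?thesis by (simp add: algebra_simps)
  qed
  define A where "A = (1 - q)\<^sup>2 / \<tau> + \<tau> * (1 + q)\<^sup>2"
  have A0: "0 \<le> A" using \<tau> by (simp add: A_def)
  have q2: "0 < 1 - q\<^sup>2" using q0 q1 by (simp add: power2_eq_square) (metis less_eq_real_def mult_less_le_imp_less mult_1)
  have "(\<Sum>j=1..<N. (q\<^sup>2) ^ j) * (1 - q\<^sup>2) = (\<Sum>j=1..<N. (q\<^sup>2) ^ j - (q\<^sup>2) ^ Suc j)"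
    unfolding sum_distrib_right by (rule sum.cong[OF refl]) (simp add: algebra_simps)
  also have "\<dots> = q\<^sup>2 - (q\<^sup>2) ^ N"
    using sum_Suc_diff'[OF N, of "\<lambda>j. - ((q\<^sup>2) ^ j)"] by simp
  also have "\<dots> \<le> q\<^sup>2" by simp
  finally have S: "(\<Sum>j=1..<N. (q\<^sup>2) ^ j) \<le> q\<^sup>2 / (1 - q\<^sup>2)" using q2 by (simp add: pos_le_divide_eq)
  have "(\<Sum>j=1..<N. (q ^ j - q ^ Suc j)\<^sup>2 / \<tau> + \<tau> * (q ^ j + q ^ Suc j)\<^sup>2) = (\<Sum>j=1..<N. (q\<^sup>2) ^ j * A)"
  proof (rule sum.cong[OF refl])
    fix j
    have "q ^ j - q ^ Suc j = q ^ j * (1 - q)" "q ^ j + q ^ Suc j = q ^ j * (1 + q)" by (simp_all add: algebra_simps)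
    then show "(q ^ j - q ^ Suc j)\<^sup>2 / \<tau> + \<tau> * (q ^ j + q ^ Suc j)\<^sup>2 = (q\<^sup>2) ^ j * A"
      by (simp only: A_def power_mult_distrib power_even_eq[symmetric] power_mult[symmetric] mult.commute[of j 2]) (simp add: algebra_simps)
  qed
  also have "\<dots> = (\<Sum>j=1..<N. (q\<^sup>2) ^ j) * A" by (simp add: sum_distrib_right)
  also have "\<dots> \<le> q\<^sup>2 / (1 - q\<^sup>2) * A" by (rule mult_right_mono[OF S A0])
  \<comment> \<open>The factor \<open>q^2\<close> comes from starting at \<open>j = 1\<close>. It
    supplies the \<open>q\<close> in \<open>\<tau> * q / (1 - q)\<close>, without which this
    quotient would exceed \<open>1 / l\<close>.\<close>
  also have "\<dots> = (1 - q) / \<tau> * (q\<^sup>2 / (1 + q)) + \<tau> * q / (1 - q) * (q * (1 + q))"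
  proof -
    have f: "1 - q\<^sup>2 = (1 - q) * (1 + q)" by (simp add: power2_eq_square algebra_simps)
    show ?thesis unfolding A_def f using q0 q1 \<tau> by (simp add: divide_simps power2_eq_square) (simp add: algebra_simps)
  qed
  also have "\<dots> \<le> l * 1 + 1 / l * 2"
  proof (rule add_mono; rule mult_mono)
    show "(1 - q) / \<tau> \<le> l" using qa \<tau> by (simp add: pos_divide_le_eq mult.commute)
    have "q * q \<le> 1" using q0 q1 by (simp add: mult_le_one)
    then show "q\<^sup>2 / (1 + q) \<le> 1" using q0 by (simp add: pos_divide_le_eq power2_eq_square)
    show "\<tau> * q / (1 - q) \<le> 1 / l" using qb q1 l by (simp add: divide_simps mult_ac)
    have "q * (1 + q) \<le> 1 * 2" using q0 q1 by (intro mult_mono) auto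
    then show "q * (1 + q) \<le> 2" by simp
  qed (use q0 q1 \<tau> l in auto)
  finally have "(\<Sum>j=1..<N. (q ^ j - q ^ Suc j)\<^sup>2 / \<tau> + \<tau> * (q ^ j + q ^ Suc j)\<^sup>2) \<le> l + 2 / l" by simp
  moreover have "(q ^ N)\<^sup>2 \<le> 1" using q0 q1 by (simp add: power_le_one)
  ultimately show ?thesis by simp
qed

context kernel_params
begin

text \<open>Parseval is used at positive times, where the series converges absolutely; restriction
  to finitely many modes makes the limit at time 0 immediate.\<close>

lemma energy_coefficients_le:
  fixes f :: "'a::euclidean_space \<Rightarrow> real"
  assumes f: "integrable torus_measure f"
    and K: "\<And>t. 0 < t \<Longrightarrow> (\<integral>x. (norm (grad t f x))\<^sup>2 \<partial>torus_measure) \<le> K"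
    and F: "finite F" "F \<subseteq> lattice"
  shows "(\<Sum>n\<in>F. (2 * pi * norm n)\<^sup>2 * (norm (fc f n))\<^sup>2) \<le> K"
proof -
  have le: "(\<Sum>n\<in>F. (2 * pi * norm n)\<^sup>2 * (norm (Pc t f n))\<^sup>2) \<le> K" if t: "0 < t" for t
  proof -
    have "(\<Sum>n\<in>F. (2 * pi * norm n)\<^sup>2 * (norm (Pc t f n))\<^sup>2) = (\<Sum>n\<in>F. \<Sum>i\<in>Basis. (norm (dcoef i (Pc t f) n))\<^sup>2)"
    proof (rule sum.cong[OF refl])
      fix n
      show "(2 * pi * norm n)\<^sup>2 * (norm (Pc t f n))\<^sup>2 = (\<Sum>i\<in>Basis. (norm (dcoef i (Pc t f) n))\<^sup>2)"
        by (simp add: dcoef_def norm_mult power_mult_distrib power2_norm_eq_sum[of n] sum_distrib_left sum_distrib_right)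
    qed
    also have "\<dots> = (\<Sum>i\<in>Basis. \<Sum>n\<in>F. (norm (dcoef i (Pc t f) n))\<^sup>2)" by (rule sum.swap)
    also have "\<dots> \<le> (\<Sum>i\<in>Basis. \<integral>x. (dseries i (Pc t f) x)\<^sup>2 \<partial>torus_measure)"
      by (intro sum_mono finite_sum_le_has_sum[OF fser_parseval[OF fser_dseries[OF t f]] F]) simp
    also have "\<dots> = (\<integral>x. (\<Sum>i\<in>Basis. (dseries i (Pc t f) x)\<^sup>2) \<partial>torus_measure)"
      by (rule Bochner_Integration.integral_sum[symmetric])
        (intro continuous_integrable_torus continuous_intros continuous_dseries[OF t f])
    also have "\<dots> = (\<integral>x. (norm (grad t f x))\<^sup>2 \<partial>torus_measure)"
      by (rule Bochner_Integration.integral_cong[OF refl]) (simp add: power2_norm_eq_sum grad_inner)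
    finally show ?thesis using K[OF t] by simp
  qed
  have "(\<lambda>k. \<Sum>n\<in>F. (2 * pi * norm n)\<^sup>2 * (norm (Pc (eta k) f n))\<^sup>2) \<longlonglongrightarrow> (\<Sum>n\<in>F. (2 * pi * norm n)\<^sup>2 * (norm (of_real (exp (- 0 * lm n)) * fc f n))\<^sup>2)"
    unfolding Pc_def by (intro tendsto_intros eta_tendsto)
  then have "(\<Sum>n\<in>F. (2 * pi * norm n)\<^sup>2 * (norm (of_real (exp (- 0 * lm n)) * fc f n))\<^sup>2) \<le> K"
    by (rule LIMSEQ_le_const2) (use le in auto)
  then show ?thesis by simp
qed

text \<open>On a grid of times the maximum is dominated by an explicit continuous \<open>R\<close>,
  whose integral Parseval evaluates mode by mode. The mean is subtracted because the weight contains
  \<open>1 / lm n\<close>; for the other modes the weight is absorbed by the Dirichlet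
  energy.\<close>

lemma maximal_discrete:
  fixes f :: "'a::euclidean_space \<Rightarrow> real"
  assumes f: "integrable torus_measure f"
    and K: "\<And>t. 0 < t \<Longrightarrow> (\<integral>x. (norm (grad t f x))\<^sup>2 \<partial>torus_measure) \<le> K"
  shows "\<exists>C. \<forall>\<tau>>0. \<forall>N\<ge>1. \<exists>R. continuous_on UNIV R \<and> (\<forall>x. 0 \<le> R x) \<and> (\<integral>x. R x \<partial>torus_measure) \<le> C \<and>
    (\<forall>k x. 1 \<le> k \<longrightarrow> k \<le> N \<longrightarrow> (Pt (real k * \<tau>) f x - (\<integral>y. f y \<partial>torus_measure))\<^sup>2 \<le> R x)"
proof -
  let ?m = "\<integral>y. f y \<partial>torus_measure"
  obtain B where B: "\<And>n::'a. n \<in> lattice \<Longrightarrow> lm n \<le> B * (norm n)\<^sup>2" using lm_le[where 'a='a] by blast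
  \<comment> \<open>Collects the upper bound \<open>lm_le\<close>, the lower bound
    \<open>c0 \<le> lm n\<close> and \<open>1 \<le> norm n\<close>, divided by the factor in the
    gradient symbol.\<close>
  define D where "D = (1 + \<bar>B\<bar> / 2 + 1 / c0) / (2 * pi)\<^sup>2"
  have D0: "0 \<le> D" using c0_pos by (simp add: D_def)
  have weight: "1 + lm n / 2 + 1 / lm n \<le> D * (2 * pi * norm n)\<^sup>2" if n: "n \<in> lattice" "n \<noteq> 0" for n :: 'a
  proof -
    have n1: "1 \<le> norm n" by (rule lattice_norm_ge_1[OF n])
    have n2: "norm n \<le> (norm n)\<^sup>2" using mult_right_mono[OF n1, of "norm n"] by (simp add: power2_eq_square)
    have l1: "lm n \<le> \<bar>B\<bar> * (norm n)\<^sup>2" using B[OF n(1)] by (rule order_trans) (simp add: mult_right_mono)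
    have "c0 * 1 \<le> c0 * norm n" using c0_pos n1 by (intro mult_left_mono) auto
    then have "c0 \<le> lm n" using lm_ge[OF n(1)] by simp
    then have "1 / lm n \<le> 1 / c0" using c0_pos by (simp add: frac_le)
    also have "\<dots> \<le> 1 / c0 * (norm n)\<^sup>2"
      using mult_left_mono[of 1 "(norm n)\<^sup>2" "1 / c0"] c0_pos n1 n2 by simp
    finally have "1 + lm n / 2 + 1 / lm n \<le> (1 + \<bar>B\<bar> / 2 + 1 / c0) * (norm n)\<^sup>2"
      using l1 n1 n2 by (simp add: algebra_simps)
    then show ?thesis by (simp add: D_def power_mult_distrib)
  qed
  define w where "w n = (if n = 0 then 0 else fc f n)" for n
  show ?thesis
  proof (intro exI[of _ "D * K"] allI impI)
    fix \<tau> :: real and N :: nat assume \<tau>: "0 < \<tau>" and N: "1 \<le> N"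
    define q where "q n = exp (- \<tau> * lm n)" for n :: 'a
    define G where "G k x = Pt (real k * \<tau>) f x - ?m" for k x
    have G: "fser (\<lambda>n. of_real (q n ^ k) * w n) (G k)" if "1 \<le> k" for k
    proof -
      have "0 < real k * \<tau>" using that \<tau> by simp
      from fser_diff[OF fser_Pt[OF this f] fser_const[of ?m]]
      have "fser (\<lambda>n. Pc (real k * \<tau>) f n - (if n = 0 then of_real ?m else 0)) (G k)" unfolding G_def .
      then show ?thesis
      proof (rule fser_cong)
        fix n :: 'a
        have "exp (- (real k * \<tau>) * lm n) = q n ^ k" unfolding q_def by (simp add: exp_of_nat_mult[symmetric] mult.assoc)
        then show "Pc (real k * \<tau>) f n - (if n = 0 then of_real ?m else 0) = of_real (q n ^ k) * w n"
          using fc_0[OF f] by (simp add: Pc_def w_def q_def)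
      qed
    qed
    note cG = fser_continuous[OF G]
    define R where "R x = (G N x)\<^sup>2 + (\<Sum>j=1..<N. (G j x - G (Suc j) x)\<^sup>2 / \<tau> + \<tau> * (G j x + G (Suc j) x)\<^sup>2) / 2" for x
    have cR: "continuous_on UNIV R" unfolding R_def
      by (intro continuous_intros cG) (use \<tau> N in auto)
    have R0: "0 \<le> R x" for x unfolding R_def using \<tau> by (intro add_nonneg_nonneg divide_nonneg_nonneg sum_nonneg) auto
    have dom: "(G k x)\<^sup>2 \<le> R x" if k: "1 \<le> k" "k \<le> N" for k x
    proof -
      have "(\<Sum>j=k..<N. (G j x - G (Suc j) x)\<^sup>2 / \<tau> + \<tau> * (G j x + G (Suc j) x)\<^sup>2)
          \<le> (\<Sum>j=1..<N. (G j x - G (Suc j) x)\<^sup>2 / \<tau> + \<tau> * (G j x + G (Suc j) x)\<^sup>2)"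
        by (rule sum_mono2) (use \<tau> k in auto)
      then show ?thesis using square_telescope_le[OF \<tau> k(2), of "\<lambda>j. G j x"] unfolding R_def by linarith
    qed
    let ?c = "\<lambda>n. ((q n ^ N)\<^sup>2 + (\<Sum>j=1..<N. (q n ^ j - q n ^ Suc j)\<^sup>2 / \<tau> + \<tau> * (q n ^ j + q n ^ Suc j)\<^sup>2) / 2) * (norm (w n))\<^sup>2"
    have hs: "(?c has_sum (\<integral>x. R x \<partial>torus_measure)) lattice"
    proof -
      have sq: "(norm (of_real r * w n))\<^sup>2 = r\<^sup>2 * (norm (w n))\<^sup>2" for r n by (simp add: norm_mult power_mult_distrib)
      have h1: "((\<lambda>n. (q n ^ N)\<^sup>2 * (norm (w n))\<^sup>2) has_sum (\<integral>x. (G N x)\<^sup>2 \<partial>torus_measure)) lattice"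
        using fser_parseval[OF G[OF N]] unfolding sq .
      have h2: "((\<lambda>n. (q n ^ j - q n ^ Suc j)\<^sup>2 * (norm (w n))\<^sup>2) has_sum (\<integral>x. (G j x - G (Suc j) x)\<^sup>2 \<partial>torus_measure)) lattice" if "1 \<le> j" for j
      proof -
        have "fser (\<lambda>n. of_real (q n ^ j - q n ^ Suc j) * w n) (\<lambda>x. G j x - G (Suc j) x)"
          using fser_diff[OF G[of j] G[of "Suc j"]] that by (simp add: algebra_simps)
        from fser_parseval[OF this] show ?thesis unfolding sq .
      qed
      have h3: "((\<lambda>n. (q n ^ j + q n ^ Suc j)\<^sup>2 * (norm (w n))\<^sup>2) has_sum (\<integral>x. (G j x + G (Suc j) x)\<^sup>2 \<partial>torus_measure)) lattice" if "1 \<le> j" for j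
      proof -
        have "fser (\<lambda>n. of_real (q n ^ j + q n ^ Suc j) * w n) (\<lambda>x. G j x + G (Suc j) x)"
          using fser_add[OF G[of j] G[of "Suc j"]] that by (simp add: algebra_simps)
        from fser_parseval[OF this] show ?thesis unfolding sq .
      qed
      define I where "I j = 1 / \<tau> * (\<integral>x. (G j x - G (Suc j) x)\<^sup>2 \<partial>torus_measure) + \<tau> * (\<integral>x. (G j x + G (Suc j) x)\<^sup>2 \<partial>torus_measure)" for j
      have h4: "((\<lambda>n. 1 / \<tau> * ((q n ^ j - q n ^ Suc j)\<^sup>2 * (norm (w n))\<^sup>2) + \<tau> * ((q n ^ j + q n ^ Suc j)\<^sup>2 * (norm (w n))\<^sup>2)) has_sum I j) lattice"
        if "j \<in> {1..<N}" for j
        unfolding I_def by (intro has_sum_add has_sum_cmult_right h2 h3) (use that in auto)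
      have h5: "((\<lambda>n. (q n ^ N)\<^sup>2 * (norm (w n))\<^sup>2 + 1 / 2 * (\<Sum>j=1..<N. 1 / \<tau> * ((q n ^ j - q n ^ Suc j)\<^sup>2 * (norm (w n))\<^sup>2)
          + \<tau> * ((q n ^ j + q n ^ Suc j)\<^sup>2 * (norm (w n))\<^sup>2)))
          has_sum ((\<integral>x. (G N x)\<^sup>2 \<partial>torus_measure) + 1 / 2 * (\<Sum>j=1..<N. I j))) lattice"
        by (intro has_sum_add h1 has_sum_cmult_right has_sum_finite_sum h4) auto
      have iG: "integrable torus_measure (\<lambda>x. (G N x)\<^sup>2)"
        by (intro continuous_integrable_torus continuous_intros cG N)
      have i2: "integrable torus_measure (\<lambda>x. (G j x - G (Suc j) x)\<^sup>2)" "integrable torus_measure (\<lambda>x. (G j x + G (Suc j) x)\<^sup>2)"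
        if "j \<in> {1..<N}" for j
        by (intro continuous_integrable_torus continuous_intros cG; use that in simp)+
      have "(\<integral>x. R x \<partial>torus_measure) = (\<integral>x. (G N x)\<^sup>2 \<partial>torus_measure) + (\<Sum>j=1..<N. I j) / 2"
      proof -
        let ?t = "\<lambda>j x. (G j x - G (Suc j) x)\<^sup>2 / \<tau> + \<tau> * (G j x + G (Suc j) x)\<^sup>2"
        have it: "integrable torus_measure (?t j)" "(\<integral>x. ?t j x \<partial>torus_measure) = I j" if "j \<in> {1..<N}" for j
          using i2[OF that] by (simp_all add: I_def)
        have "integrable torus_measure (\<lambda>x. \<Sum>j=1..<N. ?t j x)" by (rule Bochner_Integration.integrable_sum) (rule it(1))
        moreover have "(\<integral>x. (\<Sum>j=1..<N. ?t j x) \<partial>torus_measure) = (\<Sum>j=1..<N. I j)"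
          using it by (subst Bochner_Integration.integral_sum) auto
        ultimately show ?thesis unfolding R_def using iG by simp
      qed
      then show ?thesis using h5 by (simp add: algebra_simps sum_distrib_left sum_distrib_right sum.distrib add_divide_distrib sum_divide_distrib)
    qed
    have "(\<integral>x. R x \<partial>torus_measure) \<le> D * K"
    proof (rule has_sum_le_finite_sums[OF hs])
      fix F :: "'a set" assume F: "finite F" "F \<subseteq> lattice"
      have "sum ?c F \<le> (\<Sum>n\<in>F. D * ((2 * pi * norm n)\<^sup>2 * (norm (fc f n))\<^sup>2))"
      proof (rule sum_mono)
        fix n assume "n \<in> F"
        then have n: "n \<in> lattice" using F by auto
        show "?c n \<le> D * ((2 * pi * norm n)\<^sup>2 * (norm (fc f n))\<^sup>2)"
        proof (cases "n = 0")
          case False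
          have "c0 * 1 \<le> c0 * norm n" using c0_pos lattice_norm_ge_1[OF n False] by (intro mult_left_mono) auto
          then have l: "0 < lm n" using lm_ge[OF n] c0_pos by linarith
          have "(q n ^ N)\<^sup>2 + (\<Sum>j=1..<N. (q n ^ j - q n ^ Suc j)\<^sup>2 / \<tau> + \<tau> * (q n ^ j + q n ^ Suc j)\<^sup>2) / 2 \<le> D * (2 * pi * norm n)\<^sup>2"
            using exp_telescope_sum_le[OF \<tau> l q_def N] weight[OF n False] by (rule order_trans)
          then have "?c n \<le> D * (2 * pi * norm n)\<^sup>2 * (norm (w n))\<^sup>2" by (rule mult_right_mono) simp
          then show ?thesis using False by (simp add: w_def mult.assoc)
        qed (simp add: w_def)
      qed
      also have "\<dots> = D * (\<Sum>n\<in>F. (2 * pi * norm n)\<^sup>2 * (norm (fc f n))\<^sup>2)" by (simp add: sum_distrib_left)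
      also have "\<dots> \<le> D * K" by (rule mult_left_mono[OF energy_coefficients_le[OF f K F] D0])
      finally show "sum ?c F \<le> D * K" .
    qed
    then show "\<exists>R. continuous_on UNIV R \<and> (\<forall>x. 0 \<le> R x) \<and> (\<integral>x. R x \<partial>torus_measure) \<le> D * K \<and>
      (\<forall>k x. 1 \<le> k \<longrightarrow> k \<le> N \<longrightarrow> (Pt (real k * \<tau>) f x - ?m)\<^sup>2 \<le> R x)"
      using cR R0 dom unfolding G_def by blast
  qed
qed

text \<open>Grids of step \<open>1 / 2 ^ m\<close> with \<open>4 ^ m\<close> points reach up to time
  \<open>2 ^ m\<close>, so in the limit they approximate every positive time. The majorants are
  combined by a lower limit, because Fatou then preserves the bound on their integrals.\<close>

lemma maximal_square_majorant:
  fixes f :: "'a::euclidean_space \<Rightarrow> real"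
  assumes f: "integrable torus_measure f"
    and K: "\<And>t. 0 < t \<Longrightarrow> (\<integral>x. (norm (grad t f x))\<^sup>2 \<partial>torus_measure) \<le> K"
  shows "\<exists>L :: 'a \<Rightarrow> ennreal. L \<in> borel_measurable torus_measure \<and> (\<integral>\<^sup>+x. L x \<partial>torus_measure) < \<infinity> \<and>
    (\<forall>t>0. \<forall>x. ennreal ((Pt t f x - (\<integral>y. f y \<partial>torus_measure))\<^sup>2) \<le> L x)"
proof -
  let ?m = "\<integral>y. f y \<partial>torus_measure"
  obtain C where C: "\<And>\<tau> N. 0 < \<tau> \<Longrightarrow> 1 \<le> N \<Longrightarrow> \<exists>R. continuous_on UNIV R \<and> (\<forall>x. 0 \<le> R x) \<and> (\<integral>x. R x \<partial>torus_measure) \<le> C \<and>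
    (\<forall>k x. 1 \<le> k \<longrightarrow> k \<le> N \<longrightarrow> (Pt (real k * \<tau>) f x - ?m)\<^sup>2 \<le> R x)"
    using maximal_discrete[OF f K] by blast
  have "\<exists>R. continuous_on UNIV R \<and> (\<forall>x. 0 \<le> R x) \<and> (\<integral>x. R x \<partial>torus_measure) \<le> C \<and>
    (\<forall>k x. 1 \<le> k \<longrightarrow> k \<le> 4 ^ m \<longrightarrow> (Pt (real k * (1 / 2 ^ m)) f x - ?m)\<^sup>2 \<le> R x)" for m :: nat
    by (rule C) simp_all
  then obtain R where R: "\<And>m. continuous_on UNIV (R m)" "\<And>m x. 0 \<le> R m x" "\<And>m. (\<integral>x. R m x \<partial>torus_measure) \<le> C"
    "\<And>m k x. 1 \<le> k \<Longrightarrow> k \<le> 4 ^ m \<Longrightarrow> (Pt (real k * (1 / 2 ^ m)) f x - ?m)\<^sup>2 \<le> R m x" for m :: nat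
    by metis
  define L where "L x = liminf (\<lambda>m. ennreal (R m x))" for x
  have Rm: "(\<lambda>x. ennreal (R m x)) \<in> borel_measurable torus_measure" for m
    using continuous_measurable_torus[OF R(1)] by simp
  have "(\<integral>\<^sup>+x. L x \<partial>torus_measure) \<le> liminf (\<lambda>m. \<integral>\<^sup>+x. ennreal (R m x) \<partial>torus_measure)"
    unfolding L_def by (rule nn_integral_liminf[OF Rm])
  also have "\<dots> \<le> liminf (\<lambda>m. ennreal C)"
  proof (rule Liminf_mono, rule always_eventually, rule allI)
    fix m
    have "(\<integral>\<^sup>+x. ennreal (R m x) \<partial>torus_measure) = ennreal (\<integral>x. R m x \<partial>torus_measure)"
      by (rule nn_integral_eq_integral[OF continuous_integrable_torus[OF R(1)]]) (simp add: R(2))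
    then show "(\<integral>\<^sup>+x. ennreal (R m x) \<partial>torus_measure) \<le> ennreal C" using R(3)[of m] by (simp add: ennreal_leI)
  qed
  also have "\<dots> = ennreal C" by (simp add: Liminf_const)
  finally have int: "(\<integral>\<^sup>+x. L x \<partial>torus_measure) < \<infinity>" by (rule order_le_less_trans) simp
  have Lm: "L \<in> borel_measurable torus_measure" unfolding L_def[abs_def] by (rule borel_measurable_liminf[OF Rm])
  have dom: "ennreal ((Pt t f x - ?m)\<^sup>2) \<le> L x" if t: "0 < t" for t x
  proof -
    \<comment> \<open>The grid time is rounded up, so it stays positive and tends to
      \<open>t\<close> from above.\<close>
    define k where "k m = nat \<lceil>t * 2 ^ m\<rceil>" for m :: nat
    have k: "t * 2 ^ m \<le> real (k m)" "real (k m) \<le> t * 2 ^ m + 1" for m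
    proof -
      have "0 \<le> t * 2 ^ m" using t by simp
      then show "t * 2 ^ m \<le> real (k m)" "real (k m) \<le> t * 2 ^ m + 1" unfolding k_def by linarith+
    qed
    have k1: "1 \<le> k m" for m
    proof -
      have "0 < t * 2 ^ m" using t by simp
      then have "0 < real (k m)" using k(1)[of m] by linarith
      then show ?thesis by simp
    qed
    have p: "t \<le> real (k m) * (1 / 2 ^ m)" "real (k m) * (1 / 2 ^ m) \<le> t + (1 / 2) ^ m" for m
      using k[of m] by (simp_all add: divide_simps power_divide)
    have "(\<lambda>m. t + (1 / 2) ^ m) \<longlonglongrightarrow> t + 0" by (intro tendsto_intros LIMSEQ_power_zero) simp
    then have lim: "(\<lambda>m. real (k m) * (1 / 2 ^ m)) \<longlonglongrightarrow> t"
      using tendsto_sandwich[of "\<lambda>m. t" "\<lambda>m. real (k m) * (1 / 2 ^ m)" sequentially "\<lambda>m. t + (1 / 2) ^ m" t] p by simp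
    have "isCont (\<lambda>s. Tk 0 f s x) t" using Tk_deriv[OF t f] by (rule DERIV_isCont)
    from isCont_tendsto_compose[OF this lim] have "(\<lambda>m. Tk 0 f (real (k m) * (1 / 2 ^ m)) x) \<longlonglongrightarrow> Tk 0 f t x" .
    moreover have "Tk 0 f (real (k m) * (1 / 2 ^ m)) x = Pt (real (k m) * (1 / 2 ^ m)) f x" for m
      using Tk_0[OF _ f, of "real (k m) * (1 / 2 ^ m)"] t p(1)[of m] by (simp add: less_le_trans)
    ultimately have "(\<lambda>m. Pt (real (k m) * (1 / 2 ^ m)) f x) \<longlonglongrightarrow> Pt t f x" using Tk_0[OF t f] by simp
    then have "(\<lambda>m. ennreal ((Pt (real (k m) * (1 / 2 ^ m)) f x - ?m)\<^sup>2)) \<longlonglongrightarrow> ennreal ((Pt t f x - ?m)\<^sup>2)"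
      by (intro tendsto_ennrealI tendsto_intros)
    then have "ennreal ((Pt t f x - ?m)\<^sup>2) = liminf (\<lambda>m. ennreal ((Pt (real (k m) * (1 / 2 ^ m)) f x - ?m)\<^sup>2))"
      by (rule lim_imp_Liminf[symmetric, rotated]) simp
    also have "\<dots> \<le> L x" unfolding L_def
    proof (rule Liminf_mono)
      have "\<forall>\<^sub>F m in sequentially. t + 1 \<le> 2 ^ m"
      proof -
        obtain M :: nat where M: "t + 1 < 2 ^ M" using real_arch_pow[of 2 "t + 1"] by auto
        have "t + 1 \<le> 2 ^ m" if "M \<le> m" for m using M power_increasing[OF that, of "2::real"] by linarith
        then show ?thesis unfolding eventually_sequentially by blast
      qed
      then show "\<forall>\<^sub>F m in sequentially. ennreal ((Pt (real (k m) * (1 / 2 ^ m)) f x - ?m)\<^sup>2) \<le> ennreal (R m x)"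
      proof eventually_elim
        case (elim m)
        have "(1::real) \<le> 2 ^ m" by simp
        then have "real (k m) \<le> (t + 1) * 2 ^ m" using k(2)[of m] unfolding distrib_right by linarith
        also have "\<dots> \<le> 2 ^ m * 2 ^ m" using elim by (intro mult_right_mono) auto
        also have "\<dots> = real (4 ^ m)" by (simp add: power_mult_distrib[symmetric])
        finally have "k m \<le> 4 ^ m" by (simp only: of_nat_le_iff)
        from R(4)[OF k1 this] show ?case by (rule ennreal_leI)
      qed
    qed
    finally show ?thesis .
  qed
  show ?thesis using Lm int dom by blast
qed

text \<open>The majorant bounds the deviation from the mean above; below there is nothing to do,
  because the maximal function is at least the mean.\<close>

lemma Umax_square_integrable:
  fixes u :: "'a::euclidean_space \<Rightarrow> real"
  assumes u: "integrable torus_measure u"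
    and K: "\<And>t. 0 < t \<Longrightarrow> (\<integral>x. (norm (grad t (\<lambda>y. \<bar>u y\<bar>) x))\<^sup>2 \<partial>torus_measure) \<le> K"
  shows "AE x in torus_measure. ustar a b u x < \<infinity>"
    and "integrable torus_measure (\<lambda>x. (Umax u x)\<^sup>2)" "integrable torus_measure (Umax u)"
proof -
  let ?f = "\<lambda>y. \<bar>u y\<bar>"
  let ?m = "\<integral>y. ?f y \<partial>torus_measure"
  have f: "integrable torus_measure ?f" using u by simp
  obtain L where L: "L \<in> borel_measurable torus_measure" "(\<integral>\<^sup>+x. L x \<partial>torus_measure) < \<infinity>"
    "\<And>t x. 0 < t \<Longrightarrow> ennreal ((Pt t ?f x - ?m)\<^sup>2) \<le> L x"
    using maximal_square_majorant[OF f K] by blast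
  have Um: "Umax u \<in> borel_measurable torus_measure" by (rule Umax_measurable[OF u refl])
  have "AE x in torus_measure. L x \<noteq> \<infinity>" by (rule nn_integral_noteq_infinite[OF L(1)]) (use L(2) in auto)
  then have fin: "AE x in torus_measure. ustar a b u x < \<infinity> \<and> ennreal ((Umax u x - ?m)\<^sup>2) \<le> L x"
  proof eventually_elim
    case (elim x)
    then obtain r where r: "0 \<le> r" "L x = ennreal r" by (cases "L x") auto
    have P: "Pt t ?f x \<le> ?m + sqrt r" if "0 < t" for t
    proof -
      have "(Pt t ?f x - ?m)\<^sup>2 \<le> r" using L(3)[OF that, of x] r by simp
      then have "\<bar>Pt t ?f x - ?m\<bar> \<le> sqrt r" by (rule real_le_rsqrt[of "\<bar>Pt t ?f x - ?m\<bar>", simplified])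
      then show ?thesis by linarith
    qed
    have f1: "ustar a b u x < \<infinity>" and f2: "Umax u x \<le> ?m + sqrt r" using ustar_finite[OF u refl P] by blast+
    have "\<bar>Umax u x - ?m\<bar> \<le> sqrt r" using f2 Umax_ge_mean[OF u refl f1] by linarith
    then have "(Umax u x - ?m)\<^sup>2 \<le> r" using r(1) by (metis abs_le_square_iff abs_of_nonneg real_sqrt_ge_zero real_sqrt_pow2)
    then show ?case using f1 r by (simp add: ennreal_leI)
  qed
  show "AE x in torus_measure. ustar a b u x < \<infinity>" using fin by eventually_elim simp
  have "(\<integral>\<^sup>+x. ennreal ((Umax u x - ?m)\<^sup>2) \<partial>torus_measure) \<le> (\<integral>\<^sup>+x. L x \<partial>torus_measure)"
    by (rule nn_integral_mono_AE) (use fin in eventually_elim, simp)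
  then have i0: "integrable torus_measure (\<lambda>x. (Umax u x - ?m)\<^sup>2)"
    using Um L(2) by (intro integrableI_nonneg) (auto intro: order_le_less_trans)
  have i1: "integrable torus_measure (\<lambda>x. 2 * (Umax u x - ?m)\<^sup>2 + 2 * ?m\<^sup>2)" using i0 by simp
  show i2: "integrable torus_measure (\<lambda>x. (Umax u x)\<^sup>2)"
  proof (rule Bochner_Integration.integrable_bound[OF i1])
    have "y\<^sup>2 \<le> 2 * (y - m)\<^sup>2 + 2 * m\<^sup>2" for y m :: real
      using zero_le_power2[of "y - 2 * m"] by (simp add: power2_eq_square algebra_simps)
    then show "AE x in torus_measure. norm ((Umax u x)\<^sup>2) \<le> norm (2 * (Umax u x - ?m)\<^sup>2 + 2 * ?m\<^sup>2)" by simp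
  qed (use Um in simp)
  have i3: "integrable torus_measure (\<lambda>x. (Umax u x)\<^sup>2 + 1)" using i2 by simp
  show "integrable torus_measure (Umax u)"
  proof (rule Bochner_Integration.integrable_bound[OF i3 Um])
    have "\<bar>y\<bar> \<le> y\<^sup>2 + 1" for y :: real using sum_squares_bound[of "\<bar>y\<bar>" 1] by (simp add: power2_eq_square)
    then show "AE x in torus_measure. norm (Umax u x) \<le> norm ((Umax u x)\<^sup>2 + 1)" by simp
  qed
qed

lemma Umax_sobolev_square:
  fixes u :: "'a::euclidean_space \<Rightarrow> real"
  assumes w: "weak_grad u g0" and g0: "integrable torus_measure (\<lambda>x. (norm (g0 x))\<^sup>2)"
  shows "AE x in torus_measure. ustar a b u x < \<infinity>"
    and "integrable torus_measure (\<lambda>x. (Umax u x)\<^sup>2)"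
    and "\<exists>g. weak_grad (Umax u) g \<and> integrable torus_measure (\<lambda>x. (norm (g x))\<^sup>2)
       \<and> (\<integral>x. (norm (g x))\<^sup>2 \<partial>torus_measure) \<le> (\<integral>x. (norm (g0 x))\<^sup>2 \<partial>torus_measure)
       \<and> (\<forall>\<Theta> C. nice \<Theta> \<longrightarrow> (\<forall>t>0. (\<integral>x. \<Theta> (grad t (Umax u) x) \<partial>torus_measure) \<le> C) \<longrightarrow>
           integrable torus_measure (\<lambda>x. \<Theta> (g x)) \<and> (\<integral>x. \<Theta> (g x) \<partial>torus_measure) \<le> C)"
proof -
  let ?K = "\<integral>x. (norm (g0 x))\<^sup>2 \<partial>torus_measure"
  have u: "integrable torus_measure u" using w by (simp add: weak_grad_def)
  then have au: "integrable torus_measure (\<lambda>y. \<bar>u y\<bar>)" by simp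
  have K: "(\<integral>x. (norm (grad t (\<lambda>y. \<bar>u y\<bar>) x))\<^sup>2 \<partial>torus_measure) \<le> ?K" if "0 < t" for t
    by (rule grad_abs_le[OF nice_square that w g0])
  note sq = Umax_square_integrable[OF u K]
  show "AE x in torus_measure. ustar a b u x < \<infinity>" by (rule sq(1))
  show "integrable torus_measure (\<lambda>x. (Umax u x)\<^sup>2)" by (rule sq(2))
  have G: "(\<integral>x. (norm (grad t (Umax u) x))\<^sup>2 \<partial>torus_measure) \<le> ?K" if "0 < t" for t
    by (rule grad_Umax_le[OF u refl sq(1,3) nice_square energy_comparison_square[OF au] K that])
  have K0: "0 \<le> ?K" by simp
  have UI: "\<exists>M\<ge>0. \<forall>t>0. (\<integral>x. trunc M (grad t (Umax u) x) \<partial>torus_measure) \<le> e" if e: "0 < e" for e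
  \<comment> \<open>A Chebyshev bound: the truncation at level \<open>M\<close> is at most the
    square divided by \<open>M\<close>. The \<open>+ 1\<close> keeps the level positive when the
    energy vanishes.\<close>
  proof (intro exI[of _ "(?K + 1) / e"] conjI allI impI)
    let ?M = "(?K + 1) / e"
    show M: "0 \<le> ?M" using e K0 by simp
    have M1: "0 < ?M" using e K0 by (intro divide_pos_pos) linarith+
    fix t :: real assume t: "0 < t"
    have le: "trunc ?M \<xi> \<le> (norm \<xi>)\<^sup>2 / ?M" for \<xi> :: 'a
    proof (cases "norm \<xi> \<le> ?M")
      case True
      then have "trunc ?M \<xi> = 0" by (simp add: trunc_def)
      then show ?thesis using divide_nonneg_pos[OF zero_le_power2 M1] by metis
    next
      case False
      then have "norm \<xi> * ?M \<le> norm \<xi> * norm \<xi>" by (intro mult_left_mono) auto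
      then have "norm \<xi> \<le> (norm \<xi>)\<^sup>2 / ?M" using M1 by (subst pos_le_divide_eq) (auto simp: power2_eq_square)
      then show ?thesis using M False by (simp add: trunc_def)
    qed
    have i: "integrable torus_measure (\<lambda>x. (norm (grad t (Umax u) x))\<^sup>2)"
      by (intro continuous_integrable_torus continuous_intros continuous_grad[OF t sq(3)])
    have "(\<integral>x. trunc ?M (grad t (Umax u) x) \<partial>torus_measure) \<le> (\<integral>x. (norm (grad t (Umax u) x))\<^sup>2 / ?M \<partial>torus_measure)"
      by (rule integral_mono) (use i le in \<open>auto simp: trunc_def intro!: continuous_integrable_torus continuous_intros continuous_grad[OF t sq(3)]\<close>)
    also have "\<dots> = (\<integral>x. (norm (grad t (Umax u) x))\<^sup>2 \<partial>torus_measure) / ?M" by simp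
    also have "\<dots> \<le> ?K / ?M" by (rule divide_right_mono[OF G[OF t] M])
    also have "\<dots> \<le> e"
    proof -
      have "?K \<le> ?K + 1" by simp
      also have "\<dots> = e * ?M" using e by simp
      finally show ?thesis using M1 by (simp only: pos_divide_le_eq)
    qed
    finally show "(\<integral>x. trunc ?M (grad t (Umax u) x) \<partial>torus_measure) \<le> e" .
  qed
  obtain g where g: "weak_grad (Umax u) g"
    "\<And>\<Theta> C. nice \<Theta> \<Longrightarrow> (\<And>t. 0 < t \<Longrightarrow> (\<integral>x. \<Theta> (grad t (Umax u) x) \<partial>torus_measure) \<le> C) \<Longrightarrow>
           integrable torus_measure (\<lambda>x. \<Theta> (g x)) \<and> (\<integral>x. \<Theta> (g x) \<partial>torus_measure) \<le> C"
    using weak_grad_exists[OF sq(3) UI] by blast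
  show "\<exists>g. weak_grad (Umax u) g \<and> integrable torus_measure (\<lambda>x. (norm (g x))\<^sup>2)
       \<and> (\<integral>x. (norm (g x))\<^sup>2 \<partial>torus_measure) \<le> ?K
       \<and> (\<forall>\<Theta> C. nice \<Theta> \<longrightarrow> (\<forall>t>0. (\<integral>x. \<Theta> (grad t (Umax u) x) \<partial>torus_measure) \<le> C) \<longrightarrow>
           integrable torus_measure (\<lambda>x. \<Theta> (g x)) \<and> (\<integral>x. \<Theta> (g x) \<partial>torus_measure) \<le> C)"
    using g(1) g(2)[OF nice_square G] g(2) by blast
qed

section \<open>Lipschitz bounds and Sobolev functions in general dimension\<close>

lemma Pt_bound_AE:
  assumes t: "0 < t" and f: "integrable torus_measure f" and B: "0 \<le> B" "AE y in torus_measure. \<bar>f y\<bar> \<le> B"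
  shows "\<bar>Pt t f x\<bar> \<le> B"
proof -
  have m: "(\<lambda>y. clamp1 B (f y)) \<in> borel_measurable torus_measure" using borel_measurable_integrable[OF f] by measurable
  have i: "integrable torus_measure (\<lambda>y. clamp1 B (f y))"
    by (rule bounded_integrable_torus[OF m]) (use clamp1_abs_le[OF B(1)] in simp)
  have "Pt t f = Pt t (\<lambda>y. clamp1 B (f y))"
    by (rule Pt_cong_AE[OF t f i]) (use B(2) in eventually_elim, simp add: clamp1_id)
  then show ?thesis using Pt_bound[OF t m, of B x] clamp1_abs_le[OF B(1)] by simp
qed

lemma dseries_inner:
  fixes f :: "'a::euclidean_space \<Rightarrow> real"
  assumes t: "0 < t" and f: "integrable torus_measure f"
  shows "dseries v (Pc t f) x = v \<bullet> grad t f x"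
proof -
  have "fser (\<lambda>n. \<Sum>i\<in>Basis. of_real (v \<bullet> i) * dcoef i (Pc t f) n) (\<lambda>x. \<Sum>i\<in>Basis. (v \<bullet> i) * dseries i (Pc t f) x)"
    by (rule fser_sum[OF finite_Basis]) (rule fser_cmult[OF fser_dseries[OF t f]])
  moreover have "(\<Sum>i\<in>Basis. of_real (v \<bullet> i) * dcoef i (Pc t f) n) = dcoef v (Pc t f) n" for n
  proof -
    have "(\<Sum>i\<in>Basis. of_real (v \<bullet> i) * dcoef i (Pc t f) n) = of_real (\<Sum>i\<in>Basis. (n \<bullet> i) * (v \<bullet> i)) * (2 * pi * \<i> * Pc t f n)"
      unfolding dcoef_def of_real_sum sum_distrib_right by (rule sum.cong[OF refl]) (simp add: mult_ac)
    also have "\<dots> = dcoef v (Pc t f) n" unfolding euclidean_inner[of n v, symmetric] dcoef_def by simp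
    finally show ?thesis .
  qed
  ultimately have "fser (dcoef v (Pc t f)) (\<lambda>x. \<Sum>i\<in>Basis. (v \<bullet> i) * dseries i (Pc t f) x)" by simp
  from fser_unique[OF fser_dseries[OF t f] this]
  have "dseries v (Pc t f) x = (\<Sum>i\<in>Basis. (v \<bullet> i) * dseries i (Pc t f) x)" by (rule fun_cong)
  also have "\<dots> = v \<bullet> grad t f x" unfolding euclidean_inner[of v "grad t f x"] by (simp add: grad_inner)
  finally show ?thesis .
qed

text \<open>The vanishing integral gives the bound almost everywhere at time \<open>t / 2\<close>;
  smoothing for another \<open>t / 2\<close> makes it hold at every point.\<close>

lemma dseries_le_of_trunc:
  fixes f :: "'a::euclidean_space \<Rightarrow> real"
  assumes f: "integrable torus_measure f" and L: "0 \<le> L"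
    and Z: "\<And>t. 0 < t \<Longrightarrow> (\<integral>x. trunc L (grad t f x) \<partial>torus_measure) \<le> 0" and t: "0 < t"
  shows "\<bar>dseries v (Pc t f) x\<bar> \<le> L * norm v"
proof -
  have h: "0 < t / 2" using t by simp
  have i: "integrable torus_measure (\<lambda>x. trunc L (grad (t / 2) f x))"
    unfolding trunc_def by (intro continuous_integrable_torus continuous_intros continuous_grad[OF h f])
  have "AE x in torus_measure. norm (grad (t / 2) f x) \<le> L" using trunc_integral_zero_iff[OF i] Z[OF h] by simp
  then have "AE x in torus_measure. \<bar>dseries v (Pc (t / 2) f) x\<bar> \<le> L * norm v"
  proof eventually_elim
    case (elim x)
    have "\<bar>v \<bullet> grad (t / 2) f x\<bar> \<le> norm v * norm (grad (t / 2) f x)" by (rule Cauchy_Schwarz_ineq2)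
    also have "\<dots> \<le> norm v * L" using elim by (intro mult_left_mono) auto
    finally show ?case unfolding dseries_inner[OF h f] by (simp add: mult.commute)
  qed
  then have "\<bar>Pt (t / 2) (dseries v (Pc (t / 2) f)) x\<bar> \<le> L * norm v"
    by (intro Pt_bound_AE[OF h continuous_integrable_torus[OF continuous_dseries[OF h f]]]) (use L in auto)
  then show ?thesis unfolding Pt_dseries[OF h h f] by simp
qed

text \<open>\<open>Pt t\<close> commutes with translations, so the smoothed function keeps the
  Lipschitz constant. Its derivative in the direction of its own gradient is the squared norm, which
  gives the bound with the same constant.\<close>

lemma grad_le_of_lipschitz:
  fixes F :: "'a::euclidean_space \<Rightarrow> real"
  assumes F: "integrable torus_measure F" "periodic_fn F" and lip: "\<And>x v. \<bar>F (x + v) - F x\<bar> \<le> L * norm v" and t: "0 < t"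
  shows "norm (grad t F x) \<le> L"
proof -
  have inc: "\<bar>Pt t F (x + v) - Pt t F x\<bar> \<le> L * norm v" for v
  proof -
    have s: "integrable torus_measure (\<lambda>y. F (y + v))" by (rule integrable_torus_shift[OF F(2,1)])
    have "Pt t F (x + v) - Pt t F x = Pt t (\<lambda>y. F (y + v) - F y) x"
      unfolding Pt_diff[OF t s F(1)] Pt_shift[OF t F] ..
    moreover have "\<bar>Pt t (\<lambda>y. F (y + v) - F y) x\<bar> \<le> L * norm v"
      by (rule Pt_bound[OF t]) (use s F(1) lip in auto)
    ultimately show ?thesis by simp
  qed
  define v where "v = grad t F x"
  obtain K where K: "\<And>x h. \<bar>Pt t F (x + h *\<^sub>R v) - Pt t F x - h * dseries v (Pc t F) x\<bar> \<le> K * h\<^sup>2"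
    using Pt_increment[OF t F(1)] by blast
  have "norm v * norm v \<le> L * norm v + K * eta k" for k
  proof -
    have d: "dseries v (Pc t F) x = norm v * norm v"
      unfolding dseries_inner[OF t F(1)] v_def by (simp add: power2_norm_eq_inner[symmetric] power2_eq_square)
    have "eta k * (norm v * norm v) \<le> K * (eta k)\<^sup>2 + L * norm (eta k *\<^sub>R v)"
      using K[of x "eta k"] inc[of "eta k *\<^sub>R v"] unfolding d by linarith
    also have "\<dots> = eta k * (L * norm v + K * eta k)" by (simp add: power2_eq_square algebra_simps)
    finally show ?thesis by (simp only: mult_le_cancel_left_pos[OF eta_pos])
  qed
  moreover have "(\<lambda>k. L * norm v + K * eta k) \<longlonglongrightarrow> L * norm v + K * 0" by (intro tendsto_intros eta_tendsto)
  ultimately have "norm v * norm v \<le> L * norm v + K * 0" by (intro LIMSEQ_le_const) auto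
  moreover have "0 \<le> L"
  proof -
    obtain i :: 'a where "i \<in> Basis" by fastforce
    then show ?thesis using order_trans[OF abs_ge_zero lip[of 0 i]] by simp
  qed
  ultimately show ?thesis unfolding v_def[symmetric] by (cases "v = 0") auto
qed

lemma Umax_lipschitz_grad:
  fixes u :: "'a::euclidean_space \<Rightarrow> real"
  assumes w: "weak_grad u g0" and L: "0 \<le> L" "AE x in torus_measure. norm (g0 x) \<le> L"
    and B: "0 \<le> B" "AE x in torus_measure. \<bar>u x\<bar> \<le> B" and t: "0 < t"
  shows "\<bar>Umax u x\<bar> \<le> B" "norm (grad t (Umax u) x) \<le> L"
proof -
  have u: "integrable torus_measure u" using w by (simp add: weak_grad_def)
  let ?f = "\<lambda>y. \<bar>u y\<bar>"
  have f: "integrable torus_measure ?f" using u by simp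
  have Pb: "\<bar>Pt t ?f x\<bar> \<le> B" if "0 < t" for t x
    by (rule Pt_bound_AE[OF that f B(1)]) (use B(2) in simp)
  have fin: "ustar a b u x < \<infinity>" and le: "Umax u x \<le> B" for x
    using ustar_finite[OF u refl, of x B] Pb by (force simp: abs_le_iff)+
  have U: "\<bar>Umax u x\<bar> \<le> B" for x
  proof -
    have "0 \<le> (\<integral>y. ?f y \<partial>torus_measure)" by simp
    then have "0 \<le> Umax u x" using Umax_ge_mean[OF u refl fin, of x] by linarith
    then show ?thesis using le[of x] by simp
  qed
  then show "\<bar>Umax u x\<bar> \<le> B" .
  have Ui: "integrable torus_measure (Umax u)"
    by (rule bounded_integrable_torus[OF Umax_measurable[OF u refl]]) (use U in simp)
  \<comment> \<open>The pointwise bound on the gradient is encoded as a vanishing truncated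
    integral, the form in which \<open>grad_abs_le\<close> transports it to the absolute value of
    \<open>u\<close>.\<close>
  have t0: "AE x in torus_measure. trunc L (g0 x) = 0" using L(2) by eventually_elim (simp add: trunc_def)
  have g0m: "(\<lambda>x. trunc L (g0 x)) \<in> borel_measurable torus_measure"
    unfolding trunc_def using weak_grad_measurable[OF w] by measurable
  have ti: "integrable torus_measure (\<lambda>x. trunc L (g0 x))"
    using integrable_cong_AE[OF g0m _ t0] by simp
  have "(\<integral>x. trunc L (g0 x) \<partial>torus_measure) = 0" using integral_cong_AE[OF g0m _ t0] by simp
  then have Z: "(\<integral>x. trunc L (grad t ?f x) \<partial>torus_measure) \<le> 0" if "0 < t" for t
    using grad_abs_le[OF nice_trunc that w ti] by simp
  have P: "\<bar>Pt t ?f (x + v) - Pt t ?f x\<bar> \<le> L * norm v" if "0 < t" for t x v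
    by (rule Pt_lipschitz_of_deriv_bound[OF that f dseries_le_of_trunc[OF f L(1) Z that]])
  have us: "\<bar>us (eta k) ?f (x + v) - us (eta k) ?f x\<bar> \<le> L * norm v" for k x v
    by (rule us_lipschitz[OF eta_pos f]) (rule P, rule less_le_trans[OF eta_pos])
  have lip: "\<bar>Umax u (x + v) - Umax u x\<bar> \<le> L * norm v" for x v
  proof (rule LIMSEQ_le_const2)
    show "(\<lambda>k. \<bar>us (eta k) ?f (x + v) - us (eta k) ?f x\<bar>) \<longlonglongrightarrow> \<bar>Umax u (x + v) - Umax u x\<bar>"
      by (intro tendsto_intros us_le_Umax(2)[OF u refl fin])
  qed (use us in auto)
  show "norm (grad t (Umax u) x) \<le> L"
    by (rule grad_le_of_lipschitz[OF Ui Umax_periodic[OF u refl] lip t])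
qed

lemma Lp_2: 
  fixes f :: "'a::euclidean_space \<Rightarrow> real"
  shows "Lp_mem 2 f \<longleftrightarrow> f \<in> borel_measurable torus_measure \<and> integrable torus_measure (\<lambda>x. (f x)\<^sup>2)"
    and "Lp_norm 2 f = (\<integral>x. (f x)\<^sup>2 \<partial>torus_measure) powr (1 / 2)"
proof -
  have p: "\<bar>y\<bar> powr 2 = y\<^sup>2" for y :: real by (cases "y = 0") (simp_all add: powr_numeral)
  have e: "enn2real 2 = 2" "(2::ennreal) \<noteq> \<infinity>" by simp_all
  show "Lp_mem 2 f \<longleftrightarrow> f \<in> borel_measurable torus_measure \<and> integrable torus_measure (\<lambda>x. (f x)\<^sup>2)"
    "Lp_norm 2 f = (\<integral>x. (f x)\<^sup>2 \<partial>torus_measure) powr (1 / 2)"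
    unfolding Lp_mem_def Lp_norm_def e p using e(2) by simp_all
qed

text \<open>For \<open>q = \<infinity>\<close> finiteness and the weak gradient come from the
  square-integrable case, since the torus has finite measure. The Lipschitz argument then bounds
  this gradient by every admissible \<open>L\<close>, which yields the comparison of norms.\<close>

lemma Umax_Lp_higher:
  fixes u :: "'a::euclidean_space \<Rightarrow> real"
  assumes q: "q = 2 \<or> q = \<infinity>" and s: "sobolev q u"
  shows "AE x in torus_measure. ustar a b u x < \<infinity>" "sobolev q (Umax u)"
    and "\<And>g0 g. weak_grad u g0 \<Longrightarrow> weak_grad (Umax u) g \<Longrightarrow> Lp_norm q (\<lambda>x. norm (g x)) \<le> Lp_norm q (\<lambda>x. norm (g0 x))"
proof -
  obtain h0 where h0: "weak_grad u h0" "Lp_mem q (\<lambda>x. norm (h0 x))" using s by (auto simp: sobolev_def)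
  have u: "integrable torus_measure u" using h0 by (simp add: weak_grad_def)
  have m0: "h0 \<in> borel_measurable torus_measure" by (rule weak_grad_measurable[OF h0(1)])
  have h2: "integrable torus_measure (\<lambda>x. (norm (h0 x))\<^sup>2)"
    using q
  proof
    assume "q = 2" then show ?thesis using h0(2) by (simp add: Lp_2)
  next
    assume q: "q = \<infinity>"
    obtain L where L: "0 \<le> L" "AE x in torus_measure. norm (h0 x) \<le> L"
      using h0(2)[unfolded q Lp_mem_infinity_iff] by auto
    have "integrable (torus_measure :: 'a measure) (\<lambda>x. L\<^sup>2)" by simp
    then show ?thesis
      by (rule Bochner_Integration.integrable_bound) (use m0 L in \<open>auto elim!: eventually_mono intro: power_mono\<close>)
  qed
  note sq = Umax_sobolev_square[OF h0(1) h2]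
  show "AE x in torus_measure. ustar a b u x < \<infinity>" by (rule sq(1))
  obtain h where h: "weak_grad (Umax u) h" "integrable torus_measure (\<lambda>x. (norm (h x))\<^sup>2)"
    "(\<integral>x. (norm (h x))\<^sup>2 \<partial>torus_measure) \<le> (\<integral>x. (norm (h0 x))\<^sup>2 \<partial>torus_measure)"
    "\<And>\<Theta> C. nice \<Theta> \<Longrightarrow> (\<And>t. 0 < t \<Longrightarrow> (\<integral>x. \<Theta> (grad t (Umax u) x) \<partial>torus_measure) \<le> C) \<Longrightarrow>
           integrable torus_measure (\<lambda>x. \<Theta> (h x)) \<and> (\<integral>x. \<Theta> (h x) \<partial>torus_measure) \<le> C"
    using sq(3) by blast
  have m: "h \<in> borel_measurable torus_measure" by (rule weak_grad_measurable[OF h(1)])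
  have mU: "Umax u \<in> borel_measurable torus_measure" by (rule Umax_measurable[OF u refl])
  have main: "Lp_mem q (Umax u) \<and> Lp_mem q (\<lambda>x. norm (h x)) \<and> Lp_norm q (\<lambda>x. norm (h x)) \<le> Lp_norm q (\<lambda>x. norm (h0 x))"
    using q
  proof
    assume "q = 2"
    then show ?thesis using m mU sq(2) h(2,3) by (auto simp: Lp_2 intro: powr_mono2)
  next
    assume q: "q = \<infinity>"
    obtain B where B: "0 \<le> B" "AE x in torus_measure. \<bar>u x\<bar> \<le> B"
      using s[unfolded q sobolev_def Lp_mem_infinity_iff] by blast
    obtain L0 where L0: "0 \<le> L0" "AE x in torus_measure. norm (h0 x) \<le> L0" using h0(2)[unfolded q Lp_mem_infinity_iff] by auto
    have tr: "AE x in torus_measure. norm (h x) \<le> L" if L: "0 \<le> L" "AE x in torus_measure. norm (h0 x) \<le> L" for L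
    proof -
      have "(\<integral>x. trunc L (grad t (Umax u) x) \<partial>torus_measure) \<le> 0" if "0 < t" for t
        using Umax_lipschitz_grad(2)[OF h0(1) L B that] by (simp add: trunc_def)
      from h(4)[OF nice_trunc this] show ?thesis using trunc_integral_zero_iff by blast
    qed
    have "Lp_mem \<infinity> (Umax u)" by (rule Lp_mem_bounded[OF mU]) (rule Umax_lipschitz_grad(1)[OF h0(1) L0 B zero_less_one])
    moreover have "Lp_mem \<infinity> (\<lambda>x. norm (h x))" unfolding Lp_mem_infinity_iff using m tr[OF L0] L0 by auto
    moreover have "Lp_norm \<infinity> (\<lambda>x. norm (h x)) \<le> Lp_norm \<infinity> (\<lambda>x. norm (h0 x))"
      by (rule Lp_norm_infinity_mono) (use m h0(2) q tr in auto)
    ultimately show ?thesis using q by simp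
  qed
  show "sobolev q (Umax u)" unfolding sobolev_def using main h(1) by blast
  fix g0 g assume g0: "weak_grad u g0" and g: "weak_grad (Umax u) g"
  have "Lp_norm q (\<lambda>x. norm (g x)) = Lp_norm q (\<lambda>x. norm (h x))"
    by (rule Lp_norm_cong_AE) (use weak_grad_measurable[OF g] m weak_grad_unique[OF g h(1)] in \<open>auto elim: eventually_mono\<close>)
  moreover have "Lp_norm q (\<lambda>x. norm (g0 x)) = Lp_norm q (\<lambda>x. norm (h0 x))"
    by (rule Lp_norm_cong_AE) (use weak_grad_measurable[OF g0] m0 weak_grad_unique[OF g0 h0(1)] in \<open>auto elim: eventually_mono\<close>)
  ultimately show "Lp_norm q (\<lambda>x. norm (g x)) \<le> Lp_norm q (\<lambda>x. norm (g0 x))" using main by simp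
qed

end

section \<open>Functions of bounded variation\<close>

lemma circ_var_le_iff:
  "circ_var f \<le> ereal V \<longleftrightarrow>
    (\<forall>n x. 0 < n \<longrightarrow> (\<forall>i<n. x i < x (Suc i)) \<longrightarrow> x n = x 0 + 1 \<longrightarrow> (\<Sum>i<n. \<bar>f (x (Suc i)) - f (x i)\<bar>) \<le> V)"
  unfolding circ_var_def by (auto simp: SUP_le_iff)

lemma circ_var_nonneg: "0 \<le> circ_var f"
  unfolding circ_var_def by (rule SUP_upper2[of "(1, real)"]) simp_all

lemma circ_var_abs: "circ_var f \<le> ereal V \<Longrightarrow> circ_var (\<lambda>x. \<bar>f x\<bar>) \<le> ereal V"
  unfolding circ_var_le_iff
proof (intro allI impI)
  fix n :: nat and x :: "nat \<Rightarrow> real"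
  assume V: "\<forall>n x. 0 < n \<longrightarrow> (\<forall>i<n. x i < x (Suc i)) \<longrightarrow> x n = x 0 + 1 \<longrightarrow> (\<Sum>i<n. \<bar>f (x (Suc i)) - f (x i)\<bar>) \<le> V"
    and x: "0 < n" "\<forall>i<n. x i < x (Suc i)" "x n = x 0 + 1"
  have "(\<Sum>i<n. \<bar>\<bar>f (x (Suc i))\<bar> - \<bar>f (x i)\<bar>\<bar>) \<le> (\<Sum>i<n. \<bar>f (x (Suc i)) - f (x i)\<bar>)"
    by (intro sum_mono abs_triangle_ineq3)
  also have "\<dots> \<le> V" using V x by blast
  finally show "(\<Sum>i<n. \<bar>\<bar>f (x (Suc i))\<bar> - \<bar>f (x i)\<bar>\<bar>) \<le> V" .
qed

context
  fixes f :: "real \<Rightarrow> real" and V :: real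
  assumes V: "circ_var f \<le> ereal V"
begin

text \<open>A partition that stops short of a full turn is closed by the extra point
  \<open>x 0 + 1\<close>.\<close>

lemma circ_var_sum_le:
  assumes x: "\<And>i. i < n \<Longrightarrow> x i < x (Suc i)" "x n \<le> x 0 + 1"
  shows "(\<Sum>i<n. \<bar>f (x (Suc i)) - f (x i)\<bar>) \<le> V"
proof (cases "x n = x 0 + 1")
  case True
  then have "0 < n" by (cases n) auto
  then show ?thesis using V x(1) True unfolding circ_var_le_iff by blast
next
  case False
  define y where "y i = (if i \<le> n then x i else x 0 + 1)" for i
  have "(\<Sum>i<Suc n. \<bar>f (y (Suc i)) - f (y i)\<bar>) \<le> V"
  proof (rule V[unfolded circ_var_le_iff, rule_format])
    fix i assume "i < Suc n"
    then show "y i < y (Suc i)" using x False by (cases "i = n") (auto simp: y_def)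
  qed (auto simp: y_def)
  moreover have "(\<Sum>i<n. \<bar>f (y (Suc i)) - f (y i)\<bar>) = (\<Sum>i<n. \<bar>f (x (Suc i)) - f (x i)\<bar>)"
    by (rule sum.cong) (auto simp: y_def)
  ultimately show ?thesis by simp
qed

lemma circ_var_bounded:
  assumes per: "periodic_fn f"
  shows "\<bar>f x\<bar> \<le> \<bar>f 0\<bar> + V"
proof -
  define z where "z = x - of_int \<lfloor>x\<rfloor>"
  have "f (z + of_int \<lfloor>x\<rfloor>) = f z"
    by (rule per[unfolded periodic_fn_def, rule_format]) (simp add: lattice_real_iff)
  then have z: "f x = f z" by (simp add: z_def)
  have V0: "0 \<le> V" using order_trans[OF circ_var_nonneg V] by simp
  have r: "0 \<le> z" "z < 1" unfolding z_def by linarith+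
  show ?thesis
  proof (cases "z = 0")
    case False
    have "(\<Sum>i<1. \<bar>f (of_nat (Suc i) * z) - f (of_nat i * z)\<bar>) \<le> V"
      by (rule circ_var_sum_le) (use False r in auto)
    then show ?thesis using z by simp
  qed (use z V0 in simp)
qed

text \<open>Jordan decomposition: \<open>T\<close> is the variation on \<open>{0..x}\<close>, and \<open>T\<close> and \<open>T - f\<close> increase.\<close>

lemma circ_var_measurable: "f \<in> borel_measurable torus_measure"
proof -
  \<comment> \<open>Chains may start anywhere in \<open>[0, x]\<close> and may have
    \<open>n = 0\<close>: this makes the set nonempty, and a chain ending at \<open>x\<close> can be
    prolonged to \<open>x'\<close>.\<close>
  define S where "S x = {(\<Sum>i<n. \<bar>f (y (Suc i)) - f (y i)\<bar>) | n y. (\<forall>i<n. y i < y (Suc i)) \<and> 0 \<le> y 0 \<and> y n = x}" for x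
  define T where "T x = Sup (S x)" for x
  have bdd: "bdd_above (S x)" if "x \<le> 1" for x
    by (rule bdd_aboveI[of _ V]) (use that in \<open>auto simp: S_def intro!: circ_var_sum_le\<close>)
  have ne: "S x \<noteq> {}" if "0 \<le> x" for x
    unfolding S_def using that by (auto intro!: exI[of _ "0::nat"] exI[of _ "\<lambda>_. x"])
  have inc: "T x + \<bar>f x' - f x\<bar> \<le> T x'" if x: "0 \<le> x" "x < x'" "x' \<le> 1" for x x'
  proof -
    have "s \<le> T x' - \<bar>f x' - f x\<bar>" if s: "s \<in> S x" for s
    proof -
      obtain n y where y: "s = (\<Sum>i<n. \<bar>f (y (Suc i)) - f (y i)\<bar>)" "\<And>i. i < n \<Longrightarrow> y i < y (Suc i)" "0 \<le> y 0" "y n = x"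
        using s unfolding S_def by blast
      define y' where "y' i = (if i \<le> n then y i else x')" for i
      have "(\<Sum>i<n. \<bar>f (y' (Suc i)) - f (y' i)\<bar>) = s" unfolding y(1) by (rule sum.cong) (auto simp: y'_def)
      then have "(\<Sum>i<Suc n. \<bar>f (y' (Suc i)) - f (y' i)\<bar>) = s + \<bar>f x' - f x\<bar>" using y(4) by (simp add: y'_def)
      moreover have "(\<Sum>i<Suc n. \<bar>f (y' (Suc i)) - f (y' i)\<bar>) \<in> S x'"
      proof -
        have "y' i < y' (Suc i)" if "i < Suc n" for i
          using that y(2)[of i] y(4) x(2) by (cases "i = n") (auto simp: y'_def)
        moreover have "0 \<le> y' 0" "y' (Suc n) = x'" using y(3) by (auto simp: y'_def)
        ultimately show ?thesis unfolding S_def by blast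
      qed
      ultimately have "s + \<bar>f x' - f x\<bar> \<le> T x'" unfolding T_def using cSup_upper[OF _ bdd[OF x(3)]] by metis
      then show ?thesis by linarith
    qed
    then have "T x \<le> T x' - \<bar>f x' - f x\<bar>" unfolding T_def[of x] by (rule cSup_least[OF ne[OF x(1)]])
    then show ?thesis by linarith
  qed
  have T1: "mono_on {0..1} T"
  proof (rule mono_onI)
    fix r s :: real assume "r \<in> {0..1}" "s \<in> {0..1}" "r \<le> s"
    then show "T r \<le> T s" using inc[of r s] by (cases "r = s") auto
  qed
  have T2: "mono_on {0..1} (\<lambda>x. T x - f x)"
  proof (rule mono_onI)
    fix r s :: real assume "r \<in> {0..1}" "s \<in> {0..1}" "r \<le> s"
    then show "T r - f r \<le> T s - f s" using inc[of r s] by (cases "r = s") auto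
  qed
  have "(\<lambda>x. T x - (T x - f x)) \<in> borel_measurable (restrict_space borel {0..1})"
    by (intro borel_measurable_diff borel_measurable_mono_on_fnc T1 T2)
  then have m: "f \<in> borel_measurable (restrict_space borel {0..1})" by simp
  have "sets (restrict_space borel {0..1::real}) \<subseteq> sets (lebesgue_on {0..1})"
    unfolding sets_restrict_space by (intro image_mono) auto
  then have "f \<in> borel_measurable (lebesgue_on {0..1})"
    using m measurable_mono[of borel borel "restrict_space borel {0..1}" "lebesgue_on {0..1}"] by (auto simp: space_restrict_space)
  then show ?thesis by simp
qed

lemma circ_var_integrable:
  assumes per: "periodic_fn f"
  shows "integrable torus_measure f"
  by (rule bounded_integrable_torus[OF circ_var_measurable]) (use circ_var_bounded[OF per] in simp)

text \<open>The mean of \<open>\<bar>f (x + h) - f x\<bar>\<close> is the mean of its average over the translates \<open>x + i * h\<close>,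
  which form a partition of the circle when \<open>h = 1 / N\<close>.\<close>

lemma circ_var_nabh_le:
  assumes per: "periodic_fn f"
  shows "(\<integral>x. trunc 0 (nabh (eta k) f x) \<partial>torus_measure) \<le> V"
proof -
  let ?h = "eta k"
  define d where "d x = \<bar>f (x + ?h) - f x\<bar>" for x
  have i: "integrable torus_measure f" by (rule circ_var_integrable[OF per])
  have di: "integrable torus_measure d" unfolding d_def
    using i integrable_torus_shift[OF per i] by (intro integrable_abs Bochner_Integration.integrable_diff)
  have dp: "periodic_fn d" unfolding periodic_fn_def
  proof (intro allI ballI)
    fix x k' :: real assume k: "k' \<in> lattice"
    have "f (x + ?h + k') = f (x + ?h)" "f (x + k') = f x" using per k unfolding periodic_fn_def by blast+
    then show "d (x + k') = d x" unfolding d_def by (simp add: add_ac)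
  qed
  have pt: "(\<Sum>i<Suc k. d (x + real i * ?h)) \<le> V" for x
  proof -
    have "(\<Sum>i<Suc k. \<bar>f (x + real (Suc i) * ?h) - f (x + real i * ?h)\<bar>) \<le> V"
    proof (rule circ_var_sum_le)
      show "x + real i * ?h < x + real (Suc i) * ?h" for i by simp
      show "x + real (Suc k) * ?h \<le> x + real 0 * ?h + 1" by (simp add: eta_def)
    qed
    then show ?thesis unfolding d_def by (simp add: algebra_simps)
  qed
  have "(\<Sum>i<Suc k. \<integral>x. d (x + real i * ?h) \<partial>torus_measure) = (\<integral>x. (\<Sum>i<Suc k. d (x + real i * ?h)) \<partial>torus_measure)"
    by (rule Bochner_Integration.integral_sum[symmetric]) (rule integrable_torus_shift[OF dp di])
  also have "\<dots> \<le> (\<integral>x. V \<partial>(torus_measure :: real measure))"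
  proof (rule integral_mono)
    show "integrable torus_measure (\<lambda>x. \<Sum>i<Suc k. d (x + real i * ?h))"
      by (rule Bochner_Integration.integrable_sum) (rule integrable_torus_shift[OF dp di])
  qed (use pt in simp_all)
  also have "\<dots> = V" by simp
  finally have "real (Suc k) * (\<integral>x. d x \<partial>torus_measure) \<le> V"
    unfolding integral_torus_shift[OF dp di] by simp
  moreover have "trunc 0 (nabh ?h f x) = real (Suc k) * d x" for x
    unfolding nabh_real trunc_def d_def by (simp add: eta_def abs_mult)
  ultimately show ?thesis by simp
qed

end

context kernel_params
begin

text \<open>Variation is a pointwise notion, so convergence is needed at every point. Both limits
  provide it: \<open>us (eta j)\<close> is continuous and periodic, so its regularisations converge
  everywhere, and it tends to the maximal function at each point.\<close>

lemma Umax_bounded_variation: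
  fixes u :: "real \<Rightarrow> real"
  assumes per: "periodic_fn u" and V: "circ_var u \<le> ereal V"
  shows "ustar a b u x < \<infinity>" "circ_var (Umax u) \<le> ereal V"
proof -
  let ?f = "\<lambda>y. \<bar>u y\<bar>"
  have u: "integrable torus_measure u" by (rule circ_var_integrable[OF V per])
  have f: "integrable torus_measure ?f" using u by simp
  note Vf = circ_var_abs[OF V]
  have pf: "periodic_fn ?f" by (rule periodic_fn_compose[OF per])
  have K: "(\<integral>y. trunc 0 (grad t ?f y) \<partial>torus_measure) \<le> V" if t: "0 < t" for t
  proof (rule grad_Pt_le_of_nabh[OF nice_trunc t pf circ_var_measurable[OF Vf] _ circ_var_nabh_le[OF Vf pf] tendsto_const])
    show "\<bar>\<bar>u x\<bar>\<bar> \<le> \<bar>u 0\<bar> + V" for x using circ_var_bounded[OF V per] by simp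
  qed
  have fin: "ustar a b u x < \<infinity>" for x by (rule Umax_bounded_real(1)[OF u K])
  then show "ustar a b u x < \<infinity>" .
  show "circ_var (Umax u) \<le> ereal V"
    unfolding circ_var_le_iff
  proof (intro allI impI)
    fix n :: nat and x :: "nat \<Rightarrow> real"
    assume x: "\<forall>i<n. x i < x (Suc i)" "x n = x 0 + 1"
    have us: "(\<Sum>i<n. \<bar>us (eta j) ?f (x (Suc i)) - us (eta j) ?f (x i)\<bar>) \<le> V" for j
    proof (rule LIMSEQ_le_const2)
      let ?F = "us (eta j) ?f"
      have c: "continuous_on UNIV ?F" by (rule us_continuous[OF eta_pos f])
      show "(\<lambda>k. \<Sum>i<n. \<bar>Pt (eta k) ?F (x (Suc i)) - Pt (eta k) ?F (x i)\<bar>) \<longlonglongrightarrow> (\<Sum>i<n. \<bar>?F (x (Suc i)) - ?F (x i)\<bar>)"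
        by (intro tendsto_intros Pt_tendsto_continuous[OF c us_periodic[OF eta_pos f]])
      have "(\<Sum>i<n. \<bar>Pt (eta k) ?F (x (Suc i)) - Pt (eta k) ?F (x i)\<bar>) \<le> V" for k
      proof -
        have "(\<Sum>i<n. \<bar>Pt (eta k) ?F (x (Suc i)) - Pt (eta k) ?F (x i)\<bar>) \<le> (\<integral>y. trunc 0 (grad (eta k) ?F y) \<partial>torus_measure)"
          by (rule Pt_variation[OF eta_pos continuous_integrable_torus[OF c]]) (use x in auto)
        also have "\<dots> \<le> (\<integral>y. trunc 0 (grad (eta j) ?f y) \<partial>torus_measure)"
          by (rule grad_us_le[OF nice_trunc energy_comparison_trunc[OF f] f eta_pos eta_pos]) simp
        also have "\<dots> \<le> V" by (rule K[OF eta_pos])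
        finally show ?thesis .
      qed
      then show "\<exists>N. \<forall>k\<ge>N. (\<Sum>i<n. \<bar>Pt (eta k) ?F (x (Suc i)) - Pt (eta k) ?F (x i)\<bar>) \<le> V" by blast
    qed
    show "(\<Sum>i<n. \<bar>Umax u (x (Suc i)) - Umax u (x i)\<bar>) \<le> V"
    proof (rule LIMSEQ_le_const2)
      show "(\<lambda>j. \<Sum>i<n. \<bar>us (eta j) ?f (x (Suc i)) - us (eta j) ?f (x i)\<bar>) \<longlonglongrightarrow> (\<Sum>i<n. \<bar>Umax u (x (Suc i)) - Umax u (x i)\<bar>)"
        by (intro tendsto_intros us_le_Umax(2)[OF u refl fin])
    qed (use us in blast)
  qed
qed

end

section \<open>Assembly of the four statements\<close>

theorem theorem2:
  fixes a b :: real and u0 :: "real \<Rightarrow> real" and v0 :: "'a::euclidean_space \<Rightarrow> real"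
    and p q :: ennreal
  assumes "a \<ge> 0" and "b \<ge> 0" and "(a, b) \<noteq> (0, 0)"
    and "periodic_fn u0" and "periodic_fn v0"
  shows
    "(1 < p \<and> sobolev p u0 \<longrightarrow>
        (AE x in torus_measure. ustar a b u0 x < \<infinity>) \<and>
        sobolev p (\<lambda>x. real_of_ereal (ustar a b u0 x)) \<and>
        (\<forall>g0 g. weak_grad u0 g0 \<and> weak_grad (\<lambda>x. real_of_ereal (ustar a b u0 x)) g \<longrightarrow>
           Lp_norm p (\<lambda>x. norm (g x)) \<le> Lp_norm p (\<lambda>x. norm (g0 x))))
   \<and> (sobolev 1 u0 \<longrightarrow>
        (AE x in torus_measure. ustar a b u0 x < \<infinity>) \<and>
        Lp_mem \<infinity> (\<lambda>x. real_of_ereal (ustar a b u0 x)) \<and>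
        (\<exists>g. weak_grad (\<lambda>x. real_of_ereal (ustar a b u0 x)) g) \<and>
        (\<forall>g0 g. weak_grad u0 g0 \<and> weak_grad (\<lambda>x. real_of_ereal (ustar a b u0 x)) g \<longrightarrow>
           Lp_norm 1 (\<lambda>x. norm (g x)) \<le> Lp_norm 1 (\<lambda>x. norm (g0 x))))
   \<and> (circ_var u0 < \<infinity> \<longrightarrow>
        (\<forall>x. ustar a b u0 x < \<infinity>) \<and>
        circ_var (\<lambda>x. real_of_ereal (ustar a b u0 x)) < \<infinity> \<and>
        circ_var (\<lambda>x. real_of_ereal (ustar a b u0 x)) \<le> circ_var u0)
   \<and> (DIM('a) > 1 \<and> (q = 2 \<or> q = \<infinity>) \<and> sobolev q v0 \<longrightarrow>
        (AE x in torus_measure. ustar a b v0 x < \<infinity>) \<and>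
        sobolev q (\<lambda>x. real_of_ereal (ustar a b v0 x)) \<and>
        (\<forall>g0 g. weak_grad v0 g0 \<and> weak_grad (\<lambda>x. real_of_ereal (ustar a b v0 x)) g \<longrightarrow>
           Lp_norm q (\<lambda>x. norm (g x)) \<le> Lp_norm q (\<lambda>x. norm (g0 x))))"
proof (intro conjI impI)
  interpret kernel_params a b by unfold_locales (use assms in auto)
  have U: "(\<lambda>x. real_of_ereal (ustar a b u x)) = Umax u" for u :: "'b::euclidean_space \<Rightarrow> real"
    by (simp add: fun_eq_iff Umax_def)
  {
    assume "1 < p \<and> sobolev p u0"
    \<comment> \<open>The cases p > 1 and p = 1 are instances of one result for
      \<open>1 \<le> p\<close>.\<close>
    then have p: "1 \<le> p" and s: "sobolev p u0" by auto
    show "AE x in torus_measure. ustar a b u0 x < \<infinity>" by (rule Umax_Lp_real(1)[OF p s])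
    show "sobolev p (\<lambda>x. real_of_ereal (ustar a b u0 x))" unfolding U by (rule Umax_Lp_real(2)[OF p s])
    show "\<forall>g0 g. weak_grad u0 g0 \<and> weak_grad (\<lambda>x. real_of_ereal (ustar a b u0 x)) g \<longrightarrow>
        Lp_norm p (\<lambda>x. norm (g x)) \<le> Lp_norm p (\<lambda>x. norm (g0 x))"
      unfolding U using Umax_Lp_real(4)[OF p s] by blast
  next
    assume s: "sobolev 1 u0"
    show "AE x in torus_measure. ustar a b u0 x < \<infinity>" by (rule Umax_Lp_real(1)[OF order_refl s])
    show "Lp_mem \<infinity> (\<lambda>x. real_of_ereal (ustar a b u0 x))" unfolding U by (rule Umax_Lp_real(3)[OF order_refl s])
    show "\<exists>g. weak_grad (\<lambda>x. real_of_ereal (ustar a b u0 x)) g"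
      unfolding U using Umax_Lp_real(2)[OF order_refl s] by (auto simp: sobolev_def)
    show "\<forall>g0 g. weak_grad u0 g0 \<and> weak_grad (\<lambda>x. real_of_ereal (ustar a b u0 x)) g \<longrightarrow>
        Lp_norm 1 (\<lambda>x. norm (g x)) \<le> Lp_norm 1 (\<lambda>x. norm (g0 x))"
      unfolding U using Umax_Lp_real(4)[OF order_refl s] by blast
  next
    assume "circ_var u0 < \<infinity>"
    then obtain V where V: "circ_var u0 = ereal V" using circ_var_nonneg[of u0] by (cases "circ_var u0") auto
    note bv = Umax_bounded_variation[OF assms(4) eq_refl[OF V]]
    show "\<forall>x. ustar a b u0 x < \<infinity>" using bv(1) by blast
    show le: "circ_var (\<lambda>x. real_of_ereal (ustar a b u0 x)) \<le> circ_var u0" unfolding U V by (rule bv(2))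
    show "circ_var (\<lambda>x. real_of_ereal (ustar a b u0 x)) < \<infinity>" using le V by (auto intro: order_le_less_trans)
  next
    assume "DIM('a) > 1 \<and> (q = 2 \<or> q = \<infinity>) \<and> sobolev q v0"
    then have q: "q = 2 \<or> q = \<infinity>" and s: "sobolev q v0" by auto
    show "AE x in torus_measure. ustar a b v0 x < \<infinity>" by (rule Umax_Lp_higher(1)[OF q s])
    show "sobolev q (\<lambda>x. real_of_ereal (ustar a b v0 x))" unfolding U by (rule Umax_Lp_higher(2)[OF q s])
    show "\<forall>g0 g. weak_grad v0 g0 \<and> weak_grad (\<lambda>x. real_of_ereal (ustar a b v0 x)) g \<longrightarrow>
        Lp_norm q (\<lambda>x. norm (g x)) \<le> Lp_norm q (\<lambda>x. norm (g0 x))"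
      unfolding U using Umax_Lp_higher(3)[OF q s] by blast
  }
qed

end
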